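(* Let $f:\mathbb{A}\to\mathbb{A}$ be a symplectic twist diffeomorphism that is Lipschitz integrable, and let $u$ be the generating function of its invariant foliation. Then $u$ is the generating function of an exact symplectic homeomorphism $\Phi:\mathbb{A}\to\mathbb{A}$ that maps the standard foliation onto the invariant one and such that $$\forall(x,c)\in\mathbb{A},\quad\Phi^{-1}\circ f\circ\Phi(x,c)=(x+\rho(c),c),$$ where $\rho:\mathbb{R}\to\mathbb{R}$ is an increasing biLipschitz homeomorphism. Moreover, the invariant foliation is a $C^1$ lamination and $\Phi$ admits a partial derivative with respect to $\theta$ (its first variable). For every $c\in\mathbb{R}$, the projected dynamics $g_c:\mathbb{T}\to\mathbb{T}$, $g_c(\theta)=\pi_1\circ f\big(\theta,c+\frac{\partial u}{\partial\theta}(\theta,c)\big)$, is $C^1$ conjugated to a rotation $R$ via the $C^1$ diffeomorphism $h_c=\mathrm{Id}_{\mathbb{T}}+\frac{\partial u}{\partial c}(\cdot,c):\mathbb{T}\to\mathbb{T}$, i.e. $h_c\circ g_c=R\circ h_c$.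
   Context: $\mathbb{T}=\mathbb{R}/\mathbb{Z}$, $\mathbb{A}=\mathbb{T}\times\mathbb{R}$ with coordinates $(\theta,r)$, $\pi_1(\theta,r)=\theta$, and symplectic form $\omega=-d(r\,d\theta)$. A symplectic twist diffeomorphism is a $C^1$ diffeomorphism $f:\mathbb{A}\to\mathbb{A}$ isotopic to the identity, with $f^*\omega=\omega$, and with the twist property: for any lift $F=(F_1,F_2):\mathbb{R}^2\to\mathbb{R}^2$ of $f$ and any $\tilde\theta\in\mathbb{R}$, the map $r\mapsto F_1(\tilde\theta,r)$ is an increasing $C^1$ diffeomorphism from $\mathbb{R}$ onto $\mathbb{R}$. A $C^0$ foliation of $\mathbb{A}$ into graphs is a partition of $\mathbb{A}$ into graphs of continuous functions $\eta_c:\mathbb{T}\to\mathbb{R}$, $c\in\mathbb{R}$, normalized by $\int_{\mathbb{T}}\eta_c=c$, such that $(\theta,c)\mapsto(\theta,\eta_c(\theta))$ is a homeomorphism of $\mathbb{A}$. A foliation into graphs $a\mapsto\eta_a$ is a Lipschitz foliation if $(\theta,a)\mapsto(\theta,\eta_a(\theta))$ is a homeomorphism that is locally biLipschitz. It is a $C^1$ lamination if $(\theta,a)\mapsto(\theta,\eta_a(\theta))$ is a homeomorphism, every $\eta_a$ is $C^1$ and $a\mapsto\eta_a$ is continuous for the $C^1$ topology on $C^1(\mathbb{T},\mathbb{R})$. A foliation is invariant under $f$ if every leaf is mapped onto itself by $f$; $f$ is Lipschitz integrable if it has an invariant Lipschitz foliation. The standard foliation has leaves $\mathbb{T}\times\{c\}$.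 The generating function of a $C^0$ foliation into graphs is the unique continuous $u:\mathbb{A}\to\mathbb{R}$ that is $C^1$ in the $\mathbb{T}$ variable with $u(0,c)=0$ for all $c$ and such that, for all $c$, the graph of $c+\frac{\partial u}{\partial\theta}(\cdot,c)$ is a leaf; thus $\eta_c=c+\frac{\partial u}{\partial\theta}(\cdot,c)$. A diffeomorphism $\phi:\mathbb{A}\to\mathbb{A}$ is exact symplectic if $\phi^*(r\,d\theta)-r\,d\theta$ is exact; an exact symplectic homeomorphism is a homeomorphism that is a limit, for the $C^0$ compact-open topology, of a sequence of exact symplectic diffeomorphisms. A $C^1$ function $u$ is a generating function of $\Phi$ if $$\Phi(x,c)=(\theta,r)\iff x=\theta+\frac{\partial u}{\partial c}(\theta,c)\ \text{ and }\ r=c+\frac{\partial u}{\partial\theta}(\theta,c).$$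
   Formalization: The map ρ is shown to be an increasing locally biLipschitz homeomorphism; globally biLipschitz fails in general, e.g. for f(θ,r) = (θ+r+r³, r), where u = 0, Φ = Id and ρ(c) = c+c³ up to an integer. *)

theory Defs
  imports "HOL-Analysis.Analysis"
begin

section \<open>The circle and the annulus\<close>

definition int_cong :: "real \<Rightarrow> real \<Rightarrow> bool" where
  "int_cong x y \<longleftrightarrow> x - y \<in> \<int>"

lemma equivp_int_cong: "equivp int_cong"
proof (rule equivpI)
  show "reflp int_cong" by (simp add: reflp_def int_cong_def)
  show "symp int_cong"
    by (metis Ints_minus int_cong_def minus_diff_eq sympI)
  show "transp int_cong"
  proof (rule transpI)
    fix x y z assume "int_cong x y" "int_cong y z"
    then have "(x - y) + (y - z) \<in> \<int>" unfolding int_cong_def by (rule Ints_add)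
    then show "int_cong x z" by (simp add: int_cong_def)
  qed
qed

quotient_type circle = real / int_cong
  morphisms rep_circle circle_of
  by (rule equivp_int_cong)

lemma circle_of_eq_iff: "circle_of x = circle_of y \<longleftrightarrow> x - y \<in> \<int>"
  by (simp add: circle.abs_eq_iff int_cong_def)

instantiation circle :: ab_group_add
begin

lift_definition zero_circle :: circle is 0 .

lift_definition plus_circle :: "circle \<Rightarrow> circle \<Rightarrow> circle" is "(+)"
  by (metis (no_types, lifting) Ints_add add_diff_add int_cong_def)

lift_definition uminus_circle :: "circle \<Rightarrow> circle" is uminus
  by (metis Ints_minus int_cong_def minus_diff_minus)

lift_definition minus_circle :: "circle \<Rightarrow> circle \<Rightarrow> circle" is "(-)"
proof -
  fix a b c d assume "int_cong a b" "int_cong c d"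
  then have "(a - b) - (c - d) \<in> \<int>" unfolding int_cong_def by (rule Ints_diff)
  then show "int_cong (a - c) (b - d)" by (simp add: int_cong_def algebra_simps)
qed

instance
  by standard (transfer; simp add: int_cong_def)+

end

lemma abs_diff_round_shift:
  fixes x y :: real
  assumes "x - y \<in> \<int>"
  shows "\<bar>x - of_int (round x)\<bar> = \<bar>y - of_int (round y)\<bar>"
proof -
  obtain k where k: "x = y + of_int k" using assms by (metis Ints_cases add_diff_cancel_left' diff_add_cancel add.commute)
  have "\<bar>x - of_int (round x)\<bar> \<le> \<bar>x - of_int (k + round y)\<bar>" by (rule round_diff_minimal)
  moreover have "\<bar>y - of_int (round y)\<bar> \<le> \<bar>y - of_int (round x - k)\<bar>" by (rule round_diff_minimal)
  ultimately show ?thesis using k by simp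
qed

text \<open>The quotient metric: the distance of two points is the distance from the difference of
  representatives to the nearest integer.\<close>

instantiation circle :: metric_space
begin

lift_definition dist_circle :: "circle \<Rightarrow> circle \<Rightarrow> real"
  is "\<lambda>x y. \<bar>x - y - of_int (round (x - y))\<bar>"
proof -
  fix a b c d assume "int_cong a b" "int_cong c d"
  then have "(a - b) - (c - d) \<in> \<int>" unfolding int_cong_def by (rule Ints_diff)
  then have "(a - c) - (b - d) \<in> \<int>" by (simp add: algebra_simps)
  then show "\<bar>a - c - of_int (round (a - c))\<bar> = \<bar>b - d - of_int (round (b - d))\<bar>"
    by (rule abs_diff_round_shift)
qed

definition uniformity_circle :: "(circle \<times> circle) filter" where
  "uniformity_circle = (INF e\<in>{0 <..}. principal {(x, y). dist x y < e})"

definition open_circle :: "circle set \<Rightarrow> bool" where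
  "open_circle U \<longleftrightarrow> (\<forall>x\<in>U. \<forall>\<^sub>F (x', y) in uniformity. x' = x \<longrightarrow> y \<in> U)"

instance
proof
  show "dist x y = 0 \<longleftrightarrow> x = y" for x y :: circle
  proof transfer
    fix x y :: real
    show "\<bar>x - y - of_int (round (x - y))\<bar> = 0 \<longleftrightarrow> int_cong x y"
      unfolding int_cong_def
      by (metis Ints_cases Ints_of_int abs_eq_0 eq_iff_diff_eq_0 round_of_int)
  qed
  show "dist x y \<le> dist x z + dist y z" for x y z :: circle
  proof transfer
    fix x y z :: real
    have "\<bar>x - y - of_int (round (x - y))\<bar> \<le> \<bar>x - y - of_int (round (x - z) - round (y - z))\<bar>"
      by (rule round_diff_minimal)
    then show "\<bar>x - y - of_int (round (x - y))\<bar>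
        \<le> \<bar>x - z - of_int (round (x - z))\<bar> + \<bar>y - z - of_int (round (y - z))\<bar>"
      by simp
  qed
qed (simp_all only: uniformity_circle_def open_circle_def)

end

lemma dist_circle_of_le: "dist (circle_of x) (circle_of y) \<le> dist x y"
  using round_diff_minimal[of "x - y" 0] by (simp add: dist_circle.abs_eq dist_real_def)

lemma open_circle_iff_quotient: "open U \<longleftrightarrow> open (circle_of -` U)"
proof
  have "continuous_on UNIV circle_of"
    unfolding continuous_on_iff by (meson dist_circle_of_le le_less_trans)
  then show "open U \<Longrightarrow> open (circle_of -` U)" by (simp add: open_vimage)
next
  assume op: "open (circle_of -` U)"
  show "open U" unfolding open_dist
  proof
    fix p assume "p \<in> U"
    obtain x where x: "p = circle_of x" by (metis Quotient3_abs_rep Quotient3_circle)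
    with op \<open>p \<in> U\<close> obtain e where e: "e > 0" "\<And>y. dist y x < e \<Longrightarrow> circle_of y \<in> U"
      unfolding open_dist by auto
    have "q \<in> U" if "dist q p < e" for q
    proof -
      obtain y where y: "q = circle_of y" by (metis Quotient3_abs_rep Quotient3_circle)
      have "dist (y - of_int (round (y - x))) x < e"
        using that by (simp add: x y dist_circle.abs_eq dist_real_def algebra_simps)
      then have "circle_of (y - of_int (round (y - x))) \<in> U" by (rule e)
      moreover have "circle_of (y - of_int (round (y - x))) = q"
        by (simp add: y circle_of_eq_iff)
      ultimately show ?thesis by simp
    qed
    then show "\<exists>e>0. \<forall>y. dist y p < e \<longrightarrow> y \<in> U" using e(1) by blast
  qed
qed

type_synonym annulus = "circle \<times> real"

definition annulus_of :: "real \<times> real \<Rightarrow> annulus" where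
  "annulus_of z = (circle_of (fst z), snd z)"

section \<open>\<open>C\<^sup>1\<close> maps and diffeomorphisms\<close>

definition homeo :: "('a::topological_space \<Rightarrow> 'b::topological_space) \<Rightarrow> bool" where
  "homeo h \<longleftrightarrow> (\<exists>g. homeomorphism UNIV UNIV h g)"

definition C1_map :: "('a::real_normed_vector \<Rightarrow> 'b::real_normed_vector) \<Rightarrow> bool" where
  "C1_map F \<longleftrightarrow>
    (\<exists>F'. (\<forall>z. (F has_derivative blinfun_apply (F' z)) (at z)) \<and> continuous_on UNIV F')"

text \<open>The following notions are relative to a covering map \<open>p\<close>, which is \<^const>\<open>circle_of\<close>,
  \<^const>\<open>annulus_of\<close> or the identity of the real line. Two lifts of the same map to the line or
  the plane differ by an integer translation, so a map is \<open>C\<^sup>1\<close> as soon as one of its lifts is.\<close>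

definition is_lift :: "('a::topological_space \<Rightarrow> 'b) \<Rightarrow> ('a \<Rightarrow> 'a) \<Rightarrow> ('b \<Rightarrow> 'b) \<Rightarrow> bool" where
  "is_lift p F f \<longleftrightarrow> continuous_on UNIV F \<and> (\<forall>z. p (F z) = f (p z))"

definition C1_via :: "('a::real_normed_vector \<Rightarrow> 'b) \<Rightarrow> ('b \<Rightarrow> 'b) \<Rightarrow> bool" where
  "C1_via p f \<longleftrightarrow> (\<exists>F. is_lift p F f \<and> C1_map F)"

definition C1_diffeo_via :: "('a::real_normed_vector \<Rightarrow> 'b) \<Rightarrow> ('b \<Rightarrow> 'b) \<Rightarrow> bool" where
  "C1_diffeo_via p f \<longleftrightarrow> bij f \<and> C1_via p f \<and> C1_via p (inv f)"

lemma int_cong_deriv: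
  fixes g :: "circle \<Rightarrow> real"
  assumes "int_cong s t"
  shows "deriv (\<lambda>x. g (circle_of x)) s = deriv (\<lambda>x. g (circle_of x)) t"
proof -
  let ?G = "\<lambda>x. g (circle_of x)"
  have per: "?G (x + (s - t)) = ?G x" for x
  proof -
    have "circle_of (x + (s - t)) = circle_of x"
      using assms by (simp add: circle_of_eq_iff int_cong_def)
    then show ?thesis by simp
  qed
  have "(?G has_field_derivative D) (at s) \<longleftrightarrow> (?G has_field_derivative D) (at t)" for D
    using DERIV_shift[of ?G D t "s - t"] by (simp add: per)
  then show ?thesis by (simp add: deriv_def)
qed

lift_definition circle_deriv :: "(circle \<Rightarrow> real) \<Rightarrow> circle \<Rightarrow> real"
  is "\<lambda>g t. deriv (\<lambda>s. g (circle_of s)) t"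
  by (rule int_cong_deriv)

definition d_theta :: "(annulus \<Rightarrow> real) \<Rightarrow> circle \<Rightarrow> real \<Rightarrow> real" where
  "d_theta u \<theta> c = circle_deriv (\<lambda>x. u (x, c)) \<theta>"

definition d_c :: "(annulus \<Rightarrow> real) \<Rightarrow> circle \<Rightarrow> real \<Rightarrow> real" where
  "d_c u \<theta> c = deriv (\<lambda>a. u (\<theta>, a)) c"

text \<open>On the line and the annulus, which are not compact, bi-Lipschitz is understood locally: the
  twist map \<open>(\<theta>, r) \<mapsto> (\<theta> + r + r\<^sup>3, r)\<close> preserves the standard foliation and its
  rotation number \<open>c + c\<^sup>3\<close> is not globally Lipschitz.\<close>

definition locally_bilipschitz :: "('a::metric_space \<Rightarrow> 'b::metric_space) \<Rightarrow> bool" where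
  "locally_bilipschitz h \<longleftrightarrow>
    (\<forall>z. \<exists>U K. open U \<and> z \<in> U \<and> K-lipschitz_on U h \<and>
       (\<forall>x\<in>U. \<forall>y\<in>U. dist x y \<le> K * dist (h x) (h y)))"

section \<open>Symplectic notions\<close>

text \<open>Differential forms on the annulus are written in the coordinates \<open>(\<theta>, r)\<close> of its
  universal cover; \<open>\<omega> = -d(r d\<theta>) = d\<theta> \<and> dr\<close>. Pullbacks are computed with a lift, and do not
  depend on its choice.\<close>

definition liouville :: "real \<times> real \<Rightarrow> real \<times> real \<Rightarrow> real" where
  "liouville z v = snd z * fst v"

definition omega :: "real \<times> real \<Rightarrow> real \<times> real \<Rightarrow> real" where
  "omega v w = fst v * snd w - snd v * fst w"

definition preserves_omega :: "(annulus \<Rightarrow> annulus) \<Rightarrow> bool" where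
  "preserves_omega f \<longleftrightarrow>
    (\<forall>F. is_lift annulus_of F f \<longrightarrow>
      (\<forall>z v w. omega (frechet_derivative F (at z) v) (frechet_derivative F (at z) w) = omega v w))"

definition symplectic_twist_diffeo :: "(annulus \<Rightarrow> annulus) \<Rightarrow> bool" where
  "symplectic_twist_diffeo f \<longleftrightarrow>
    C1_diffeo_via annulus_of f \<and>
    homotopic_with homeo euclidean euclidean id f \<and>
    preserves_omega f \<and>
    (\<forall>F. is_lift annulus_of F f \<longrightarrow>
      (\<forall>t. strict_mono (\<lambda>r. fst (F (t, r))) \<and>
           C1_diffeo_via (id :: real \<Rightarrow> real) (\<lambda>r. fst (F (t, r)))))"

text \<open>The condition on \<open>S\<close> below says \<open>dS = \<phi>\<^sup>*(r d\<theta>) - r d\<theta>\<close>, for a function \<open>S\<close> on the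
  annulus (not merely on the plane), that is, exactness.\<close>

definition exact_symplectic_diffeo :: "(annulus \<Rightarrow> annulus) \<Rightarrow> bool" where
  "exact_symplectic_diffeo \<phi> \<longleftrightarrow>
    C1_diffeo_via annulus_of \<phi> \<and>
    (\<exists>F (S :: annulus \<Rightarrow> real). is_lift annulus_of F \<phi> \<and>
      (\<forall>z. ((\<lambda>y. S (annulus_of y)) has_derivative
             (\<lambda>v. liouville (F z) (frechet_derivative F (at z) v) - liouville z v)) (at z)))"

text \<open>Convergence in the compact-open topology is uniform convergence on compact sets.\<close>

definition exact_symplectic_homeo :: "(annulus \<Rightarrow> annulus) \<Rightarrow> bool" where
  "exact_symplectic_homeo \<Phi> \<longleftrightarrow>
    homeo \<Phi> \<and>
    (\<exists>\<phi> :: nat \<Rightarrow> annulus \<Rightarrow> annulus. (\<forall>n. exact_symplectic_diffeo (\<phi> n)) \<and>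
      (\<forall>K. compact K \<longrightarrow> uniform_limit K \<phi> \<Phi> sequentially))"

section \<open>Foliations into graphs\<close>

definition graph_of :: "(circle \<Rightarrow> real) \<Rightarrow> annulus set" where
  "graph_of g = {(\<theta>, g \<theta>) | \<theta>. True}"

definition leaves :: "(real \<Rightarrow> circle \<Rightarrow> real) \<Rightarrow> annulus set set" where
  "leaves \<eta> = range (\<lambda>c. graph_of (\<eta> c))"

definition leaf_map :: "(real \<Rightarrow> circle \<Rightarrow> real) \<Rightarrow> annulus \<Rightarrow> annulus" where
  "leaf_map \<eta> = (\<lambda>(\<theta>, c). (\<theta>, \<eta> c \<theta>))"

definition graph_foliation :: "(real \<Rightarrow> circle \<Rightarrow> real) \<Rightarrow> bool" where
  "graph_foliation \<eta> \<longleftrightarrow>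
    (\<forall>c. continuous_on UNIV (\<eta> c)) \<and>
    partition_on UNIV (leaves \<eta>) \<and>
    (\<forall>c. integral {0..1} (\<lambda>t. \<eta> c (circle_of t)) = c) \<and>
    homeo (leaf_map \<eta>)"

definition lipschitz_foliation :: "(real \<Rightarrow> circle \<Rightarrow> real) \<Rightarrow> bool" where
  "lipschitz_foliation \<eta> \<longleftrightarrow> graph_foliation \<eta> \<and> locally_bilipschitz (leaf_map \<eta>)"

definition C1_lamination :: "(real \<Rightarrow> circle \<Rightarrow> real) \<Rightarrow> bool" where
  "C1_lamination \<eta> \<longleftrightarrow>
    homeo (leaf_map \<eta>) \<and>
    (\<forall>a. C1_map (\<lambda>t. \<eta> a (circle_of t))) \<and>
    (\<forall>a. uniform_limit UNIV \<eta> (\<eta> a) (at a) \<and>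
         uniform_limit UNIV (\<lambda>b. circle_deriv (\<eta> b)) (circle_deriv (\<eta> a)) (at a))"

definition foliation_invariant ::
    "(annulus \<Rightarrow> annulus) \<Rightarrow> (real \<Rightarrow> circle \<Rightarrow> real) \<Rightarrow> bool" where
  "foliation_invariant f \<eta> \<longleftrightarrow> (\<forall>L\<in>leaves \<eta>. f ` L = L)"

definition standard_foliation :: "real \<Rightarrow> circle \<Rightarrow> real" where
  "standard_foliation c \<theta> = c"

text \<open>Since \<open>\<partial>u/\<partial>\<theta>\<close> has mean zero and leaves are normalized by their mean, the
  leaf in the last condition is necessarily the graph of \<open>\<eta> c\<close>.\<close>

definition foliation_generating_function ::
    "(annulus \<Rightarrow> real) \<Rightarrow> (real \<Rightarrow> circle \<Rightarrow> real) \<Rightarrow> bool" where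
  "foliation_generating_function u \<eta> \<longleftrightarrow>
    continuous_on UNIV u \<and>
    (\<forall>c. C1_map (\<lambda>t. u (circle_of t, c))) \<and>
    (\<forall>c. u (0, c) = 0) \<and>
    (\<forall>c. graph_of (\<lambda>\<theta>. c + d_theta u \<theta> c) \<in> leaves \<eta>)"

definition generating_function_of :: "(annulus \<Rightarrow> real) \<Rightarrow> (annulus \<Rightarrow> annulus) \<Rightarrow> bool" where
  "generating_function_of u \<Phi> \<longleftrightarrow>
    C1_map (\<lambda>z. u (annulus_of z)) \<and>
    (\<forall>x c \<theta> r. \<Phi> (x, c) = (\<theta>, r) \<longleftrightarrow>
       x = \<theta> + circle_of (d_c u \<theta> c) \<and> r = c + d_theta u \<theta> c)"

definition has_partial_theta :: "(annulus \<Rightarrow> annulus) \<Rightarrow> bool" where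
  "has_partial_theta \<Phi> \<longleftrightarrow>
    (\<exists>F. is_lift annulus_of F \<Phi> \<and> (\<forall>t c. (\<lambda>s. F (s, c)) differentiable (at t)))"

definition projected_dynamics ::
    "(annulus \<Rightarrow> annulus) \<Rightarrow> (annulus \<Rightarrow> real) \<Rightarrow> real \<Rightarrow> circle \<Rightarrow> circle" where
  "projected_dynamics f u c \<theta> = fst (f (\<theta>, c + d_theta u \<theta> c))"

definition conjugacy :: "(annulus \<Rightarrow> real) \<Rightarrow> real \<Rightarrow> circle \<Rightarrow> circle" where
  "conjugacy u c \<theta> = \<theta> + circle_of (d_c u \<theta> c)"

end

theory Submission
  imports Defs "HOL-Analysis.Analysis"
begin

text \<open>The whole argument takes place on the universal cover. Let \<open>F\<close> be a lift of the twist map, let the leaves be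
  the graphs of \<open>eta (_, c)\<close>, and put \<open>W (t, c) = u (t, c) + c t\<close>, so that \<open>dW/dt = eta\<close>. On the leaf \<open>c\<close> the map \<open>F\<close> projects to
  the lift \<open>G (_, c)\<close> of a circle homeomorphism. What has to be shown is that \<open>H = dW/dc\<close> exists, is continuous,
  and that \<open>H (_, c)\<close> is a \<open>C\<^sup>1\<close> diffeomorphism conjugating \<open>G (_, c)\<close> to a translation; the map \<open>\<Phi>\<close> generated by \<open>u\<close> then
  sends \<open>(H (t, c), c)\<close> to \<open>(t, eta (t, c))\<close>.

  The source of everything is conservation of area. The function \<open>W (_, c') - W (_, c)\<close> is the area between two
  leaves. Since \<open>F\<close> preserves area and both leaves, this function changes along an orbit by a constant, up to the area
  of the thin triangle swept by the image of a vertical segment, which is of order \<open>(c' - c)\<^sup>2\<close>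
  (\<open>flux_identity\<close>, \<open>flux_defect_bound\<close>). Divided by \<open>c' - c\<close> it becomes an almost conjugacy \<open>quot c c'\<close> of \<open>G (_, c)\<close> to a
  translation, and the Lipschitz property of the foliation makes it bi-Lipschitz with a constant independent of \<open>c'\<close>. Letting \<open>c' \<longrightarrow> c\<close> one finds
  that all iterates of \<open>G (_, c)\<close> are bi-Lipschitz with the same constant (\<open>iterate_bilip\<close>), and that the \<open>n\<close>-th iterates on two
  leaves separate at a speed comparable to \<open>n (c2 - c1)\<close> (\<open>iterate_growth\<close>).

  The linear separation has two consequences. The rotation number \<open>rho\<close> is bi-Lipschitz on compact sets
  (\<open>rho_bilip\<close>). And the chords of a leaf are squeezed between
  the directions that \<open>F\<^sup>n\<close> maps to the vertical and the images of the vertical under \<open>F\<^sup>n\<close>, whose slopes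
  differ by \<open>O(1 / n)\<close>; hence the leaves are \<open>C\<^sup>1\<close> and the foliation is a \<open>C\<^sup>1\<close> lamination (\<open>eta_C1\<close>, \<open>slope_continuous\<close>).

  The limit of \<open>quot c c'\<close> for \<open>c' \<longrightarrow> c\<close> is found in two ways. If \<open>G (_, c)\<close> has no periodic points, its
  orbits are dense on the circle; the supremum of the derivatives of all iterates is an invariant density, continuous by
  minimality, so a \<open>C\<^sup>1\<close> conjugacy exists (\<open>C1_conjugacy\<close>), and the
  equicontinuous almost conjugacies \<open>quot c c'\<close> must converge to it (\<open>approximate_conjugacies_converge\<close>). If there is a
  periodic point, all points are periodic, and the flux identity summed over a period shows that the squared
  distance to a nearby leaf, weighted by the accumulated twist, is asymptotically the same at all points
  (\<open>periodic_leaf_expansion\<close>); this gives the limit and its derivative explicitly. Continuity of \<open>H\<close> in \<open>c\<close> distinguishes the same cases (\<open>H_tendsto\<close>).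

  It remains that the homeomorphism generated by a \<open>C\<^sup>1\<close> function \<open>W\<close> with monotone partial derivatives is a
  limit of exact symplectic diffeomorphisms. These are generated by the averages of \<open>W\<close> over small boxes, which are \<open>C\<^sup>2\<close> with
  a positive mixed derivative (\<open>smooth_generating_function\<close>, \<open>exact_symplectic_homeo_annulus_map\<close>).\<close>

section \<open>Calculus in the plane\<close>

lemma continuous_on_UNIV_comp:
  assumes "continuous_on UNIV h" "continuous_on A g"
  shows "continuous_on A (\<lambda>x. h (g x))"
  using assms by (metis continuous_on_compose2 subset_UNIV)

lemma has_derivative_plane:
  fixes f p q :: "real \<times> real \<Rightarrow> real"
  assumes p: "\<And>x y. ((\<lambda>x. f (x, y)) has_real_derivative p (x, y)) (at x)"
    and q: "\<And>x y. ((\<lambda>y. f (x, y)) has_real_derivative q (x, y)) (at y)"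
    and cont: "continuous_on UNIV q"
  shows "(f has_derivative (\<lambda>v. p z * fst v + q z * snd v)) (at z)"
proof -
  obtain x y where z: "z = (x, y)" by force
  have "((\<lambda>(x, y). f (x, y)) has_derivative (\<lambda>(tx, ty). p (x, y) * tx + blinfun_scaleR_left (q (x, y)) ty))
      (at (x, y) within UNIV \<times> UNIV)"
  proof (rule has_derivative_partialsI)
    show "((\<lambda>x. f (x, y)) has_derivative (*) (p (x, y))) (at x within UNIV)"
      using p[of y x] by (simp add: has_field_derivative_def)
    show "((\<lambda>y. f (x, y)) has_derivative blinfun_apply (blinfun_scaleR_left (q (x, y)))) (at y within UNIV)" for x y
      by (rule has_derivative_eq_rhs[OF q[unfolded has_field_derivative_def]]) (auto simp: fun_eq_iff)
    have "continuous_on UNIV (\<lambda>z. blinfun_scaleR_left (q z) :: real \<Rightarrow>\<^sub>L real)"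
      by (rule continuous_on_blinfun_componentwise) (auto intro!: continuous_intros cont)
    then show "continuous (at (x, y) within UNIV \<times> UNIV)
       (\<lambda>(x, y). blinfun_scaleR_left (q (x, y)) :: real \<Rightarrow>\<^sub>L real)"
      by (simp add: continuous_on_eq_continuous_within case_prod_unfold)
  qed auto
  then show ?thesis by (simp add: z case_prod_unfold mult.commute[of "snd _"])
qed

lemma has_derivative_plane_partials:
  fixes f :: "real \<times> real \<Rightarrow> real"
  assumes "(f has_derivative (\<lambda>v. p * fst v + q * snd v)) (at (x, y))"
  shows "((\<lambda>x. f (x, y)) has_real_derivative p) (at x)"
    and "((\<lambda>y. f (x, y)) has_real_derivative q) (at y)"
proof -
  have "((\<lambda>x. f (x, y)) has_derivative (\<lambda>h. p * fst (h, 0::real) + q * snd (h, 0::real))) (at x)"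
    by (rule has_derivative_compose[where f = "\<lambda>x. (x, y)" and g = f, OF _ assms])
       (auto intro!: derivative_eq_intros)
  then show "((\<lambda>x. f (x, y)) has_real_derivative p) (at x)"
    by (simp add: has_field_derivative_def)
  have "((\<lambda>y. f (x, y)) has_derivative (\<lambda>h. p * fst (0::real, h) + q * snd (0::real, h))) (at y)"
    by (rule has_derivative_compose[where f = "\<lambda>y. (x, y)" and g = f, OF _ assms])
       (auto intro!: derivative_eq_intros)
  then show "((\<lambda>y. f (x, y)) has_real_derivative q) (at y)"
    by (simp add: has_field_derivative_def)
qed

lemma C1_map_plane:
  fixes f1 f2 p1 q1 p2 q2 :: "real \<times> real \<Rightarrow> real"
  assumes d1: "\<And>z. (f1 has_derivative (\<lambda>v. p1 z * fst v + q1 z * snd v)) (at z)"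
    and d2: "\<And>z. (f2 has_derivative (\<lambda>v. p2 z * fst v + q2 z * snd v)) (at z)"
    and cont: "continuous_on UNIV p1" "continuous_on UNIV q1" "continuous_on UNIV p2" "continuous_on UNIV q2"
  shows "C1_map (\<lambda>z. (f1 z, f2 z))"
  unfolding C1_map_def
proof (intro exI conjI allI)
  let ?D = "\<lambda>z. Blinfun (\<lambda>v. (p1 z * fst v + q1 z * snd v, p2 z * fst v + q2 z * snd v))"
  have "bounded_linear (\<lambda>v. (p1 z * fst v + q1 z * snd v, p2 z * fst v + q2 z * snd v))" for z
    by (intro bounded_linear_intros)
  then have ap: "blinfun_apply (?D z) = (\<lambda>v. (p1 z * fst v + q1 z * snd v, p2 z * fst v + q2 z * snd v))" for z
    by (rule bounded_linear_Blinfun_apply)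
  show "((\<lambda>z. (f1 z, f2 z)) has_derivative blinfun_apply (?D z)) (at z)" for z
    unfolding ap by (intro has_derivative_Pair d1 d2)
  show "continuous_on UNIV ?D"
    by (rule continuous_on_blinfun_componentwise)
       (auto simp: ap Basis_prod_def intro!: continuous_intros cont)
qed

lemma C1_map_scalar:
  fixes f p q :: "real \<times> real \<Rightarrow> real"
  assumes d: "\<And>z. (f has_derivative (\<lambda>v. p z * fst v + q z * snd v)) (at z)"
    and cont: "continuous_on UNIV p" "continuous_on UNIV q"
  shows "C1_map f"
  unfolding C1_map_def
proof (intro exI conjI allI)
  let ?D = "\<lambda>z. Blinfun (\<lambda>v. p z * fst v + q z * snd v)"
  have "bounded_linear (\<lambda>v. p z * fst v + q z * snd v)" for z
    by (intro bounded_linear_intros)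
  then have ap: "blinfun_apply (?D z) = (\<lambda>v. p z * fst v + q z * snd v)" for z
    by (rule bounded_linear_Blinfun_apply)
  show "(f has_derivative blinfun_apply (?D z)) (at z)" for z
    unfolding ap by (rule d)
  show "continuous_on UNIV ?D"
    by (rule continuous_on_blinfun_componentwise)
       (auto simp: ap Basis_prod_def intro!: continuous_intros cont)
qed

lemma C1_map_line:
  fixes f p :: "real \<Rightarrow> real"
  assumes d: "\<And>t. (f has_real_derivative p t) (at t)" and cont: "continuous_on UNIV p"
  shows "C1_map f"
  unfolding C1_map_def
proof (intro exI conjI allI)
  show "(f has_derivative blinfun_apply (blinfun_scaleR_left (p z))) (at z)" for z
    by (rule has_derivative_eq_rhs[OF d[unfolded has_field_derivative_def]]) (auto simp: fun_eq_iff)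
  show "continuous_on UNIV (\<lambda>z. blinfun_scaleR_left (p z) :: real \<Rightarrow>\<^sub>L real)"
    by (rule continuous_on_blinfun_componentwise) (auto intro!: continuous_intros cont)
qed

lemma C1_map_lineD:
  fixes f :: "real \<Rightarrow> real"
  assumes "C1_map f"
  obtains p where "\<And>t. (f has_real_derivative p t) (at t)" "continuous_on UNIV p"
proof -
  obtain F' where F': "\<And>z. (f has_derivative blinfun_apply (F' z)) (at z)" "continuous_on UNIV F'"
    using assms unfolding C1_map_def by auto
  show thesis
  proof
    show "(f has_real_derivative blinfun_apply (F' t) 1) (at t)" for t
    proof (rule has_derivative_imp_has_field_derivative[OF F'(1)])
      fix x :: real
      have "blinfun_apply (F' t) (x *\<^sub>R 1) = x *\<^sub>R blinfun_apply (F' t) 1"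
        by (rule blinfun.scaleR_right)
      then show "x * blinfun_apply (F' t) 1 = blinfun_apply (F' t) x" by simp
    qed
    show "continuous_on UNIV (\<lambda>t. blinfun_apply (F' t) 1)"
      by (intro continuous_intros F'(2))
  qed
qed

text \<open>Continuity of the fibrewise inverse costs no estimate: \<open>(t, r) \<mapsto> (t, X (t, r))\<close> is a continuous
  bijection of the plane, hence a homeomorphism by invariance of domain.\<close>

lemma fibered_inverse_continuous:
  fixes X :: "real \<times> real \<Rightarrow> real"
  assumes cX: "continuous_on UNIV X" and mono: "\<And>t r r'. r < r' \<Longrightarrow> X (t, r) < X (t, r')"
    and surj: "\<And>t. surj (\<lambda>r. X (t, r))"
  obtains Y where "\<And>t y. X (t, Y (t, y)) = y" "\<And>t r. Y (t, X (t, r)) = r" "continuous_on UNIV Y"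
proof -
  define Y where "Y z = (SOME r. X (fst z, r) = snd z)" for z
  have XY: "X (t, Y (t, y)) = y" for t y
  proof -
    have "\<exists>r. X (t, r) = y" using surj[of t] by (metis surjE)
    then have "X (t, SOME r. X (t, r) = y) = y" by (rule someI_ex)
    then show ?thesis by (simp add: Y_def)
  qed
  have YX: "Y (t, X (t, r)) = r" for t r
    by (metis XY linorder_neqE_linordered_idom mono order_less_irrefl)
  let ?K = "\<lambda>z. (fst z, X z)" and ?L = "\<lambda>z. (fst z, Y z)"
  have KL: "?K (?L z) = z" and LK: "?L (?K z) = z" for z
    using XY[of "fst z" "snd z"] YX[of "fst z" "snd z"] by auto
  have contK: "continuous_on UNIV ?K" by (intro continuous_intros cX)
  have "inj ?K" by (rule inj_on_inverseI[where g = ?L]) (rule LK)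
  then obtain g where "homeomorphism UNIV (?K ` UNIV) ?K g"
    using invariance_of_domain_homeomorphism[OF open_UNIV contK] by auto
  moreover have "?K ` UNIV = UNIV" by (rule surjI[where f = ?L]) (rule KL)
  ultimately have g: "continuous_on UNIV g" "\<And>z. g (?K z) = z"
    by (auto simp: homeomorphism_def)
  have "g z = ?L z" for z using g(2)[of "?L z"] unfolding KL .
  then have "g = ?L" by (simp add: fun_eq_iff)
  then have "continuous_on UNIV ?L" using g(1) by (simp only:)
  from continuous_on_snd[OF this] have "continuous_on UNIV Y" by simp
  from that[OF XY YX this] show thesis .
qed

lemma fibered_inverse:
  fixes X p q :: "real \<times> real \<Rightarrow> real"
  assumes dX: "\<And>z. (X has_derivative (\<lambda>v. p z * fst v + q z * snd v)) (at z)"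
    and pos: "\<And>z. q z > 0" and surj: "\<And>t. surj (\<lambda>r. X (t, r))"
  obtains Y where "\<And>t y. X (t, Y (t, y)) = y" "\<And>t r. Y (t, X (t, r)) = r" "continuous_on UNIV Y"
    "\<And>t y. (Y has_derivative
       (\<lambda>v. - p (t, Y (t, y)) / q (t, Y (t, y)) * fst v + 1 / q (t, Y (t, y)) * snd v)) (at (t, y))"
proof -
  have mono: "X (t, r) < X (t, r')" if "r < r'" for t r r'
    by (rule DERIV_pos_imp_increasing[OF that])
       (use has_derivative_plane_partials(2)[OF dX] pos in blast)
  have cX: "continuous_on UNIV X"
    by (rule continuous_at_imp_continuous_on) (use dX has_derivative_continuous in blast)
  obtain Y where XY: "\<And>t y. X (t, Y (t, y)) = y" and YX: "\<And>t r. Y (t, X (t, r)) = r" and cY: "continuous_on UNIV Y"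
    by (rule fibered_inverse_continuous[OF cX mono surj], assumption) (rule that; assumption)
  let ?K = "\<lambda>z. (fst z, X z)" and ?L = "\<lambda>z. (fst z, Y z)"
  have KL: "?K (?L z) = z" for z using XY[of "fst z" "snd z"] by auto
  have contL: "continuous_on UNIV ?L" by (intro continuous_intros cY)
  have der: "(Y has_derivative
       (\<lambda>v. - p (t, Y (t, y)) / q (t, Y (t, y)) * fst v + 1 / q (t, Y (t, y)) * snd v)) (at (t, y))" for t y
  proof -
    let ?z = "(t, Y (t, y))"
    have "(?L has_derivative (\<lambda>v. (fst v, - p ?z / q ?z * fst v + 1 / q ?z * snd v))) (at (t, y))"
    proof (rule has_derivative_inverse_basic[OF _ _ _ _ open_UNIV UNIV_I])
      show "(?K has_derivative (\<lambda>v. (fst v, p ?z * fst v + q ?z * snd v))) (at (fst (t, y), Y (t, y)))"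
        by (auto intro!: derivative_eq_intros dX)
      show "bounded_linear (\<lambda>v. (fst v, - p ?z / q ?z * fst v + 1 / q ?z * snd v))"
        by (intro bounded_linear_intros)
      show "(\<lambda>v. (fst v, - p ?z / q ?z * fst v + 1 / q ?z * snd v)) \<circ> (\<lambda>v. (fst v, p ?z * fst v + q ?z * snd v)) = id"
        using pos[of ?z] by (auto simp: fun_eq_iff field_simps)
      show "continuous (at (t, y)) ?L"
        using contL by (simp add: continuous_on_eq_continuous_at)
      show "\<And>z. ?K (?L z) = z" by (rule KL)
    qed
    from has_derivative_snd[OF this] show ?thesis by simp
  qed
  from that[OF XY YX cY der] show thesis .
qed

lemma parametric_integral_derivative:
  fixes I J1 J2 :: "real \<times> real \<Rightarrow> real \<Rightarrow> real"
  assumes dI: "\<And>z s. ((\<lambda>z. I z s) has_derivative (\<lambda>v. J1 z s * fst v + J2 z s * snd v)) (at z)"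
    and cI: "continuous_on UNIV (\<lambda>x. I (fst x) (snd x))"
    and c1: "continuous_on UNIV (\<lambda>x. J1 (fst x) (snd x))" and c2: "continuous_on UNIV (\<lambda>x. J2 (fst x) (snd x))"
  shows "((\<lambda>z. integral {0..1} (I z)) has_derivative
     (\<lambda>v. integral {0..1} (J1 z) * fst v + integral {0..1} (J2 z) * snd v)) (at z)"
proof -
  let ?D = "\<lambda>z s. Blinfun (\<lambda>v. J1 z s * fst v + J2 z s * snd v)"
  have "bounded_linear (\<lambda>v. J1 z s * fst v + J2 z s * snd v)" for z s
    by (intro bounded_linear_intros)
  then have ap: "blinfun_apply (?D z s) = (\<lambda>v. J1 z s * fst v + J2 z s * snd v)" for z s
    by (rule bounded_linear_Blinfun_apply)
  have slice: "continuous_on {0..1} (\<lambda>s. f z s)" if "continuous_on UNIV (\<lambda>x. f (fst x) (snd x))"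
    for f :: "real \<times> real \<Rightarrow> real \<Rightarrow> 'b::topological_space" and z
    using continuous_on_UNIV_comp[OF that, of "{0..1}" "\<lambda>s. (z, s)"] by (simp add: continuous_intros)
  have cD: "continuous_on UNIV (\<lambda>x. ?D (fst x) (snd x))"
  proof (rule continuous_on_blinfun_componentwise)
    fix i :: "real \<times> real"
    show "continuous_on UNIV (\<lambda>x. blinfun_apply (?D (fst x) (snd x)) i)"
      unfolding ap by (intro continuous_intros c1 c2)
  qed
  have D: "((\<lambda>z. integral (cbox 0 1) (I z)) has_derivative blinfun_apply (integral (cbox 0 1) (?D z))) (at z within UNIV)"
  proof (rule leibniz_rule)
    show "((\<lambda>z. I z s) has_derivative blinfun_apply (?D z s)) (at z within UNIV)" for z s
      unfolding ap using dI by simp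
    show "I z integrable_on cbox 0 1" for z
      using integrable_continuous_real[OF slice[OF cI]] by simp
    show "continuous_on (UNIV \<times> cbox 0 1) (\<lambda>(z, s). ?D z s)"
      unfolding case_prod_unfold by (rule continuous_on_subset[OF cD]) simp
  qed auto
  have "blinfun_apply (integral {0..1} (?D z)) v = integral {0..1} (J1 z) * fst v + integral {0..1} (J2 z) * snd v" for v
  proof -
    have "blinfun_apply (integral {0..1} (?D z)) v = integral {0..1} (\<lambda>s. blinfun_apply (?D z s) v)"
      using blinfun_apply_integral[OF integrable_continuous_real[OF slice[OF cD, of z]]] by auto
    also have "\<dots> = integral {0..1} (\<lambda>s. J1 z s * fst v) + integral {0..1} (\<lambda>s. J2 z s * snd v)"
      unfolding ap using slice[OF c1, of z] slice[OF c2, of z]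
      by (intro Henstock_Kurzweil_Integration.integral_add integrable_continuous_real continuous_intros)
    finally show ?thesis by simp
  qed
  then have "blinfun_apply (integral {0..1} (?D z)) = (\<lambda>v. integral {0..1} (J1 z) * fst v + integral {0..1} (J2 z) * snd v)"
    by (rule ext)
  with D show ?thesis by (simp only: cbox_interval)
qed

text \<open>The Poincare lemma: integrate \<open>P dx + Q dy\<close> along the rays from the origin. Closedness is the
  common coefficient \<open>p2\<close> of the two derivatives.\<close>

lemma closed_form_primitive:
  fixes P Q p1 p2 q1 q2 :: "real \<times> real \<Rightarrow> real"
  assumes dP: "\<And>z. (P has_derivative (\<lambda>v. p1 z * fst v + p2 z * snd v)) (at z)"
    and dQ: "\<And>z. (Q has_derivative (\<lambda>v. p2 z * fst v + q2 z * snd v)) (at z)"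
    and cont: "continuous_on UNIV p1" "continuous_on UNIV p2" "continuous_on UNIV q2"
  obtains S where "\<And>z. (S has_derivative (\<lambda>v. P z * fst v + Q z * snd v)) (at z)"
proof -
  have cP: "continuous_on A P" and cQ: "continuous_on A Q" for A
    by (meson dP dQ continuous_at_imp_continuous_on has_derivative_continuous)+
  note sub = continuous_on_UNIV_comp[OF cP] continuous_on_UNIV_comp[OF cQ] cont[THEN continuous_on_UNIV_comp]
  \<comment> \<open>The integrand of the primitive; \<open>J\<close> is its partial derivative, which is exactly \<open>d(s R(s z))/ds\<close>.\<close>
  define I where "I z s = P (s *\<^sub>R z) * fst z + Q (s *\<^sub>R z) * snd z" for z :: "real \<times> real" and s :: real
  define J where "J R r1 r2 z s = R (s *\<^sub>R z) + s * (r1 (s *\<^sub>R z) * fst z + r2 (s *\<^sub>R z) * snd z)"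
    for R r1 r2 :: "real \<times> real \<Rightarrow> real" and z :: "real \<times> real" and s :: real
  have sc: "((\<lambda>z. R (s *\<^sub>R z)) has_derivative (\<lambda>v. r1 (s *\<^sub>R z) * fst (s *\<^sub>R v) + r2 (s *\<^sub>R z) * snd (s *\<^sub>R v))) (at z)"
    if "\<And>z. (R has_derivative (\<lambda>v. r1 z * fst v + r2 z * snd v)) (at z)" for R r1 r2 :: "real \<times> real \<Rightarrow> real" and s z
    by (rule has_derivative_compose[OF _ that]) (auto intro!: derivative_eq_intros)
  have dI: "((\<lambda>z. I z s) has_derivative (\<lambda>v. J P p1 p2 z s * fst v + J Q p2 q2 z s * snd v)) (at z)" for z s
    unfolding I_def
    by (rule derivative_eq_intros sc[OF dP] sc[OF dQ] refl)+
       (simp add: J_def algebra_simps fun_eq_iff)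
  have FT: "integral {0..1} (J R r1 r2 z) = R z"
    if dR: "\<And>z. (R has_derivative (\<lambda>v. r1 z * fst v + r2 z * snd v)) (at z)" for R r1 r2 z
  proof -
    have "(J R r1 r2 z has_integral (1 * R (1 *\<^sub>R z) - 0 * R (0 *\<^sub>R z))) {0..1}"
    proof (rule fundamental_theorem_of_calculus)
      fix s :: real
      have "((\<lambda>s. R (s *\<^sub>R z)) has_derivative (\<lambda>h. r1 (s *\<^sub>R z) * fst (h *\<^sub>R z) + r2 (s *\<^sub>R z) * snd (h *\<^sub>R z))) (at s)"
        by (rule has_derivative_compose[OF _ dR]) (auto intro!: derivative_eq_intros)
      then have "((\<lambda>s. R (s *\<^sub>R z)) has_real_derivative (r1 (s *\<^sub>R z) * fst z + r2 (s *\<^sub>R z) * snd z)) (at s)"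
        by (rule has_derivative_imp_has_field_derivative) (simp add: algebra_simps)
      then have "((\<lambda>s. s * R (s *\<^sub>R z)) has_real_derivative J R r1 r2 z s) (at s)"
        by (auto intro!: derivative_eq_intros simp: J_def)
      then show "((\<lambda>s. s * R (s *\<^sub>R z)) has_vector_derivative J R r1 r2 z s) (at s within {0..1})"
        using has_real_derivative_iff_has_vector_derivative has_vector_derivative_at_within by blast
    qed simp
    then show ?thesis by (simp add: integral_unique)
  qed
  show thesis
  proof
    show "((\<lambda>z. integral {0..1} (I z)) has_derivative (\<lambda>v. P z * fst v + Q z * snd v)) (at z)" for z
      by (rule has_derivative_eq_rhs[OF parametric_integral_derivative[OF dI]])
         (simp_all only: FT[OF dP] FT[OF dQ], unfold I_def J_def, (intro continuous_intros sub)+)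
  qed
qed

section \<open>Mean values and difference quotients\<close>

lemma tendsto_between:
  fixes R R' \<xi> :: "'i \<Rightarrow> real"
  assumes "(R \<longlongrightarrow> r) Fl" "(R' \<longlongrightarrow> r) Fl" "\<forall>\<^sub>F j in Fl. \<xi> j \<in> closed_segment (R j) (R' j)"
  shows "(\<xi> \<longlongrightarrow> r) Fl"
proof (rule tendsto_sandwich)
  show "((\<lambda>j. min (R j) (R' j)) \<longlongrightarrow> r) Fl" "((\<lambda>j. max (R j) (R' j)) \<longlongrightarrow> r) Fl"
    using tendsto_min[OF assms(1,2)] tendsto_max[OF assms(1,2)] by simp_all
  show "\<forall>\<^sub>F j in Fl. min (R j) (R' j) \<le> \<xi> j" "\<forall>\<^sub>F j in Fl. \<xi> j \<le> max (R j) (R' j)"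
    using assms(3) by (auto elim!: eventually_mono simp: closed_segment_eq_real_ivl split: if_splits)
qed

lemma mvt_segment:
  fixes f f' :: "real \<Rightarrow> real"
  assumes "\<And>r. (f has_real_derivative f' r) (at r)"
  obtains \<xi> where "\<xi> \<in> closed_segment r r'" "f r' - f r = (r' - r) * f' \<xi>"
proof (cases r r' rule: linorder_cases)
  case less
  then obtain z where "r < z" "z < r'" "f r' - f r = (r' - r) * f' z"
    using MVT2[OF less, of f f'] assms by blast
  then show thesis using that[of z] by (auto simp: closed_segment_eq_real_ivl)
next
  case equal
  then show thesis using that[of r] by simp
next
  case greater
  then obtain z where "r' < z" "z < r" "f r - f r' = (r - r') * f' z"
    using MVT2[OF greater, of f f'] assms by blast
  then show thesis using that[of z] by (auto simp: closed_segment_eq_real_ivl algebra_simps)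
qed

lemma tendsto_difference_quotient:
  fixes \<phi> :: "'i \<Rightarrow> real \<Rightarrow> real" and \<phi>' :: "'i \<Rightarrow> real \<Rightarrow> real"
  assumes der: "\<And>j r. ((\<phi> j) has_real_derivative \<phi>' j r) (at r)"
    and lim: "\<And>\<xi>. (\<xi> \<longlongrightarrow> r0) Fl \<Longrightarrow> ((\<lambda>j. \<phi>' j (\<xi> j)) \<longlongrightarrow> l) Fl"
    and R: "(R \<longlongrightarrow> r0) Fl" and R': "(R' \<longlongrightarrow> r0) Fl" and ne: "\<forall>\<^sub>F j in Fl. R j \<noteq> R' j"
  shows "((\<lambda>j. (\<phi> j (R' j) - \<phi> j (R j)) / (R' j - R j)) \<longlongrightarrow> l) Fl"
proof -
  have "\<exists>\<xi>. \<forall>j. \<xi> j \<in> closed_segment (R j) (R' j) \<and> \<phi> j (R' j) - \<phi> j (R j) = (R' j - R j) * \<phi>' j (\<xi> j)"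
    by (rule choice) (metis mvt_segment[OF der])
  then obtain \<xi> where \<xi>: "\<And>j. \<xi> j \<in> closed_segment (R j) (R' j)"
    "\<And>j. \<phi> j (R' j) - \<phi> j (R j) = (R' j - R j) * \<phi>' j (\<xi> j)" by blast
  have "(\<xi> \<longlongrightarrow> r0) Fl" by (rule tendsto_between[OF R R']) (simp add: \<xi>(1))
  from lim[OF this] show ?thesis
    by (rule Lim_transform_eventually) (use ne in \<open>eventually_elim, simp add: \<xi>(2)\<close>)
qed

text \<open>A primitive of \<open>J b\<close>, where \<open>J\<close> vanishes at \<open>r1\<close>, is quadratic near \<open>r1\<close>. Cauchy's mean value
  theorem against \<open>(r - r1)\<^sup>2\<close> removes one factor \<open>r - r1\<close>, the ordinary one applied to \<open>J\<close> the other.\<close>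

lemma second_order_mvt:
  fixes f J J' b :: "real \<Rightarrow> real"
  assumes f: "\<And>r. (f has_real_derivative J r * b r) (at r)"
    and J: "\<And>r. (J has_real_derivative J' r) (at r)" and J1: "J r1 = 0"
  obtains \<xi> \<xi>' where "\<xi> \<in> closed_segment r0 r1" "\<xi>' \<in> closed_segment r0 r1"
    "f r1 - f r0 = - ((r1 - r0)^2 * (J' \<xi>' * b \<xi>) / 2)"
proof (cases "r0 = r1")
  case True
  then show thesis using that[of r0 r0] by simp
next
  case False
  let ?g = "\<lambda>r. (r - r1)^2"
  have dg: "(?g has_real_derivative 2 * (r - r1)) (at r)" for r
    by (auto intro!: derivative_eq_intros)
  have "\<exists>z. z \<in> open_segment r0 r1 \<and> (f r1 - f r0) * (2 * (z - r1)) = (?g r1 - ?g r0) * (J z * b z)"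
  proof (cases "r0 < r1")
    case True
    have "\<exists>z. r0 < z \<and> z < r1 \<and> (f r1 - f r0) * (2 * (z - r1)) = (?g r1 - ?g r0) * (J z * b z)"
      by (rule GMVT'[OF True]) (rule f dg DERIV_isCont[OF f] DERIV_isCont[OF dg])+
    then show ?thesis using True by (auto simp: open_segment_eq_real_ivl)
  next
    case False
    with \<open>r0 \<noteq> r1\<close> have lt: "r1 < r0" by simp
    have "\<exists>z. r1 < z \<and> z < r0 \<and> (f r0 - f r1) * (2 * (z - r1)) = (?g r0 - ?g r1) * (J z * b z)"
      by (rule GMVT'[OF lt]) (rule f dg DERIV_isCont[OF f] DERIV_isCont[OF dg])+
    then show ?thesis using lt by (auto simp: open_segment_eq_real_ivl algebra_simps)
  qed
  then obtain \<xi> where \<xi>: "\<xi> \<in> open_segment r0 r1" "(f r1 - f r0) * (2 * (\<xi> - r1)) = - ((r0 - r1)^2 * (J \<xi> * b \<xi>))"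
    by auto
  obtain \<xi>' where \<xi>': "\<xi>' \<in> closed_segment r1 \<xi>" "J \<xi> = (\<xi> - r1) * J' \<xi>'"
    using mvt_segment[OF J, of r1 \<xi>] J1 by auto
  have ne: "\<xi> - r1 \<noteq> 0" using \<xi>(1) by (auto simp: open_segment_def)
  have "(\<xi> - r1) * ((f r1 - f r0) * 2) = (\<xi> - r1) * (- ((r0 - r1)^2 * (J' \<xi>' * b \<xi>)))"
    using \<xi>(2) unfolding \<xi>'(2) by (simp add: algebra_simps)
  with ne have "(f r1 - f r0) * 2 = - ((r0 - r1)^2 * (J' \<xi>' * b \<xi>))"
    by (simp only: mult_cancel_left) simp
  then have "f r1 - f r0 = - ((r1 - r0)^2 * (J' \<xi>' * b \<xi>) / 2)"
    by (simp add: power2_commute)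
  moreover have "\<xi>' \<in> closed_segment r0 r1"
    using \<xi>(1) \<xi>'(1) by (auto simp: open_segment_eq_real_ivl closed_segment_eq_real_ivl split: if_splits)
  moreover have "\<xi> \<in> closed_segment r0 r1"
    using \<xi>(1) by (simp add: open_segment_def)
  ultimately show thesis using that by blast
qed

text \<open>A chain rule along a curve that is only Lipschitz: when the derivative vanishes at the point, the
  increment is \<open>o\<close> of the distance, which the Lipschitz bound turns into \<open>o(t' - t)\<close>. This is how the
  invariant leaves can be differentiated along before they are known to be differentiable.\<close>

lemma has_derivative_zero_Lipschitz_curve:
  fixes \<Xi> :: "real \<times> real \<Rightarrow> real" and e :: "real \<Rightarrow> real"
  assumes d: "(\<Xi> has_derivative (\<lambda>v. 0)) (at (t, e t))"
    and lip: "\<And>t'. \<bar>e t' - e t\<bar> \<le> K * \<bar>t' - t\<bar>"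
  shows "((\<lambda>t. \<Xi> (t, e t)) has_real_derivative 0) (at t)"
proof -
  have "((\<lambda>t'. (\<Xi> (t', e t') - \<Xi> (t, e t)) / (t' - t)) \<longlongrightarrow> 0) (at t)"
  proof (rule tendstoI)
    fix \<epsilon> :: real assume \<epsilon>: "\<epsilon> > 0"
    define K' where "K' = 1 + \<bar>K\<bar>"
    have K': "K' > 0" by (simp add: K'_def)
    have "\<exists>\<delta>>0. \<forall>y. norm (y - (t, e t)) < \<delta> \<longrightarrow> \<bar>\<Xi> y - \<Xi> (t, e t)\<bar> \<le> \<epsilon> / (2 * K') * norm (y - (t, e t))"
    proof -
      have "\<forall>\<epsilon>>0. \<exists>\<delta>>0. \<forall>y. norm (y - (t, e t)) < \<delta> \<longrightarrow> norm (\<Xi> y - \<Xi> (t, e t) - 0) \<le> \<epsilon> * norm (y - (t, e t))"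
        using d unfolding has_derivative_at_alt by blast
      moreover have "\<epsilon> / (2 * K') > 0" using \<epsilon> K' by simp
      ultimately show ?thesis by (metis diff_zero real_norm_def)
    qed
    then obtain \<delta> where \<delta>: "\<delta> > 0" "\<And>y. norm (y - (t, e t)) < \<delta> \<Longrightarrow> \<bar>\<Xi> y - \<Xi> (t, e t)\<bar> \<le> \<epsilon> / (2 * K') * norm (y - (t, e t))"
      by blast
    have nrm: "norm ((t', e t') - (t, e t)) \<le> K' * \<bar>t' - t\<bar>" for t'
    proof -
      have "norm ((t', e t') - (t, e t)) \<le> \<bar>t' - t\<bar> + \<bar>e t' - e t\<bar>"
        using norm_Pair_le[of "t' - t" "e t' - e t"] by simp
      also have "\<bar>e t' - e t\<bar> \<le> \<bar>K\<bar> * \<bar>t' - t\<bar>"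
        using lip[of t'] abs_ge_self[of K] by (meson abs_ge_zero mult_right_mono order_trans)
      finally show ?thesis by (simp add: K'_def algebra_simps)
    qed
    have "\<forall>\<^sub>F t' in at t. t' \<noteq> t \<and> dist t' t < \<delta> / K'"
      using \<delta>(1) K' by (auto simp: eventually_at intro!: exI[of _ "\<delta> / K'"])
    then show "\<forall>\<^sub>F t' in at t. dist ((\<Xi> (t', e t') - \<Xi> (t, e t)) / (t' - t)) 0 < \<epsilon>"
    proof eventually_elim
      case (elim t')
      have "K' * \<bar>t' - t\<bar> < \<delta>"
        using elim K' by (simp add: dist_real_def pos_less_divide_eq mult.commute)
      then have "\<bar>\<Xi> (t', e t') - \<Xi> (t, e t)\<bar> \<le> \<epsilon> / (2 * K') * (K' * \<bar>t' - t\<bar>)"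
        using \<delta>(2)[of "(t', e t')"] nrm[of t'] \<epsilon> K'
        by (smt (verit) divide_nonneg_pos mult_left_mono)
      also have "\<dots> = \<epsilon> / 2 * \<bar>t' - t\<bar>" using K' by simp
      finally have "\<bar>\<Xi> (t', e t') - \<Xi> (t, e t)\<bar> / \<bar>t' - t\<bar> \<le> \<epsilon> / 2"
        using elim by (simp add: pos_divide_le_eq)
      then have "\<bar>\<Xi> (t', e t') - \<Xi> (t, e t)\<bar> / \<bar>t' - t\<bar> < \<epsilon>"
        using \<epsilon> by linarith
      then show ?case by (simp add: dist_real_def abs_divide)
    qed
  qed
  then show ?thesis by (simp add: has_field_derivative_iff)
qed

lemma continuous_antiderivative:
  fixes f :: "real \<Rightarrow> real"
  assumes "continuous_on UNIV f"
  obtains g where "\<And>t. (g has_real_derivative f t) (at t)" "g 0 = 0"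
proof -
  have "\<exists>g. \<forall>x::real. - \<infinity> < ereal x \<longrightarrow> ereal x < \<infinity> \<longrightarrow> (g has_vector_derivative f x) (at x)"
    by (rule einterval_antiderivative) (use assms in \<open>auto simp: continuous_on_eq_continuous_at\<close>)
  then obtain g where g: "\<And>t. (g has_real_derivative f t) (at t)"
    by (auto simp: has_real_derivative_iff_has_vector_derivative)
  show thesis
  proof (rule that)
    show "((\<lambda>t. g t - g 0) has_real_derivative f t) (at t)" for t
      using g by (auto intro!: derivative_eq_intros)
  qed simp
qed

section \<open>Circle maps with uniformly bi-Lipschitz iterates\<close>

lemma has_real_derivative_zero_const:
  fixes f :: "real \<Rightarrow> real"
  assumes "\<And>t. (f has_real_derivative 0) (at t)"
  shows "f t = f t'"
  using DERIV_isconst_all assms by blast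

lemma shift_of_int:
  fixes f :: "real \<Rightarrow> real"
  assumes "\<And>t. f (t + 1) = f t + d"
  shows "f (t + of_int m) = f t + of_int m * d"
proof (induction m rule: int_induct[where k = 0])
  case (step1 i)
  then show ?case using assms[of "t + of_int i"] by (simp add: algebra_simps)
next
  case (step2 i)
  then show ?case using assms[of "t + of_int (i - 1)"] by (simp add: algebra_simps)
qed simp

text \<open>A lift to the line of a \<open>C\<^sup>1\<close> circle diffeomorphism all of whose iterates have the same bi-Lipschitz
  constant \<open>K\<close>. The restrictions of the twist map to the invariant leaves are of this kind.\<close>

locale bilipschitz_circle_map =
  fixes G A :: "real \<Rightarrow> real" and K :: real
  assumes shift: "G (t + 1) = G t + 1"
    and der: "(G has_real_derivative A t) (at t)"
    and contA: "continuous_on UNIV A"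
    and K: "K \<ge> 1"
    and bilip: "t \<le> t' \<Longrightarrow> (t' - t) / K \<le> (G ^^ n) t' - (G ^^ n) t \<and> (G ^^ n) t' - (G ^^ n) t \<le> K * (t' - t)"
begin

lemma shift_iter: "(G ^^ n) (t + of_int m) = (G ^^ n) t + of_int m"
proof (induction n)
  case (Suc n)
  then show ?case using shift_of_int[of G 1, OF shift] by simp
qed simp

lemma strict_mono_iter: "strict_mono (G ^^ n)"
proof (rule strict_monoI)
  fix t t' :: real assume "t < t'"
  then have "0 < (t' - t) / K" using K by simp
  then show "(G ^^ n) t < (G ^^ n) t'" using bilip[of t t' n] \<open>t < t'\<close> by linarith
qed

lemma inj_iter: "inj (G ^^ n)"
  by (rule strict_mono_imp_inj_on[OF strict_mono_iter])

lemma cont_iter: "continuous_on UNIV (G ^^ n)"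
proof (induction n)
  case (Suc n)
  have "continuous_on UNIV G" by (simp add: DERIV_isCont[OF der] continuous_at_imp_continuous_on)
  then show ?case using Suc by (simp add: o_def) (rule continuous_on_compose2, auto)
qed (simp add: id_def)

lemma surj_G: "surj G"
proof -
  have "\<exists>t. G t = y" for y
  proof -
    have "G (of_int \<lfloor>y - G 0\<rfloor>) \<le> y" "y \<le> G (of_int \<lceil>y - G 0\<rceil>)"
      using shift_iter[of 1 0] by (simp_all add: algebra_simps) linarith+
    moreover have "continuous_on {of_int \<lfloor>y - G 0\<rfloor>..of_int \<lceil>y - G 0\<rceil>} G"
      using continuous_on_subset[OF cont_iter[of 1]] by simp
    moreover have "(of_int \<lfloor>y - G 0\<rfloor> :: real) \<le> of_int \<lceil>y - G 0\<rceil>"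
      by (simp add: floor_le_ceiling)
    ultimately show ?thesis
      using IVT'[of G "of_int \<lfloor>y - G 0\<rfloor>" y "of_int \<lceil>y - G 0\<rceil>"] by blast
  qed
  then show ?thesis by (metis surj_def)
qed

definition g :: "real \<Rightarrow> real" where "g = inv G"

lemma Gg: "G (g t) = t" and gG: "g (G t) = t"
  using surj_G inj_iter[of 1] by (simp_all add: g_def surj_f_inv_f)

lemma cont_g: "continuous_on UNIV g"
proof -
  have "\<bar>g t' - g t\<bar> \<le> K * \<bar>t' - t\<bar>" for t t'
  proof -
    have le: "\<bar>y' - y\<bar> / K \<le> \<bar>G y' - G y\<bar>" if "y \<le> y'" for y y'
    proof -
      have "(y' - y) / K \<le> G y' - G y" using bilip[OF that, of 1] by simp
      also have "\<dots> \<le> \<bar>G y' - G y\<bar>" by simp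
      finally show ?thesis using that by simp
    qed
    have "\<bar>y' - y\<bar> / K \<le> \<bar>G y' - G y\<bar>" for y y'
      using le[of y y'] le[of y' y] by (metis abs_minus_commute linear)
    from this[of "g t'" "g t"] show ?thesis
      using K by (simp add: Gg field_simps)
  qed
  then have "K-lipschitz_on UNIV g" using K by (intro lipschitz_onI) (auto simp: dist_real_def)
  then show ?thesis by (rule lipschitz_on_continuous_on)
qed

lemma g_shift: "g (t + 1) = g t + 1"
  by (metis Gg gG shift)

lemma g_iter_shift: "(g ^^ m) (t + 1) = (g ^^ m) t + 1"
  by (induction m) (simp_all add: g_shift)

lemma cont_g_iter: "continuous_on UNIV (g ^^ m)"
proof (induction m)
  case (Suc m)
  then show ?case by (simp add: o_def) (rule continuous_on_compose2[OF cont_g], auto)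
qed (simp add: id_def)

lemma A_shift: "A (t + 1) = A t"
proof -
  have "((\<lambda>s. G (s + 1)) has_real_derivative A (t + 1)) (at t)"
    using der[of "t + 1"] DERIV_shift[of G "A (t + 1)" t 1] by simp
  moreover have "((\<lambda>s. G s + 1) has_real_derivative A t) (at t)"
    using der[of t] by (auto intro!: derivative_eq_intros)
  ultimately show ?thesis using shift by (simp add: DERIV_unique)
qed

definition An :: "nat \<Rightarrow> real \<Rightarrow> real" where "An n t = (\<Prod>k<n. A ((G ^^ k) t))"

lemma An_Suc: "An (Suc n) t = An n t * A ((G ^^ n) t)" "An (Suc n) t = A t * An n (G t)"
proof -
  show "An (Suc n) t = An n t * A ((G ^^ n) t)" by (simp add: An_def)
  have "An (Suc n) t = A t * (\<Prod>k<n. A ((G ^^ Suc k) t))"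
    unfolding An_def prod.lessThan_Suc_shift by simp
  then show "An (Suc n) t = A t * An n (G t)"
    unfolding An_def by (simp only: funpow_Suc_right o_apply)
qed

lemma An_0: "An 0 t = 1" by (simp add: An_def)

lemma der_iter: "((G ^^ n) has_real_derivative An n t) (at t)"
proof (induction n)
  case (Suc n)
  have "((\<lambda>t. G ((G ^^ n) t)) has_real_derivative A ((G ^^ n) t) * An n t) (at t)"
    by (rule DERIV_chain2[OF der Suc])
  then show ?case by (simp add: An_Suc o_def mult.commute)
qed (simp add: An_def id_def)

lemma cont_An: "continuous_on UNIV (An n)"
  unfolding An_def by (intro continuous_intros continuous_on_compose2[OF contA cont_iter]) auto

lemma An_shift: "An n (t + 1) = An n t"
  unfolding An_def using shift_iter[of _ t 1] A_shift by simp

lemma An_bounds: "1 / K \<le> An n t" "An n t \<le> K"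
proof -
  have lim: "((\<lambda>y. ((G ^^ n) y - (G ^^ n) t) / (y - t)) \<longlongrightarrow> An n t) (at_right t)"
    using der_iter[of n t] unfolding has_field_derivative_iff by (rule tendsto_mono[OF at_le[OF subset_UNIV]])
  have ev: "\<forall>\<^sub>F y in at_right t. 1 / K \<le> ((G ^^ n) y - (G ^^ n) t) / (y - t) \<and> ((G ^^ n) y - (G ^^ n) t) / (y - t) \<le> K"
  proof -
    have "\<forall>\<^sub>F y in at_right t. t < y" by (simp add: eventually_at_right_less)
    then show ?thesis
    proof eventually_elim
      case (elim y)
      then show ?case using bilip[of t y n] by (auto simp: pos_divide_le_eq pos_le_divide_eq)
    qed
  qed
  show "1 / K \<le> An n t"
    by (rule tendsto_lowerbound[OF lim]) (use ev in \<open>auto elim: eventually_mono\<close>)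
  show "An n t \<le> K"
    by (rule tendsto_upperbound[OF lim]) (use ev in \<open>auto elim: eventually_mono\<close>)
qed

lemma An_pos: "An n t > 0"
  using An_bounds(1)[of n t] K by (meson divide_pos_pos less_le_trans less_numeral_extra(1) order_less_le_trans)

end

locale aperiodic_circle_map = bilipschitz_circle_map +
  assumes aper: "n > 0 \<Longrightarrow> (G ^^ n) t \<noteq> t + of_int m"
begin

text \<open>Such a map without periodic points has only dense orbits. Otherwise a closed invariant set has a
  complementary gap \<open>(a, b)\<close>; all its images are gaps as well and are at least \<open>(b - a) / K\<close> long. Two
  points of the orbit of \<open>a\<close> that are closer than that on the circle then have to coincide, and
  recurrence produces a periodic point.\<close>

lemma minimal:
  assumes cl: "closed E" and ne: "E \<noteq> {}" and inv: "\<And>t. G t \<in> E \<longleftrightarrow> t \<in> E"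
    and sh: "\<And>t. t \<in> E \<Longrightarrow> t + 1 \<in> E" "\<And>t. t \<in> E \<Longrightarrow> t - 1 \<in> E"
  shows "E = UNIV"
proof (rule ccontr)
  assume "E \<noteq> UNIV"
  then obtain y where y: "y \<notin> E" by auto
  have shZ: "t + of_int m \<in> E" if "t \<in> E" for t m
    using that
  proof (induction m rule: int_induct[where k = 0])
    case (step1 i) then show ?case using sh(1)[of "t + of_int i"] by (simp add: algebra_simps)
  next
    case (step2 i) then show ?case using sh(2)[of "t + of_int i"] by (simp add: algebra_simps)
  qed simp
  obtain x where x: "x \<in> E" using ne by auto
  have inv_n: "(G ^^ n) t \<in> E \<longleftrightarrow> t \<in> E" for n t by (induction n) (simp_all add: inv)
  define a where "a = Sup (E \<inter> {..y})"
  define b where "b = Inf (E \<inter> {y..})"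
  have "x + of_int \<lfloor>y - x\<rfloor> \<in> E \<inter> {..y}" using shZ[OF x] by simp linarith
  then have a: "a \<in> E \<inter> {..y}" unfolding a_def
    by (intro closed_contains_Sup) (auto intro: closed_Int cl bdd_aboveI[of _ y])
  have "x + of_int \<lceil>y - x\<rceil> \<in> E \<inter> {y..}" using shZ[OF x] by simp linarith
  then have b: "b \<in> E \<inter> {y..}" unfolding b_def
    by (intro closed_contains_Inf) (auto intro: closed_Int cl bdd_belowI[of _ y])
  have ab: "a < b" using a b y by (metis IntE atLeast_iff atMost_iff le_less less_le_trans)
  have gap: "t \<notin> E" if "a < t" "t < b" for t
  proof
    assume "t \<in> E"
    show False
    proof (cases "t \<le> y")
      case True
      then have "t \<le> a" unfolding a_def using \<open>t \<in> E\<close> by (intro cSup_upper) (auto intro: bdd_aboveI[of _ y])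
      then show False using that by simp
    next
      case False
      then have "b \<le> t" unfolding b_def using \<open>t \<in> E\<close> by (intro cInf_lower) (auto intro: bdd_belowI[of _ y])
      then show False using that by simp
    qed
  qed
  define L where "L = (b - a) / K"
  have L: "L > 0" using ab K by (simp add: L_def)
  define p where "p k = frac ((G ^^ k) a)" for k
  have pE: "p k \<in> E" for k
    using shZ[of "(G ^^ k) a" "- \<lfloor>(G ^^ k) a\<rfloor>"] a inv_n by (simp add: p_def frac_def)
  \<comment> \<open>Between \<open>p k\<close> and \<open>p k + L\<close> lies the image of the gap, which contains no point of \<open>E\<close>.\<close>
  have pgap: False if "p k < p l" "p l < p k + L" for k l
  proof -
    define x where "x = p l + of_int \<lfloor>(G ^^ k) a\<rfloor>"
    have xE: "x \<in> E" unfolding x_def by (rule shZ[OF pE])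
    have x1: "(G ^^ k) a < x" using that(1) by (simp add: x_def p_def frac_def)
    have x2: "x < (G ^^ k) b"
      using that(2) bilip[of a b k] ab by (simp add: x_def p_def[of k] frac_def L_def)
    have "surj (G ^^ k)" using surj_G by (rule surj_fn)
    then obtain x' where x': "x = (G ^^ k) x'" by (metis surjE)
    have "a < x'" "x' < b" using x1 x2 strict_mono_less[OF strict_mono_iter] unfolding x' by blast+
    moreover have "x' \<in> E" using xE x' inv_n by simp
    ultimately show False using gap by blast
  qed
  have "bounded (range p)"
    unfolding bounded_iff by (rule exI[of _ 1]) (auto simp: p_def abs_of_nonneg[OF frac_ge_0] intro: less_imp_le frac_lt_1)
  then obtain l r where r: "strict_mono (r :: nat \<Rightarrow> nat)" and lim: "(p \<circ> r) \<longlonglongrightarrow> l"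
    using bounded_imp_convergent_subsequence by blast
  have "Cauchy (p \<circ> r)" using lim by (rule LIMSEQ_imp_Cauchy)
  then obtain M where M: "\<And>m n. m \<ge> M \<Longrightarrow> n \<ge> M \<Longrightarrow> dist ((p \<circ> r) m) ((p \<circ> r) n) < L"
    using L unfolding Cauchy_def by blast
  define k where "k = r M"
  define l where "l = r (Suc M)"
  have kl: "k < l" using r by (simp add: k_def l_def strict_mono_less)
  have d: "\<bar>p k - p l\<bar> < L" using M[of M "Suc M"] by (simp add: k_def l_def dist_real_def)
  show False
  proof (cases "p k" "p l" rule: linorder_cases)
    case less then show False using pgap d by fastforce
  next
    case greater then show False using pgap d by fastforce
  next
    case equal
    define m where "m = \<lfloor>(G ^^ l) a\<rfloor> - \<lfloor>(G ^^ k) a\<rfloor>"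
    have "(G ^^ k) ((G ^^ (l - k)) a) = (G ^^ (k + (l - k))) a" by (simp add: funpow_add)
    also have "\<dots> = (G ^^ l) a" using kl by simp
    also have "\<dots> = (G ^^ k) a + of_int m" using equal by (simp add: p_def frac_def m_def)
    also have "\<dots> = (G ^^ k) (a + of_int m)" by (simp add: shift_iter)
    finally have "(G ^^ (l - k)) a = a + of_int m" using inj_iter by (meson injD)
    then show False using aper[of "l - k" a m] kl by simp
  qed
qed

text \<open>With \<open>y = G\<^sup>-\<^sup>m t\<close> this is \<open>(G\<^sup>n)'(y) / (G\<^sup>m)'(y)\<close>, the derivative at \<open>t\<close> of \<open>G\<close> iterated \<open>n - m\<close>
  times. Indexing by pairs of naturals covers forward and backward iterates without negative exponents.\<close>

definition B :: "nat \<times> nat \<Rightarrow> real \<Rightarrow> real" where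
  "B mn t = An (snd mn) ((g ^^ fst mn) t) / An (fst mn) ((g ^^ fst mn) t)"

lemma B_bounds: "1 / K^2 \<le> B mn t" "B mn t \<le> K^2" "B mn t > 0"
proof -
  let ?y = "(g ^^ fst mn) t"
  note b = An_bounds[of "fst mn" ?y] An_bounds[of "snd mn" ?y] An_pos[of "fst mn" ?y] An_pos[of "snd mn" ?y]
  have "(1 / K) / K \<le> B mn t" unfolding B_def
    using b K by (intro frac_le) auto
  then show "1 / K^2 \<le> B mn t" by (simp add: power2_eq_square)
  have "B mn t \<le> K / (1 / K)" unfolding B_def
    using b K by (intro frac_le) auto
  then show "B mn t \<le> K^2" by (simp add: power2_eq_square)
  show "B mn t > 0" unfolding B_def using b by simp
qed

lemma cont_B: "continuous_on UNIV (B mn)"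
proof -
  have "continuous_on UNIV (\<lambda>t. An n ((g ^^ m) t))" for m n
    by (rule continuous_on_compose2[OF cont_An cont_g_iter]) auto
  then show ?thesis unfolding B_def using An_pos by (intro continuous_intros) (auto simp: less_imp_neq[symmetric] order_less_imp_not_eq2)
qed

lemma B_shift: "B mn (t + 1) = B mn t"
  by (simp add: B_def g_iter_shift An_shift)

lemma G_iter_g: "(G ^^ m) ((g ^^ m) t) = t"
  by (induction m arbitrary: t) (simp_all add: Gg funpow_swap1)

lemma B_step: "B (Suc m, n) (G t) * A t = B (m, n) t"
proof -
  let ?y = "(g ^^ m) t"
  have "(g ^^ Suc m) (G t) = ?y" by (simp add: funpow_swap1 gG)
  moreover have "An (Suc m) ?y = An m ?y * A t" by (simp add: An_Suc(1) G_iter_g)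
  moreover have "A t > 0" using An_pos[of "Suc 0" t] by (simp add: An_def)
  ultimately show ?thesis by (simp add: B_def)
qed

lemma B_step0: "B (0, n) (G t) * A t = B (0, Suc n) t"
  using An_Suc(2)[of n t] by (simp add: B_def An_0)

lemma B_pull: "\<exists>mn'. B mn t = B mn' (G t) * A t"
  by (cases mn) (metis B_step)

lemma B_push: "\<exists>mn'. B mn (G t) * A t = B mn' t"
proof (cases mn)
  case (Pair m n)
  then show ?thesis by (cases m) (metis B_step0, metis B_step)
qed

text \<open>The derivatives of all iterates form a family that is mapped to itself, up to the factor \<open>A\<close>, by
  \<open>G\<close>. Its supremum and its infimum are therefore densities with \<open>P (G t) * A t = P t\<close>, the first lower and
  the second upper semicontinuous.\<close>

definition P :: "real \<Rightarrow> real" where "P t = (SUP mn. B mn t)"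
definition Q :: "real \<Rightarrow> real" where "Q t = (INF mn. B mn t)"

lemma bdd_B: "bdd_above (range (\<lambda>mn. B mn t))" "bdd_below (range (\<lambda>mn. B mn t))"
  using B_bounds by (auto intro!: bdd_aboveI[of _ "K^2"] bdd_belowI[of _ "1/K^2"])

lemma B_le_P: "B mn t \<le> P t" and Q_le_B: "Q t \<le> B mn t"
  unfolding P_def Q_def using bdd_B by (auto intro: cSUP_upper cINF_lower)

lemma P_pos: "P t > 0" using B_le_P[of "(0,0)" t] B_bounds(3) less_le_trans by blast

lemma Q_pos: "Q t > 0"
proof -
  have "1 / K^2 \<le> Q t" unfolding Q_def using B_bounds by (intro cINF_greatest) auto
  moreover have "1 / K^2 > 0" using K by simp
  ultimately show ?thesis by linarith
qed

lemma P_G: "P (G t) * A t = P t"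
proof -
  have A: "A t > 0" using An_pos[of "Suc 0" t] by (simp add: An_def)
  have "P t \<le> P (G t) * A t" unfolding P_def[of t]
    by (rule cSUP_least) (use B_pull B_le_P A in \<open>auto simp: mult_right_mono\<close>, metis mult_right_mono less_imp_le)
  moreover have "P (G t) \<le> P t / A t" unfolding P_def[of "G t"]
    by (rule cSUP_least) (use B_push B_le_P A in \<open>auto simp: pos_le_divide_eq\<close>, metis)
  ultimately show ?thesis using A by (simp add: pos_le_divide_eq)
qed

lemma P_shift: "P (t + 1) = P t" by (simp add: P_def B_shift)

text \<open>The set where \<open>P / Q\<close> is at most its value at \<open>t0\<close> is closed, because \<open>P\<close> is a supremum and \<open>Q\<close> an
  infimum of continuous functions, and it is invariant. Minimality makes it everything.\<close>

lemma P_over_Q_const: "P t * Q t0 \<le> P t0 * Q t"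
proof -
  define x where "x = P t0 / Q t0"
  have x: "x > 0" using P_pos Q_pos by (simp add: x_def)
  define E where "E = (\<Inter>mn. \<Inter>mn'. {t. B mn t \<le> x * B mn' t})"
  have "E = UNIV"
  proof (rule minimal)
    show "closed E" unfolding E_def
      by (intro closed_INT ballI closed_Collect_le continuous_intros cont_B)
    have "B mn t0 \<le> x * B mn' t0" for mn mn'
    proof -
      have "B mn t0 \<le> P t0" by (rule B_le_P)
      also have "\<dots> = x * Q t0" using Q_pos[of t0] by (simp add: x_def)
      also have "\<dots> \<le> x * B mn' t0" using Q_le_B x by (simp add: mult_left_mono)
      finally show ?thesis .
    qed
    then show "E \<noteq> {}" unfolding E_def by blast
    show "G t \<in> E \<longleftrightarrow> t \<in> E" for t
    proof -
      have A: "A t > 0" using An_pos[of "Suc 0" t] by (simp add: An_def)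
      have iff: "B mn (G t) * A t \<le> x * (B mn' (G t) * A t) \<longleftrightarrow> B mn (G t) \<le> x * B mn' (G t)" for mn mn'
        using A by (metis mult.assoc mult_le_cancel_right_pos)
      show ?thesis
      proof
        assume "G t \<in> E"
        then show "t \<in> E" unfolding E_def using B_pull[of _ t] iff by simp metis
      next
        assume "t \<in> E"
        then show "G t \<in> E" unfolding E_def using B_push[of _ t] iff by simp metis
      qed
    qed
    show "t + 1 \<in> E" if "t \<in> E" for t using that by (simp add: E_def B_shift)
    show "t - 1 \<in> E" if "t \<in> E" for t using that B_shift[of _ "t - 1"] by (simp add: E_def)
  qed
  then have le: "B mn t \<le> x * B mn' t" for mn mn'
  proof -
    have "t \<in> E" using \<open>E = UNIV\<close> by simp
    then show ?thesis unfolding E_def by blast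
  qed
  have "P t / x \<le> Q t" unfolding Q_def
  proof (rule cINF_greatest)
    fix mn'
    have "P t \<le> x * B mn' t" unfolding P_def by (rule cSUP_least) (use le in auto)
    then show "P t / x \<le> B mn' t" using x by (simp add: pos_divide_le_eq mult.commute)
  qed simp
  then have "P t \<le> Q t * x" using x by (simp add: pos_divide_le_eq)
  then have "P t \<le> (Q t * P t0) / Q t0" by (simp add: x_def)
  then show ?thesis using Q_pos[of t0] by (simp add: pos_le_divide_eq mult.commute)
qed

text \<open>As \<open>P\<close> is a constant multiple of \<open>Q\<close>, it is both lower and upper semicontinuous.\<close>

lemma cont_P: "continuous_on UNIV P"
proof -
  define \<kappa> where "\<kappa> = P 0 / Q 0"
  have \<kappa>: "\<kappa> > 0" using P_pos Q_pos by (simp add: \<kappa>_def)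
  have PQ: "P t = \<kappa> * Q t" for t
    using P_over_Q_const[of t 0] P_over_Q_const[of 0 t] Q_pos[of 0] by (simp add: \<kappa>_def field_simps)
  have "(P \<longlongrightarrow> P t) (at t)" for t
  proof (rule order_tendstoI)
    fix x assume "x < P t"
    then obtain mn where "x < B mn t" using less_cSUP_iff[OF UNIV_not_empty bdd_B(1)[of t], of x] unfolding P_def by auto
    moreover have "(B mn \<longlongrightarrow> B mn t) (at t)" using cont_B by (simp add: continuous_on_def)
    ultimately have "\<forall>\<^sub>F y in at t. x < B mn y" by (simp add: order_tendstoD)
    then show "\<forall>\<^sub>F y in at t. x < P y" by (rule eventually_mono) (meson B_le_P less_le_trans)
  next
    fix x assume "P t < x"
    then have "Q t < x / \<kappa>" using \<kappa> by (simp add: PQ field_simps)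
    then obtain mn where "B mn t < x / \<kappa>" using cINF_less_iff[OF UNIV_not_empty bdd_B(2)[of t], of "x / \<kappa>"] unfolding Q_def by auto
    moreover have "(B mn \<longlongrightarrow> B mn t) (at t)" using cont_B by (simp add: continuous_on_def)
    ultimately have "\<forall>\<^sub>F y in at t. B mn y < x / \<kappa>" by (simp add: order_tendstoD)
    then show "\<forall>\<^sub>F y in at t. P y < x"
    proof (rule eventually_mono)
      fix y assume "B mn y < x / \<kappa>"
      then have "Q y < x / \<kappa>" using Q_le_B le_less_trans by blast
      then show "P y < x" using \<kappa> by (simp add: PQ field_simps)
    qed
  qed
  then show ?thesis by (simp add: continuous_on_def)
qed

text \<open>Integrating the continuous invariant density \<open>P\<close> and normalizing its integral over a period to \<open>1\<close>
  straightens \<open>G\<close> to a rotation.\<close>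

theorem C1_conjugacy:
  obtains h h' \<rho> where "\<And>t. (h has_real_derivative h' t) (at t)" "continuous_on UNIV h'" "\<And>t. h' t > 0"
    "h 0 = 0" "\<And>t. h (t + 1) = h t + 1" "\<And>t. h (G t) = h t + \<rho>"
proof -
  obtain I where I: "\<And>t. (I has_real_derivative P t) (at t)" "I 0 = 0"
    using continuous_antiderivative[OF cont_P] by blast
  have "I 0 < I 1" by (rule DERIV_pos_imp_increasing) (use I P_pos in auto)
  then have I1: "I 1 > 0" using I by simp
  have Ish: "I (t + 1) - I t = I 1" for t
  proof -
    have "((\<lambda>t. I (t + 1) - I t) has_real_derivative 0) (at t)" for t
    proof -
      have "((\<lambda>t. I (t + 1)) has_real_derivative P t) (at t)"
        using I(1)[of "t + 1"] DERIV_shift[of I "P (t + 1)" t 1] P_shift by simp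
      then show ?thesis using I(1)[of t] by (auto intro!: derivative_eq_intros)
    qed
    from has_real_derivative_zero_const[OF this, of t 0] show ?thesis using I by simp
  qed
  have IG: "I (G t) - I t = I (G 0)" for t
  proof -
    have "((\<lambda>t. I (G t) - I t) has_real_derivative 0) (at t)" for t
    proof -
      have "((\<lambda>t. I (G t)) has_real_derivative P (G t) * A t) (at t)"
        by (rule DERIV_chain2[OF I(1) der])
      then show ?thesis using I(1)[of t] P_G[of t] by (auto intro!: derivative_eq_intros)
    qed
    from has_real_derivative_zero_const[OF this, of t 0] show ?thesis using I by simp
  qed
  show thesis
  proof
    show "((\<lambda>t. I t / I 1) has_real_derivative P t / I 1) (at t)" for t
      by (rule DERIV_cdivide[OF I(1)])
    show "continuous_on UNIV (\<lambda>t. P t / I 1)" using I1 by (intro continuous_intros cont_P) auto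
    show "P t / I 1 > 0" for t using P_pos I1 by simp
    show "I 0 / I 1 = 0" using I by simp
    show "I (t + 1) / I 1 = I t / I 1 + 1" for t
      using Ish[of t] I1 by (simp add: field_simps)
    show "I (G t) / I 1 = I t / I 1 + I (G 0) / I 1" for t
      using IG[of t] I1 by (simp add: field_simps)
  qed
qed

end

context aperiodic_circle_map begin

text \<open>Uniqueness of the conjugacy, in a stable form. The error \<open>w j = k j - h\<close> is bounded and grows along
  orbits by \<open>c j - \<rho>\<close> up to \<open>e j\<close>; boundedness forces \<open>c j \<longrightarrow> \<rho>\<close>. The set where \<open>w j\<close> tends to \<open>0\<close> is then
  invariant, it is closed by equicontinuity and contains \<open>0\<close>, so it is everything by minimality.\<close>

theorem approximate_conjugacies_converge:
  fixes h :: "real \<Rightarrow> real" and k :: "'i \<Rightarrow> real \<Rightarrow> real"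
  assumes h: "continuous_on UNIV h" "h 0 = 0" "\<And>t. h (t + 1) = h t + 1" "\<And>t. h (G t) = h t + \<rho>"
    and lip: "\<forall>\<^sub>F j in Fl. \<forall>t t'. \<bar>k j t' - k j t\<bar> \<le> L * \<bar>t' - t\<bar>"
    and k: "\<forall>\<^sub>F j in Fl. k j 0 = 0" "\<forall>\<^sub>F j in Fl. \<forall>t. k j (t + 1) = k j t + 1"
    and near: "\<forall>\<^sub>F j in Fl. \<forall>t. \<bar>k j (G t) - k j t - c j\<bar> \<le> e j" and e: "(e \<longlongrightarrow> 0) Fl"
  shows "((\<lambda>j. k j t) \<longlongrightarrow> h t) Fl"
proof -
  define w where "w j t = k j t - h t" for j t
  have "compact (h ` {0..1})" using h(1) by (intro compact_continuous_image) (auto intro: continuous_on_subset)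
  then have "bounded (h ` {0..1})" by (rule compact_imp_bounded)
  then obtain M where "\<forall>x\<in>h ` {0..1}. norm x \<le> M" by (auto simp: bounded_iff)
  then have M: "\<bar>h t\<bar> \<le> M" if "t \<in> {0..1}" for t using that by auto
  define b where "b = \<bar>L\<bar> + M"
  have wsh: "\<forall>\<^sub>F j in Fl. \<forall>t. w j (t + 1) = w j t"
    using k(2) by (rule eventually_mono) (simp add: w_def h(3))
  have wb: "\<forall>\<^sub>F j in Fl. \<forall>t. \<bar>w j t\<bar> \<le> b"
    using wsh lip k(1)
  proof eventually_elim
    case (elim j)
    show ?case
    proof
      fix t
      have "w j t = w j (frac t)"
        using shift_of_int[of "w j" 0 "frac t" "\<lfloor>t\<rfloor>"] elim(1) by (simp add: frac_def)
      moreover have "\<bar>k j (frac t)\<bar> \<le> \<bar>L\<bar>"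
      proof -
        have "\<bar>k j (frac t) - k j 0\<bar> \<le> L * \<bar>frac t - 0\<bar>" using elim(2) by blast
        also have "\<dots> \<le> \<bar>L\<bar> * 1" using frac_lt_1[of t] frac_ge_0[of t] by (intro mult_mono) auto
        finally show ?thesis using elim(3) by simp
      qed
      moreover have "\<bar>h (frac t)\<bar> \<le> M" using M frac_lt_1[of t] frac_ge_0[of t] by auto
      ultimately show "\<bar>w j t\<bar> \<le> b" by (simp add: w_def b_def)
    qed
  qed
  have step: "\<forall>\<^sub>F j in Fl. \<forall>t. \<bar>w j (G t) - w j t - (c j - \<rho>)\<bar> \<le> e j"
  proof -
    have "w j (G t) - w j t - (c j - \<rho>) = k j (G t) - k j t - c j" for j t
      by (simp add: w_def h(4))
    then show ?thesis using near by (simp only:)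
  qed
  have d0: "((\<lambda>j. c j - \<rho>) \<longlongrightarrow> 0) Fl"
  proof (rule tendstoI)
    fix \<epsilon> :: real assume \<epsilon>: "\<epsilon> > 0"
    \<comment> \<open>So many steps with a drift of \<open>\<epsilon> / 2\<close> each would exceed \<open>2 * b\<close>, the oscillation of \<open>w j\<close>.\<close>
    obtain n :: nat where n: "4 * (\<bar>b\<bar> + 1) / \<epsilon> < of_nat n" using reals_Archimedean2 by blast
    have "0 \<le> 4 * (\<bar>b\<bar> + 1) / \<epsilon>" using \<epsilon> by simp
    then have n0: "n > 0" using n by (cases n) auto
    have "\<forall>\<^sub>F j in Fl. e j < \<epsilon> / 2" using order_tendstoD(2)[OF e, of "\<epsilon> / 2"] \<epsilon> by simp
    with wb step show "\<forall>\<^sub>F j in Fl. dist (c j - \<rho>) 0 < \<epsilon>"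
    proof eventually_elim
      case (elim j)
      have it: "\<bar>w j ((G ^^ m) 0) - w j 0 - of_nat m * (c j - \<rho>)\<bar> \<le> of_nat m * e j" for m
      proof (induction m)
        case (Suc m)
        have "\<bar>w j (G ((G ^^ m) 0)) - w j ((G ^^ m) 0) - (c j - \<rho>)\<bar> \<le> e j" using elim(2) by blast
        with Suc show ?case by (simp add: algebra_simps)
      qed simp
      have "\<bar>w j ((G ^^ n) 0)\<bar> \<le> b" "\<bar>w j 0\<bar> \<le> b" using elim(1) by blast+
      with it[of n] have "\<bar>of_nat n * (c j - \<rho>)\<bar> \<le> 2 * b + of_nat n * e j"
        by linarith
      then have "of_nat n * \<bar>c j - \<rho>\<bar> \<le> 2 * b + of_nat n * e j"
        by (simp add: abs_mult)
      moreover have "4 * (\<bar>b\<bar> + 1) < of_nat n * \<epsilon>" using n \<epsilon> by (simp add: pos_divide_less_eq)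
      moreover have "of_nat n * e j < of_nat n * (\<epsilon> / 2)" using elim(3) n0 by simp
      ultimately have "of_nat n * \<bar>c j - \<rho>\<bar> < of_nat n * \<epsilon>" by simp
      then show ?case using n0 by (simp add: dist_real_def)
    qed
  qed
  have wG: "((\<lambda>j. w j (G t) - w j t) \<longlongrightarrow> 0) Fl" for t
  proof -
    have "((\<lambda>j. w j (G t) - w j t - (c j - \<rho>)) \<longlongrightarrow> 0) Fl"
      by (rule Lim_null_comparison[OF eventually_mono[OF step] e]) simp
    from tendsto_add[OF this d0] show ?thesis by simp
  qed
  define E where "E = {t. ((\<lambda>j. w j t) \<longlongrightarrow> 0) Fl}"
  have "E = UNIV"
  proof (rule minimal)
    show "closed E" unfolding closed_sequential_limits
    proof (intro allI impI, elim conjE)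
      fix x l assume xE: "\<forall>n. x n \<in> E" and xl: "x \<longlonglongrightarrow> (l :: real)"
      have "((\<lambda>j. w j l) \<longlongrightarrow> 0) Fl"
      proof (rule tendstoI)
        fix \<epsilon> :: real assume \<epsilon>: "\<epsilon> > 0"
        have "(\<lambda>n. \<bar>L\<bar> * \<bar>l - x n\<bar> + \<bar>h l - h (x n)\<bar>) \<longlonglongrightarrow> \<bar>L\<bar> * \<bar>l - l\<bar> + \<bar>h l - h l\<bar>"
          by (intro tendsto_add tendsto_mult tendsto_rabs tendsto_diff tendsto_const xl continuous_on_tendsto_compose[OF h(1) xl]) auto
        then have "\<forall>\<^sub>F n in sequentially. \<bar>L\<bar> * \<bar>l - x n\<bar> + \<bar>h l - h (x n)\<bar> < \<epsilon> / 2"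
          using order_tendstoD(2)[of _ _ sequentially "\<epsilon> / 2"] \<epsilon> by fastforce
        then obtain n where n: "\<bar>L\<bar> * \<bar>l - x n\<bar> + \<bar>h l - h (x n)\<bar> < \<epsilon> / 2"
          by (auto simp: eventually_sequentially)
        have "((\<lambda>j. w j (x n)) \<longlongrightarrow> 0) Fl" using xE by (simp add: E_def)
        then have "\<forall>\<^sub>F j in Fl. dist (w j (x n)) 0 < \<epsilon> / 2" using \<epsilon> by (intro tendstoD) auto
        with lip show "\<forall>\<^sub>F j in Fl. dist (w j l) 0 < \<epsilon>"
        proof eventually_elim
          case (elim j)
          have "\<bar>k j l - k j (x n)\<bar> \<le> L * \<bar>l - x n\<bar>" using elim(1) by blast
          also have "\<dots> \<le> \<bar>L\<bar> * \<bar>l - x n\<bar>" by (simp add: mult_right_mono)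
          finally show ?case using n elim(2) unfolding dist_real_def w_def by linarith
        qed
      qed
      then show "l \<in> E" by (simp add: E_def)
    qed
    have "((\<lambda>j. w j 0) \<longlongrightarrow> 0) Fl"
      by (rule tendsto_eventually[OF eventually_mono[OF k(1)]]) (simp add: w_def h(2))
    then show "E \<noteq> {}" by (auto simp: E_def)
    show "G t \<in> E \<longleftrightarrow> t \<in> E" for t
      using wG[of t] tendsto_add[of "\<lambda>j. w j (G t) - w j t" 0 Fl "\<lambda>j. w j t" 0]
        tendsto_diff[of "\<lambda>j. w j (G t)" 0 Fl "\<lambda>j. w j (G t) - w j t" 0]
      by (auto simp: E_def)
    have sh: "t + 1 \<in> E \<longleftrightarrow> t \<in> E" for t
    proof -
      have "\<forall>\<^sub>F j in Fl. w j (t + 1) = w j t" using wsh by (rule eventually_mono) simp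
      then show ?thesis unfolding E_def by (simp add: tendsto_cong)
    qed
    show "t + 1 \<in> E" if "t \<in> E" for t using that sh by simp
    show "t - 1 \<in> E" if "t \<in> E" for t using that sh[of "t - 1"] by simp
  qed
  then have "((\<lambda>j. w j t) \<longlongrightarrow> 0) Fl" by (auto simp: E_def)
  from tendsto_add[OF this tendsto_const[of "h t"]] show ?thesis by (simp add: w_def)
qed

end

section \<open>Area-preserving twist maps with an invariant foliation\<close>

lemma le_of_small_errors:
  fixes x y C :: real
  assumes e0: "e0 > 0" and le: "\<And>e. 0 < e \<Longrightarrow> e < e0 \<Longrightarrow> x \<le> y + C * e"
  shows "x \<le> y"
proof -
  have "((\<lambda>e. y + C * e) \<longlongrightarrow> y + C * 0) (at_right 0)" by (intro tendsto_intros)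
  moreover have "\<forall>\<^sub>F e in at_right 0. x \<le> y + C * e"
    using le e0 by (auto simp: eventually_at_right intro!: exI[of _ e0])
  ultimately show ?thesis using tendsto_lowerbound[of "\<lambda>e. y + C * e" "y + C * 0" "at_right 0" x] by simp
qed

lemma compact_bound:
  fixes f :: "'a::topological_space \<Rightarrow> real"
  assumes "compact S" "continuous_on S f"
  obtains M where "M \<ge> 1" "\<And>x. x \<in> S \<Longrightarrow> \<bar>f x\<bar> \<le> M"
proof -
  have "bounded (f ` S)" using assms by (intro compact_imp_bounded compact_continuous_image)
  then obtain M where "\<forall>x\<in>f ` S. norm x \<le> M" by (auto simp: bounded_iff)
  then have "\<And>x. x \<in> S \<Longrightarrow> \<bar>f x\<bar> \<le> max M 1" by fastforce
  then show thesis using that[of "max M 1"] by simp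
qed

lemma compact_positive_bound:
  fixes f :: "'a::topological_space \<Rightarrow> real"
  assumes "compact S" "continuous_on S f" "\<And>x. x \<in> S \<Longrightarrow> f x > 0"
  obtains m where "m > 0" "\<And>x. x \<in> S \<Longrightarrow> m \<le> f x"
proof (cases "S = {}")
  case True then show thesis using that[of 1] by simp
next
  case False
  then obtain x0 where "x0 \<in> S" "\<And>x. x \<in> S \<Longrightarrow> f x0 \<le> f x"
    using continuous_attains_inf[OF assms(1) False assms(2)] by blast
  then show thesis using that[of "f x0"] assms(3) by blast
qed

text \<open>A symplectic twist map and an invariant Lipschitz foliation, seen on the universal cover: \<open>F\<close> is a lift of
  the map, the leaves are the graphs of \<open>eta (_, c)\<close>, and \<open>W (t, c) = u (t, c) + c t\<close> is the primitive of the
  leaves, so that the generating function is absorbed in one function of the plane.\<close>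

locale twist_foliation =
  fixes F :: "real \<times> real \<Rightarrow> real \<times> real" and F' :: "real \<times> real \<Rightarrow> (real \<times> real) \<Rightarrow>\<^sub>L (real \<times> real)"
    and eta W :: "real \<times> real \<Rightarrow> real"
  assumes dF: "(F has_derivative blinfun_apply (F' z)) (at z)"
    and cF': "continuous_on UNIV F'"
    and area: "omega (F' z v) (F' z w) = omega v w"
    and twist: "fst (F' z (0, 1)) > 0"
    and twist_surj: "surj (\<lambda>r. fst (F (t, r)))"
    and F_shift: "F (t + 1, r) = F (t, r) + (1, 0)"
    and leaf: "snd (F (t, eta (t, c))) = eta (fst (F (t, eta (t, c))), c)"
    and eta_bilip: "\<exists>K\<ge>1. \<forall>t t' c c'. \<bar>c\<bar> \<le> N \<longrightarrow> \<bar>c'\<bar> \<le> N \<longrightarrow>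
         \<bar>eta (t', c) - eta (t, c)\<bar> \<le> K * \<bar>t' - t\<bar> \<and>
         (c \<le> c' \<longrightarrow> (c' - c) / K \<le> eta (t, c') - eta (t, c) \<and> eta (t, c') - eta (t, c) \<le> K * (c' - c))"
    and eta_surj: "surj (\<lambda>c. eta (t, c))"
    and W_der: "((\<lambda>t. W (t, c)) has_real_derivative eta (t, c)) (at t)"
    and W_0: "W (0, c) = 0"
    and W_shift: "W (t + 1, c) = W (t, c) + c"
begin

text \<open>The entries of the Jacobian matrix of \<open>F\<close>, first row \<open>a b\<close>, second row \<open>p d\<close>.\<close>

definition "a z = fst (F' z (1, 0))"
definition "b z = fst (F' z (0, 1))"
definition "p z = snd (F' z (1, 0))"
definition "d z = snd (F' z (0, 1))"

lemma b_pos: "b z > 0" by (simp add: b_def twist)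

lemma det: "a z * d z - b z * p z = 1"
  using area[of z "(1,0)" "(0,1)"] by (simp add: omega_def a_def b_def p_def d_def algebra_simps)

lemma cont_entries: "continuous_on UNIV a" "continuous_on UNIV b" "continuous_on UNIV p" "continuous_on UNIV d"
  unfolding a_def[abs_def] b_def[abs_def] p_def[abs_def] d_def[abs_def] by (intro continuous_intros cF')+

lemma F'_eq: "F' z v = (a z * fst v + b z * snd v, p z * fst v + d z * snd v)"
proof -
  have "v = fst v *\<^sub>R (1, 0) + snd v *\<^sub>R (0, 1)" by (cases v) simp
  then have "F' z v = fst v *\<^sub>R F' z (1, 0) + snd v *\<^sub>R F' z (0, 1)"
    by (metis blinfun.add_right blinfun.scaleR_right)
  then show ?thesis
    by (simp add: a_def b_def p_def d_def prod_eq_iff algebra_simps)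
qed

lemma dF1: "((\<lambda>z. fst (F z)) has_derivative (\<lambda>v. a z * fst v + b z * snd v)) (at z)"
  using has_derivative_fst[OF dF[of z]] by (simp add: F'_eq)

lemma dF2: "((\<lambda>z. snd (F z)) has_derivative (\<lambda>v. p z * fst v + d z * snd v)) (at z)"
  using has_derivative_snd[OF dF[of z]] by (simp add: F'_eq)

lemmas dF1_partials = has_derivative_plane_partials[OF dF1]
lemmas dF2_partials = has_derivative_plane_partials[OF dF2]

lemma F'_shift: "F' (t + 1, r) = F' (t, r)"
proof -
  have "((\<lambda>z. F (z + (1, 0))) has_derivative blinfun_apply (F' (t + 1, r))) (at (t, r))"
    by (rule has_derivative_compose[where f = "\<lambda>z. z + (1, 0)" and g = F, of "\<lambda>v. v", simplified])
       (use dF[of "(t + 1, r)"] in \<open>auto intro!: derivative_eq_intros\<close>)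
  moreover have "F (z + (1, 0)) = F z + (1, 0)" for z using F_shift[of "fst z" "snd z"] by (cases z) simp
  ultimately have "((\<lambda>z. F z + (1, 0)) has_derivative blinfun_apply (F' (t + 1, r))) (at (t, r))" by simp
  moreover have "((\<lambda>z. F z + (1, 0)) has_derivative blinfun_apply (F' (t, r))) (at (t, r))"
    by (auto intro!: derivative_eq_intros dF)
  ultimately have "blinfun_apply (F' (t + 1, r)) = blinfun_apply (F' (t, r))" by (rule has_derivative_unique)
  then show ?thesis by (simp add: blinfun_apply_inject)
qed

lemma b_shift: "b (t + of_int m, r) = b (t, r)"
  using shift_of_int[of "\<lambda>t. b (t, r)" 0 t m] by (simp add: b_def F'_shift)

lemma eta_shift: "eta (t + 1, c) = eta (t, c)"
proof -
  have "((\<lambda>t. W (t + 1, c)) has_real_derivative eta (t + 1, c)) (at t)"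
    using W_der[of c "t + 1"] DERIV_shift[of "\<lambda>t. W (t, c)" "eta (t + 1, c)" t 1] by simp
  moreover have "((\<lambda>t. W (t, c) + c) has_real_derivative eta (t, c)) (at t)"
    by (auto intro!: derivative_eq_intros W_der)
  ultimately show ?thesis by (simp add: W_shift DERIV_unique)
qed

lemma eta_shift_int: "eta (t + of_int m, c) = eta (t, c)"
  using shift_of_int[of "\<lambda>t. eta (t, c)" 0 t m] by (simp add: eta_shift)

definition G :: "real \<times> real \<Rightarrow> real" where "G z = fst (F (fst z, eta z))"

lemma F_leaf: "F (t, eta (t, c)) = (G (t, c), eta (G (t, c), c))"
  using leaf[of t c] by (simp add: G_def prod_eq_iff)

lemma G_shift: "G (t + 1, c) = G (t, c) + 1"
  by (simp add: G_def F_shift eta_shift)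

text \<open>Preservation of the area makes \<open>F\<^sub>2 dF\<^sub>1 - r dt\<close> closed, but its coefficients are merely continuous. In
  the coordinates \<open>(t, y) = (t, F\<^sub>1 (t, r))\<close> of the twist property the same form is \<open>F\<^sub>2 dy - r dt\<close>, whose
  coefficients are \<open>C\<^sup>1\<close>, and there the Poincare lemma applies.\<close>

theorem exactness:
  obtains S where "\<And>z. (S has_derivative (\<lambda>v. snd (F z) * (a z * fst v + b z * snd v) - snd z * fst v)) (at z)"
proof -
  obtain Y where Y: "\<And>t y. fst (F (t, Y (t, y))) = y" "\<And>t r. Y (t, fst (F (t, r))) = r"
    and dY: "\<And>t y. (Y has_derivative
       (\<lambda>v. - a (t, Y (t, y)) / b (t, Y (t, y)) * fst v + 1 / b (t, Y (t, y)) * snd v)) (at (t, y))"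
    by (rule fibered_inverse[OF dF1 b_pos twist_surj]) (rule that)
  let ?L = "\<lambda>z. (fst z, Y z)"
  have dY': "(Y has_derivative (\<lambda>v. - a (?L z) / b (?L z) * fst v + 1 / b (?L z) * snd v)) (at z)" for z
    using dY[of "fst z" "snd z"] by simp
  have cY: "continuous_on UNIV Y"
    by (rule continuous_at_imp_continuous_on) (use dY' has_derivative_continuous in blast)
  then have cL: "continuous_on UNIV ?L" by (intro continuous_intros)
  note cE = cont_entries[THEN continuous_on_UNIV_comp, OF cL]
  have dQ: "((\<lambda>z. snd (F (?L z))) has_derivative (\<lambda>v. - 1 / b (?L z) * fst v + d (?L z) / b (?L z) * snd v)) (at z)" for z
  proof -
    have "(?L has_derivative (\<lambda>v. (fst v, - a (?L z) / b (?L z) * fst v + 1 / b (?L z) * snd v))) (at z)"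
      by (auto intro!: derivative_eq_intros dY')
    from has_derivative_compose[OF this dF2]
    have "((\<lambda>z. snd (F (?L z))) has_derivative (\<lambda>v. p (?L z) * fst v + d (?L z) * (- a (?L z) / b (?L z) * fst v + 1 / b (?L z) * snd v))) (at z)"
      by simp
    moreover have "p (?L z) + d (?L z) * (- a (?L z) / b (?L z)) = - 1 / b (?L z)"
      using det[of "?L z"] b_pos[of "?L z"] by (simp add: field_simps)
    then have "p (?L z) * x + d (?L z) * (- a (?L z) / b (?L z) * x + 1 / b (?L z) * y)
        = - 1 / b (?L z) * x + d (?L z) / b (?L z) * y" for x y
    proof -
      have "p (?L z) * x + d (?L z) * (- a (?L z) / b (?L z) * x + 1 / b (?L z) * y)
          = (p (?L z) + d (?L z) * (- a (?L z) / b (?L z))) * x + d (?L z) / b (?L z) * y"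
        by (simp add: algebra_simps)
      then show ?thesis unfolding \<open>p (?L z) + d (?L z) * (- a (?L z) / b (?L z)) = - 1 / b (?L z)\<close> .
    qed
    ultimately show ?thesis by (simp only:)
  qed
  have dP: "((\<lambda>z. - Y z) has_derivative (\<lambda>v. a (?L z) / b (?L z) * fst v + - 1 / b (?L z) * snd v)) (at z)" for z
    by (rule derivative_eq_intros dY' refl)+ simp
  obtain S' where S': "\<And>z. (S' has_derivative (\<lambda>v. - Y z * fst v + snd (F (?L z)) * snd v)) (at z)"
  proof (rule closed_form_primitive[OF dP dQ])
    show "continuous_on UNIV (\<lambda>z. a (?L z) / b (?L z))" "continuous_on UNIV (\<lambda>z. - 1 / b (?L z))"
      "continuous_on UNIV (\<lambda>z. d (?L z) / b (?L z))"
      using b_pos by (auto intro!: continuous_intros cE simp: less_imp_neq[symmetric] order_less_imp_not_eq2)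
  qed blast
  show thesis
  proof
    fix z
    have "((\<lambda>z. (fst z, fst (F z))) has_derivative (\<lambda>v. (fst v, a z * fst v + b z * snd v))) (at z)"
      by (intro has_derivative_Pair dF1 has_derivative_fst has_derivative_ident)
    from has_derivative_compose[OF this S']
    show "((\<lambda>z. S' (fst z, fst (F z))) has_derivative (\<lambda>v. snd (F z) * (a z * fst v + b z * snd v) - snd z * fst v)) (at z)"
      using Y(2)[of "fst z" "snd z"] by (simp add: algebra_simps)
  qed
qed

end

section \<open>The flux between two leaves\<close>

context twist_foliation begin

lemma eta_mono: "c \<le> c' \<Longrightarrow> eta (t, c) \<le> eta (t, c')"
  and eta_strict_mono: "c < c' \<Longrightarrow> eta (t, c) < eta (t, c')"
proof -
  obtain K where K: "K \<ge> 1" "\<And>t c1 c2. \<bar>c1\<bar> \<le> \<bar>c\<bar> + \<bar>c'\<bar> \<Longrightarrow> \<bar>c2\<bar> \<le> \<bar>c\<bar> + \<bar>c'\<bar> \<Longrightarrow> c1 \<le> c2 \<Longrightarrow>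
      (c2 - c1) / K \<le> eta (t, c2) - eta (t, c1)"
    using eta_bilip[of "\<bar>c\<bar> + \<bar>c'\<bar>"] by blast
  have *: "(c' - c) / K \<le> eta (t, c') - eta (t, c)" if "c \<le> c'" using K(2)[of c c' t] that by simp
  show "eta (t, c) \<le> eta (t, c')" if "c \<le> c'"
  proof -
    have "0 \<le> (c' - c) / K" using K(1) that by simp
    then show ?thesis using *[OF that] by linarith
  qed
  show "eta (t, c) < eta (t, c')" if "c < c'"
  proof -
    have "0 < (c' - c) / K" using K(1) that by simp
    then show ?thesis using * that by linarith
  qed
qed

lemma eta_le_iff: "eta (t, c) \<le> eta (t, c') \<longleftrightarrow> c \<le> c'"
  by (meson eta_mono eta_strict_mono linorder_not_le)

lemma eta_between:
  assumes "r \<in> closed_segment (eta (t, c)) (eta (t, c'))"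
  obtains \<gamma> where "r = eta (t, \<gamma>)" "\<gamma> \<in> closed_segment c c'"
proof -
  obtain \<gamma> where \<gamma>: "r = eta (t, \<gamma>)" using eta_surj[of t] by (metis surjE)
  show thesis
    by (rule that[OF \<gamma>]) (use assms in \<open>auto simp: \<gamma> closed_segment_eq_real_ivl eta_le_iff split: if_splits\<close>)
qed

lemma local_bounds:
  obtains K L \<kappa> where "K \<ge> 1" "L \<ge> 1" "\<kappa> > 0"
    "\<And>c t t'. \<bar>c\<bar> \<le> N \<Longrightarrow> \<bar>eta (t', c) - eta (t, c)\<bar> \<le> K * \<bar>t' - t\<bar>"
    "\<And>c c' t. \<bar>c\<bar> \<le> N \<Longrightarrow> \<bar>c'\<bar> \<le> N \<Longrightarrow> c \<le> c' \<Longrightarrow> (c' - c) / K \<le> eta (t, c') - eta (t, c)"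
    "\<And>c c' t. \<bar>c\<bar> \<le> N \<Longrightarrow> \<bar>c'\<bar> \<le> N \<Longrightarrow> c \<le> c' \<Longrightarrow> eta (t, c') - eta (t, c) \<le> K * (c' - c)"
    "\<And>c c' t. \<bar>c\<bar> \<le> N \<Longrightarrow> \<bar>c'\<bar> \<le> N \<Longrightarrow> c \<le> c' \<Longrightarrow> \<kappa> * (c' - c) \<le> G (t, c') - G (t, c)"
    "\<And>c c' t. \<bar>c\<bar> \<le> N \<Longrightarrow> \<bar>c'\<bar> \<le> N \<Longrightarrow> c \<le> c' \<Longrightarrow> G (t, c') - G (t, c) \<le> L * (c' - c)"
    "\<And>c t. \<bar>c\<bar> \<le> N \<Longrightarrow> \<bar>b (t, eta (t, c))\<bar> \<le> L"
proof -
  obtain K where K: "K \<ge> 1"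
    and Kt: "\<And>c t t'. \<bar>c\<bar> \<le> N \<Longrightarrow> \<bar>eta (t', c) - eta (t, c)\<bar> \<le> K * \<bar>t' - t\<bar>"
    and Kc: "\<And>c c' t. \<bar>c\<bar> \<le> N \<Longrightarrow> \<bar>c'\<bar> \<le> N \<Longrightarrow> c \<le> c' \<Longrightarrow> (c' - c) / K \<le> eta (t, c') - eta (t, c)"
      "\<And>c c' t. \<bar>c\<bar> \<le> N \<Longrightarrow> \<bar>c'\<bar> \<le> N \<Longrightarrow> c \<le> c' \<Longrightarrow> eta (t, c') - eta (t, c) \<le> K * (c' - c)"
    using eta_bilip[of N] by blast
  define R where "R = \<bar>eta (0, N)\<bar> + \<bar>eta (0, -N)\<bar> + K"
  have R: "eta (t, c) \<in> {-R..R}" if "\<bar>c\<bar> \<le> N" for t c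
  proof -
    have "\<bar>eta (frac t, c) - eta (0, c)\<bar> \<le> K * \<bar>frac t - 0\<bar>" using Kt that by blast
    also have "\<dots> \<le> K * 1" using K frac_lt_1[of t] frac_ge_0[of t] by (intro mult_left_mono) auto
    finally have "\<bar>eta (t, c) - eta (0, c)\<bar> \<le> K"
      using eta_shift_int[of "frac t" "\<lfloor>t\<rfloor>" c] by (simp add: frac_def)
    moreover have "eta (0, c) \<le> eta (0, N)" "eta (0, -N) \<le> eta (0, c)"
      using that by (auto intro!: eta_mono)
    ultimately show ?thesis by (auto simp: R_def)
  qed
  let ?Q = "{0..1::real} \<times> {-R..R}"
  have cq: "compact ?Q" by (intro compact_Times compact_Icc)
  obtain M2 where M2: "M2 \<ge> 1" "\<And>z. z \<in> ?Q \<Longrightarrow> \<bar>b z\<bar> \<le> M2"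
    using compact_bound[OF cq continuous_on_subset[OF cont_entries(2)]] by blast
  obtain m where m: "m > 0" "\<And>z. z \<in> ?Q \<Longrightarrow> m \<le> b z"
    using compact_positive_bound[OF cq continuous_on_subset[OF cont_entries(2)]] b_pos by blast
  have fr: "(frac t, r) \<in> ?Q" if "r \<in> {-R..R}" for t r
    using that frac_lt_1[of t] frac_ge_0[of t] by auto
  have ent: "b (t, r) = b (frac t, r)" for t r
    using b_shift[of "frac t" "\<lfloor>t\<rfloor>" r] by (simp add: frac_def)
  have bM: "\<bar>b (t, r)\<bar> \<le> M2" and bm: "m \<le> b (t, r)" if "r \<in> {-R..R}" for t r
    unfolding ent[of t r] using M2 m fr[OF that] by blast+
  have seg: "\<xi> \<in> {-R..R}" if "\<xi> \<in> closed_segment r r'" "r \<in> {-R..R}" "r' \<in> {-R..R}" for \<xi> r r'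
    using that by (auto simp: closed_segment_eq_real_ivl split: if_splits)
  show thesis
  proof (rule that[of K "M2 * K" "m / K"])
    show "M2 * K \<ge> 1" using mult_mono[of 1 M2 1 K] M2 K by simp
    show "m / K > 0" using m K by simp
    show "m / K * (c' - c) \<le> G (t, c') - G (t, c)" "G (t, c') - G (t, c) \<le> (M2 * K) * (c' - c)"
      if c: "\<bar>c\<bar> \<le> N" "\<bar>c'\<bar> \<le> N" "c \<le> c'" for c c' t
    proof -
      obtain \<xi> where \<xi>: "\<xi> \<in> closed_segment (eta (t, c)) (eta (t, c'))"
        "fst (F (t, eta (t, c'))) - fst (F (t, eta (t, c))) = (eta (t, c') - eta (t, c)) * b (t, \<xi>)"
        using mvt_segment[OF dF1_partials(2)[of t]] by blast
      have \<xi>R: "\<xi> \<in> {-R..R}" by (rule seg[OF \<xi>(1)]) (use R c in blast)+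
      have eq: "G (t, c') - G (t, c) = (eta (t, c') - eta (t, c)) * b (t, \<xi>)" using \<xi>(2) by (simp add: G_def)
      have "(c' - c) / K * m \<le> (eta (t, c') - eta (t, c)) * b (t, \<xi>)"
        using Kc(1)[OF c] bm[OF \<xi>R, of t] m eta_mono[OF c(3), of t] by (intro mult_mono) auto
      then show "m / K * (c' - c) \<le> G (t, c') - G (t, c)" by (simp add: eq mult.commute)
      have "(eta (t, c') - eta (t, c)) * b (t, \<xi>) \<le> (K * (c' - c)) * M2"
        using Kc(2)[OF c] bM[OF \<xi>R, of t] b_pos[of "(t, \<xi>)"] K c by (intro mult_mono) auto
      also have "\<dots> = M2 * K * (c' - c)" by simp
      finally show "G (t, c') - G (t, c) \<le> (M2 * K) * (c' - c)" by (simp add: eq)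
    qed
    show "\<bar>b (t, eta (t, c))\<bar> \<le> M2 * K" if "\<bar>c\<bar> \<le> N" for c t
    proof -
      have "\<bar>b (t, eta (t, c))\<bar> \<le> M2 * 1" using bM[OF R[OF that], of t] by simp
      also have "M2 * 1 \<le> M2 * K" using M2 K by (intro mult_left_mono) auto
      finally show ?thesis .
    qed
  qed (use K Kt Kc in auto)
qed

text \<open>On a leaf the action form \<open>F\<^sub>2 dF\<^sub>1 - r dt\<close> equals \<open>dW (G t) - dW t\<close>, since both the point and its image lie
  on the leaf. The difference of the primitives is thus critical on the leaf and constant along it, although
  the leaf is only Lipschitz.\<close>

lemma action_along_leaf:
  assumes S: "\<And>z. (S has_derivative (\<lambda>v. snd (F z) * (a z * fst v + b z * snd v) - snd z * fst v)) (at z)"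
  obtains k where "\<And>t c. S (t, eta (t, c)) = W (G (t, c), c) - W (t, c) + k c"
proof -
  have zero: "((\<lambda>t. S (t, eta (t, c)) - W (G (t, c), c) + W (t, c)) has_real_derivative 0) (at t)" for t c
  proof -
    define \<Xi> where "\<Xi> z = S z - W (fst (F z), c) + W (fst z, c)" for z
    have dW: "((\<lambda>t. W (t, c)) has_derivative (*) (eta (t, c))) (at t)" for t
      using W_der by (simp add: has_field_derivative_def)
    have "(\<Xi> has_derivative (\<lambda>v. (snd (F z) * (a z * fst v + b z * snd v) - snd z * fst v)
        - eta (fst (F z), c) * (a z * fst v + b z * snd v) + eta (fst z, c) * fst v)) (at z)" for z
      unfolding \<Xi>_def
      by (intro has_derivative_add has_derivative_diff S has_derivative_compose[OF dF1 dW]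
          has_derivative_compose[OF _ dW] has_derivative_fst has_derivative_ident)
    from this[of "(t, eta (t, c))"]
    have "(\<Xi> has_derivative (\<lambda>v. 0)) (at (t, eta (t, c)))" by (simp add: F_leaf)
    moreover obtain K where "\<And>t'. \<bar>eta (t', c) - eta (t, c)\<bar> \<le> K * \<bar>t' - t\<bar>"
      using eta_bilip[of "\<bar>c\<bar>"] by blast
    ultimately have "((\<lambda>t. \<Xi> (t, eta (t, c))) has_real_derivative 0) (at t)"
      by (rule has_derivative_zero_Lipschitz_curve)
    then show ?thesis by (simp add: \<Xi>_def F_leaf)
  qed
  show thesis
    by (rule that[of "\<lambda>c. S (0, eta (0, c)) - W (G (0, c), c) + W (0, c)"])
       (use has_real_derivative_zero_const[OF zero, of _ _ 0] in \<open>simp add: algebra_simps\<close>)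
qed

text \<open>The integral of \<open>(eta (x, c') - y) dx\<close> over the image of the vertical segment from leaf \<open>c\<close> to leaf \<open>c'\<close>
  above \<open>t\<close>, see \<open>flux_density\<close>: the signed area of the thin triangle between that image, the leaf \<open>c'\<close> and
  the vertical through \<open>G (t, c)\<close>.\<close>

definition flux_defect :: "(real \<times> real \<Rightarrow> real) \<Rightarrow> real \<Rightarrow> real \<Rightarrow> real \<Rightarrow> real" where
  "flux_defect S c c' t = (W (G (t, c'), c') - S (t, eta (t, c'))) - (W (G (t, c), c') - S (t, eta (t, c)))"

text \<open>Conservation of area: \<open>W (_, c') - W (_, c)\<close> measures the area between two leaves, and the region above
  \<open>[0, t]\<close> is mapped to one that differs from a region between verticals by a triangle at either end.\<close>

lemma flux_identity:
  assumes S: "\<And>t c. S (t, eta (t, c)) = W (G (t, c), c) - W (t, c) + k c"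
  shows "(W (G (t, c), c') - W (G (t, c), c)) - (W (t, c') - W (t, c)) + flux_defect S c c' t = k c - k c'"
  by (simp add: flux_defect_def S)

lemma flux_density:
  assumes S: "\<And>z. (S has_derivative (\<lambda>v. snd (F z) * (a z * fst v + b z * snd v) - snd z * fst v)) (at z)"
  shows "((\<lambda>r. W (fst (F (t, r)), c) - S (t, r)) has_real_derivative
    (eta (fst (F (t, r)), c) - snd (F (t, r))) * b (t, r)) (at r)"
proof -
  have "(S has_derivative (\<lambda>v. (snd (F z) * a z - snd z) * fst v + (snd (F z) * b z) * snd v)) (at z)" for z
    by (rule has_derivative_eq_rhs[OF S]) (auto simp: algebra_simps)
  from has_derivative_plane_partials(2)[OF this]
  have "((\<lambda>r. S (t, r)) has_real_derivative snd (F (t, r)) * b (t, r)) (at r)" .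
  moreover have "((\<lambda>r. W (fst (F (t, r)), c)) has_real_derivative eta (fst (F (t, r)), c) * b (t, r)) (at r)"
    by (rule DERIV_chain2[OF W_der dF1_partials(2)])
  ultimately show ?thesis by (auto intro!: derivative_eq_intros simp: algebra_simps)
qed

text \<open>The area between two leaves, per unit of flux. It depends on \<open>t\<close> like an almost conjugacy of \<open>G (_, c)\<close> to a
  rotation, and its limit for \<open>c' \<longrightarrow> c\<close> will be the conjugacy.\<close>

definition quot :: "real \<Rightarrow> real \<Rightarrow> real \<Rightarrow> real" where
  "quot c c' t = (W (t, c') - W (t, c)) / (c' - c)"

lemma quot_0: "quot c c' 0 = 0"
  by (simp add: quot_def W_0)

lemma quot_shift: "c \<noteq> c' \<Longrightarrow> quot c c' (t + 1) = quot c c' t + 1"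
  unfolding quot_def W_shift by (simp add: field_simps)

lemma quot_der: "(quot c c' has_real_derivative (eta (t, c') - eta (t, c)) / (c' - c)) (at t)"
  unfolding quot_def by (intro DERIV_cdivide DERIV_diff W_der)

end

text \<open>The constants of the foliation are uniform only on compact parts of the annulus; this locale fixes those of
  the leaves with parameter in \<open>[-N, N]\<close>.\<close>

locale local_twist_foliation = twist_foliation +
  fixes N K L \<kappa> :: real
  assumes K: "K \<ge> 1" and L: "L \<ge> 1" and \<kappa>: "\<kappa> > 0"
    and eta_lip: "\<bar>c\<bar> \<le> N \<Longrightarrow> \<bar>eta (t', c) - eta (t, c)\<bar> \<le> K * \<bar>t' - t\<bar>"
    and eta_low: "\<bar>c\<bar> \<le> N \<Longrightarrow> \<bar>c'\<bar> \<le> N \<Longrightarrow> c \<le> c' \<Longrightarrow> (c' - c) / K \<le> eta (t, c') - eta (t, c)"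
    and eta_upp: "\<bar>c\<bar> \<le> N \<Longrightarrow> \<bar>c'\<bar> \<le> N \<Longrightarrow> c \<le> c' \<Longrightarrow> eta (t, c') - eta (t, c) \<le> K * (c' - c)"
    and G_low: "\<bar>c\<bar> \<le> N \<Longrightarrow> \<bar>c'\<bar> \<le> N \<Longrightarrow> c \<le> c' \<Longrightarrow> \<kappa> * (c' - c) \<le> G (t, c') - G (t, c)"
    and G_upp: "\<bar>c\<bar> \<le> N \<Longrightarrow> \<bar>c'\<bar> \<le> N \<Longrightarrow> c \<le> c' \<Longrightarrow> G (t, c') - G (t, c) \<le> L * (c' - c)"
    and b_bound: "\<bar>c\<bar> \<le> N \<Longrightarrow> \<bar>b (t, eta (t, c))\<bar> \<le> L"
begin

lemma eta_abs:
  assumes "\<bar>c\<bar> \<le> N" "\<bar>c'\<bar> \<le> N" shows "\<bar>eta (t, c') - eta (t, c)\<bar> \<le> K * \<bar>c' - c\<bar>"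
proof (cases "c \<le> c'")
  case True then show ?thesis using eta_upp[OF assms True, of t] eta_mono[OF True, of t] by simp
next
  case False
  then have "c' \<le> c" by simp
  then show ?thesis using eta_upp[OF assms(2,1), of t] eta_mono[of c' c t] by simp
qed

lemma eta_quot_bounds:
  assumes "\<bar>c\<bar> \<le> N" "\<bar>c'\<bar> \<le> N" "c \<noteq> c'"
  shows "1 / K \<le> (eta (t, c') - eta (t, c)) / (c' - c)" "(eta (t, c') - eta (t, c)) / (c' - c) \<le> K"
proof -
  have *: "1 / K \<le> (eta (t, c') - eta (t, c)) / (c' - c) \<and> (eta (t, c') - eta (t, c)) / (c' - c) \<le> K"
    if "\<bar>c\<bar> \<le> N" "\<bar>c'\<bar> \<le> N" "c < c'" for c c'
    using eta_low[OF that(1,2), of t] eta_upp[OF that(1,2), of t] that(3) K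
    by (auto simp: field_simps)
  have "1 / K \<le> (eta (t, c') - eta (t, c)) / (c' - c) \<and> (eta (t, c') - eta (t, c)) / (c' - c) \<le> K"
  proof (cases "c < c'")
    case True then show ?thesis using * assms by blast
  next
    case False
    then have "c' < c" using assms by simp
    moreover have "(eta (t, c') - eta (t, c)) / (c' - c) = (eta (t, c) - eta (t, c')) / (c - c')"
      by (metis minus_diff_eq minus_divide_divide)
    ultimately show ?thesis using *[of c' c] assms by simp
  qed
  then show "1 / K \<le> (eta (t, c') - eta (t, c)) / (c' - c)" "(eta (t, c') - eta (t, c)) / (c' - c) \<le> K" by auto
qed

lemma quot_bilip:
  assumes "\<bar>c\<bar> \<le> N" "\<bar>c'\<bar> \<le> N" "c \<noteq> c'" "t \<le> t'"
  shows "(t' - t) / K \<le> quot c c' t' - quot c c' t" "quot c c' t' - quot c c' t \<le> K * (t' - t)"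
proof -
  obtain \<xi> where \<xi>: "quot c c' t' - quot c c' t = (t' - t) * ((eta (\<xi>, c') - eta (\<xi>, c)) / (c' - c))"
    using mvt_segment[OF quot_der[of c c'], of t t'] by blast
  show "(t' - t) / K \<le> quot c c' t' - quot c c' t" "quot c c' t' - quot c c' t \<le> K * (t' - t)"
    unfolding \<xi> using mult_left_mono[OF eta_quot_bounds(1)[OF assms(1-3), of \<xi>], of "t' - t"]
      mult_left_mono[OF eta_quot_bounds(2)[OF assms(1-3), of \<xi>], of "t' - t"] assms(4)
    by (simp_all add: mult.commute)
qed

lemma quot_lip:
  assumes "\<bar>c\<bar> \<le> N" "\<bar>c'\<bar> \<le> N" "c \<noteq> c'"
  shows "\<bar>quot c c' t' - quot c c' t\<bar> \<le> K * \<bar>t' - t\<bar>"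
proof -
  have *: "\<bar>quot c c' t' - quot c c' t\<bar> \<le> K * \<bar>t' - t\<bar>" if "t \<le> t'" for t t'
  proof -
    have "0 \<le> (t' - t) / K" using K that by simp
    then show ?thesis using quot_bilip[OF assms that] that by simp
  qed
  show ?thesis using *[of t t'] *[of t' t] by (metis abs_minus_commute linear)
qed

text \<open>The triangle has width and height of order \<open>c' - c\<close>, so its area is quadratic. Each intermediate point of
  the vertical segment lies on an intermediate leaf \<open>\<gamma>\<close>, which is where bi-Lipschitz transversality is used.\<close>

lemma flux_defect_bound:
  assumes S: "\<And>z. (S has_derivative (\<lambda>v. snd (F z) * (a z * fst v + b z * snd v) - snd z * fst v)) (at z)"
    and c: "\<bar>c\<bar> \<le> N" "\<bar>c'\<bar> \<le> N"
  shows "\<bar>flux_defect S c c' t\<bar> \<le> K^2 * L * \<bar>c' - c\<bar>^2"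
proof -
  obtain \<xi> where \<xi>: "\<xi> \<in> closed_segment (eta (t, c)) (eta (t, c'))"
    "(W (fst (F (t, eta (t, c'))), c') - S (t, eta (t, c'))) - (W (fst (F (t, eta (t, c))), c') - S (t, eta (t, c)))
      = (eta (t, c') - eta (t, c)) * ((eta (fst (F (t, \<xi>)), c') - snd (F (t, \<xi>))) * b (t, \<xi>))"
    using mvt_segment[OF flux_density[OF S, of t c']] by blast
  obtain \<gamma> where \<gamma>: "\<xi> = eta (t, \<gamma>)" "\<gamma> \<in> closed_segment c c'" using eta_between[OF \<xi>(1)] by blast
  have \<gamma>N: "\<bar>\<gamma>\<bar> \<le> N" and \<gamma>c: "\<bar>c' - \<gamma>\<bar> \<le> \<bar>c' - c\<bar>"
    using \<gamma>(2) c by (auto simp: closed_segment_eq_real_ivl split: if_splits)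
  have "flux_defect S c c' t = (eta (t, c') - eta (t, c)) * ((eta (G (t, \<gamma>), c') - eta (G (t, \<gamma>), \<gamma>)) * b (t, eta (t, \<gamma>)))"
    using \<xi>(2) by (simp add: flux_defect_def \<gamma>(1) F_leaf)
  then have "\<bar>flux_defect S c c' t\<bar> = \<bar>eta (t, c') - eta (t, c)\<bar> * (\<bar>eta (G (t, \<gamma>), c') - eta (G (t, \<gamma>), \<gamma>)\<bar> * \<bar>b (t, eta (t, \<gamma>))\<bar>)"
    by (simp add: abs_mult)
  also have "\<dots> \<le> (K * \<bar>c' - c\<bar>) * ((K * \<bar>c' - c\<bar>) * L)"
  proof (intro mult_mono)
    show "\<bar>eta (t, c') - eta (t, c)\<bar> \<le> K * \<bar>c' - c\<bar>" by (rule eta_abs[OF c])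
    have "\<bar>eta (G (t, \<gamma>), c') - eta (G (t, \<gamma>), \<gamma>)\<bar> \<le> K * \<bar>c' - \<gamma>\<bar>" by (rule eta_abs[OF \<gamma>N c(2)])
    also have "\<dots> \<le> K * \<bar>c' - c\<bar>" using \<gamma>c K by (simp add: mult_left_mono)
    finally show "\<bar>eta (G (t, \<gamma>), c') - eta (G (t, \<gamma>), \<gamma>)\<bar> \<le> K * \<bar>c' - c\<bar>" .
    show "\<bar>b (t, eta (t, \<gamma>))\<bar> \<le> L" by (rule b_bound[OF \<gamma>N])
  qed (use K L in auto)
  finally show ?thesis by (simp add: power2_eq_square algebra_simps)
qed

text \<open>Dividing the flux identity by \<open>c' - c\<close> leaves an error of first order.\<close>

lemma quot_near_conjugacy:
  obtains k0 where "\<And>c c' t. \<bar>c\<bar> \<le> N \<Longrightarrow> \<bar>c'\<bar> \<le> N \<Longrightarrow> c \<noteq> c' \<Longrightarrow>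
    \<bar>quot c c' (G (t, c)) - quot c c' t - k0 c c'\<bar> \<le> K^2 * L * \<bar>c' - c\<bar>"
proof -
  obtain S where S: "\<And>z. (S has_derivative (\<lambda>v. snd (F z) * (a z * fst v + b z * snd v) - snd z * fst v)) (at z)"
    using exactness by blast
  obtain k where k: "\<And>t c. S (t, eta (t, c)) = W (G (t, c), c) - W (t, c) + k c"
    using action_along_leaf[OF S] by blast
  show thesis
  proof (rule that[of "\<lambda>c c'. (k c - k c') / (c' - c)"])
    fix c c' t assume c: "\<bar>c\<bar> \<le> N" "\<bar>c'\<bar> \<le> N" "c \<noteq> c'"
    have "quot c c' (G (t, c)) - quot c c' t - (k c - k c') / (c' - c) = - flux_defect S c c' t / (c' - c)"
      unfolding quot_def flux_identity[OF k, of t c c', symmetric]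
      by (simp flip: diff_divide_distrib)
    then have "\<bar>quot c c' (G (t, c)) - quot c c' t - (k c - k c') / (c' - c)\<bar> = \<bar>flux_defect S c c' t\<bar> / \<bar>c' - c\<bar>"
      by (simp add: abs_divide)
    also have "\<dots> \<le> (K^2 * L * \<bar>c' - c\<bar>^2) / \<bar>c' - c\<bar>"
      by (intro divide_right_mono flux_defect_bound[OF S c(1,2)]) simp
    also have "\<dots> = K^2 * L * \<bar>c' - c\<bar>"
    proof -
      have "K^2 * L * e^2 / e = K^2 * L * e" if "e \<noteq> 0" for e :: real
        using that by (simp add: power2_eq_square)
      from this[of "\<bar>c' - c\<bar>"] show ?thesis using c by (simp del: power2_abs)
    qed
    finally show "\<bar>quot c c' (G (t, c)) - quot c c' t - (k c - k c') / (c' - c)\<bar> \<le> K^2 * L * \<bar>c' - c\<bar>" .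
  qed
qed

abbreviation Gc :: "real \<Rightarrow> real \<Rightarrow> real" where "Gc c \<equiv> \<lambda>t. G (t, c)"

lemma quot_displacement:
  assumes c: "\<bar>c\<bar> \<le> N" "\<bar>c'\<bar> \<le> N" "c \<noteq> c'" and A: "A \<ge> 0"
    and low: "\<bar>c\<bar> \<le> N \<Longrightarrow> A \<le> quot c c' t' - quot c c' t"
  shows "A \<le> K * (t' - t)"
proof (cases "t \<le> t'")
  case True
  then show ?thesis using low[OF c(1)] quot_bilip(2)[OF c(1-3) True] by simp
next
  case False
  then have "(t - t') / K > 0" using K by simp
  then show ?thesis using quot_bilip(1)[OF c(1-3), of t' t] False low[OF c(1)] A by linarith
qed

lemma quot_displacement_upper:
  assumes c: "\<bar>c\<bar> \<le> N" "\<bar>c'\<bar> \<le> N" "c \<noteq> c'" and A: "A \<ge> 0"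
    and upp: "quot c c' t' - quot c c' t \<le> A"
  shows "t' - t \<le> K * A"
proof (cases "t \<le> t'")
  case True
  have "(t' - t) / K \<le> A" using upp quot_bilip(1)[OF c(1-3) True] by linarith
  then show ?thesis using K by (simp add: pos_divide_le_eq mult.commute)
next
  case False
  have "0 \<le> K * A" using K A by simp
  then show ?thesis using False by linarith
qed

text \<open>Iterating \<open>n\<close> times, \<open>quot c c'\<close> conjugates \<open>G\<^sup>n\<close> to a translation with an error \<open>n O(c' - c)\<close>. It is bi-Lipschitz
  with a constant that does not depend on \<open>c'\<close>, so for fixed \<open>n\<close> the limit \<open>c' \<longrightarrow> c\<close> bounds the Lipschitz constants
  of \<open>G\<^sup>n\<close> independently of \<open>n\<close>.\<close>

lemma iterate_bilip:
  assumes c: "\<bar>c\<bar> < N" and t: "t \<le> t'"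
  shows "(t' - t) / K^2 \<le> (Gc c ^^ n) t' - (Gc c ^^ n) t" "(Gc c ^^ n) t' - (Gc c ^^ n) t \<le> K^2 * (t' - t)"
proof -
  obtain k0 where k0: "\<And>c c' t. \<bar>c\<bar> \<le> N \<Longrightarrow> \<bar>c'\<bar> \<le> N \<Longrightarrow> c \<noteq> c' \<Longrightarrow>
    \<bar>quot c c' (G (t, c)) - quot c c' t - k0 c c'\<bar> \<le> K^2 * L * \<bar>c' - c\<bar>"
    using quot_near_conjugacy by blast
  let ?C = "2 * of_nat n * K^2 * L"
  have close: "\<bar>(quot c c' ((Gc c ^^ n) t') - quot c c' ((Gc c ^^ n) t)) - (quot c c' t' - quot c c' t)\<bar> \<le> ?C * e"
    if e: "0 < e" "e < N - \<bar>c\<bar>" "c' = c + e" for e c' t t'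
  proof -
    have c': "\<bar>c\<bar> \<le> N" "\<bar>c'\<bar> \<le> N" "c \<noteq> c'" "\<bar>c' - c\<bar> = e" using e by auto
    have it: "\<bar>quot c c' ((Gc c ^^ m) t) - quot c c' t - of_nat m * k0 c c'\<bar> \<le> of_nat m * (K^2 * L * e)" for m t
    proof (induction m)
      case (Suc m)
      have "\<bar>quot c c' (G ((Gc c ^^ m) t, c)) - quot c c' ((Gc c ^^ m) t) - k0 c c'\<bar> \<le> K^2 * L * e"
        using k0[OF c'(1-3)] c'(4) by simp
      with Suc show ?case by (simp add: algebra_simps)
    qed simp
    show ?thesis using it[of n t] it[of n t'] by (simp add: algebra_simps)
  qed
  have e0: "N - \<bar>c\<bar> > 0" using c by simp
  have "(t' - t) / K \<le> K * ((Gc c ^^ n) t' - (Gc c ^^ n) t)"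
  proof (cases "t = t'")
    case False
    show ?thesis
    proof (rule le_of_small_errors[OF _ ])
      \<comment> \<open>Below this bound on \<open>e\<close> the lower estimate \<open>(t' - t) / K - ?C * e\<close> is still nonnegative, so it fixes the order of the two images.\<close>
      show "min (N - \<bar>c\<bar>) ((t' - t) / K / (?C + 1)) > 0"
      proof -
        have "?C + 1 > 0" using K L by (intro add_nonneg_pos) auto
        moreover have "(t' - t) / K > 0" using t False K by simp
        ultimately have "(t' - t) / K / (?C + 1) > 0" by (rule divide_pos_pos[rotated])
        then show ?thesis using e0 by simp
      qed
      fix e assume e: "0 < e" "e < min (N - \<bar>c\<bar>) ((t' - t) / K / (?C + 1))"
      have c': "\<bar>c\<bar> \<le> N" "\<bar>c + e\<bar> \<le> N" "c \<noteq> c + e" using e by auto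
      have pos: "?C + 1 > 0" using K L by (intro add_nonneg_pos) auto
      have "e < (t' - t) / K / (?C + 1)" using e(2) by (simp only: min_less_iff_conj)
      then have "e * (?C + 1) < (t' - t) / K" by (simp only: pos_less_divide_eq[OF pos])
      then have nn: "(t' - t) / K - ?C * e \<ge> 0" using e by (simp add: algebra_simps)
      have "(t' - t) / K - ?C * e \<le> K * ((Gc c ^^ n) t' - (Gc c ^^ n) t)"
        by (rule quot_displacement[OF c' nn])
           (use close[of e "c + e" t' t] quot_bilip(1)[OF c' t] e in auto)
      then show "(t' - t) / K \<le> K * ((Gc c ^^ n) t' - (Gc c ^^ n) t) + ?C * e" by simp
    qed
  qed simp
  then show "(t' - t) / K^2 \<le> (Gc c ^^ n) t' - (Gc c ^^ n) t"
    using K by (simp add: field_simps power2_eq_square)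
  have "(Gc c ^^ n) t' - (Gc c ^^ n) t \<le> K * (K * (t' - t))"
  proof (rule le_of_small_errors[OF e0])
    fix e assume e: "0 < e" "e < N - \<bar>c\<bar>"
    have c': "\<bar>c\<bar> \<le> N" "\<bar>c + e\<bar> \<le> N" "c \<noteq> c + e" using e by auto
    have "0 \<le> K * (t' - t) + ?C * e" using K L e t by simp
    from quot_displacement_upper[OF c' this]
    have "(Gc c ^^ n) t' - (Gc c ^^ n) t \<le> K * (K * (t' - t) + ?C * e)"
      using close[of e "c + e" t' t] quot_bilip(2)[OF c' t] e by auto
    then show "(Gc c ^^ n) t' - (Gc c ^^ n) t \<le> K * (K * (t' - t)) + (K * ?C) * e" by (simp add: algebra_simps)
  qed
  then show "(Gc c ^^ n) t' - (Gc c ^^ n) t \<le> K^2 * (t' - t)" by (simp add: power2_eq_square)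
qed

end

section \<open>Linear separation of neighbouring leaves\<close>

context local_twist_foliation begin

text \<open>Measured by the almost conjugacy \<open>quot c1 c'\<close> of the lower leaf, one step on leaf \<open>c2\<close> exceeds the step on leaf
  \<open>c1\<close> by the twist, which is comparable to \<open>c2 - c1\<close> at every point. The gains add up, and the error
  terms disappear for \<open>c' \<longrightarrow> c1\<close>.\<close>

lemma iterate_growth:
  assumes c: "\<bar>c1\<bar> < N" "\<bar>c2\<bar> < N" "c1 \<le> c2"
  shows "of_nat n * (\<kappa> / K^2) * (c2 - c1) \<le> (Gc c2 ^^ n) t - (Gc c1 ^^ n) t"
    and "(Gc c2 ^^ n) t - (Gc c1 ^^ n) t \<le> of_nat n * (L * K^2) * (c2 - c1)"
proof -
  obtain k0 where k0: "\<And>c c' t. \<bar>c\<bar> \<le> N \<Longrightarrow> \<bar>c'\<bar> \<le> N \<Longrightarrow> c \<noteq> c' \<Longrightarrow>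
    \<bar>quot c c' (G (t, c)) - quot c c' t - k0 c c'\<bar> \<le> K^2 * L * \<bar>c' - c\<bar>"
    using quot_near_conjugacy by blast
  let ?D = "c2 - c1"
  have cN: "\<bar>c1\<bar> \<le> N" "\<bar>c2\<bar> \<le> N" using c by auto
  have bounds: "of_nat n * (\<kappa> * ?D / K) - of_nat n * (2 * K^2 * L) * e \<le> quot c1 c' ((Gc c2 ^^ n) t) - quot c1 c' ((Gc c1 ^^ n) t)"
    "quot c1 c' ((Gc c2 ^^ n) t) - quot c1 c' ((Gc c1 ^^ n) t) \<le> of_nat n * (K * L * ?D) + of_nat n * (2 * K^2 * L) * e"
    if e: "0 < e" "e < N - \<bar>c1\<bar>" "c' = c1 + e" for e c'
  proof -
    have c': "\<bar>c1\<bar> \<le> N" "\<bar>c'\<bar> \<le> N" "c1 \<noteq> c'" "\<bar>c' - c1\<bar> = e" using e by auto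
    let ?q = "quot c1 c'"
    have near: "\<bar>?q (G (x, c1)) - ?q x - k0 c1 c'\<bar> \<le> K^2 * L * e" for x
      using k0[OF c'(1-3)] c'(4) by simp
    have st: "\<kappa> * ?D / K \<le> ?q (G (x, c2)) - ?q (G (x, c1))" "?q (G (x, c2)) - ?q (G (x, c1)) \<le> K * L * ?D" for x
    proof -
      have le: "\<kappa> * ?D \<le> G (x, c2) - G (x, c1)" "G (x, c2) - G (x, c1) \<le> L * ?D"
        using G_low[OF cN c(3)] G_upp[OF cN c(3)] by auto
      moreover have "0 \<le> \<kappa> * ?D" using \<kappa> c by simp
      ultimately have mono: "G (x, c1) \<le> G (x, c2)" by linarith
      have "\<kappa> * ?D / K \<le> (G (x, c2) - G (x, c1)) / K" using le K by (simp add: divide_right_mono)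
      then show "\<kappa> * ?D / K \<le> ?q (G (x, c2)) - ?q (G (x, c1))"
        using quot_bilip(1)[OF c'(1-3) mono] by linarith
      have "K * (G (x, c2) - G (x, c1)) \<le> K * (L * ?D)" using le K by (simp add: mult_left_mono)
      then show "?q (G (x, c2)) - ?q (G (x, c1)) \<le> K * L * ?D"
        using quot_bilip(2)[OF c'(1-3) mono] by (simp add: mult.assoc)
    qed
    have it1: "\<bar>?q ((Gc c1 ^^ m) t) - ?q t - of_nat m * k0 c1 c'\<bar> \<le> of_nat m * (K^2 * L * e)" for m
    proof (induction m)
      case (Suc m)
      with near[of "(Gc c1 ^^ m) t"] show ?case by (simp add: algebra_simps)
    qed simp
    \<comment> \<open>In each step \<open>X\<close> is the gain by the twist and \<open>V\<close> the almost translation on the lower leaf.\<close>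
    have it2: "of_nat m * (\<kappa> * ?D / K - K^2 * L * e) \<le> ?q ((Gc c2 ^^ m) t) - ?q t - of_nat m * k0 c1 c'
       \<and> ?q ((Gc c2 ^^ m) t) - ?q t - of_nat m * k0 c1 c' \<le> of_nat m * (K * L * ?D + K^2 * L * e)" for m
    proof (induction m)
      case (Suc m)
      define X where "X = ?q (G ((Gc c2 ^^ m) t, c2)) - ?q (G ((Gc c2 ^^ m) t, c1))"
      define V where "V = ?q (G ((Gc c2 ^^ m) t, c1)) - ?q ((Gc c2 ^^ m) t) - k0 c1 c'"
      define Z where "Z = ?q ((Gc c2 ^^ m) t) - ?q t - of_nat m * k0 c1 c'"
      define B1 where "B1 = \<kappa> * ?D / K"
      define B2 where "B2 = K * L * ?D"
      define E where "E = K^2 * L * e"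
      have eq: "?q ((Gc c2 ^^ Suc m) t) - ?q t - of_nat (Suc m) * k0 c1 c' = X + V + Z"
        by (simp add: X_def V_def Z_def algebra_simps)
      have "B1 \<le> X" "X \<le> B2" using st by (simp_all add: X_def B1_def B2_def)
      moreover have "\<bar>V\<bar> \<le> E" using near by (simp add: V_def E_def)
      ultimately have XV: "B1 - E \<le> X + V" "X + V \<le> B2 + E" by linarith+
      have Z: "of_nat m * (B1 - E) \<le> Z" "Z \<le> of_nat m * (B2 + E)"
        using Suc by (simp_all add: Z_def B1_def B2_def E_def)
      have "of_nat (Suc m) * (B1 - E) = (B1 - E) + of_nat m * (B1 - E)"
        "of_nat (Suc m) * (B2 + E) = (B2 + E) + of_nat m * (B2 + E)" by (simp_all add: algebra_simps)
      then show ?case unfolding eq B1_def[symmetric] B2_def[symmetric] E_def[symmetric]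
        using add_mono[OF XV(1) Z(1)] add_mono[OF XV(2) Z(2)] by (simp only: conj_commute)
    qed simp
    have i1: "\<bar>?q ((Gc c1 ^^ n) t) - ?q t - of_nat n * k0 c1 c'\<bar> \<le> of_nat n * (K^2 * L * e)" by (rule it1)
    have ex: "of_nat n * (\<kappa> * ?D / K - K^2 * L * e) = of_nat n * (\<kappa> * ?D / K) - of_nat n * (K^2 * L * e)"
      "of_nat n * (K * L * ?D + K^2 * L * e) = of_nat n * (K * L * ?D) + of_nat n * (K^2 * L * e)"
      "of_nat n * (2 * K^2 * L) * e = 2 * (of_nat n * (K^2 * L * e))" by (simp_all add: algebra_simps)
    show "of_nat n * (\<kappa> * ?D / K) - of_nat n * (2 * K^2 * L) * e \<le> ?q ((Gc c2 ^^ n) t) - ?q ((Gc c1 ^^ n) t)"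
      "?q ((Gc c2 ^^ n) t) - ?q ((Gc c1 ^^ n) t) \<le> of_nat n * (K * L * ?D) + of_nat n * (2 * K^2 * L) * e"
      using i1 it2[of n] unfolding ex by linarith+
  qed
  let ?C = "of_nat n * (2 * K^2 * L)"
  have e0: "N - \<bar>c1\<bar> > 0" using c by simp
  have C0: "?C \<ge> 0" using K L by simp
  have D0: "?D \<ge> 0" using c by simp
  have "of_nat n * (\<kappa> * ?D / K) \<le> K * ((Gc c2 ^^ n) t - (Gc c1 ^^ n) t)"
  proof (cases "of_nat n * (\<kappa> * ?D / K) = 0")
    case True
    then show ?thesis
    proof (cases "n = 0")
      case False
      then have "c1 = c2" using True \<kappa> K by simp
      then show ?thesis by simp
    qed simp
  next
    case False
    moreover have "of_nat n * (\<kappa> * ?D / K) \<ge> 0" using \<kappa> K D0 by simp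
    ultimately have pos: "of_nat n * (\<kappa> * ?D / K) > 0" by linarith
    show ?thesis
    proof (rule le_of_small_errors)
      have "of_nat n * (\<kappa> * ?D / K) / (?C + 1) > 0"
      proof (rule divide_pos_pos[OF pos])
        show "?C + 1 > 0" using C0 by linarith
      qed
      then show "min (N - \<bar>c1\<bar>) (of_nat n * (\<kappa> * ?D / K) / (?C + 1)) > 0" using e0 by simp
      fix e assume e: "0 < e" "e < min (N - \<bar>c1\<bar>) (of_nat n * (\<kappa> * ?D / K) / (?C + 1))"
      have c': "\<bar>c1\<bar> \<le> N" "\<bar>c1 + e\<bar> \<le> N" "c1 \<noteq> c1 + e" using e by auto
      have "?C + 1 > 0" using C0 by linarith
      moreover have "e < of_nat n * (\<kappa> * ?D / K) / (?C + 1)" using e(2) by (simp only: min_less_iff_conj)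
      ultimately have "e * (?C + 1) < of_nat n * (\<kappa> * ?D / K)" by (simp only: pos_less_divide_eq)
      then have nn: "of_nat n * (\<kappa> * ?D / K) - ?C * e \<ge> 0" using e by (simp add: algebra_simps)
      have "of_nat n * (\<kappa> * ?D / K) - ?C * e \<le> K * ((Gc c2 ^^ n) t - (Gc c1 ^^ n) t)"
        by (rule quot_displacement[OF c' nn]) (rule bounds(1), use e in auto)
      then show "of_nat n * (\<kappa> * ?D / K) \<le> K * ((Gc c2 ^^ n) t - (Gc c1 ^^ n) t) + ?C * e" by simp
    qed
  qed
  then show "of_nat n * (\<kappa> / K^2) * (c2 - c1) \<le> (Gc c2 ^^ n) t - (Gc c1 ^^ n) t"
    using K by (simp add: field_simps power2_eq_square)
  have "(Gc c2 ^^ n) t - (Gc c1 ^^ n) t \<le> K * (of_nat n * (K * L * ?D))"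
  proof (rule le_of_small_errors[OF e0])
    fix e assume e: "0 < e" "e < N - \<bar>c1\<bar>"
    have c': "\<bar>c1\<bar> \<le> N" "\<bar>c1 + e\<bar> \<le> N" "c1 \<noteq> c1 + e" using e by auto
    have nn: "0 \<le> of_nat n * (K * L * ?D) + ?C * e" using K L D0 e by simp
    have "(Gc c2 ^^ n) t - (Gc c1 ^^ n) t \<le> K * (of_nat n * (K * L * ?D) + ?C * e)"
      by (rule quot_displacement_upper[OF c' nn]) (rule bounds(2), use e in auto)
    then show "(Gc c2 ^^ n) t - (Gc c1 ^^ n) t \<le> K * (of_nat n * (K * L * ?D)) + (K * ?C) * e" by (simp add: algebra_simps)
  qed
  then show "(Gc c2 ^^ n) t - (Gc c1 ^^ n) t \<le> of_nat n * (L * K^2) * (c2 - c1)"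
    by (simp add: power2_eq_square algebra_simps)
qed

end

section \<open>Derivatives of iterates along a leaf\<close>

context twist_foliation begin

text \<open>The derivative of the iterates; \<open>an bn pn dn\<close> below are the entries of its matrix, in the order of
  \<open>a b p d\<close>.\<close>

primrec M :: "nat \<Rightarrow> real \<times> real \<Rightarrow> (real \<times> real) \<Rightarrow>\<^sub>L (real \<times> real)" where
  "M 0 z = id_blinfun"
| "M (Suc n) z = blinfun_compose (F' ((F ^^ n) z)) (M n z)"

lemma dFn: "((F ^^ n) has_derivative blinfun_apply (M n z)) (at z)"
proof (induction n)
  case 0
  have "blinfun_apply (id_blinfun :: (real \<times> real) \<Rightarrow>\<^sub>L (real \<times> real)) = id" by auto
  then show ?case by (simp add: id_def)
next
  case (Suc n)
  from has_derivative_compose[OF Suc dF]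
  have "((\<lambda>z. F ((F ^^ n) z)) has_derivative (\<lambda>v. F' ((F ^^ n) z) (M n z v))) (at z)" .
  moreover have "blinfun_apply (M (Suc n) z) = (\<lambda>v. F' ((F ^^ n) z) (M n z v))" by (auto simp: fun_eq_iff)
  ultimately show ?case by (simp add: o_def)
qed

lemma cont_Fn: "continuous_on UNIV (F ^^ n)"
  by (rule continuous_at_imp_continuous_on) (use dFn has_derivative_continuous in blast)

lemma cont_M: "continuous_on UNIV (M n)"
proof (induction n)
  case (Suc n)
  show ?case
    by (simp, rule bounded_bilinear.continuous_on[OF bounded_bilinear_blinfun_compose
          continuous_on_UNIV_comp[OF cF' cont_Fn] Suc])
qed simp

lemma area_M: "omega (M n z v) (M n z w) = omega v w"
  by (induction n) (simp_all add: area)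

lemma M_add: "M (n + m) z = blinfun_compose (M m ((F ^^ n) z)) (M n z)"
proof (induction m)
  case 0 then show ?case by (simp add: blinfun_eqI)
next
  case (Suc m)
  have "(F ^^ (n + m)) z = (F ^^ m) ((F ^^ n) z)" by (simp add: funpow_add add.commute[of n])
  then show ?case using Suc by (auto intro!: blinfun_eqI)
qed

definition "an n z = fst (M n z (1, 0))"
definition "bn n z = fst (M n z (0, 1))"
definition "pn n z = snd (M n z (1, 0))"
definition "dn n z = snd (M n z (0, 1))"

lemma M_eq: "M n z v = (an n z * fst v + bn n z * snd v, pn n z * fst v + dn n z * snd v)"
proof -
  have "v = fst v *\<^sub>R (1, 0) + snd v *\<^sub>R (0, 1)" by (cases v) simp
  then have "M n z v = fst v *\<^sub>R M n z (1, 0) + snd v *\<^sub>R M n z (0, 1)"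
    by (metis blinfun.add_right blinfun.scaleR_right)
  then show ?thesis by (simp add: an_def bn_def pn_def dn_def prod_eq_iff algebra_simps)
qed

lemma det_n: "an n z * dn n z - bn n z * pn n z = 1"
  using area_M[of n z "(1,0)" "(0,1)"] by (simp add: omega_def an_def bn_def pn_def dn_def algebra_simps)

lemma bn_add: "bn (n + m) z = an m ((F ^^ n) z) * bn n z + bn m ((F ^^ n) z) * dn n z"
  unfolding bn_def[of "n + m"] M_add by (simp add: M_eq[of m] M_eq[of n z "(0,1)"])

lemma cont_an: "continuous_on UNIV (an n)" and cont_bn: "continuous_on UNIV (bn n)"
  unfolding an_def[abs_def] bn_def[abs_def] by (intro continuous_intros cont_M)+

lemma dFn1: "((\<lambda>z. fst ((F ^^ n) z)) has_derivative (\<lambda>v. an n z * fst v + bn n z * snd v)) (at z)"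
  using has_derivative_fst[OF dFn[of n z]] by (simp add: M_eq)

lemma dFn2: "((\<lambda>z. snd ((F ^^ n) z)) has_derivative (\<lambda>v. pn n z * fst v + dn n z * snd v)) (at z)"
  using has_derivative_snd[OF dFn[of n z]] by (simp add: M_eq)

lemma Fn_leaf: "(F ^^ n) (t, eta (t, c)) = (((\<lambda>t. G (t, c)) ^^ n) t, eta (((\<lambda>t. G (t, c)) ^^ n) t, c))"
  by (induction n) (simp_all add: F_leaf)

text \<open>The derivative of \<open>F\<^sup>n\<close> transports difference quotients of the leaf asymptotically, whether or not these
  converge.\<close>

lemma leaf_quotient_relation:
  "((\<lambda>t'. (((\<lambda>t. G (t, c)) ^^ n) t' - ((\<lambda>t. G (t, c)) ^^ n) t) / (t' - t)
      - an n (t, eta (t, c)) - bn n (t, eta (t, c)) * ((eta (t', c) - eta (t, c)) / (t' - t))) \<longlongrightarrow> 0) (at t)" (is ?th1)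
  "((\<lambda>t'. (eta (((\<lambda>t. G (t, c)) ^^ n) t', c) - eta (((\<lambda>t. G (t, c)) ^^ n) t, c)) / (t' - t)
      - pn n (t, eta (t, c)) - dn n (t, eta (t, c)) * ((eta (t', c) - eta (t, c)) / (t' - t))) \<longlongrightarrow> 0) (at t)" (is ?th2)
proof -
  obtain K where lip: "\<And>t'. \<bar>eta (t', c) - eta (t, c)\<bar> \<le> K * \<bar>t' - t\<bar>"
    using eta_bilip[of "\<bar>c\<bar>"] by blast
  have gen: "((\<lambda>t'. (f (t', eta (t', c)) - f (t, eta (t, c))) / (t' - t) - x - y * ((eta (t', c) - eta (t, c)) / (t' - t))) \<longlongrightarrow> 0) (at t)"
    if f: "(f has_derivative (\<lambda>v. x * fst v + y * snd v)) (at (t, eta (t, c)))" for f x y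
  proof -
    have "((\<lambda>z. f z - x * fst z - y * snd z) has_derivative (\<lambda>v. 0)) (at (t, eta (t, c)))"
      by (auto intro!: derivative_eq_intros f)
    from has_derivative_zero_Lipschitz_curve[OF this lip]
    have "((\<lambda>t'. ((f (t', eta (t', c)) - x * t' - y * eta (t', c)) - (f (t, eta (t, c)) - x * t - y * eta (t, c))) / (t' - t)) \<longlongrightarrow> 0) (at t)"
      by (simp add: has_field_derivative_iff)
    then show ?thesis
    proof (rule Lim_transform_eventually)
      have "\<forall>\<^sub>F t' in at t. t' \<noteq> t" by (simp add: eventually_at_filter)
      then show "\<forall>\<^sub>F t' in at t. ((f (t', eta (t', c)) - x * t' - y * eta (t', c)) - (f (t, eta (t, c)) - x * t - y * eta (t, c))) / (t' - t)
          = (f (t', eta (t', c)) - f (t, eta (t, c))) / (t' - t) - x - y * ((eta (t', c) - eta (t, c)) / (t' - t))"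
      proof eventually_elim
        case (elim t')
        have num: "(f (t', eta (t', c)) - x * t' - y * eta (t', c)) - (f (t, eta (t, c)) - x * t - y * eta (t, c))
          = (f (t', eta (t', c)) - f (t, eta (t, c))) - x * (t' - t) - y * (eta (t', c) - eta (t, c))"
          by (simp add: algebra_simps)
        have "(u - x * h - y * v) / h = u / h - x - y * (v / h)" if "h \<noteq> 0" for u h v
          using that by (simp add: diff_divide_distrib)
        then show ?case unfolding num using elim by simp
      qed
    qed
  qed
  show ?th1 using gen[OF dFn1[of n "(t, eta (t, c))"]] by (simp add: Fn_leaf)
  show ?th2 using gen[OF dFn2[of n "(t, eta (t, c))"]] by (simp add: Fn_leaf)
qed

end

section \<open>Differentiability of the leaves\<close>

context local_twist_foliation begin

lemma Gc_iter_shift: "(Gc c ^^ n) (t + of_int m) = (Gc c ^^ n) t + of_int m"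
proof (induction n)
  case (Suc n)
  then show ?case using shift_of_int[of "Gc c" 1] G_shift by simp
qed simp

text \<open>Leaves separate linearly in \<open>n\<close>, and their vertical distance is comparable to the difference of the
  parameters, so \<open>bn n\<close>, the derivative of the first coordinate in the vertical direction, grows linearly.\<close>

lemma bn_bounds:
  assumes c: "\<bar>c\<bar> < N"
  shows "of_nat n * (\<kappa> / K^3) \<le> bn n (t, eta (t, c))" "bn n (t, eta (t, c)) \<le> of_nat n * (L * K^3)"
proof -
  let ?\<phi> = "\<lambda>r. fst ((F ^^ n) (t, r))"
  have der: "(?\<phi> has_real_derivative bn n (t, eta (t, c))) (at (eta (t, c)))"
    by (rule has_derivative_plane_partials(2)[OF dFn1])
  have lim_eta: "((\<lambda>c'. eta (t, c')) \<longlongrightarrow> eta (t, c)) (at_right c)"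
  proof (rule tendstoI)
    fix e :: real assume e: "e > 0"
    have "\<forall>\<^sub>F c' in at_right c. c < c' \<and> c' < min N (c + e / K)"
      unfolding eventually_at_right_field
      by (rule exI[of _ "min N (c + e / K)"]) (use c e K in auto)
    then show "\<forall>\<^sub>F c' in at_right c. dist (eta (t, c')) (eta (t, c)) < e"
    proof eventually_elim
      case (elim c')
      have "\<bar>eta (t, c') - eta (t, c)\<bar> \<le> K * \<bar>c' - c\<bar>" by (rule eta_abs) (use c elim in auto)
      also have "\<dots> < e" using elim K by (simp add: pos_less_divide_eq mult.commute algebra_simps field_simps)
      finally show ?case by (simp add: dist_real_def)
    qed
  qed
  have near: "\<forall>\<^sub>F c' in at_right c. c < c' \<and> c' < N"
    unfolding eventually_at_right_field by (rule exI[of _ N]) (use c in auto)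
  have fl: "filterlim (\<lambda>c'. eta (t, c')) (at (eta (t, c))) (at_right c)"
    unfolding filterlim_at using lim_eta near eta_strict_mono by (auto elim!: eventually_mono) (metis less_irrefl)
  have lim: "((\<lambda>c'. (?\<phi> (eta (t, c')) - ?\<phi> (eta (t, c))) / (eta (t, c') - eta (t, c))) \<longlongrightarrow> bn n (t, eta (t, c))) (at_right c)"
    by (rule filterlim_compose[OF der[unfolded has_field_derivative_iff] fl])
  have ev: "\<forall>\<^sub>F c' in at_right c. of_nat n * (\<kappa> / K^3) \<le> (?\<phi> (eta (t, c')) - ?\<phi> (eta (t, c))) / (eta (t, c') - eta (t, c))
     \<and> (?\<phi> (eta (t, c')) - ?\<phi> (eta (t, c))) / (eta (t, c') - eta (t, c)) \<le> of_nat n * (L * K^3)"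
    using near
  proof eventually_elim
    case (elim c')
    let ?\<Delta> = "eta (t, c') - eta (t, c)" and ?\<delta> = "c' - c"
    have c'N: "\<bar>c'\<bar> < N" "c \<le> c'" using elim c by auto
    have \<Delta>: "?\<delta> / K \<le> ?\<Delta>" "?\<Delta> \<le> K * ?\<delta>" using eta_low eta_upp c c'N by auto
    have \<Delta>0: "?\<Delta> > 0" using elim eta_strict_mono by simp
    have gr: "of_nat n * (\<kappa> / K^2) * ?\<delta> \<le> (Gc c' ^^ n) t - (Gc c ^^ n) t"
      "(Gc c' ^^ n) t - (Gc c ^^ n) t \<le> of_nat n * (L * K^2) * ?\<delta>"
      using iterate_growth[OF c c'N] by auto
    have "of_nat n * (\<kappa> / K^3) * ?\<Delta> \<le> of_nat n * (\<kappa> / K^3) * (K * ?\<delta>)"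
      using \<Delta> \<kappa> K by (intro mult_left_mono) auto
    also have "\<dots> = of_nat n * (\<kappa> / K^2) * ?\<delta>" using K by (simp add: power2_eq_square power3_eq_cube)
    finally have 1: "of_nat n * (\<kappa> / K^3) * ?\<Delta> \<le> (Gc c' ^^ n) t - (Gc c ^^ n) t" using gr by linarith
    have "of_nat n * (L * K^2) * ?\<delta> = of_nat n * (L * K^3) * (?\<delta> / K)" using K by (simp add: power2_eq_square power3_eq_cube)
    also have "\<dots> \<le> of_nat n * (L * K^3) * ?\<Delta>" using \<Delta> L K by (intro mult_left_mono) auto
    finally have 2: "(Gc c' ^^ n) t - (Gc c ^^ n) t \<le> of_nat n * (L * K^3) * ?\<Delta>" using gr by linarith
    show ?case using 1 2 \<Delta>0 by (simp add: Fn_leaf pos_le_divide_eq pos_divide_le_eq)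
  qed
  show "of_nat n * (\<kappa> / K^3) \<le> bn n (t, eta (t, c))"
    by (rule tendsto_lowerbound[OF lim]) (use ev in \<open>auto elim: eventually_mono\<close>)
  show "bn n (t, eta (t, c)) \<le> of_nat n * (L * K^3)"
    by (rule tendsto_upperbound[OF lim]) (use ev in \<open>auto elim: eventually_mono\<close>)
qed

lemma bn_pos: "\<bar>c\<bar> < N \<Longrightarrow> n > 0 \<Longrightarrow> bn n (t, eta (t, c)) > 0"
  using bn_bounds(1)[of c n t] \<kappa> K by (smt (verit) divide_pos_pos mult_pos_pos of_nat_0_less_iff zero_less_power)

lemma iterate_quotient_bounds:
  assumes c: "\<bar>c\<bar> < N" and t: "t' \<noteq> t"
  shows "1 / K^2 \<le> ((Gc c ^^ n) t' - (Gc c ^^ n) t) / (t' - t)"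
    and "\<bar>(Gc c ^^ n) t' - (Gc c ^^ n) t\<bar> \<ge> \<bar>t' - t\<bar> / K^2"
proof -
  have *: "1 / K^2 \<le> ((Gc c ^^ n) t' - (Gc c ^^ n) t) / (t' - t)" if "t < t'" for t t'
    using iterate_bilip(1)[OF c, of t t' n] that by (simp add: pos_le_divide_eq)
  show q: "1 / K^2 \<le> ((Gc c ^^ n) t' - (Gc c ^^ n) t) / (t' - t)"
  proof (cases "t < t'")
    case False
    then have "t' < t" using t by simp
    from *[OF this] show ?thesis by (metis minus_diff_eq minus_divide_divide)
  qed (rule *)
  also have "\<dots> \<le> \<bar>((Gc c ^^ n) t' - (Gc c ^^ n) t) / (t' - t)\<bar>" by (rule abs_ge_self)
  finally show "\<bar>(Gc c ^^ n) t' - (Gc c ^^ n) t\<bar> \<ge> \<bar>t' - t\<bar> / K^2"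
    using t by (simp add: abs_divide pos_le_divide_eq)
qed

lemma Gc_iter_surj:
  assumes c: "\<bar>c\<bar> < N" shows "\<exists>y. (Gc c ^^ n) y = t"
proof -
  let ?f = "Gc c ^^ n"
  have "continuous_on UNIV ?f"
  proof (rule lipschitz_on_continuous_on)
    show "(K^2)-lipschitz_on UNIV ?f"
    proof (rule lipschitz_onI)
      fix x y :: real
      have *: "\<bar>?f x - ?f y\<bar> \<le> K^2 * \<bar>x - y\<bar>" if "y \<le> x" for x y
        using iterate_bilip[OF c that, of n] that K by (smt (verit) divide_nonneg_nonneg zero_le_power2)
      show "dist (?f x) (?f y) \<le> K^2 * dist x y"
        using *[of x y] *[of y x] by (metis abs_minus_commute dist_real_def linear)
    qed (use K in simp)
  qed
  moreover have "?f (of_int \<lfloor>t - ?f 0\<rfloor>) \<le> t" "t \<le> ?f (of_int \<lceil>t - ?f 0\<rceil>)"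
    using Gc_iter_shift[where c = c and n = n and t = 0] by simp_all linarith+
  moreover have "(of_int \<lfloor>t - ?f 0\<rfloor> :: real) \<le> of_int \<lceil>t - ?f 0\<rceil>"
    by (simp add: floor_le_ceiling)
  ultimately show ?thesis
    using IVT'[of ?f "of_int \<lfloor>t - ?f 0\<rfloor>" t "of_int \<lceil>t - ?f 0\<rceil>"] continuous_on_subset by blast
qed

text \<open>The slope of the direction that the derivative of \<open>F\<^sup>n\<close> makes vertical.\<close>

definition sig :: "nat \<Rightarrow> real \<times> real \<Rightarrow> real" where
  "sig n z = - an n (fst z, eta z) / bn n (fst z, eta z)"

text \<open>Forward iterates keep their order along the leaf: the image of a chord of the leaf points to the right, which
  puts its slope above that of the direction mapped to the vertical.\<close>

lemma slope_lower:
  assumes c: "\<bar>c\<bar> < N" and n: "n > 0"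
  shows "\<forall>\<^sub>F t' in at t. sig n (t, c) < (eta (t', c) - eta (t, c)) / (t' - t)"
proof -
  let ?z = "(t, eta (t, c))"
  have "1 / K^2 > 0" using K by simp
  from tendstoD[OF leaf_quotient_relation(1)[where c = c and n = n and t = t] this]
  have "\<forall>\<^sub>F t' in at t. dist (((Gc c ^^ n) t' - (Gc c ^^ n) t) / (t' - t) - an n ?z - bn n ?z * ((eta (t', c) - eta (t, c)) / (t' - t))) 0 < 1 / K^2" .
  moreover have "\<forall>\<^sub>F t' in at t. t' \<noteq> t" by (simp add: eventually_at_filter)
  ultimately show ?thesis
  proof eventually_elim
    case (elim t')
    let ?Q = "(eta (t', c) - eta (t, c)) / (t' - t)"
    have "- an n ?z < ?Q * bn n ?z"
      using elim(1) iterate_quotient_bounds(1)[OF c elim(2), of n]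
      unfolding dist_real_def mult.commute[of ?Q] by linarith
    then have "- an n ?z / bn n ?z < ?Q" using bn_pos[OF c n, of t] by (simp only: pos_divide_less_eq)
    then show ?case by (simp add: sig_def)
  qed
qed

text \<open>The mirror image for backward iterates: the slope of a chord lies below that of the image of the vertical
  under \<open>F\<^sup>n\<close>, taken at the \<open>n\<close>-th preimage. Eliminating the quotients by the determinant \<open>1\<close> leaves a
  strict inequality.\<close>

lemma slope_upper:
  assumes c: "\<bar>c\<bar> < N" and n: "n > 0" and y: "(Gc c ^^ n) y = t"
  shows "\<forall>\<^sub>F t' in at t. (eta (t', c) - eta (t, c)) / (t' - t) < dn n (y, eta (y, c)) / bn n (y, eta (y, c))"
proof -
  let ?g = "Gc c ^^ n" and ?z = "(y, eta (y, c))"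
  let ?Q = "\<lambda>y'. (eta (y', c) - eta (y, c)) / (y' - y)"
  have bp: "bn n ?z > 0" by (rule bn_pos[OF c n])
  have "((\<lambda>y'. dn n ?z * ((?g y' - ?g y) / (y' - y) - an n ?z - bn n ?z * ?Q y')
      - bn n ?z * ((eta (?g y', c) - eta (?g y, c)) / (y' - y) - pn n ?z - dn n ?z * ?Q y')) \<longlongrightarrow> dn n ?z * 0 - bn n ?z * 0) (at y)"
    by (intro tendsto_intros leaf_quotient_relation)
  then have "\<forall>\<^sub>F y' in at y. dist (dn n ?z * ((?g y' - ?g y) / (y' - y) - an n ?z - bn n ?z * ?Q y')
      - bn n ?z * ((eta (?g y', c) - eta (?g y, c)) / (y' - y) - pn n ?z - dn n ?z * ?Q y')) 0 < 1"
    using tendstoD[of _ _ "at y" 1] by fastforce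
  moreover have "\<forall>\<^sub>F y' in at y. y' \<noteq> y" by (simp add: eventually_at_filter)
  ultimately have ev: "\<forall>\<^sub>F y' in at y. (eta (?g y', c) - eta (t, c)) / (?g y' - t) < dn n ?z / bn n ?z"
  proof eventually_elim
    case (elim y')
    define u where "u = (?g y' - ?g y) / (y' - y)"
    define v where "v = (eta (?g y', c) - eta (?g y, c)) / (y' - y)"
    have eq: "dn n ?z * (u - an n ?z - bn n ?z * ?Q y') - bn n ?z * (v - pn n ?z - dn n ?z * ?Q y')
        = dn n ?z * u - bn n ?z * v - (an n ?z * dn n ?z - bn n ?z * pn n ?z)"
      by (simp add: algebra_simps)
    have "\<bar>dn n ?z * u - bn n ?z * v - 1\<bar> < 1"
      using elim(1) unfolding u_def[symmetric] v_def[symmetric] eq det_n by (simp add: dist_real_def)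
    then have 1: "v * bn n ?z < dn n ?z * u" by (simp add: mult.commute)
    have u: "u > 0"
    proof -
      have "1 / K^2 \<le> u" unfolding u_def by (rule iterate_quotient_bounds(1)[OF c elim(2)])
      moreover have "1 / K^2 > 0" using K by simp
      ultimately show ?thesis by linarith
    qed
    have "v / u < dn n ?z / bn n ?z" using 1 u bp by (simp add: field_simps)
    moreover have "v / u = (eta (?g y', c) - eta (t, c)) / (?g y' - t)"
      using elim(2) by (simp add: u_def v_def y)
    ultimately show ?case by simp
  qed
  then obtain \<delta> where \<delta>: "\<delta> > 0" "\<And>y'. y' \<noteq> y \<Longrightarrow> dist y' y < \<delta> \<Longrightarrow> (eta (?g y', c) - eta (t, c)) / (?g y' - t) < dn n ?z / bn n ?z"
    unfolding eventually_at by auto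
  have K2: "K^2 > 0" using K by simp
  show ?thesis unfolding eventually_at
  proof (intro exI conjI ballI impI)
    show "\<delta> / K^2 > 0" using \<delta> K2 by simp
    fix t' assume t': "t' \<noteq> t \<and> dist t' t < \<delta> / K^2"
    obtain y' where y': "?g y' = t'" using Gc_iter_surj[OF c] by blast
    have ne: "y' \<noteq> y" using y' y t' by auto
    have "\<bar>y' - y\<bar> / K^2 \<le> \<bar>t' - t\<bar>" using iterate_quotient_bounds(2)[OF c ne, of n] y y' by simp
    also have "\<dots> < \<delta> / K^2" using t' by (simp add: dist_real_def)
    finally have "\<bar>y' - y\<bar> < \<delta>" using K2 by (simp add: divide_less_cancel)
    then have "dist y' y < \<delta>" by (simp add: dist_real_def)
    from \<delta>(2)[OF ne this] show "(eta (t', c) - eta (t, c)) / (t' - t) < dn n ?z / bn n ?z" by (simp add: y')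
  qed
qed

definition slope_const :: real where "slope_const = 2 * (L * K^3) / (\<kappa> / K^3)^2"

text \<open>The two barriers meet: the chain rule for \<open>2 n = n + n\<close> writes their difference as \<open>bn (2 n) / (bn n * bn n)\<close>,
  which is of order \<open>1 / n\<close>.\<close>

lemma slope_gap:
  assumes c: "\<bar>c\<bar> < N" and n: "n > 0" and y: "(Gc c ^^ n) y = t"
  shows "dn n (y, eta (y, c)) / bn n (y, eta (y, c)) \<le> sig n (t, c) + slope_const / of_nat n"
proof -
  let ?y = "(y, eta (y, c))" and ?t = "(t, eta (t, c))"
  have F: "(F ^^ n) ?y = ?t" by (simp add: Fn_leaf y)
  have b: "bn n ?y > 0" "bn n ?t > 0" by (rule bn_pos[OF c n])+
  have low: "of_nat n * (\<kappa> / K^3) \<le> bn n ?y" "of_nat n * (\<kappa> / K^3) \<le> bn n ?t" by (rule bn_bounds(1)[OF c])+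
  have pos: "of_nat n * (\<kappa> / K^3) > 0" using n \<kappa> K by simp
  have "dn n ?y / bn n ?y - sig n (t, c) = bn (n + n) ?y / (bn n ?y * bn n ?t)"
    using b by (simp add: sig_def bn_add F field_simps)
  also have "\<dots> \<le> (of_nat (n + n) * (L * K^3)) / ((of_nat n * (\<kappa> / K^3)) * (of_nat n * (\<kappa> / K^3)))"
  proof (intro frac_le)
    show "bn (n + n) ?y \<le> of_nat (n + n) * (L * K^3)" by (rule bn_bounds(2)[OF c])
    show "0 \<le> real (n + n) * (L * K^3)" using L K by simp
    show "0 < (of_nat n * (\<kappa> / K^3)) * (of_nat n * (\<kappa> / K^3))" by (rule mult_pos_pos[OF pos pos])
    show "(of_nat n * (\<kappa> / K^3)) * (of_nat n * (\<kappa> / K^3)) \<le> bn n ?y * bn n ?t"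
      by (intro mult_mono low) (use pos b in auto)
  qed
  also have "\<dots> = slope_const / of_nat n"
    using n \<kappa> K by (simp add: slope_const_def power2_eq_square field_simps)
  finally show ?thesis by simp
qed

lemma slope_sandwich:
  assumes c: "\<bar>c\<bar> < N" and n: "n > 0"
  shows "\<forall>\<^sub>F t' in at t. \<bar>(eta (t', c) - eta (t, c)) / (t' - t) - sig n (t, c)\<bar> \<le> slope_const / of_nat n"
proof -
  obtain y where y: "(Gc c ^^ n) y = t" using Gc_iter_surj[OF c] by blast
  show ?thesis using slope_lower[OF c n, of t] slope_upper[OF c n y]
    by eventually_elim (use slope_gap[OF c n y] in linarith)
qed

lemma eta_differentiable:
  assumes c: "\<bar>c\<bar> < N"
  obtains s where "((\<lambda>t. eta (t, c)) has_real_derivative s) (at t)"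
    "\<And>n. n > 0 \<Longrightarrow> \<bar>s - sig n (t, c)\<bar> \<le> slope_const / of_nat n"
proof -
  let ?Q = "\<lambda>t'. (eta (t', c) - eta (t, c)) / (t' - t)"
  have C0: "slope_const \<ge> 0" using \<kappa> K L by (simp add: slope_const_def)
  have diff: "\<bar>sig n (t, c) - sig m (t, c)\<bar> \<le> slope_const / of_nat n + slope_const / of_nat m" if "n > 0" "m > 0" for n m
  proof -
    have "\<forall>\<^sub>F t' in at t. \<bar>sig n (t, c) - sig m (t, c)\<bar> \<le> slope_const / of_nat n + slope_const / of_nat m"
      using slope_sandwich[OF c that(1), of t] slope_sandwich[OF c that(2), of t]
      by eventually_elim linarith
    then show ?thesis by simp
  qed
  have small: "\<exists>n0>0. \<forall>n\<ge>n0. slope_const / of_nat n < e" if "e > 0" for e :: real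
  proof -
    have "(\<lambda>n. slope_const / of_nat n) \<longlonglongrightarrow> 0" by (rule lim_const_over_n)
    then have "\<forall>\<^sub>F n in sequentially. slope_const / of_nat n < e" using that by (rule order_tendstoD(2))
    then obtain n0 where "\<forall>n\<ge>n0. slope_const / of_nat n < e" by (auto simp: eventually_sequentially)
    then show ?thesis by (intro exI[of _ "max n0 1"]) auto
  qed
  have "Cauchy (\<lambda>n. sig n (t, c))"
  proof (rule CauchyI)
    fix e :: real assume "e > 0"
    then obtain n0 where n0: "n0 > 0" "\<And>n. n \<ge> n0 \<Longrightarrow> slope_const / of_nat n < e / 2"
      using small[of "e / 2"] by auto
    have "norm (sig m (t, c) - sig n (t, c)) < e" if "m \<ge> n0" "n \<ge> n0" for m n
      using diff[of m n] n0(1) n0(2)[OF that(1)] n0(2)[OF that(2)] that unfolding real_norm_def by linarith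
    then show "\<exists>M. \<forall>m\<ge>M. \<forall>n\<ge>M. norm (sig m (t, c) - sig n (t, c)) < e" by blast
  qed
  then obtain s where s: "(\<lambda>n. sig n (t, c)) \<longlonglongrightarrow> s" using Cauchy_convergent_iff convergent_def by blast
  have sn: "\<bar>s - sig n (t, c)\<bar> \<le> slope_const / of_nat n" if "n > 0" for n
  proof (rule tendsto_le[OF sequentially_bot])
    show "(\<lambda>m. \<bar>sig m (t, c) - sig n (t, c)\<bar>) \<longlonglongrightarrow> \<bar>s - sig n (t, c)\<bar>" by (intro tendsto_intros s)
    have "(\<lambda>m. slope_const / of_nat m + slope_const / of_nat n) \<longlonglongrightarrow> 0 + slope_const / of_nat n"
      by (intro tendsto_intros lim_const_over_n)
    then show "(\<lambda>m. slope_const / of_nat m + slope_const / of_nat n) \<longlonglongrightarrow> slope_const / of_nat n" by simp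
    show "\<forall>\<^sub>F m in sequentially. \<bar>sig m (t, c) - sig n (t, c)\<bar> \<le> slope_const / of_nat m + slope_const / of_nat n"
      unfolding eventually_sequentially by (rule exI[of _ 1]) (use diff that in auto)
  qed
  have "(?Q \<longlongrightarrow> s) (at t)"
  proof (rule tendstoI)
    fix e :: real assume "e > 0"
    then obtain n where n: "n > 0" "slope_const / of_nat n < e / 2" using small[of "e / 2"] by auto
    show "\<forall>\<^sub>F t' in at t. dist (?Q t') s < e"
      using slope_sandwich[OF c n(1), of t]
      by eventually_elim (use sn[OF n(1)] n(2) in \<open>unfold dist_real_def, linarith\<close>)
  qed
  then have "((\<lambda>t. eta (t, c)) has_real_derivative s) (at t)" by (simp add: has_field_derivative_iff)
  then show thesis using that sn by blast
qed

end

context twist_foliation begin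

definition slope :: "real \<times> real \<Rightarrow> real" where "slope z = deriv (\<lambda>t. eta (t, snd z)) (fst z)"

lemma local_foliation:
  obtains K L \<kappa> where "local_twist_foliation F F' eta W N K L \<kappa>"
proof -
  obtain K L \<kappa> where "K \<ge> 1" "L \<ge> 1" "\<kappa> > 0"
    "\<And>c t t'. \<bar>c\<bar> \<le> N \<Longrightarrow> \<bar>eta (t', c) - eta (t, c)\<bar> \<le> K * \<bar>t' - t\<bar>"
    "\<And>c c' t. \<bar>c\<bar> \<le> N \<Longrightarrow> \<bar>c'\<bar> \<le> N \<Longrightarrow> c \<le> c' \<Longrightarrow> (c' - c) / K \<le> eta (t, c') - eta (t, c)"
    "\<And>c c' t. \<bar>c\<bar> \<le> N \<Longrightarrow> \<bar>c'\<bar> \<le> N \<Longrightarrow> c \<le> c' \<Longrightarrow> eta (t, c') - eta (t, c) \<le> K * (c' - c)"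
    "\<And>c c' t. \<bar>c\<bar> \<le> N \<Longrightarrow> \<bar>c'\<bar> \<le> N \<Longrightarrow> c \<le> c' \<Longrightarrow> \<kappa> * (c' - c) \<le> G (t, c') - G (t, c)"
    "\<And>c c' t. \<bar>c\<bar> \<le> N \<Longrightarrow> \<bar>c'\<bar> \<le> N \<Longrightarrow> c \<le> c' \<Longrightarrow> G (t, c') - G (t, c) \<le> L * (c' - c)"
    "\<And>c t. \<bar>c\<bar> \<le> N \<Longrightarrow> \<bar>b (t, eta (t, c))\<bar> \<le> L"
    by (rule local_bounds[of N]) (rule that; assumption)
  then have "local_twist_foliation F F' eta W N K L \<kappa>"
    by unfold_locales auto
  then show thesis by (rule that)
qed

lemma cont_eta: "continuous_on UNIV eta"
proof -
  have "isCont eta (t, c)" for t c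
  proof -
    obtain K L \<kappa> where "local_twist_foliation F F' eta W (\<bar>c\<bar> + 1) K L \<kappa>" by (rule local_foliation)
    then interpret lf: local_twist_foliation F F' eta W "\<bar>c\<bar> + 1" K L \<kappa> .
    show ?thesis unfolding isCont_def
    proof (rule Lim_null_comparison[where g = "\<lambda>z. K * \<bar>fst z - t\<bar> + K * \<bar>snd z - c\<bar>", THEN Lim_null[THEN iffD2]])
      have "\<forall>\<^sub>F z in at (t, c). dist z (t, c) < 1" unfolding eventually_at by (rule exI[of _ 1]) auto
      then show "\<forall>\<^sub>F z in at (t, c). norm (eta z - eta (t, c)) \<le> K * \<bar>fst z - t\<bar> + K * \<bar>snd z - c\<bar>"
      proof eventually_elim
        case (elim z)
        have "dist (snd z) c < 1" using elim dist_snd_le[of z "(t, c)"] by simp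
        then have "\<bar>snd z\<bar> \<le> \<bar>c\<bar> + 1" by (simp add: dist_real_def)
        then have "\<bar>eta (fst z, snd z) - eta (fst z, c)\<bar> \<le> K * \<bar>snd z - c\<bar>"
          by (intro lf.eta_abs) auto
        moreover have "\<bar>eta (fst z, c) - eta (t, c)\<bar> \<le> K * \<bar>fst z - t\<bar>"
          by (intro lf.eta_lip) auto
        ultimately show ?case by simp
      qed
      have "((\<lambda>z. K * \<bar>fst z - t\<bar> + K * \<bar>snd z - c\<bar>) \<longlongrightarrow> K * \<bar>fst (t, c) - t\<bar> + K * \<bar>snd (t, c) - c\<bar>) (at (t, c))"
        by (intro tendsto_intros)
      then show "((\<lambda>z. K * \<bar>fst z - t\<bar> + K * \<bar>snd z - c\<bar>) \<longlongrightarrow> 0) (at (t, c))" by simp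
    qed
  qed
  then show ?thesis by (simp add: continuous_at_imp_continuous_on)
qed

text \<open>The slopes \<open>sig n\<close> are continuous and converge locally uniformly, at rate \<open>1 / n\<close>, to the derivative of the
  leaf.\<close>

theorem eta_C1: "((\<lambda>t. eta (t, c)) has_real_derivative slope (t, c)) (at t)"
  and slope_continuous: "continuous_on UNIV slope"
proof -
  show der: "((\<lambda>t. eta (t, c)) has_real_derivative slope (t, c)) (at t)" for t c
  proof -
    obtain K L \<kappa> where "local_twist_foliation F F' eta W (\<bar>c\<bar> + 1) K L \<kappa>" by (rule local_foliation)
    then interpret lf: local_twist_foliation F F' eta W "\<bar>c\<bar> + 1" K L \<kappa> .
    obtain s where "((\<lambda>t. eta (t, c)) has_real_derivative s) (at t)"
      using lf.eta_differentiable[of c t] by auto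
    then show ?thesis by (simp add: slope_def DERIV_imp_deriv)
  qed
  have "isCont slope (t, c)" for t c
  proof -
    let ?N = "\<bar>c\<bar> + 1"
    obtain K L \<kappa> where "local_twist_foliation F F' eta W ?N K L \<kappa>" by (rule local_foliation)
    then interpret lf: local_twist_foliation F F' eta W ?N K L \<kappa> .
    let ?S = "UNIV \<times> {- ?N<..<?N} :: (real \<times> real) set"
    have sn: "\<bar>slope z - lf.sig n z\<bar> \<le> lf.slope_const / of_nat n" if "z \<in> ?S" "n > 0" for z n
    proof -
      obtain x y where z: "z = (x, y)" "\<bar>y\<bar> < ?N" using \<open>z \<in> ?S\<close> by (cases z) auto
      obtain s where s: "((\<lambda>t. eta (t, y)) has_real_derivative s) (at x)"
        "\<And>n. n > 0 \<Longrightarrow> \<bar>s - lf.sig n (x, y)\<bar> \<le> lf.slope_const / of_nat n"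
        using lf.eta_differentiable[OF z(2), of x] by auto
      have "s = slope (x, y)" using DERIV_unique[OF s(1) der] .
      then show ?thesis using s(2)[OF that(2)] z by simp
    qed
    have "uniform_limit ?S (\<lambda>n. lf.sig n) slope sequentially"
    proof (rule uniform_limitI)
      fix e :: real assume e: "e > 0"
      have "(\<lambda>n. lf.slope_const / of_nat n) \<longlonglongrightarrow> 0" by (rule lim_const_over_n)
      then have "\<forall>\<^sub>F n in sequentially. lf.slope_const / of_nat n < e" using e by (rule order_tendstoD(2))
      with eventually_gt_at_top[of 0] show "\<forall>\<^sub>F n in sequentially. \<forall>z\<in>?S. dist (lf.sig n z) (slope z) < e"
      proof eventually_elim
        case (elim n)
        show ?case
        proof
          fix z assume "z \<in> ?S"
          from sn[OF this elim(1)] show "dist (lf.sig n z) (slope z) < e"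
            using elim(2) unfolding dist_real_def by linarith
        qed
      qed
    qed
    moreover have "\<forall>\<^sub>F n in sequentially. continuous_on ?S (lf.sig n)"
      using eventually_gt_at_top[of 0]
    proof eventually_elim
      case (elim n)
      have cz: "continuous_on ?S (\<lambda>z. (fst z, eta z))"
        by (intro continuous_intros continuous_on_subset[OF cont_eta]) auto
      have "bn n (fst z, eta z) \<noteq> 0" if "z \<in> ?S" for z
      proof -
        have "\<bar>snd z\<bar> < \<bar>c\<bar> + 1" using that by (cases z) (auto simp: abs_less_iff)
        from lf.bn_pos[OF this elim, of "fst z"] show ?thesis by simp
      qed
      then show ?case unfolding lf.sig_def
        by (intro continuous_intros continuous_on_UNIV_comp[OF cont_an cz] continuous_on_UNIV_comp[OF cont_bn cz]) auto
    qed
    ultimately have "continuous_on ?S slope" by (intro uniform_limit_theorem[of _ "\<lambda>n. lf.sig n"]) auto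
    moreover have "open ?S" by (intro open_Times) auto
    moreover have "(t, c) \<in> ?S" by auto
    ultimately show ?thesis by (simp add: continuous_on_eq_continuous_at)
  qed
  then show "continuous_on UNIV slope" by (simp add: continuous_at_imp_continuous_on)
qed

end

section \<open>Periodic points, uniform limits and near-rotations\<close>

lemma continuous_on_UNIV_tendsto:
  assumes "continuous_on UNIV f" "(X \<longlongrightarrow> x) Fl"
  shows "((\<lambda>j. f (X j)) \<longlongrightarrow> f x) Fl"
  using continuous_on_tendsto_compose[OF assms] by simp

context bilipschitz_circle_map begin

text \<open>If \<open>G\<^sup>q\<close> fixes one point of the circle, the orbit of \<open>t\<close> under it is monotone and bounded, hence converges
  to a fixed point \<open>l\<close>. The iterates are uniformly bi-Lipschitz, so a point cannot approach \<open>l\<close> unless it is \<open>l\<close>.\<close>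

lemma periodic_point_all_periodic:
  assumes per: "(G ^^ q) t0 = t0 + of_int m"
  shows "(G ^^ q) t = t + of_int m"
proof -
  define x where "x n = (G ^^ (q * n)) t - of_int (int n * m)" for n
  have fix_iter: "(G ^^ (q * n)) s = s + of_int (int n * m)" if "(G ^^ q) s = s + of_int m" for n s
  proof (induction n)
    case (Suc n)
    have "(G ^^ (q * Suc n)) s = (G ^^ q) ((G ^^ (q * n)) s)" by (simp add: funpow_add)
    also have "\<dots> = s + of_int (int (Suc n) * m)" unfolding Suc shift_iter that by (simp add: algebra_simps)
    finally show ?case .
  qed simp
  have xS: "x (Suc n) = (G ^^ q) (x n) - of_int m" for n
  proof -
    have "(G ^^ (q * Suc n)) t = (G ^^ q) (x n + of_int (int n * m))" by (simp add: funpow_add x_def)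
    then show ?thesis unfolding shift_iter by (simp add: x_def algebra_simps)
  qed
  have mono: "monoseq x"
  proof (cases "x 0 \<le> x 1")
    case True
    have "x n \<le> x (Suc n)" for n
    proof (induction n)
      case (Suc n)
      then show ?case unfolding xS[of n] xS[of "Suc n"] using strict_mono_less_eq[OF strict_mono_iter] by simp
    qed (use True in simp)
    then show ?thesis by (simp add: monoseq_Suc)
  next
    case False
    have "x (Suc n) \<le> x n" for n
    proof (induction n)
      case (Suc n)
      then show ?case unfolding xS[of n] xS[of "Suc n"] using strict_mono_less_eq[OF strict_mono_iter] by simp
    qed (use False in simp)
    then show ?thesis by (simp add: monoseq_Suc)
  qed
  have two: "\<bar>s - s'\<bar> / K \<le> \<bar>(G ^^ n) s - (G ^^ n) s'\<bar> \<and> \<bar>(G ^^ n) s - (G ^^ n) s'\<bar> \<le> K * \<bar>s - s'\<bar>" for n s s'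
  proof -
    have *: "\<bar>s - s'\<bar> / K \<le> \<bar>(G ^^ n) s - (G ^^ n) s'\<bar> \<and> \<bar>(G ^^ n) s - (G ^^ n) s'\<bar> \<le> K * \<bar>s - s'\<bar>" if "s' \<le> s" for s s'
    proof -
      have "0 \<le> (s - s') / K" using that K by simp
      then show ?thesis using bilip[OF that, of n] that by simp
    qed
    show ?thesis using *[of s s'] *[of s' s] by (metis abs_minus_commute linear)
  qed
  have xb: "\<bar>x n - t0\<bar> \<le> K * \<bar>t - t0\<bar>" for n
    using two[of t t0 "q * n"] fix_iter[OF per, of n] by (simp add: x_def algebra_simps)
  have "\<bar>x n\<bar> \<le> K * \<bar>t - t0\<bar> + \<bar>t0\<bar>" for n using xb[of n] by linarith
  then have "Bseq x" by (intro BseqI'[of x "K * \<bar>t - t0\<bar> + \<bar>t0\<bar>"]) simp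
  then have "convergent x" using mono by (rule Bseq_monoseq_convergent)
  then obtain l where l: "x \<longlonglongrightarrow> l" by (auto simp: convergent_def)
  have "(\<lambda>n. (G ^^ q) (x n) - of_int m) \<longlonglongrightarrow> (G ^^ q) l - of_int m"
    by (intro tendsto_intros continuous_on_UNIV_tendsto[OF cont_iter l])
  moreover have "(\<lambda>n. (G ^^ q) (x n) - of_int m) \<longlonglongrightarrow> l"
    using LIMSEQ_Suc[OF l] by (simp add: xS)
  ultimately have "(G ^^ q) l - of_int m = l" by (rule LIMSEQ_unique)
  then have fl: "(G ^^ q) l = l + of_int m" by simp
  have le: "\<bar>t - l\<bar> / K \<le> \<bar>x n - l\<bar>" for n
    using two[of t l "q * n"] fix_iter[OF fl, of n] by (simp add: x_def algebra_simps)
  have "(\<lambda>n. \<bar>x n - l\<bar>) \<longlonglongrightarrow> \<bar>l - l\<bar>" by (intro tendsto_intros l)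
  then have "\<bar>t - l\<bar> / K \<le> \<bar>l - l\<bar>" by (rule tendsto_lowerbound) (use le in auto)
  then have "t = l" using K by (simp add: field_simps)
  then show ?thesis using fl by simp
qed

end

text \<open>Convergence of \<open>f (y, c')\<close> jointly in \<open>y \<longrightarrow> x\<close> and \<open>c' \<longrightarrow> c\<close> to a continuous limit is uniform on compact
  sets.\<close>

lemma uniform_from_continuous_convergence:
  fixes f :: "real \<times> real \<Rightarrow> real"
  assumes S: "compact S" and r: "continuous_on UNIV r" and e: "e > 0"
    and lim: "\<And>x. (f \<longlongrightarrow> r x) (at (x, c) within {z. snd z \<noteq> c})"
  shows "\<forall>\<^sub>F c' in at c. \<forall>x\<in>S. \<bar>f (x, c') - r x\<bar> < e"
proof -
  have "\<exists>\<delta>>0. (\<forall>y c'. dist y x < \<delta> \<longrightarrow> dist c' c < \<delta> \<longrightarrow> c' \<noteq> c \<longrightarrow> \<bar>f (y, c') - r y\<bar> < e)" for x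
  proof -
    have "\<forall>\<^sub>F z in at (x, c) within {z. snd z \<noteq> c}. dist (f z) (r x) < e / 2"
      using lim e by (intro tendstoD) auto
    then obtain \<delta>1 where \<delta>1: "\<delta>1 > 0" "\<And>z. snd z \<noteq> c \<Longrightarrow> dist z (x, c) < \<delta>1 \<Longrightarrow> dist (f z) (r x) < e / 2"
      unfolding eventually_at by (metis (mono_tags, lifting) mem_Collect_eq snd_conv)
    obtain \<delta>2 where \<delta>2: "\<delta>2 > 0" "\<And>y. dist y x < \<delta>2 \<Longrightarrow> dist (r y) (r x) < e / 2"
      using r e unfolding continuous_on_iff by (metis UNIV_I half_gt_zero)
    show ?thesis
    proof (intro exI conjI allI impI)
      show "min (\<delta>1 / 2) \<delta>2 > 0" using \<delta>1 \<delta>2 by simp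
      fix y c' assume y: "dist y x < min (\<delta>1 / 2) \<delta>2" "dist c' c < min (\<delta>1 / 2) \<delta>2" "c' \<noteq> c"
      have "dist (y, c') (x, c) \<le> dist y x + dist c' c"
        unfolding dist_Pair_Pair using sqrt_sum_squares_le_sum[of "dist y x" "dist c' c"] by simp
      then have "dist (f (y, c')) (r x) < e / 2" using \<delta>1(2)[of "(y, c')"] y by simp
      moreover have "dist (r y) (r x) < e / 2" using \<delta>2 y by simp
      ultimately show "\<bar>f (y, c') - r y\<bar> < e" unfolding dist_real_def by linarith
    qed
  qed
  then obtain \<delta> where \<delta>: "\<And>x. \<delta> x > 0"
    "\<And>x y c'. dist y x < \<delta> x \<Longrightarrow> dist c' c < \<delta> x \<Longrightarrow> c' \<noteq> c \<Longrightarrow> \<bar>f (y, c') - r y\<bar> < e"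
    by metis
  have "S \<subseteq> (\<Union>x\<in>S. ball x (\<delta> x))" using \<delta>(1) by auto
  then obtain T where T: "T \<subseteq> S" "finite T" "S \<subseteq> (\<Union>x\<in>T. ball x (\<delta> x))"
    using compactE_image[OF S, of S "\<lambda>x. ball x (\<delta> x)"] by auto
  have "\<forall>\<^sub>F c' in at c. \<forall>x\<in>T. dist c' c < \<delta> x"
    using T(2) by (rule eventually_ball_finite) (auto intro!: eventually_at_ball[of "\<delta> _" c UNIV, simplified mem_ball] simp: \<delta>(1) eventually_at intro: exI[of _ "\<delta> _"])
  moreover have "\<forall>\<^sub>F c' in at c. c' \<noteq> c" by (simp add: eventually_at_filter)
  ultimately show ?thesis
  proof eventually_elim
    case (elim c')
    show ?case
    proof
      fix y assume "y \<in> S"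
      then obtain x where "x \<in> T" "dist y x < \<delta> x" using T(3) by (auto simp: dist_commute)
      then show "\<bar>f (y, c') - r y\<bar> < e" using \<delta>(2) elim by blast
    qed
  qed
qed

text \<open>If \<open>k\<close> conjugates \<open>\<Gamma>\<close> to the translation by \<open>\<delta>\<close> exactly and \<open>h\<close> does so up to an error \<open>e\<close>, then along the
  orbit of \<open>0\<close> the two functions differ by at most \<open>2 e\<close> per step. A small \<open>\<delta>\<close> makes this orbit a net of mesh \<open>\<delta>\<close> that
  needs \<open>1 / \<delta>\<close> steps to pass \<open>[0, 1]\<close>, and monotonicity interpolates in between. The estimate is useful when
  \<open>e\<close> is small compared with \<open>\<delta>\<close>.\<close>

lemma almost_rotation_comparison:
  fixes h k \<Gamma> :: "real \<Rightarrow> real"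
  assumes h: "mono h" "h 0 = 0" "\<And>t. h (t + 1) = h t + 1"
    and k: "strict_mono k" "k 0 = 0" "\<And>t. k (t + 1) = k t + 1"
    and k\<Gamma>: "\<And>t. k (\<Gamma> t) = k t + \<delta>" and h\<Gamma>: "\<And>t. \<bar>h (\<Gamma> t) - h t - \<tau>\<bar> \<le> e"
  shows "\<bar>\<tau> - \<delta>\<bar> \<le> e" (is ?th1)
    and "\<delta> > 0 \<Longrightarrow> y \<in> {0..1} \<Longrightarrow> \<bar>h y - k y\<bar> \<le> 2 * (1 / \<delta> + 1) * e + \<delta>" (is "PROP ?th2")
proof -
  have hk: "\<bar>h t - k t\<bar> \<le> 1" for t
  proof -
    have "h t - k t = h (frac t) - k (frac t)"
      using shift_of_int[of h 1 "frac t" "\<lfloor>t\<rfloor>", OF h(3)] shift_of_int[of k 1 "frac t" "\<lfloor>t\<rfloor>", OF k(3)]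
      by (simp add: frac_def)
    moreover have "h 0 \<le> h (frac t)" "h (frac t) \<le> h 1" "k 0 \<le> k (frac t)" "k (frac t) \<le> k 1"
      using monoD[OF h(1)] monoD[OF strict_mono_mono[OF k(1)]] frac_lt_1[of t] frac_ge_0[of t] by (simp_all add: less_imp_le)
    moreover have "h 1 = 1" "k 1 = 1" using h(2) h(3)[of 0] k(2) k(3)[of 0] by simp_all
    ultimately show ?thesis using h(2) k(2) by linarith
  qed
  have kn: "k ((\<Gamma> ^^ n) 0) = of_nat n * \<delta>" for n
    by (induction n) (simp_all add: k\<Gamma> k(2) algebra_simps)
  have hn: "\<bar>h ((\<Gamma> ^^ n) 0) - of_nat n * \<tau>\<bar> \<le> of_nat n * e" for n
  proof (induction n)
    case (Suc n)
    with h\<Gamma>[of "(\<Gamma> ^^ n) 0"] show ?case by (simp add: algebra_simps)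
  qed (simp add: h(2))
  show th1: ?th1
  proof (rule ccontr)
    assume "\<not> ?th1"
    then have pos: "\<bar>\<tau> - \<delta>\<bar> - e > 0" by simp
    obtain n :: nat where n: "1 / (\<bar>\<tau> - \<delta>\<bar> - e) < of_nat n" using reals_Archimedean2 by blast
    then have "1 < of_nat n * (\<bar>\<tau> - \<delta>\<bar> - e)" using pos by (simp only: pos_divide_less_eq)
    moreover have "of_nat n * \<bar>\<tau> - \<delta>\<bar> \<le> of_nat n * e + 1"
    proof -
      have "\<bar>of_nat n * (\<tau> - \<delta>)\<bar> \<le> of_nat n * e + 1"
        using hn[of n] hk[of "(\<Gamma> ^^ n) 0"] unfolding kn right_diff_distrib by linarith
      then show ?thesis by (simp add: abs_mult)
    qed
    ultimately show False by (simp add: algebra_simps)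
  qed
  show "PROP ?th2"
  proof -
    assume \<delta>: "\<delta> > 0" and y: "y \<in> {0..1}"
    have e0: "e \<ge> 0" using th1 by linarith
    have ky: "0 \<le> k y" "k y \<le> 1"
      using monoD[OF strict_mono_mono[OF k(1)], of 0 y] monoD[OF strict_mono_mono[OF k(1)], of y 1] y k(2) k(3)[of 0] by auto
    define n where "n = nat \<lfloor>k y / \<delta>\<rfloor>"
    have "of_nat n \<le> k y / \<delta>" "k y / \<delta> < of_nat n + 1"
      unfolding n_def using ky \<delta> by (simp_all add: floor_less_iff)
    then have n: "of_nat n * \<delta> \<le> k y" "k y < of_nat (Suc n) * \<delta>"
      using \<delta> by (simp_all add: pos_le_divide_eq pos_divide_less_eq add.commute)
    have "k ((\<Gamma> ^^ n) 0) \<le> k y" "k y < k ((\<Gamma> ^^ Suc n) 0)" unfolding kn using n by auto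
    then have "(\<Gamma> ^^ n) 0 \<le> y" "y \<le> (\<Gamma> ^^ Suc n) 0"
      using strict_mono_less_eq[OF k(1)] strict_mono_less[OF k(1)] less_imp_le by blast+
    then have hy: "h ((\<Gamma> ^^ n) 0) \<le> h y" "h y \<le> h ((\<Gamma> ^^ Suc n) 0)" using monoD[OF h(1)] by blast+
    have close: "\<bar>h ((\<Gamma> ^^ m) 0) - of_nat m * \<delta>\<bar> \<le> 2 * of_nat m * e" for m
    proof -
      have "\<bar>of_nat m * \<tau> - of_nat m * \<delta>\<bar> \<le> of_nat m * e"
        using mult_left_mono[OF th1, of "of_nat m"] by (simp add: abs_mult flip: right_diff_distrib)
      with hn[of m] show ?thesis by linarith
    qed
    have "of_nat n \<le> 1 / \<delta>" using n(1) ky \<delta> by (simp add: pos_le_divide_eq)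
    then have ne: "2 * of_nat (Suc n) * e \<le> 2 * (1 / \<delta> + 1) * e" using e0 by (intro mult_right_mono) auto
    have ne': "2 * of_nat n * e \<le> 2 * of_nat (Suc n) * e" using e0 by (intro mult_right_mono) auto
    have S: "of_nat (Suc n) * \<delta> = of_nat n * \<delta> + \<delta>" by (simp add: algebra_simps)
    show "\<bar>h y - k y\<bar> \<le> 2 * (1 / \<delta> + 1) * e + \<delta>"
      using hy n close[of n] close[of "Suc n"] ne ne' unfolding S by linarith
  qed
qed

section \<open>First-order expansions between leaves\<close>

context twist_foliation begin

lemma cont_F: "continuous_on UNIV F"
  using cont_Fn[of 1] by simp

lemma cont_graph: "continuous_on UNIV (\<lambda>z. (fst z, eta z))"
  by (intro continuous_intros cont_eta)

lemma cont_G: "continuous_on UNIV G"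
  unfolding G_def[abs_def] by (intro continuous_intros continuous_on_UNIV_comp[OF cont_F cont_graph])

definition A :: "real \<times> real \<Rightarrow> real" where
  "A z = a (fst z, eta z) + b (fst z, eta z) * slope z"

lemma cont_A: "continuous_on UNIV A"
  unfolding A_def[abs_def]
  by (intro continuous_intros continuous_on_UNIV_comp[OF cont_entries(1) cont_graph]
      continuous_on_UNIV_comp[OF cont_entries(2) cont_graph] slope_continuous)

lemma dgraph: "((\<lambda>t. (t, eta (t, c))) has_derivative (\<lambda>h. (h, slope (t, c) * h))) (at t)"
  using eta_C1[of c t] by (intro has_derivative_Pair has_derivative_ident) (simp add: has_field_derivative_def)

lemma G_der: "((\<lambda>t. G (t, c)) has_real_derivative A (t, c)) (at t)"
  unfolding G_def A_def fst_conv
  by (rule has_derivative_imp_has_field_derivative[OF has_derivative_compose[OF dgraph[of c t] dF1]])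
     (simp add: algebra_simps)

lemma slope_transport: "slope (G (t, c), c) * A (t, c) = p (t, eta (t, c)) + d (t, eta (t, c)) * slope (t, c)"
proof -
  have "((\<lambda>t. snd (F (t, eta (t, c)))) has_real_derivative (p (t, eta (t, c)) + d (t, eta (t, c)) * slope (t, c))) (at t)"
    by (rule has_derivative_imp_has_field_derivative[OF has_derivative_compose[OF dgraph[of c t] dF2]])
       (simp add: algebra_simps)
  moreover have "((\<lambda>t. eta (G (t, c), c)) has_real_derivative slope (G (t, c), c) * A (t, c)) (at t)"
    by (rule DERIV_chain2[OF eta_C1 G_der])
  ultimately show ?thesis by (simp add: F_leaf DERIV_unique)
qed

lemma circle_map:
  obtains K where "bilipschitz_circle_map (\<lambda>t. G (t, c)) (\<lambda>t. A (t, c)) K"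
proof -
  obtain K L \<kappa> where "local_twist_foliation F F' eta W (\<bar>c\<bar> + 1) K L \<kappa>" by (rule local_foliation)
  then interpret lf: local_twist_foliation F F' eta W "\<bar>c\<bar> + 1" K L \<kappa> .
  have "bilipschitz_circle_map (\<lambda>t. G (t, c)) (\<lambda>t. A (t, c)) (K^2)"
  proof
    show "G (t + 1, c) = G (t, c) + 1" for t by (rule G_shift)
    show "((\<lambda>t. G (t, c)) has_real_derivative A (t, c)) (at t)" for t by (rule G_der)
    show "continuous_on UNIV (\<lambda>t. A (t, c))"
      by (rule continuous_on_UNIV_comp[OF cont_A]) (intro continuous_intros)
    show "K^2 \<ge> 1" using lf.K by simp
    show "t \<le> t' \<Longrightarrow> (t' - t) / K^2 \<le> (lf.Gc c ^^ n) t' - (lf.Gc c ^^ n) t \<and> (lf.Gc c ^^ n) t' - (lf.Gc c ^^ n) t \<le> K^2 * (t' - t)" for t t' n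
      using lf.iterate_bilip[of c t t' n] by simp
  qed
  then show thesis by (rule that)
qed

lemma A_pos: "A z > 0"
proof -
  obtain t c where z: "z = (t, c)" by force
  obtain K where "bilipschitz_circle_map (\<lambda>t. G (t, c)) (\<lambda>t. A (t, c)) K" by (rule circle_map)
  then interpret bilipschitz_circle_map "\<lambda>t. G (t, c)" "\<lambda>t. A (t, c)" K .
  show ?thesis using An_pos[of 1 t] by (simp add: An_def z)
qed

text \<open>In coordinates adapted to the leaf the derivative of \<open>F\<close> is triangular with determinant \<open>1\<close>: it stretches by
  \<open>A\<close> along the leaf and by \<open>1 / A\<close> across.\<close>

lemma symplectic_slope: "d (t, eta (t, c)) - slope (G (t, c), c) * b (t, eta (t, c)) = 1 / A (t, c)"
proof -
  let ?z = "(t, eta (t, c))"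
  have "(d ?z - slope (G (t, c), c) * b ?z) * A (t, c) = d ?z * A (t, c) - (slope (G (t, c), c) * A (t, c)) * b ?z"
    by (simp add: algebra_simps)
  also have "\<dots> = 1" unfolding slope_transport using det[of ?z] by (simp add: A_def algebra_simps)
  finally show ?thesis using A_pos[of "(t, c)"] by (simp add: eq_divide_eq)
qed

lemma G_strict_mono: "c < c' \<Longrightarrow> G (t, c) < G (t, c')"
proof -
  assume "c < c'"
  have "fst (F (t, r)) < fst (F (t, r'))" if "r < r'" for r r'
    by (rule DERIV_pos_imp_increasing[OF that]) (use dF1_partials(2) b_pos in blast)
  then show ?thesis using eta_strict_mono[OF \<open>c < c'\<close>, of t] by (simp add: G_def)
qed

end

lemma continuous_on_UNIV_tendsto2:
  assumes "continuous_on UNIV f" "(Y \<longlongrightarrow> y) Fl" "(Z \<longlongrightarrow> z) Fl"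
  shows "((\<lambda>j. f (Y j, Z j)) \<longlongrightarrow> f (y, z)) Fl"
  by (rule continuous_on_UNIV_tendsto[OF assms(1) tendsto_Pair[OF assms(2,3)]])

context twist_foliation begin

abbreviation leaf_gap :: "real \<Rightarrow> real \<Rightarrow> real \<Rightarrow> real" where
  "leaf_gap c c' t \<equiv> eta (t, c') - eta (t, c)"

text \<open>All limits below are taken along an arbitrary filter, with a base point \<open>X j \<longrightarrow> x\<close> and a leaf \<open>C j \<longrightarrow> c\<close> moving
  at the same time. This joint form is what makes the later limits uniform in the base point.\<close>

context
  fixes Fl :: "'i filter" and X C :: "'i \<Rightarrow> real" and x c :: real
  assumes X: "(X \<longlongrightarrow> x) Fl" and C: "(C \<longlongrightarrow> c) Fl" and ne: "\<forall>\<^sub>F j in Fl. C j \<noteq> c"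
begin

lemma gap_nonzero: "\<forall>\<^sub>F j in Fl. \<forall>t. eta (t, c) \<noteq> eta (t, C j) \<and> eta (t, C j) \<noteq> eta (t, c)"
  using ne by (rule eventually_mono) (metis eta_strict_mono linorder_neqE_linordered_idom order_less_irrefl)

lemma eta_lims: "((\<lambda>j. eta (X j, c)) \<longlongrightarrow> eta (x, c)) Fl" "((\<lambda>j. eta (X j, C j)) \<longlongrightarrow> eta (x, c)) Fl"
  by (intro continuous_on_UNIV_tendsto2 cont_eta X C tendsto_const)+

lemma G_lims: "((\<lambda>j. G (X j, c)) \<longlongrightarrow> G (x, c)) Fl" "((\<lambda>j. G (X j, C j)) \<longlongrightarrow> G (x, c)) Fl"
  by (intro continuous_on_UNIV_tendsto2 cont_G X C tendsto_const)+

lemma twist_quotient_limit: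
  "((\<lambda>j. (G (X j, C j) - G (X j, c)) / leaf_gap c (C j) (X j)) \<longlongrightarrow> b (x, eta (x, c))) Fl"
proof -
  have "((\<lambda>j. (fst (F (X j, eta (X j, C j))) - fst (F (X j, eta (X j, c)))) / leaf_gap c (C j) (X j)) \<longlongrightarrow> b (x, eta (x, c))) Fl"
    by (rule tendsto_difference_quotient[where \<phi> = "\<lambda>j r. fst (F (X j, r))" and \<phi>' = "\<lambda>j r. b (X j, r)", OF dF1_partials(2) _ eta_lims])
       (auto intro!: continuous_on_UNIV_tendsto2 cont_entries X eventually_mono[OF gap_nonzero])
  then show ?thesis by (simp add: G_def)
qed

lemma height_quotient_limit:
  "((\<lambda>j. (eta (G (X j, C j), C j) - eta (G (X j, c), c)) / leaf_gap c (C j) (X j)) \<longlongrightarrow> d (x, eta (x, c))) Fl"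
proof -
  have "((\<lambda>j. (snd (F (X j, eta (X j, C j))) - snd (F (X j, eta (X j, c)))) / leaf_gap c (C j) (X j)) \<longlongrightarrow> d (x, eta (x, c))) Fl"
    by (rule tendsto_difference_quotient[where \<phi> = "\<lambda>j r. snd (F (X j, r))" and \<phi>' = "\<lambda>j r. d (X j, r)", OF dF2_partials(2) _ eta_lims])
       (auto intro!: continuous_on_UNIV_tendsto2 cont_entries X eventually_mono[OF gap_nonzero])
  then show ?thesis by (simp add: F_leaf)
qed

lemma G_separates: "\<forall>\<^sub>F j in Fl. G (X j, c) \<noteq> G (X j, C j)"
  using ne by (rule eventually_mono) (metis G_strict_mono linorder_neqE_linordered_idom order_less_irrefl)

lemma slope_quotient_limit:
  "((\<lambda>j. (eta (G (X j, C j), C j) - eta (G (X j, c), C j)) / (G (X j, C j) - G (X j, c))) \<longlongrightarrow> slope (G (x, c), c)) Fl"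
  by (rule tendsto_difference_quotient[where \<phi> = "\<lambda>j t. eta (t, C j)" and \<phi>' = "\<lambda>j t. slope (t, C j)", OF eta_C1 _ G_lims G_separates])
     (intro continuous_on_UNIV_tendsto2 slope_continuous C)

text \<open>Two nearby leaves approach each other by the factor \<open>1 / A\<close> while they are stretched by \<open>A\<close>.\<close>

lemma gap_transport_limit:
  "((\<lambda>j. leaf_gap c (C j) (G (X j, c)) / leaf_gap c (C j) (X j)) \<longlongrightarrow> 1 / A (x, c)) Fl"
proof -
  have "((\<lambda>j. (eta (G (X j, C j), C j) - eta (G (X j, c), c)) / leaf_gap c (C j) (X j)
      - ((eta (G (X j, C j), C j) - eta (G (X j, c), C j)) / (G (X j, C j) - G (X j, c)))
        * ((G (X j, C j) - G (X j, c)) / leaf_gap c (C j) (X j)))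
      \<longlongrightarrow> d (x, eta (x, c)) - slope (G (x, c), c) * b (x, eta (x, c))) Fl"
    by (intro tendsto_diff tendsto_mult height_quotient_limit slope_quotient_limit twist_quotient_limit)
  then have "((\<lambda>j. (eta (G (X j, C j), C j) - eta (G (X j, c), c)) / leaf_gap c (C j) (X j)
      - ((eta (G (X j, C j), C j) - eta (G (X j, c), C j)) / (G (X j, C j) - G (X j, c)))
        * ((G (X j, C j) - G (X j, c)) / leaf_gap c (C j) (X j)))
      \<longlongrightarrow> 1 / A (x, c)) Fl" by (simp only: symplectic_slope)
  then show ?thesis
    by (rule Lim_transform_eventually)
       (use G_separates in \<open>rule eventually_mono, simp flip: diff_divide_distrib\<close>)
qed

text \<open>To second order the triangle has height \<open>leaf_gap\<close> times \<open>1 / A\<close> and width \<open>leaf_gap\<close> times the twist \<open>b\<close>.\<close>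

lemma flux_defect_limit:
  assumes S: "\<And>z. (S has_derivative (\<lambda>v. snd (F z) * (a z * fst v + b z * snd v) - snd z * fst v)) (at z)"
  shows "((\<lambda>j. flux_defect S c (C j) (X j) / (leaf_gap c (C j) (X j))^2) \<longlongrightarrow> b (x, eta (x, c)) / A (x, c) / 2) Fl"
proof -
  let ?J' = "\<lambda>j r. slope (fst (F (X j, r)), C j) * b (X j, r) - d (X j, r)"
  have "\<exists>\<xi> \<xi>'. \<xi> \<in> closed_segment (eta (X j, c)) (eta (X j, C j)) \<and> \<xi>' \<in> closed_segment (eta (X j, c)) (eta (X j, C j)) \<and>
      flux_defect S c (C j) (X j) = - ((leaf_gap c (C j) (X j))^2 * (?J' j \<xi>' * b (X j, \<xi>)) / 2)" for j
  proof -
    obtain \<xi> \<xi>' where "\<xi> \<in> closed_segment (eta (X j, c)) (eta (X j, C j))" "\<xi>' \<in> closed_segment (eta (X j, c)) (eta (X j, C j))"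
      "(W (fst (F (X j, eta (X j, C j))), C j) - S (X j, eta (X j, C j))) - (W (fst (F (X j, eta (X j, c))), C j) - S (X j, eta (X j, c)))
        = - ((leaf_gap c (C j) (X j))^2 * (?J' j \<xi>' * b (X j, \<xi>)) / 2)"
    proof (rule second_order_mvt[OF flux_density[OF S]])
      show "((\<lambda>r. eta (fst (F (X j, r)), C j) - snd (F (X j, r))) has_real_derivative ?J' j r) (at r)" for r
        by (intro DERIV_diff DERIV_chain2[OF eta_C1 dF1_partials(2)] dF2_partials(2))
      show "eta (fst (F (X j, eta (X j, C j))), C j) - snd (F (X j, eta (X j, C j))) = 0" by (simp add: F_leaf)
    qed blast
    then show ?thesis by (auto simp: flux_defect_def F_leaf)
  qed
  then obtain \<xi> \<xi>' where \<xi>: "\<And>j. \<xi> j \<in> closed_segment (eta (X j, c)) (eta (X j, C j))"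
    "\<And>j. \<xi>' j \<in> closed_segment (eta (X j, c)) (eta (X j, C j))"
    "\<And>j. flux_defect S c (C j) (X j) = - ((leaf_gap c (C j) (X j))^2 * (?J' j (\<xi>' j) * b (X j, \<xi> j)) / 2)"
    by metis
  have lx: "(\<xi> \<longlongrightarrow> eta (x, c)) Fl" "(\<xi>' \<longlongrightarrow> eta (x, c)) Fl"
    by (rule tendsto_between[OF eta_lims], simp add: \<xi>)+
  have "((\<lambda>j. - ((slope (fst (F (X j, \<xi>' j)), C j) * b (X j, \<xi>' j) - d (X j, \<xi>' j)) * b (X j, \<xi> j) / 2)) \<longlongrightarrow>
      - ((slope (fst (F (x, eta (x, c))), c) * b (x, eta (x, c)) - d (x, eta (x, c))) * b (x, eta (x, c)) / 2)) Fl"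
    by (intro tendsto_intros continuous_on_UNIV_tendsto2[OF slope_continuous] tendsto_fst continuous_on_UNIV_tendsto2[OF cont_F] continuous_on_UNIV_tendsto2[OF cont_entries(2)] continuous_on_UNIV_tendsto2[OF cont_entries(4)] X C lx) simp_all
  moreover have "- ((slope (fst (F (x, eta (x, c))), c) * b (x, eta (x, c)) - d (x, eta (x, c))) * b (x, eta (x, c)) / 2)
      = b (x, eta (x, c)) / A (x, c) / 2"
  proof -
    have neg: "- ((s * y - v) * y / 2) = (v - s * y) * y / 2" for s y v :: real by (simp add: field_simps)
    show ?thesis unfolding F_leaf fst_conv neg symplectic_slope by simp
  qed
  ultimately have "((\<lambda>j. - ((slope (fst (F (X j, \<xi>' j)), C j) * b (X j, \<xi>' j) - d (X j, \<xi>' j)) * b (X j, \<xi> j) / 2)) \<longlongrightarrow>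
      b (x, eta (x, c)) / A (x, c) / 2) Fl" by (simp only:)
  then show ?thesis
  proof (rule Lim_transform_eventually)
    show "\<forall>\<^sub>F j in Fl. - ((slope (fst (F (X j, \<xi>' j)), C j) * b (X j, \<xi>' j) - d (X j, \<xi>' j)) * b (X j, \<xi> j) / 2)
        = flux_defect S c (C j) (X j) / (leaf_gap c (C j) (X j))^2"
      using gap_nonzero by (rule eventually_mono) (simp add: \<xi>(3))
  qed
qed

end

lemma iterate_lims:
  assumes X: "(X \<longlongrightarrow> x) Fl" and C: "(C \<longlongrightarrow> c) Fl"
  shows "((\<lambda>j. ((\<lambda>t. G (t, C j)) ^^ n) (X j)) \<longlongrightarrow> ((\<lambda>t. G (t, c)) ^^ n) x) Fl"
proof (induction n)
  case (Suc n)
  show ?case using continuous_on_UNIV_tendsto2[OF cont_G Suc C] by simp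
qed (simp add: X)

end

section \<open>Leaves with periodic points\<close>

lemma quotient_filter_lims:
  fixes x c :: real
  shows "(fst \<longlongrightarrow> x) (at (x, c) within {z. snd z \<noteq> c})" "(snd \<longlongrightarrow> c) (at (x, c) within {z. snd z \<noteq> c})"
    "\<forall>\<^sub>F z in at (x, c) within {z. snd z \<noteq> c}. snd z \<noteq> c"
proof -
  have "((\<lambda>z. z) \<longlongrightarrow> (x, c)) (at (x, c) within {z. snd z \<noteq> c})" by (rule tendsto_ident_at)
  from tendsto_fst[OF this] tendsto_snd[OF this]
  show "(fst \<longlongrightarrow> x) (at (x, c) within {z. snd z \<noteq> c})" "(snd \<longlongrightarrow> c) (at (x, c) within {z. snd z \<noteq> c})"
    by simp_all
  show "\<forall>\<^sub>F z in at (x, c) within {z. snd z \<noteq> c}. snd z \<noteq> c"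
    by (simp add: eventually_at_filter)
qed

lemma quotient_filter_compose:
  fixes x c :: real
  assumes "(f \<longlongrightarrow> l) (at (x, c) within {z. snd z \<noteq> c})"
    and "(X \<longlongrightarrow> x) Fl" "(C \<longlongrightarrow> c) Fl" "\<forall>\<^sub>F j in Fl. C j \<noteq> c"
  shows "((\<lambda>j. f (X j, C j)) \<longlongrightarrow> l) Fl"
proof (rule filterlim_compose[OF assms(1)])
  show "filterlim (\<lambda>j. (X j, C j)) (at (x, c) within {z. snd z \<noteq> c}) Fl"
    unfolding filterlim_at
    using tendsto_Pair[OF assms(2,3)] assms(4) by (auto elim: eventually_mono)
qed

context twist_foliation begin

definition A_iter :: "nat \<Rightarrow> real \<Rightarrow> real \<Rightarrow> real" where
  "A_iter n c x = (\<Prod>k<n. A (((\<lambda>t. G (t, c)) ^^ k) x, c))"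

lemma A_iter_pos: "A_iter n c x > 0"
  unfolding A_iter_def by (intro prod_pos) (simp add: A_pos)

lemma cont_G_slice: "continuous_on UNIV (\<lambda>t. G (t, c))"
  by (rule continuous_on_UNIV_comp[OF cont_G]) (intro continuous_intros)

lemma cont_iter: "continuous_on UNIV ((\<lambda>t. G (t, c)) ^^ n)"
proof (induction n)
  case (Suc n)
  show ?case by (simp add: o_def) (rule continuous_on_UNIV_comp[OF cont_G_slice Suc])
qed (simp add: id_def)

lemma cont_slice_iter:
  assumes "continuous_on UNIV f"
  shows "continuous_on UNIV (\<lambda>x. f (((\<lambda>t. G (t, c)) ^^ n) x, c))"
  by (rule continuous_on_UNIV_comp[OF assms]) (intro continuous_intros cont_iter)

lemma gap_iterate_limit:
  assumes X: "(X \<longlongrightarrow> x) Fl" and C: "(C \<longlongrightarrow> c) Fl" and ne: "\<forall>\<^sub>F j in Fl. C j \<noteq> c"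
  shows "((\<lambda>j. leaf_gap c (C j) (((\<lambda>t. G (t, c)) ^^ n) (X j)) / leaf_gap c (C j) (X j)) \<longlongrightarrow> 1 / A_iter n c x) Fl"
proof (induction n)
  case 0
  show ?case
    by (rule tendsto_eventually, rule eventually_mono[OF gap_nonzero[OF X C ne]]) (simp add: A_iter_def)
next
  case (Suc n)
  let ?g = "(\<lambda>t. G (t, c)) ^^ n"
  have Xn: "((\<lambda>j. ?g (X j)) \<longlongrightarrow> ?g x) Fl" by (rule continuous_on_UNIV_tendsto[OF cont_iter X])
  have "((\<lambda>j. leaf_gap c (C j) (G (?g (X j), c)) / leaf_gap c (C j) (?g (X j)) * (leaf_gap c (C j) (?g (X j)) / leaf_gap c (C j) (X j)))
      \<longlongrightarrow> 1 / A (?g x, c) * (1 / A_iter n c x)) Fl"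
    by (intro tendsto_mult gap_transport_limit[OF Xn C ne] Suc)
  moreover have "1 / A (?g x, c) * (1 / A_iter n c x) = 1 / A_iter (Suc n) c x"
    by (simp add: A_iter_def mult.commute)
  ultimately have "((\<lambda>j. leaf_gap c (C j) (G (?g (X j), c)) / leaf_gap c (C j) (?g (X j)) * (leaf_gap c (C j) (?g (X j)) / leaf_gap c (C j) (X j)))
      \<longlongrightarrow> 1 / A_iter (Suc n) c x) Fl" by simp
  then show ?case
    by (rule Lim_transform_eventually) (rule eventually_mono[OF gap_nonzero[OF X C ne]], simp)
qed

text \<open>The twist accumulated over a period, each contribution being pulled back to the starting point.\<close>

definition twist_sum :: "nat \<Rightarrow> real \<Rightarrow> real \<Rightarrow> real" where
  "twist_sum q c x = (\<Sum>i<q. b (((\<lambda>t. G (t, c)) ^^ i) x, eta (((\<lambda>t. G (t, c)) ^^ i) x, c))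
      / A (((\<lambda>t. G (t, c)) ^^ i) x, c) / (A_iter i c x)^2)"

lemma twist_sum_pos: "q > 0 \<Longrightarrow> twist_sum q c x > 0"
  unfolding twist_sum_def by (rule sum_pos) (auto intro!: divide_pos_pos mult_pos_pos zero_less_power b_pos A_pos A_iter_pos)

lemma cont_twist_sum: "continuous_on UNIV (twist_sum q c)"
proof -
  have bg: "continuous_on UNIV (\<lambda>z. b (fst z, eta z))"
    by (rule continuous_on_UNIV_comp[OF cont_entries(2) cont_graph])
  have bi: "continuous_on UNIV (\<lambda>x. b (((\<lambda>t. G (t, c)) ^^ i) x, eta (((\<lambda>t. G (t, c)) ^^ i) x, c)))" for i
    using cont_slice_iter[OF bg] by simp
  have ne: "A z \<noteq> 0" "A_iter n c x \<noteq> 0" for z n x using A_pos[of z] A_iter_pos[of n c x] by auto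
  have ci: "continuous_on UNIV (A_iter n c)" for n
    unfolding A_iter_def[abs_def] by (intro continuous_intros cont_slice_iter[OF cont_A])
  show ?thesis unfolding twist_sum_def[abs_def]
    by (intro continuous_intros bi ci cont_slice_iter[OF cont_A]) (auto simp: ne)
qed

lemma flux_sum_limit:
  assumes S: "\<And>z. (S has_derivative (\<lambda>v. snd (F z) * (a z * fst v + b z * snd v) - snd z * fst v)) (at z)"
    and X: "(X \<longlongrightarrow> x) Fl" and C: "(C \<longlongrightarrow> c) Fl" and ne: "\<forall>\<^sub>F j in Fl. C j \<noteq> c"
  shows "((\<lambda>j. (\<Sum>i<q. flux_defect S c (C j) (((\<lambda>t. G (t, c)) ^^ i) (X j))) / (leaf_gap c (C j) (X j))^2)
     \<longlongrightarrow> twist_sum q c x / 2) Fl"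
proof -
  let ?g = "\<lambda>i. (\<lambda>t. G (t, c)) ^^ i"
  have term_lim: "((\<lambda>j. flux_defect S c (C j) (?g i (X j)) / (leaf_gap c (C j) (X j))^2) \<longlongrightarrow>
      b (?g i x, eta (?g i x, c)) / A (?g i x, c) / 2 * (1 / A_iter i c x)^2) Fl" for i
  proof -
    have Xi: "((\<lambda>j. ?g i (X j)) \<longlongrightarrow> ?g i x) Fl" by (rule continuous_on_UNIV_tendsto[OF cont_iter X])
    have "((\<lambda>j. flux_defect S c (C j) (?g i (X j)) / (leaf_gap c (C j) (?g i (X j)))^2
        * (leaf_gap c (C j) (?g i (X j)) / leaf_gap c (C j) (X j))^2) \<longlongrightarrow>
      b (?g i x, eta (?g i x, c)) / A (?g i x, c) / 2 * (1 / A_iter i c x)^2) Fl"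
      by (intro tendsto_mult tendsto_power flux_defect_limit[OF Xi C ne S] gap_iterate_limit[OF X C ne])
    then show ?thesis
      by (rule Lim_transform_eventually)
         (rule eventually_mono[OF gap_nonzero[OF X C ne]], simp add: power_divide)
  qed
  have "((\<lambda>j. \<Sum>i<q. flux_defect S c (C j) (?g i (X j)) / (leaf_gap c (C j) (X j))^2) \<longlongrightarrow>
     (\<Sum>i<q. b (?g i x, eta (?g i x, c)) / A (?g i x, c) / 2 * (1 / A_iter i c x)^2)) Fl"
    by (intro tendsto_sum term_lim)
  moreover have "(\<Sum>i<q. b (?g i x, eta (?g i x, c)) / A (?g i x, c) / 2 * (1 / A_iter i c x)^2) = twist_sum q c x / 2"
    unfolding twist_sum_def sum_divide_distrib by (rule sum.cong) (simp_all add: power_divide)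
  ultimately show ?thesis by (simp only: sum_divide_distrib)
qed

lemma W_shift_int: "W (t + of_int m, c) = W (t, c) + of_int m * c"
  using shift_of_int[of "\<lambda>t. W (t, c)" c t m] W_shift by simp

text \<open>Summed over a period the flux identity telescopes, and what remains is independent of the starting point.\<close>

lemma flux_sum_periodic:
  assumes S: "\<And>t c. S (t, eta (t, c)) = W (G (t, c), c) - W (t, c) + k c"
    and per: "\<And>t. ((\<lambda>t. G (t, c)) ^^ q) t = t + of_int m"
  shows "(\<Sum>i<q. flux_defect S c c' (((\<lambda>t. G (t, c)) ^^ i) t)) = of_nat q * (k c - k c') - of_int m * (c' - c)"
proof -
  let ?x = "\<lambda>i. ((\<lambda>t. G (t, c)) ^^ i) t" and ?w = "\<lambda>t. W (t, c') - W (t, c)"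
  have "flux_defect S c c' (?x i) = (k c - k c') - (?w (?x (Suc i)) - ?w (?x i))" for i
    using flux_identity[OF S, of "?x i" c c'] by simp
  then have "(\<Sum>i<q. flux_defect S c c' (?x i)) = of_nat q * (k c - k c') - (\<Sum>i<q. ?w (?x (Suc i)) - ?w (?x i))"
    by (simp add: sum_subtractf)
  also have "(\<Sum>i<q. ?w (?x (Suc i)) - ?w (?x i)) = ?w (?x q) - ?w (?x 0)"
    by (rule sum_lessThan_telescope)
  also have "\<dots> = of_int m * (c' - c)" unfolding per by (simp add: W_shift_int algebra_simps)
  finally show ?thesis .
qed

text \<open>On a leaf of periodic points, the flux defects along one period add up to a number \<open>\<Phi> c'\<close> that does not depend
  on the point. By \<open>flux_sum_limit\<close> it is asymptotic to \<open>leaf_gap\<^sup>2 * twist_sum / 2\<close>, so the ratio of the gaps at two points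
  converges to the square root of the inverse ratio of the twist sums, which is positive and continuous.
  Integration gives the limit of \<open>quot c c'\<close>.\<close>

theorem periodic_leaf_expansion:
  assumes q: "q > 0" and per: "\<And>t. ((\<lambda>t. G (t, c)) ^^ q) t = t + of_int m"
  obtains h h' where "\<And>t. (h has_real_derivative h' t) (at t)" "continuous_on UNIV h'" "\<And>t. h' t > 0" "h 0 = 0"
    "\<And>t. ((\<lambda>c'. quot c c' t) \<longlongrightarrow> h t) (at c)"
    "\<And>x. ((\<lambda>z. leaf_gap c (snd z) (fst z) / (snd z - c)) \<longlongrightarrow> h' x) (at (x, c) within {z. snd z \<noteq> c})"
    "\<And>x. (h' x)^2 * twist_sum q c x = (h' 0)^2 * twist_sum q c 0"
proof -
  obtain S where S: "\<And>z. (S has_derivative (\<lambda>v. snd (F z) * (a z * fst v + b z * snd v) - snd z * fst v)) (at z)"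
    using exactness by blast
  obtain k where k: "\<And>t c. S (t, eta (t, c)) = W (G (t, c), c) - W (t, c) + k c"
    using action_along_leaf[OF S] by blast
  let ?B = "twist_sum q c"
  define \<Phi> where "\<Phi> c' = of_nat q * (k c - k c') - of_int m * (c' - c)" for c'
  define r where "r x = sqrt (?B 0 / ?B x)" for x
  have Bpos: "?B x > 0" for x by (rule twist_sum_pos[OF q])
  have rpos: "r x > 0" for x using Bpos by (simp add: r_def)
  have cr: "continuous_on UNIV r" unfolding r_def[abs_def]
    by (intro continuous_intros cont_twist_sum) (use Bpos in \<open>simp add: order_less_imp_not_eq2\<close>)
  let ?R = "\<lambda>z. leaf_gap c (snd z) (fst z) / leaf_gap c (snd z) 0"
  have Rlim: "(?R \<longlongrightarrow> r x) (at (x, c) within {z. snd z \<noteq> c})" for x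
  proof -
    let ?Fl = "at (x, c) within {z :: real \<times> real. snd z \<noteq> c}"
    note qf = quotient_filter_lims[where x = x and c = c]
    have l1: "((\<lambda>z. \<Phi> (snd z) / (leaf_gap c (snd z) (fst z))^2) \<longlongrightarrow> ?B x / 2) ?Fl"
      using flux_sum_limit[OF S qf, of q] unfolding flux_sum_periodic[OF k per] \<Phi>_def .
    have l0: "((\<lambda>z. \<Phi> (snd z) / (leaf_gap c (snd z) 0)^2) \<longlongrightarrow> ?B 0 / 2) ?Fl"
      using flux_sum_limit[OF S tendsto_const[of 0] qf(2,3), of q] unfolding flux_sum_periodic[OF k per] \<Phi>_def .
    have "((\<lambda>z. sqrt ((\<Phi> (snd z) / (leaf_gap c (snd z) 0)^2) / (\<Phi> (snd z) / (leaf_gap c (snd z) (fst z))^2)))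
        \<longlongrightarrow> sqrt ((?B 0 / 2) / (?B x / 2))) ?Fl"
      by (intro tendsto_real_sqrt tendsto_divide l0 l1) (use Bpos[of x] in simp)
    then have "((\<lambda>z. sqrt ((\<Phi> (snd z) / (leaf_gap c (snd z) 0)^2) / (\<Phi> (snd z) / (leaf_gap c (snd z) (fst z))^2)))
        \<longlongrightarrow> r x) ?Fl" by (simp add: r_def)
    then show ?thesis
    proof (rule Lim_transform_eventually)
      have "\<forall>\<^sub>F z in ?Fl. \<Phi> (snd z) / (leaf_gap c (snd z) (fst z))^2 > 0"
        using order_tendstoD(1)[OF l1, of 0] Bpos[of x] by simp
      with qf(3) show "\<forall>\<^sub>F z in ?Fl. sqrt ((\<Phi> (snd z) / (leaf_gap c (snd z) 0)^2) / (\<Phi> (snd z) / (leaf_gap c (snd z) (fst z))^2)) = ?R z"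
      proof eventually_elim
        case (elim z)
        then have ph: "\<Phi> (snd z) \<noteq> 0" by auto
        have Rpos: "?R z > 0"
        proof (cases "snd z > c")
          case True
          then show ?thesis using eta_strict_mono[of c "snd z" "fst z"] eta_strict_mono[of c "snd z" 0]
            by (intro divide_pos_pos) simp_all
        next
          case False
          then have "snd z < c" using elim by simp
          then show ?thesis using eta_strict_mono[of "snd z" c "fst z"] eta_strict_mono[of "snd z" c 0]
            by (intro divide_neg_neg) simp_all
        qed
        have eq: "(\<Phi> (snd z) / (leaf_gap c (snd z) 0)^2) / (\<Phi> (snd z) / (leaf_gap c (snd z) (fst z))^2) = (?R z)^2"
          using ph by (simp add: power_divide)
        show ?case unfolding eq using Rpos by (simp only: real_sqrt_abs abs_of_pos)
      qed
    qed
  qed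
  obtain g where g: "\<And>t. (g has_real_derivative r t) (at t)" "g 0 = 0"
    using continuous_antiderivative[OF cr] by blast
  \<comment> \<open>\<open>quot c c'\<close> rescaled by the gap at \<open>0\<close>, whose size relative to \<open>c' - c\<close> is only found at the end, from the value at \<open>t = 1\<close>.\<close>
  define V where "V c' t = (W (t, c') - W (t, c)) / leaf_gap c c' 0" for c' t
  have Vlim: "((\<lambda>c'. V c' t) \<longlongrightarrow> g t) (at c)" for t
  proof (rule tendstoI)
    fix e :: real assume e: "e > 0"
    define e' where "e' = e / (\<bar>t\<bar> + 1)"
    have e': "e' > 0" "\<bar>t\<bar> * e' < e" using e by (simp_all add: e'_def field_simps)
    have "\<forall>\<^sub>F c' in at c. \<forall>x\<in>closed_segment 0 t. \<bar>?R (x, c') - r x\<bar> < e'"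
      by (rule uniform_from_continuous_convergence[OF _ cr e'(1) Rlim]) auto
    then show "\<forall>\<^sub>F c' in at c. dist (V c' t) (g t) < e"
    proof eventually_elim
      case (elim c')
      have der: "((\<lambda>t. V c' t - g t) has_real_derivative (?R (s, c') - r s)) (at s)" for s
        unfolding V_def fst_conv snd_conv by (intro DERIV_diff g DERIV_cdivide W_der)
      obtain \<xi> where \<xi>: "\<xi> \<in> closed_segment 0 t" "(V c' t - g t) - (V c' 0 - g 0) = (t - 0) * (?R (\<xi>, c') - r \<xi>)"
        using mvt_segment[OF der, of 0 t] by blast
      have "V c' t - g t = t * (?R (\<xi>, c') - r \<xi>)" using \<xi>(2) by (simp add: V_def W_0 g(2))
      then have "\<bar>V c' t - g t\<bar> = \<bar>t\<bar> * \<bar>?R (\<xi>, c') - r \<xi>\<bar>" by (simp add: abs_mult)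
      also have "\<dots> \<le> \<bar>t\<bar> * e'" using elim \<xi>(1) by (intro mult_left_mono) auto
      finally show ?case using e'(2) by (simp add: dist_real_def)
    qed
  qed
  have "g 0 < g 1" by (rule DERIV_pos_imp_increasing) (use g(1) rpos in auto)
  then have g1: "g 1 > 0" using g(2) by simp
  have V1: "V c' 1 = (c' - c) / leaf_gap c c' 0" for c'
    using W_shift[of 0] by (simp add: V_def W_0)
  have V1lim: "((\<lambda>c'. (c' - c) / leaf_gap c c' 0) \<longlongrightarrow> g 1) (at c)" using Vlim[of 1] by (simp add: V1)
  show thesis
  proof (rule that[of "\<lambda>t. g t / g 1" "\<lambda>t. r t / g 1"])
    show "((\<lambda>t. g t / g 1) has_real_derivative r t / g 1) (at t)" for t by (rule DERIV_cdivide[OF g(1)])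
    show "continuous_on UNIV (\<lambda>t. r t / g 1)" using g1 by (intro continuous_intros cr) auto
    show "r t / g 1 > 0" for t using rpos g1 by simp
    show "g 0 / g 1 = 0" by (simp add: g(2))
    show "((\<lambda>c'. quot c c' t) \<longlongrightarrow> g t / g 1) (at c)" for t
    proof -
      have "((\<lambda>c'. V c' t / V c' 1) \<longlongrightarrow> g t / g 1) (at c)" using g1 by (intro tendsto_divide Vlim) auto
      then show ?thesis
      proof (rule Lim_transform_eventually)
        have "\<forall>\<^sub>F c' in at c. c' \<noteq> c" by (simp add: eventually_at_filter)
        then show "\<forall>\<^sub>F c' in at c. V c' t / V c' 1 = quot c c' t"
        proof eventually_elim
          case (elim c')
          have "leaf_gap c c' 0 \<noteq> 0" using elim eta_strict_mono[of c c' 0] eta_strict_mono[of c' c 0] by linarith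
          then show ?case unfolding V1 by (simp add: V_def quot_def)
        qed
      qed
    qed
    show "((\<lambda>z. leaf_gap c (snd z) (fst z) / (snd z - c)) \<longlongrightarrow> r x / g 1) (at (x, c) within {z. snd z \<noteq> c})" for x
    proof -
      let ?Fl = "at (x, c) within {z :: real \<times> real. snd z \<noteq> c}"
      note qf = quotient_filter_lims[where x = x and c = c]
      have "filterlim snd (at c) ?Fl" unfolding filterlim_at using qf by (auto elim: eventually_mono)
      from filterlim_compose[OF V1lim this]
      have "((\<lambda>z. (snd z - c) / leaf_gap c (snd z) 0) \<longlongrightarrow> g 1) ?Fl" .
      with Rlim[of x] have "((\<lambda>z. ?R z / ((snd z - c) / leaf_gap c (snd z) 0)) \<longlongrightarrow> r x / g 1) ?Fl"
        using g1 by (intro tendsto_divide) auto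
      then show ?thesis
      proof (rule Lim_transform_eventually)
        show "\<forall>\<^sub>F z in ?Fl. ?R z / ((snd z - c) / leaf_gap c (snd z) 0) = leaf_gap c (snd z) (fst z) / (snd z - c)"
          using gap_nonzero[OF qf] by (rule eventually_mono) (simp add: divide_simps)
      qed
    qed
    have "(r x)^2 * ?B x = ?B 0" for x
      using Bpos[of x] Bpos[of 0] by (simp add: r_def)
    then show "(r x / g 1)^2 * ?B x = (r 0 / g 1)^2 * ?B 0" for x
      by (simp add: power_divide)
  qed
qed

end

section \<open>The derivative of the generating function in the leaf parameter\<close>

context twist_foliation begin

lemma local_quot_near:
  obtains N K C k0 where "\<bar>c\<bar> < N" "K \<ge> 1"
    "\<And>c' t t'. \<bar>c'\<bar> \<le> N \<Longrightarrow> c' \<noteq> c \<Longrightarrow> \<bar>quot c c' t' - quot c c' t\<bar> \<le> K * \<bar>t' - t\<bar>"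
    "\<And>c' t. \<bar>c'\<bar> \<le> N \<Longrightarrow> c' \<noteq> c \<Longrightarrow> \<bar>quot c c' (G (t, c)) - quot c c' t - k0 c'\<bar> \<le> C * \<bar>c' - c\<bar>"
proof -
  let ?N = "\<bar>c\<bar> + 1"
  obtain K L \<kappa> where "local_twist_foliation F F' eta W ?N K L \<kappa>" by (rule local_foliation)
  then interpret lf: local_twist_foliation F F' eta W ?N K L \<kappa> .
  obtain k0 where k0: "\<And>c c' t. \<bar>c\<bar> \<le> ?N \<Longrightarrow> \<bar>c'\<bar> \<le> ?N \<Longrightarrow> c \<noteq> c' \<Longrightarrow>
    \<bar>quot c c' (G (t, c)) - quot c c' t - k0 c c'\<bar> \<le> K^2 * L * \<bar>c' - c\<bar>"
    using lf.quot_near_conjugacy by blast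
  show thesis
    by (rule that[of ?N K "k0 c" "K^2 * L"]) (use lf.K in \<open>auto intro!: lf.quot_lip k0\<close>)
qed

lemma eventually_near: "\<bar>c\<bar> < N \<Longrightarrow> \<forall>\<^sub>F c' in at c. \<bar>c'\<bar> \<le> N \<and> c' \<noteq> (c :: real)"
  unfolding eventually_at
  by (rule exI[of _ "N - \<bar>c\<bar>"]) (auto simp: dist_real_def)

text \<open>A leaf either consists of periodic points, where the limit comes from the second-order expansion, or has none,
  where the almost conjugacies \<open>quot c c'\<close> are forced to converge to the unique conjugacy.\<close>

lemma quot_limit:
  obtains h h' where "\<And>t. (h has_real_derivative h' t) (at t)" "continuous_on UNIV h'" "\<And>t. h' t > 0" "h 0 = 0"
    "\<And>t. ((\<lambda>c'. quot c c' t) \<longlongrightarrow> h t) (at c)"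
proof -
  obtain K where "bilipschitz_circle_map (\<lambda>t. G (t, c)) (\<lambda>t. A (t, c)) K" by (rule circle_map)
  then interpret cm: bilipschitz_circle_map "\<lambda>t. G (t, c)" "\<lambda>t. A (t, c)" K .
  show thesis
  proof (cases "\<exists>n>0. \<exists>t m. ((\<lambda>t. G (t, c)) ^^ n) t = t + of_int m")
    case True
    then obtain q t0 m where q: "q > 0" "((\<lambda>t. G (t, c)) ^^ q) t0 = t0 + of_int m" by blast
    show thesis
      by (rule periodic_leaf_expansion[OF q(1) cm.periodic_point_all_periodic[OF q(2)]]) (rule that; assumption)
  next
    case False
    interpret ap: aperiodic_circle_map "\<lambda>t. G (t, c)" "\<lambda>t. A (t, c)" K
      by unfold_locales (use False in blast)
    obtain h h' \<rho> where h: "\<And>t. (h has_real_derivative h' t) (at t)" "continuous_on UNIV h'" "\<And>t. h' t > 0"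
      "h 0 = 0" "\<And>t. h (t + 1) = h t + 1" "\<And>t. h (G (t, c)) = h t + \<rho>"
      by (rule ap.C1_conjugacy) (rule that; assumption)
    have ch: "continuous_on UNIV h" by (simp add: continuous_at_imp_continuous_on DERIV_isCont[OF h(1)])
    obtain N K' C k0 where N: "\<bar>c\<bar> < N"
      and lip: "\<And>c' t t'. \<bar>c'\<bar> \<le> N \<Longrightarrow> c' \<noteq> c \<Longrightarrow> \<bar>quot c c' t' - quot c c' t\<bar> \<le> K' * \<bar>t' - t\<bar>"
      and near: "\<And>c' t. \<bar>c'\<bar> \<le> N \<Longrightarrow> c' \<noteq> c \<Longrightarrow> \<bar>quot c c' (G (t, c)) - quot c c' t - k0 c'\<bar> \<le> C * \<bar>c' - c\<bar>"
      by (rule local_quot_near[of c]) (rule that; assumption)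
    note ev = eventually_near[OF N]
    have "((\<lambda>c'. quot c c' t) \<longlongrightarrow> h t) (at c)" for t
    proof (rule ap.approximate_conjugacies_converge[OF ch h(4,5,6)])
      show "\<forall>\<^sub>F c' in at c. \<forall>t t'. \<bar>quot c c' t' - quot c c' t\<bar> \<le> K' * \<bar>t' - t\<bar>"
        using ev by (rule eventually_mono) (use lip in blast)
      show "\<forall>\<^sub>F c' in at c. quot c c' 0 = 0" by (simp add: quot_0)
      show "\<forall>\<^sub>F c' in at c. \<forall>t. quot c c' (t + 1) = quot c c' t + 1"
        using ev by (rule eventually_mono) (use quot_shift in metis)
      show "\<forall>\<^sub>F c' in at c. \<forall>t. \<bar>quot c c' (G (t, c)) - quot c c' t - k0 c'\<bar> \<le> C * \<bar>c' - c\<bar>"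
        using ev by (rule eventually_mono) (use near in blast)
      have "((\<lambda>c'. C * \<bar>c' - c\<bar>) \<longlongrightarrow> C * \<bar>c - c\<bar>) (at c)" by (intro tendsto_intros)
      then show "((\<lambda>c'. C * \<bar>c' - c\<bar>) \<longlongrightarrow> 0) (at c)" by simp
    qed
    from that[OF h(1) h(2) h(3) h(4) this] show thesis .
  qed
qed

text \<open>In terms of the generating function \<open>u\<close> this is \<open>t + du/dc\<close>, the lift of the conjugacy on the leaf \<open>c\<close>.\<close>

definition H :: "real \<times> real \<Rightarrow> real" where "H z = deriv (\<lambda>c. W (fst z, c)) (snd z)"

lemma quot_tendsto_H: "((\<lambda>c'. quot c c' t) \<longlongrightarrow> H (t, c)) (at c)"
  and H_der: "((\<lambda>c. W (t, c)) has_real_derivative H (t, c)) (at c)"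
proof -
  obtain h where h: "((\<lambda>c'. quot c c' t) \<longlongrightarrow> h) (at c)" using quot_limit[of c] by metis
  then have "((\<lambda>c. W (t, c)) has_real_derivative h) (at c)"
    unfolding has_field_derivative_iff quot_def .
  then have "H (t, c) = h" by (simp add: H_def DERIV_imp_deriv)
  with h \<open>((\<lambda>c. W (t, c)) has_real_derivative h) (at c)\<close>
  show "((\<lambda>c'. quot c c' t) \<longlongrightarrow> H (t, c)) (at c)" "((\<lambda>c. W (t, c)) has_real_derivative H (t, c)) (at c)"
    by simp_all
qed

lemma H_eqI: "((\<lambda>c'. quot c c' t) \<longlongrightarrow> h) (at c) \<Longrightarrow> H (t, c) = h"
  by (rule tendsto_unique[OF _ quot_tendsto_H]) auto

theorem H_C1:
  obtains h' where "\<And>t. ((\<lambda>t. H (t, c)) has_real_derivative h' t) (at t)" "continuous_on UNIV h'" "\<And>t. h' t > 0"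
proof -
  obtain h h' where h: "\<And>t. (h has_real_derivative h' t) (at t)" "continuous_on UNIV h'" "\<And>t. h' t > 0"
    "\<And>t. ((\<lambda>c'. quot c c' t) \<longlongrightarrow> h t) (at c)"
    by (rule quot_limit[of c]) (rule that; assumption)
  have "(\<lambda>t. H (t, c)) = h" using H_eqI[OF h(4)] by auto
  then show thesis using that[of h'] h(1-3) by simp
qed

lemma H_0: "H (0, c) = 0"
  by (rule H_eqI) (simp add: quot_0)

lemma H_shift: "H (t + 1, c) = H (t, c) + 1"
proof -
  have "((\<lambda>c. W (t + 1, c)) has_real_derivative H (t, c) + 1) (at c)"
    unfolding W_shift by (auto intro!: derivative_eq_intros H_der)
  then show ?thesis using H_der DERIV_unique by blast
qed

lemma H_strict_mono: "strict_mono (\<lambda>t. H (t, c))"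
proof (rule strict_monoI)
  fix t t' :: real assume "t < t'"
  obtain h' where h': "\<And>t. ((\<lambda>t. H (t, c)) has_real_derivative h' t) (at t)" "\<And>t. h' t > 0"
    by (rule H_C1[of c]) (rule that; assumption)
  show "H (t, c) < H (t', c)" by (rule DERIV_pos_imp_increasing[OF \<open>t < t'\<close>]) (use h' in blast)
qed

text \<open>The translation number of \<open>G (_, c)\<close>, read off at \<open>t = 0\<close>, where \<open>H\<close> vanishes.\<close>

definition rho :: "real \<Rightarrow> real" where "rho c = H (G (0, c), c)"

text \<open>In the limit \<open>c' \<longrightarrow> c\<close> the error of the almost conjugacy \<open>quot c c'\<close> vanishes.\<close>

theorem H_conjugacy: "H (G (t, c), c) = H (t, c) + rho c"
proof -
  obtain N K C k0 where N: "\<bar>c\<bar> < N"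
    and near: "\<And>c' t. \<bar>c'\<bar> \<le> N \<Longrightarrow> c' \<noteq> c \<Longrightarrow> \<bar>quot c c' (G (t, c)) - quot c c' t - k0 c'\<bar> \<le> C * \<bar>c' - c\<bar>"
    by (rule local_quot_near[of c]) (rule that; assumption)
  have z: "((\<lambda>c'. C * \<bar>c' - c\<bar>) \<longlongrightarrow> 0) (at c)"
  proof -
    have "((\<lambda>c'. C * \<bar>c' - c\<bar>) \<longlongrightarrow> C * \<bar>c - c\<bar>) (at c)" by (intro tendsto_intros)
    then show ?thesis by simp
  qed
  have "((\<lambda>c'. quot c c' (G (t, c)) - quot c c' t - k0 c') \<longlongrightarrow> 0) (at c)" for t
    by (rule Lim_null_comparison[OF eventually_mono[OF eventually_near[OF N]] z]) (use near in simp)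
  then have "((\<lambda>c'. (quot c c' (G (t, c)) - quot c c' t - k0 c') - (quot c c' (G (0, c)) - quot c c' 0 - k0 c')) \<longlongrightarrow> 0 - 0) (at c)"
    by (intro tendsto_diff)
  moreover have "(x - y - k) - (x' - y' - k) = x - y - (x' - y')" for x y x' y' k :: real by simp
  ultimately have "((\<lambda>c'. quot c c' (G (t, c)) - quot c c' t - (quot c c' (G (0, c)) - quot c c' 0)) \<longlongrightarrow> 0) (at c)"
    by (simp only: diff_zero)
  moreover have "((\<lambda>c'. quot c c' (G (t, c)) - quot c c' t - (quot c c' (G (0, c)) - quot c c' 0)) \<longlongrightarrow>
      H (G (t, c), c) - H (t, c) - (H (G (0, c), c) - H (0, c))) (at c)"
    by (intro tendsto_diff quot_tendsto_H)
  ultimately have "H (G (t, c), c) - H (t, c) - (H (G (0, c), c) - H (0, c)) = 0"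
    by (rule tendsto_unique[OF trivial_limit_at, rotated])
  then show ?thesis by (simp add: rho_def H_0)
qed

lemma H_iterate: "H (((\<lambda>t. G (t, c)) ^^ n) t, c) = H (t, c) + of_nat n * rho c"
  by (induction n) (simp_all add: H_conjugacy algebra_simps)

end

context local_twist_foliation begin

lemma H_lip:
  assumes c: "\<bar>c\<bar> < N" shows "\<bar>H (t', c) - H (t, c)\<bar> \<le> K * \<bar>t' - t\<bar>"
proof (rule tendsto_upperbound)
  show "((\<lambda>c'. \<bar>quot c c' t' - quot c c' t\<bar>) \<longlongrightarrow> \<bar>H (t', c) - H (t, c)\<bar>) (at c)"
    by (intro tendsto_rabs tendsto_diff quot_tendsto_H)
  show "\<forall>\<^sub>F c' in at c. \<bar>quot c c' t' - quot c c' t\<bar> \<le> K * \<bar>t' - t\<bar>"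
    using eventually_near[OF c] by (rule eventually_mono) (use c in \<open>auto intro!: quot_lip\<close>)
qed auto

end

section \<open>The rotation number and the continuity of the conjugacies\<close>

lemma le_of_multiples:
  fixes x y C :: real
  assumes "\<And>n :: nat. of_nat n * x \<le> of_nat n * y + C"
  shows "x \<le> y"
proof (rule ccontr)
  assume "\<not> x \<le> y"
  then have pos: "x - y > 0" by simp
  obtain n :: nat where "C / (x - y) < of_nat n" using reals_Archimedean2 by blast
  then have "C < of_nat n * (x - y)" using pos by (simp only: pos_divide_less_eq)
  with assms[of n] show False by (simp add: algebra_simps)
qed

context twist_foliation begin

lemma H_shift_int: "H (t + of_int m, c) = H (t, c) + of_int m"
  using shift_of_int[of "\<lambda>t. H (t, c)" 1 t m] H_shift by simp

lemma H_near_id: "\<bar>H (t, c) - t\<bar> \<le> 1"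
proof -
  have "H (t, c) - t = H (frac t, c) - frac t"
    using H_shift_int[of "frac t" "\<lfloor>t\<rfloor>" c] by (simp add: frac_def)
  moreover have "H (0, c) \<le> H (frac t, c)" "H (frac t, c) \<le> H (0 + 1, c)"
    using monoD[OF strict_mono_mono[OF H_strict_mono[of c]]] frac_lt_1[of t] frac_ge_0[of t] by (simp_all add: less_imp_le)
  ultimately show ?thesis unfolding H_shift H_0 using frac_lt_1[of t] frac_ge_0[of t] by linarith
qed

lemma H_conj_derivative:
  assumes h': "\<And>t. ((\<lambda>t. H (t, c)) has_real_derivative h' t) (at t)"
  shows "h' (G (t, c)) * A (t, c) = h' t"
proof -
  have "((\<lambda>t. H (G (t, c), c)) has_real_derivative h' (G (t, c)) * A (t, c)) (at t)"
    by (rule DERIV_chain2[OF h' G_der])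
  moreover have "((\<lambda>t. H (t, c) + rho c) has_real_derivative h' t) (at t)"
    by (auto intro!: derivative_eq_intros h')
  ultimately show ?thesis unfolding H_conjugacy by (rule DERIV_unique)
qed

lemma iterate_derivative_transport:
  assumes h': "\<And>t. ((\<lambda>t. H (t, c)) has_real_derivative h' t) (at t)"
  shows "h' (((\<lambda>t. G (t, c)) ^^ n) x) * A_iter n c x = h' x"
proof (induction n)
  case (Suc n)
  let ?y = "((\<lambda>t. G (t, c)) ^^ n) x"
  have "h' (G (?y, c)) * (A_iter n c x * A (?y, c)) = (h' (G (?y, c)) * A (?y, c)) * A_iter n c x" by simp
  also have "\<dots> = h' x" unfolding H_conj_derivative[OF h'] by (rule Suc)
  finally show ?case by (simp add: A_iter_def)
qed (simp add: A_iter_def)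

end

context local_twist_foliation begin

lemma G_abs:
  assumes "\<bar>c\<bar> \<le> N" "\<bar>c'\<bar> \<le> N" shows "\<bar>G (t, c') - G (t, c)\<bar> \<le> L * \<bar>c' - c\<bar>"
proof -
  have *: "\<bar>G (t, c') - G (t, c)\<bar> \<le> L * \<bar>c' - c\<bar>" if "\<bar>c\<bar> \<le> N" "\<bar>c'\<bar> \<le> N" "c \<le> c'" for c c'
  proof -
    have "0 \<le> \<kappa> * (c' - c)" using \<kappa> that by simp
    then have "0 \<le> G (t, c') - G (t, c)" using G_low[OF that, of t] by linarith
    then show ?thesis using G_upp[OF that, of t] that by simp
  qed
  show ?thesis using *[of c c'] *[of c' c] assms by (metis abs_minus_commute linear)
qed

text \<open>Conjugacies are at distance at most \<open>1\<close> from the identity, so the \<open>n\<close>-th iterates on two leaves separate like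
  \<open>n\<close> times the difference of the rotation numbers, up to an error \<open>2\<close>. Divide \<open>iterate_growth\<close> by \<open>n\<close>.\<close>

theorem rho_bilip:
  assumes c: "\<bar>c1\<bar> < N" "\<bar>c2\<bar> < N" "c1 \<le> c2"
  shows "\<kappa> / K^2 * (c2 - c1) \<le> rho c2 - rho c1" "rho c2 - rho c1 \<le> L * K^2 * (c2 - c1)"
proof -
  have near: "\<bar>of_nat n * rho c' - (Gc c' ^^ n) 0\<bar> \<le> 1" for n c'
    using H_near_id[of "(Gc c' ^^ n) 0" c'] by (simp add: H_iterate H_0)
  have cmp: "of_nat n * (rho c2 - rho c1) \<le> (Gc c2 ^^ n) 0 - (Gc c1 ^^ n) 0 + 2"
    "(Gc c2 ^^ n) 0 - (Gc c1 ^^ n) 0 \<le> of_nat n * (rho c2 - rho c1) + 2" for n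
    using near[of n c1] near[of n c2] unfolding right_diff_distrib by linarith+
  show "\<kappa> / K^2 * (c2 - c1) \<le> rho c2 - rho c1"
  proof (rule le_of_multiples[where C = 2])
    fix n :: nat
    have "of_nat n * (\<kappa> / K^2 * (c2 - c1)) \<le> (Gc c2 ^^ n) 0 - (Gc c1 ^^ n) 0"
      using iterate_growth(1)[OF c, of n 0] by (simp only: mult.assoc)
    then show "of_nat n * (\<kappa> / K^2 * (c2 - c1)) \<le> of_nat n * (rho c2 - rho c1) + 2"
      using cmp(2)[of n] by (rule order_trans)
  qed
  show "rho c2 - rho c1 \<le> L * K^2 * (c2 - c1)"
  proof (rule le_of_multiples[where C = 2])
    fix n :: nat
    have "(Gc c2 ^^ n) 0 - (Gc c1 ^^ n) 0 \<le> of_nat n * (L * K^2 * (c2 - c1))"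
      using iterate_growth(2)[OF c, of n 0] by (simp only: mult.assoc)
    then show "of_nat n * (rho c2 - rho c1) \<le> of_nat n * (L * K^2 * (c2 - c1)) + 2"
      using cmp(1)[of n] by (meson add_right_mono order_trans)
  qed
qed

end

context twist_foliation begin

lemma rho_strict_mono: "strict_mono rho"
proof (rule strict_monoI)
  fix c c' :: real assume "c < c'"
  let ?N = "\<bar>c\<bar> + \<bar>c'\<bar> + 1"
  obtain K L \<kappa> where "local_twist_foliation F F' eta W ?N K L \<kappa>" by (rule local_foliation)
  then interpret lf: local_twist_foliation F F' eta W ?N K L \<kappa> .
  have "0 < \<kappa> / K^2 * (c' - c)" using lf.K lf.\<kappa> \<open>c < c'\<close> by simp
  moreover have "\<bar>c\<bar> < ?N" "\<bar>c'\<bar> < ?N" by auto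
  ultimately show "rho c < rho c'" using lf.rho_bilip(1)[of c c'] \<open>c < c'\<close> by linarith
qed

text \<open>The conjugacy of a periodic leaf \<open>c\<close> sees the \<open>q\<close>-th iterate on a nearby leaf as a near-translation. The first-order
  coefficient is the constant of \<open>periodic_leaf_expansion\<close>, so the displacement does not depend on the point.\<close>

lemma periodic_displacement_limit:
  assumes h': "\<And>t. ((\<lambda>t. H (t, c)) has_real_derivative h' t) (at t)" "continuous_on UNIV h'"
    and gap: "\<And>x. ((\<lambda>z. leaf_gap c (snd z) (fst z) / (snd z - c)) \<longlongrightarrow> h' x) (at (x, c) within {z. snd z \<noteq> c})"
  shows "((\<lambda>z. (H (((\<lambda>t. G (t, snd z)) ^^ q) (fst z), c) - H (fst z, c) - of_nat q * rho c) / (snd z - c))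
     \<longlongrightarrow> (h' x)^2 * twist_sum q c x) (at (x, c) within {z. snd z \<noteq> c})"
proof -
  let ?Fl = "at (x, c) within {z :: real \<times> real. snd z \<noteq> c}"
  let ?Z = "\<lambda>i z. ((\<lambda>t. G (t, snd z)) ^^ i) (fst z)" and ?x = "\<lambda>i. ((\<lambda>t. G (t, c)) ^^ i) x"
  note qf = quotient_filter_lims[where x = x and c = c]
  have step: "((\<lambda>z. (H (?Z (Suc i) z, c) - H (?Z i z, c) - rho c) / (snd z - c))
     \<longlongrightarrow> h' (G (?x i, c)) * (b (?x i, eta (?x i, c)) * h' (?x i))) ?Fl" for i
  proof -
    have Z: "(?Z i \<longlongrightarrow> ?x i) ?Fl" by (rule iterate_lims[OF qf(1,2)])
    note lims = Z qf(2,3)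
    have "((\<lambda>z. (H (G (?Z i z, snd z), c) - H (G (?Z i z, c), c)) / (G (?Z i z, snd z) - G (?Z i z, c))
        * ((G (?Z i z, snd z) - G (?Z i z, c)) / leaf_gap c (snd z) (?Z i z)
           * (leaf_gap c (snd z) (?Z i z) / (snd z - c))))
     \<longlongrightarrow> h' (G (?x i, c)) * (b (?x i, eta (?x i, c)) * h' (?x i))) ?Fl"
    proof (intro tendsto_mult)
      show "((\<lambda>z. (H (G (?Z i z, snd z), c) - H (G (?Z i z, c), c)) / (G (?Z i z, snd z) - G (?Z i z, c)))
        \<longlongrightarrow> h' (G (?x i, c))) ?Fl"
        by (rule tendsto_difference_quotient[where \<phi> = "\<lambda>j t. H (t, c)" and \<phi>' = "\<lambda>j. h'", OF h'(1) _ G_lims[OF lims] G_separates[OF lims]])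
           (rule continuous_on_UNIV_tendsto[OF h'(2)])
      show "((\<lambda>z. (G (?Z i z, snd z) - G (?Z i z, c)) / leaf_gap c (snd z) (?Z i z)) \<longlongrightarrow> b (?x i, eta (?x i, c))) ?Fl"
        by (rule twist_quotient_limit[OF lims])
      show "((\<lambda>z. leaf_gap c (snd z) (?Z i z) / (snd z - c)) \<longlongrightarrow> h' (?x i)) ?Fl"
        using quotient_filter_compose[OF gap lims] by simp
    qed
    then show ?thesis
    proof (rule Lim_transform_eventually)
      show "\<forall>\<^sub>F z in ?Fl. (H (G (?Z i z, snd z), c) - H (G (?Z i z, c), c)) / (G (?Z i z, snd z) - G (?Z i z, c))
        * ((G (?Z i z, snd z) - G (?Z i z, c)) / leaf_gap c (snd z) (?Z i z)
           * (leaf_gap c (snd z) (?Z i z) / (snd z - c))) = (H (?Z (Suc i) z, c) - H (?Z i z, c) - rho c) / (snd z - c)"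
        using G_separates[OF lims] gap_nonzero[OF lims]
        by eventually_elim (simp add: H_conjugacy diff_diff_eq)
    qed
  qed
  have "((\<lambda>z. \<Sum>i<q. (H (?Z (Suc i) z, c) - H (?Z i z, c) - rho c) / (snd z - c))
     \<longlongrightarrow> (\<Sum>i<q. h' (G (?x i, c)) * (b (?x i, eta (?x i, c)) * h' (?x i)))) ?Fl"
    by (intro tendsto_sum step)
  moreover have "(\<Sum>i<q. (H (?Z (Suc i) z, c) - H (?Z i z, c) - rho c) / (snd z - c))
      = (H (?Z q z, c) - H (fst z, c) - of_nat q * rho c) / (snd z - c)" for z
  proof -
    have "(\<Sum>i<q. H (?Z (Suc i) z, c) - H (?Z i z, c)) = H (?Z q z, c) - H (?Z 0 z, c)"
      by (rule sum_lessThan_telescope)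
    then have "(\<Sum>i<q. H (?Z (Suc i) z, c) - H (?Z i z, c) - rho c) = H (?Z q z, c) - H (fst z, c) - of_nat q * rho c"
      by (simp add: sum_subtractf)
    then show ?thesis by (simp only: sum_divide_distrib[symmetric])
  qed
  moreover have "(\<Sum>i<q. h' (G (?x i, c)) * (b (?x i, eta (?x i, c)) * h' (?x i))) = (h' x)^2 * twist_sum q c x"
    unfolding twist_sum_def sum_distrib_left
  proof (rule sum.cong[OF refl])
    fix i
    have Ap: "A (?x i, c) > 0" "A_iter i c x > 0" by (simp_all add: A_pos A_iter_pos)
    have 1: "h' (G (?x i, c)) = h' (?x i) / A (?x i, c)"
      using H_conj_derivative[OF h'(1), of "?x i"] Ap(1) by (simp add: eq_divide_eq)
    have 2: "h' (?x i) = h' x / A_iter i c x"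
      using iterate_derivative_transport[OF h'(1), of i x] Ap(2) by (simp add: eq_divide_eq)
    show "h' (G (?x i, c)) * (b (?x i, eta (?x i, c)) * h' (?x i))
       = (h' x)^2 * (b (?x i, eta (?x i, c)) / A (?x i, c) / (A_iter i c x)^2)"
      unfolding 1 2 by (simp add: power2_eq_square ac_simps)
  qed
  ultimately show ?thesis by (simp only:)
qed

end

context local_twist_foliation begin

text \<open>On the leaf \<open>c'\<close> the map \<open>\<Gamma> = G\<^sup>q - m\<close> is exactly a translation by \<open>\<delta>\<close> for \<open>H (_, c')\<close>, and a translation by
  \<open>(c' - c) \<mu>\<close> with error \<open>o(c' - c)\<close> for \<open>H (_, c)\<close>. As \<open>\<delta>\<close> is comparable to \<open>c' - c\<close>, the comparison of
  near-rotations shows that the two conjugacies are close.\<close>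

lemma H_tendsto_periodic:
  assumes c: "\<bar>c\<bar> < N" and q: "q > 0" and per: "\<And>t. (Gc c ^^ q) t = t + of_int m" and y: "y \<in> {0..1}"
  shows "((\<lambda>c'. H (y, c')) \<longlongrightarrow> H (y, c)) (at c)"
proof -
  obtain h h' where h: "\<And>t. (h has_real_derivative h' t) (at t)" "continuous_on UNIV h'" "\<And>t. h' t > 0"
    "\<And>t. ((\<lambda>c'. quot c c' t) \<longlongrightarrow> h t) (at c)"
    and gap: "\<And>x. ((\<lambda>z. leaf_gap c (snd z) (fst z) / (snd z - c)) \<longlongrightarrow> h' x) (at (x, c) within {z. snd z \<noteq> c})"
    and const: "\<And>x. (h' x)^2 * twist_sum q c x = (h' 0)^2 * twist_sum q c 0"
    by (rule periodic_leaf_expansion[OF q per]) (rule that; assumption)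
  have "h = (\<lambda>t. H (t, c))" using H_eqI[OF h(4)] by auto
  then have hd: "((\<lambda>t. H (t, c)) has_real_derivative h' t) (at t)" for t using h(1) by simp
  define \<mu> where "\<mu> = (h' 0)^2 * twist_sum q c 0"
  let ?f = "\<lambda>z. (H (((\<lambda>t. G (t, snd z)) ^^ q) (fst z), c) - H (fst z, c) - of_nat q * rho c) / (snd z - c)"
  have lim: "(?f \<longlongrightarrow> \<mu>) (at (x, c) within {z. snd z \<noteq> c})" for x
  proof -
    have "(h' x)^2 * twist_sum q c x = \<mu>" unfolding \<mu>_def by (rule const)
    then show ?thesis using periodic_displacement_limit[OF hd h(2) gap, of q x] by (simp only:)
  qed
  have qrho: "of_nat q * rho c = of_int m"
    using H_iterate[of q c 0] per[of 0] H_shift_int[of 0 m c] by simp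
  define \<alpha> where "\<alpha> = \<kappa> / K^2"
  define \<beta> where "\<beta> = L * K^2"
  have \<alpha>: "\<alpha> > 0" using \<kappa> K by (simp add: \<alpha>_def)
  have \<beta>: "\<beta> > 0" using L K by (simp add: \<beta>_def)
  show ?thesis
  proof (rule tendstoI)
    fix E :: real assume E: "E > 0"
    \<comment> \<open>With these choices the first term of the final estimate is \<open>E / 4\<close> and the two others together are below \<open>E / 2\<close>.\<close>
    define e where "e = E * \<alpha> / 8"
    have e: "e > 0" using E \<alpha> by (simp add: e_def)
    define \<epsilon>0 where "\<epsilon>0 = E / (2 * (2 * e + of_nat q * \<beta>))"
    have qb: "2 * e + of_nat q * \<beta> > 0" using e \<beta> by (simp add: add_pos_nonneg)
    have \<epsilon>0: "\<epsilon>0 > 0" using E qb by (simp add: \<epsilon>0_def)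
    have "\<forall>\<^sub>F c' in at c. \<forall>x\<in>{0..1}. \<bar>?f (x, c') - \<mu>\<bar> < e"
      by (rule uniform_from_continuous_convergence[OF _ _ e lim]) (auto intro: continuous_intros)
    moreover have "\<forall>\<^sub>F c' in at c. dist c' c < \<epsilon>0"
      using \<epsilon>0 by (auto simp: eventually_at)
    moreover have "\<forall>\<^sub>F c' in at c. \<bar>c'\<bar> < N \<and> c' \<noteq> c"
      unfolding eventually_at by (rule exI[of _ "N - \<bar>c\<bar>"]) (use c in \<open>auto simp: dist_real_def\<close>)
    ultimately show "\<forall>\<^sub>F c' in at c. dist (H (y, c')) (H (y, c)) < E"
    proof eventually_elim
      case (elim c')
      have c': "\<bar>c'\<bar> < N" "c' \<noteq> c" using elim(3) by auto
      let ?\<Gamma> = "\<lambda>t. (Gc c' ^^ q) t - of_int m"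
      let ?\<epsilon> = "c' - c"
      define \<delta> where "\<delta> = of_nat q * rho c' - of_int m"
      have k\<Gamma>: "H (?\<Gamma> t, c') = H (t, c') + \<delta>" for t
        using H_shift_int[of "(Gc c' ^^ q) t" "- m" c'] by (simp add: H_iterate \<delta>_def)
      have unif: "\<bar>H ((Gc c' ^^ q) t, c) - H (t, c) - of_nat q * rho c - ?\<epsilon> * \<mu>\<bar> \<le> \<bar>?\<epsilon>\<bar> * e" for t
      proof -
        define X where "X = H ((Gc c' ^^ q) (frac t), c) - H (frac t, c) - of_nat q * rho c"
        have t: "t = frac t + of_int \<lfloor>t\<rfloor>" by (simp add: frac_def)
        have "H ((Gc c' ^^ q) t, c) - H (t, c) - of_nat q * rho c = X"
          by (subst (1 2) t) (simp add: Gc_iter_shift H_shift_int X_def)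
        moreover have "\<bar>X / ?\<epsilon> - \<mu>\<bar> \<le> e"
        proof -
          have "frac t \<in> {0..1}" by (simp add: less_imp_le[OF frac_lt_1])
          from bspec[OF elim(1) this] show ?thesis by (simp add: X_def)
        qed
        then have "\<bar>?\<epsilon>\<bar> * \<bar>X / ?\<epsilon> - \<mu>\<bar> \<le> \<bar>?\<epsilon>\<bar> * e" by (intro mult_left_mono) auto
        then have "\<bar>?\<epsilon> * (X / ?\<epsilon> - \<mu>)\<bar> \<le> \<bar>?\<epsilon>\<bar> * e" by (simp only: abs_mult)
        moreover have "?\<epsilon> * (X / ?\<epsilon> - \<mu>) = X - ?\<epsilon> * \<mu>" using c' by (simp add: right_diff_distrib)
        ultimately show ?thesis by simp
      qed
      have h\<Gamma>: "\<bar>H (?\<Gamma> t, c) - H (t, c) - ?\<epsilon> * \<mu>\<bar> \<le> \<bar>?\<epsilon>\<bar> * e" for t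
        using unif[of t] H_shift_int[of "(Gc c' ^^ q) t" "- m" c] by (simp add: qrho)
      have \<delta>\<epsilon>: "\<alpha> * \<bar>?\<epsilon>\<bar> \<le> \<bar>\<delta>\<bar> \<and> \<bar>\<delta>\<bar> \<le> of_nat q * \<beta> * \<bar>?\<epsilon>\<bar>"
      proof -
        have "\<delta> = of_nat q * (rho c' - rho c)" using qrho by (simp add: \<delta>_def algebra_simps)
        then have d: "\<bar>\<delta>\<bar> = of_nat q * \<bar>rho c' - rho c\<bar>" by (simp add: abs_mult)
        have r: "\<alpha> * \<bar>?\<epsilon>\<bar> \<le> \<bar>rho c' - rho c\<bar> \<and> \<bar>rho c' - rho c\<bar> \<le> \<beta> * \<bar>?\<epsilon>\<bar>"
        proof (cases "c \<le> c'")
          case True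
          have "\<alpha> * (c' - c) \<ge> 0" using \<alpha> True by simp
          with rho_bilip[OF c c'(1) True] True show ?thesis by (simp add: \<alpha>_def \<beta>_def)
        next
          case False
          then have le: "c' \<le> c" by simp
          have "\<alpha> * (c - c') \<ge> 0" using \<alpha> le by simp
          with rho_bilip[OF c'(1) c le] le show ?thesis by (simp add: \<alpha>_def \<beta>_def)
        qed
        have "\<bar>rho c' - rho c\<bar> \<le> of_nat q * \<bar>rho c' - rho c\<bar>"
          using q mult_right_mono[of 1 "of_nat q" "\<bar>rho c' - rho c\<bar>"] by simp
        moreover have "of_nat q * \<bar>rho c' - rho c\<bar> \<le> of_nat q * (\<beta> * \<bar>?\<epsilon>\<bar>)"
          using r by (intro mult_left_mono) auto
        ultimately show ?thesis using r d by (simp add: mult.assoc)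
      qed
      have \<delta>0: "\<bar>\<delta>\<bar> > 0"
      proof -
        have "\<alpha> * \<bar>?\<epsilon>\<bar> > 0" using \<alpha> c' by simp
        then show ?thesis using \<delta>\<epsilon> by linarith
      qed
      have hm: "mono (\<lambda>t. H (t, c))" by (rule strict_mono_mono[OF H_strict_mono])
      have "\<bar>H (y, c) - H (y, c')\<bar> \<le> 2 * (1 / \<bar>\<delta>\<bar> + 1) * (\<bar>?\<epsilon>\<bar> * e) + \<bar>\<delta>\<bar>"
      proof (cases "\<delta> > 0")
        case True
        have abs: "\<bar>\<delta>\<bar> = \<delta>" using True by simp
        show ?thesis unfolding abs
          by (rule almost_rotation_comparison(2)[where h = "\<lambda>t. H (t, c)" and k = "\<lambda>t. H (t, c')" and \<Gamma> = ?\<Gamma> and \<tau> = "?\<epsilon> * \<mu>"])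
             (rule hm H_0 H_shift H_strict_mono k\<Gamma> h\<Gamma> True y)+
      next
        case False
        \<comment> \<open>The comparison needs a positive translation, so \<open>\<Gamma>\<close> is replaced by its inverse \<open>s\<close>.\<close>
        have "\<exists>s. \<forall>t. ?\<Gamma> (s t) = t"
        proof (rule choice, rule allI)
          fix t show "\<exists>s. ?\<Gamma> s = t" using Gc_iter_surj[OF c'(1), of q "t + of_int m"] by (auto simp: diff_eq_eq)
        qed
        then obtain s where s: "\<And>t. ?\<Gamma> (s t) = t" by blast
        have ks: "H (s t, c') = H (t, c') + - \<delta>" for t using k\<Gamma>[of "s t"] unfolding s by simp
        have hs: "\<bar>H (s t, c) - H (t, c) - (- (?\<epsilon> * \<mu>))\<bar> \<le> \<bar>?\<epsilon>\<bar> * e" for t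
          using h\<Gamma>[of "s t"] unfolding s by linarith
        have pos: "- \<delta> > 0" using False \<delta>0 by simp
        have abs: "\<bar>\<delta>\<bar> = - \<delta>" using pos by simp
        show ?thesis unfolding abs
          by (rule almost_rotation_comparison(2)[where h = "\<lambda>t. H (t, c)" and k = "\<lambda>t. H (t, c')" and \<Gamma> = s and \<tau> = "- (?\<epsilon> * \<mu>)"])
             (rule hm H_0 H_shift H_strict_mono ks hs pos y)+
      qed
      also have "\<dots> = 2 * (\<bar>?\<epsilon>\<bar> / \<bar>\<delta>\<bar>) * e + 2 * \<bar>?\<epsilon>\<bar> * e + \<bar>\<delta>\<bar>" by (simp add: algebra_simps)
      also have "\<dots> \<le> 2 * (1 / \<alpha>) * e + 2 * \<bar>?\<epsilon>\<bar> * e + of_nat q * \<beta> * \<bar>?\<epsilon>\<bar>"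
      proof -
        have "\<bar>?\<epsilon>\<bar> / \<bar>\<delta>\<bar> \<le> 1 / \<alpha>" using \<delta>\<epsilon> \<delta>0 \<alpha> by (simp only: pos_divide_le_eq pos_le_divide_eq) (simp add: mult.commute pos_le_divide_eq)
        then have "2 * (\<bar>?\<epsilon>\<bar> / \<bar>\<delta>\<bar>) * e \<le> 2 * (1 / \<alpha>) * e" using e by (intro mult_right_mono mult_left_mono) auto
        then show ?thesis using \<delta>\<epsilon> by linarith
      qed
      also have "\<dots> = E / 4 + \<bar>?\<epsilon>\<bar> * (2 * e + of_nat q * \<beta>)" using \<alpha> by (simp add: e_def algebra_simps)
      also have "\<dots> < E"
      proof -
        have "\<bar>?\<epsilon>\<bar> < E / (2 * (2 * e + of_nat q * \<beta>))" using elim(2) by (simp only: dist_real_def \<epsilon>0_def)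
        then have "\<bar>?\<epsilon>\<bar> * (2 * (2 * e + of_nat q * \<beta>)) < E" using qb by (simp only: pos_less_divide_eq mult_pos_pos zero_less_numeral)
        then have "2 * (\<bar>?\<epsilon>\<bar> * (2 * e + of_nat q * \<beta>)) < E" by (simp only: mult.left_commute)
        then show ?thesis using E by linarith
      qed
      finally show ?case by (simp add: dist_real_def abs_minus_commute)
    qed
  qed
qed

text \<open>The conjugacy of a nearby leaf is an almost conjugacy for the leaf \<open>c\<close>, with an error of order \<open>c' - c\<close>.\<close>

lemma H_tendsto_aperiodic:
  assumes c: "\<bar>c\<bar> < N" and ap: "\<And>n t m. n > 0 \<Longrightarrow> (Gc c ^^ n) t \<noteq> t + of_int m"
  shows "((\<lambda>c'. H (y, c')) \<longlongrightarrow> H (y, c)) (at c)"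
proof -
  obtain K' where "bilipschitz_circle_map (\<lambda>t. G (t, c)) (\<lambda>t. A (t, c)) K'" by (rule circle_map)
  then interpret cm: bilipschitz_circle_map "\<lambda>t. G (t, c)" "\<lambda>t. A (t, c)" K' .
  interpret ap: aperiodic_circle_map "\<lambda>t. G (t, c)" "\<lambda>t. A (t, c)" K'
    by unfold_locales (rule ap)
  obtain h' where "\<And>t. ((\<lambda>t. H (t, c)) has_real_derivative h' t) (at t)"
    by (rule H_C1[of c]) (rule that; assumption)
  then have ch: "continuous_on UNIV (\<lambda>t. H (t, c))" by (meson DERIV_isCont continuous_at_imp_continuous_on)
  have ev: "\<forall>\<^sub>F c' in at c. \<bar>c'\<bar> < N"
    unfolding eventually_at by (rule exI[of _ "N - \<bar>c\<bar>"]) (use c in \<open>auto simp: dist_real_def\<close>)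
  show ?thesis
  proof (rule ap.approximate_conjugacies_converge[OF ch H_0 H_shift H_conjugacy])
    show "\<forall>\<^sub>F c' in at c. \<forall>t t'. \<bar>H (t', c') - H (t, c')\<bar> \<le> K * \<bar>t' - t\<bar>"
      using ev by (rule eventually_mono) (use H_lip in blast)
    show "\<forall>\<^sub>F c' in at c. H (0, c') = 0" by (simp add: H_0)
    show "\<forall>\<^sub>F c' in at c. \<forall>t. H (t + 1, c') = H (t, c') + 1" by (simp add: H_shift)
    show "\<forall>\<^sub>F c' in at c. \<forall>t. \<bar>H (G (t, c), c') - H (t, c') - rho c'\<bar> \<le> K * (L * \<bar>c' - c\<bar>)"
      using ev
    proof (rule eventually_mono, intro allI)
      fix c' t assume c': "\<bar>c'\<bar> < N"
      have "\<bar>H (G (t, c), c') - H (t, c') - rho c'\<bar> = \<bar>H (G (t, c'), c') - H (G (t, c), c')\<bar>"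
        by (simp add: H_conjugacy)
      also have "\<dots> \<le> K * \<bar>G (t, c') - G (t, c)\<bar>" by (rule H_lip[OF c'])
      also have "\<dots> \<le> K * (L * \<bar>c' - c\<bar>)" using K c c' by (intro mult_left_mono G_abs) auto
      finally show "\<bar>H (G (t, c), c') - H (t, c') - rho c'\<bar> \<le> K * (L * \<bar>c' - c\<bar>)" .
    qed
    have "((\<lambda>c'. K * (L * \<bar>c' - c\<bar>)) \<longlongrightarrow> K * (L * \<bar>c - c\<bar>)) (at c)" by (intro tendsto_intros)
    then show "((\<lambda>c'. K * (L * \<bar>c' - c\<bar>)) \<longlongrightarrow> 0) (at c)" by simp
  qed
qed

end

context twist_foliation begin

lemma H_tendsto: "((\<lambda>c'. H (t, c')) \<longlongrightarrow> H (t, c)) (at c)"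
proof -
  obtain K L \<kappa> where "local_twist_foliation F F' eta W (\<bar>c\<bar> + 1) K L \<kappa>" by (rule local_foliation)
  then interpret lf: local_twist_foliation F F' eta W "\<bar>c\<bar> + 1" K L \<kappa> .
  obtain K' where "bilipschitz_circle_map (\<lambda>t. G (t, c)) (\<lambda>t. A (t, c)) K'" by (rule circle_map)
  then interpret cm: bilipschitz_circle_map "\<lambda>t. G (t, c)" "\<lambda>t. A (t, c)" K' .
  show ?thesis
  proof (cases "\<exists>n>0. \<exists>t m. ((\<lambda>t. G (t, c)) ^^ n) t = t + of_int m")
    case True
    then obtain q t0 m where q: "q > 0" "((\<lambda>t. G (t, c)) ^^ q) t0 = t0 + of_int m" by blast
    have "((\<lambda>c'. H (frac t, c') + of_int \<lfloor>t\<rfloor>) \<longlongrightarrow> H (frac t, c) + of_int \<lfloor>t\<rfloor>) (at c)"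
      by (intro tendsto_add tendsto_const lf.H_tendsto_periodic[OF _ q(1) cm.periodic_point_all_periodic[OF q(2)]])
         (auto simp: less_imp_le[OF frac_lt_1])
    then show ?thesis unfolding H_shift_int[symmetric] by (simp add: frac_def)
  next
    case False
    show ?thesis by (rule lf.H_tendsto_aperiodic) (simp, use False in blast)
  qed
qed

theorem H_continuous: "continuous_on UNIV H"
proof -
  have "isCont H (t, c)" for t c
  proof -
    obtain K L \<kappa> where "local_twist_foliation F F' eta W (\<bar>c\<bar> + 1) K L \<kappa>" by (rule local_foliation)
    then interpret lf: local_twist_foliation F F' eta W "\<bar>c\<bar> + 1" K L \<kappa> .
    have cc: "isCont (\<lambda>c'. H (t, c')) c" using H_tendsto by (simp add: isCont_def)
    show ?thesis unfolding isCont_def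
    proof (rule Lim_null_comparison[where g = "\<lambda>z. K * \<bar>fst z - t\<bar> + \<bar>H (t, snd z) - H (t, c)\<bar>", THEN Lim_null[THEN iffD2]])
      have "\<forall>\<^sub>F z in at (t, c). dist z (t, c) < 1" unfolding eventually_at by (rule exI[of _ 1]) auto
      then show "\<forall>\<^sub>F z in at (t, c). norm (H z - H (t, c)) \<le> K * \<bar>fst z - t\<bar> + \<bar>H (t, snd z) - H (t, c)\<bar>"
      proof eventually_elim
        case (elim z)
        have "dist (snd z) c < 1" using elim dist_snd_le[of z "(t, c)"] by simp
        then have "\<bar>snd z\<bar> < \<bar>c\<bar> + 1" by (simp add: dist_real_def)
        from lf.H_lip[OF this, of "fst z" t] show ?case by simp
      qed
      have s: "(snd \<longlongrightarrow> c) (at (t, c))" "(fst \<longlongrightarrow> t) (at (t, c))"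
        using tendsto_snd[OF tendsto_ident_at[of "(t, c)" UNIV]] tendsto_fst[OF tendsto_ident_at[of "(t, c)" UNIV]] by simp_all
      have "((\<lambda>z. K * \<bar>fst z - t\<bar> + \<bar>H (t, snd z) - H (t, c)\<bar>) \<longlongrightarrow> K * \<bar>t - t\<bar> + \<bar>H (t, c) - H (t, c)\<bar>) (at (t, c))"
        by (intro tendsto_intros s isCont_tendsto_compose[OF cc])
      then show "((\<lambda>z. K * \<bar>fst z - t\<bar> + \<bar>H (t, snd z) - H (t, c)\<bar>) \<longlongrightarrow> 0) (at (t, c))" by simp
    qed
  qed
  then show ?thesis by (simp add: continuous_at_imp_continuous_on)
qed

end

section \<open>Lifting between the annulus and the plane\<close>

lemma circle_of_rep: "circle_of (rep_circle x) = x"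
  by (rule Quotient3_abs_rep[OF Quotient3_circle])

lemma annulus_of_rep: "annulus_of (rep_circle (fst q), snd q) = q"
  by (simp add: annulus_of_def circle_of_rep)

lemma annulus_of_eq_iff: "annulus_of z = annulus_of w \<longleftrightarrow> fst z - fst w \<in> \<int> \<and> snd z = snd w"
  by (simp add: annulus_of_def circle_of_eq_iff)

lemma circle_of_shift: "circle_of (t + of_int m) = circle_of t"
  by (simp add: circle_of_eq_iff)

text \<open>The covering is a local isometry: distances to a given point are attained by representatives.\<close>

lemma near_representative:
  obtains y where "circle_of y = \<theta>" "\<bar>y - x\<bar> = dist \<theta> (circle_of x)"
proof -
  define t where "t = rep_circle \<theta>"
  have t: "\<theta> = circle_of t" by (simp add: t_def circle_of_rep)
  show thesis
  proof (rule that[of "t + of_int (- round (t - x))"])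
    show "circle_of (t + of_int (- round (t - x))) = \<theta>" unfolding circle_of_shift by (simp add: t)
    show "\<bar>t + of_int (- round (t - x)) - x\<bar> = dist \<theta> (circle_of x)"
      by (simp add: t dist_circle.abs_eq algebra_simps)
  qed
qed

lemma near_annulus_representative:
  fixes z :: "real \<times> real"
  obtains y where "annulus_of y = q" "dist y z = dist q (annulus_of z)"
proof -
  obtain t where t: "circle_of t = fst q" "\<bar>t - fst z\<bar> = dist (fst q) (circle_of (fst z))"
    by (rule near_representative)
  have "annulus_of (t, snd q) = q" by (simp add: annulus_of_def t)
  moreover have "dist (t, snd q) z = dist q (annulus_of z)"
    using t by (cases z, cases q) (simp add: annulus_of_def dist_Pair_Pair dist_real_def)
  ultimately show thesis by (rule that)
qed

lemma dist_annulus_of_le: "dist (annulus_of z) (annulus_of w) \<le> dist z w"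
  unfolding annulus_of_def dist_Pair_Pair dist_prod_def
  by (intro real_sqrt_le_mono add_mono power_mono) (auto simp: dist_circle_of_le)

lemma continuous_on_circle_of: "continuous_on UNIV circle_of"
  by (rule lipschitz_on_continuous_on[of 1], rule lipschitz_onI) (simp_all add: dist_circle_of_le)

lemma continuous_on_annulus_of: "continuous_on UNIV annulus_of"
  by (rule lipschitz_on_continuous_on[of 1], rule lipschitz_onI) (simp_all add: dist_annulus_of_le)

lemma circle_cases:
  obtains t where "\<theta> = circle_of t"
  by (rule that[OF circle_of_rep[symmetric]])

lemma circle_of_add: "circle_of s + circle_of t = circle_of (s + t)"
  by (simp add: plus_circle.abs_eq)

lemma compact_circle: "compact (UNIV :: circle set)"
proof -
  have "\<theta> \<in> circle_of ` {0..1}" for \<theta>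
  proof -
    obtain t where t: "\<theta> = circle_of t" by (rule circle_cases)
    have "circle_of (frac t) = \<theta>" using circle_of_shift[of "frac t" "\<lfloor>t\<rfloor>"] by (simp add: t frac_def)
    moreover have "frac t \<in> {0..1}" by (simp add: less_imp_le[OF frac_lt_1])
    ultimately show ?thesis by (metis image_eqI)
  qed
  then have "(UNIV :: circle set) = circle_of ` {0..1}" by auto
  moreover have "compact (circle_of ` {0..1})"
    by (intro compact_continuous_image continuous_on_subset[OF continuous_on_circle_of]) auto
  ultimately show ?thesis by simp
qed

lemma continuous_on_annulus:
  fixes f :: "annulus \<Rightarrow> 'a::metric_space"
  assumes "continuous_on UNIV (\<lambda>z. f (annulus_of z))"
  shows "continuous_on UNIV f"
  unfolding continuous_on_iff
proof (intro ballI allI impI)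
  fix p :: annulus and e :: real assume e: "e > 0"
  define z where "z = (rep_circle (fst p), snd p)"
  have z: "annulus_of z = p" by (simp add: z_def annulus_of_rep)
  obtain \<delta> where \<delta>: "\<delta> > 0" "\<And>y. dist y z < \<delta> \<Longrightarrow> dist (f (annulus_of y)) (f (annulus_of z)) < e"
    using assms e unfolding continuous_on_iff by blast
  have "dist (f q) (f p) < e" if "dist q p < \<delta>" for q
  proof -
    obtain y where "annulus_of y = q" "dist y z = dist q (annulus_of z)" by (rule near_annulus_representative)
    then show ?thesis using \<delta>(2)[of y] that by (simp add: z)
  qed
  then show "\<exists>\<delta>>0. \<forall>q\<in>UNIV. dist q p < \<delta> \<longrightarrow> dist (f q) (f p) < e" using \<delta>(1) by blast
qed

definition descend :: "(real \<times> real \<Rightarrow> real \<times> real) \<Rightarrow> annulus \<Rightarrow> annulus" where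
  "descend J q = annulus_of (J (rep_circle (fst q), snd q))"

definition equivariant :: "(real \<times> real \<Rightarrow> real \<times> real) \<Rightarrow> bool" where
  "equivariant J \<longleftrightarrow> (\<forall>t r. J (t + 1, r) = J (t, r) + (1, 0))"

lemma equivariant_shift_int:
  assumes "equivariant J" shows "J (t + of_int m, r) = J (t, r) + (of_int m, 0)"
proof -
  have "fst (J (t + of_int m, r)) = fst (J (t, r)) + of_int m * 1"
    by (rule shift_of_int) (use assms in \<open>simp add: equivariant_def\<close>)
  moreover have "snd (J (t + of_int m, r)) = snd (J (t, r)) + of_int m * 0"
    by (rule shift_of_int) (use assms in \<open>simp add: equivariant_def\<close>)
  ultimately show ?thesis by (simp add: prod_eq_iff)
qed

lemma descend_annulus_of:
  assumes "equivariant J" shows "descend J (annulus_of z) = annulus_of (J z)"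
proof -
  have "circle_of (rep_circle (circle_of (fst z))) = circle_of (fst z)" by (rule circle_of_rep)
  then obtain m where "rep_circle (circle_of (fst z)) = fst z + of_int m"
    unfolding circle_of_eq_iff by (metis Ints_cases add.commute diff_eq_eq)
  then show ?thesis
    using equivariant_shift_int[OF assms, of "fst z" m "snd z"]
    by (simp add: descend_def annulus_of_def circle_of_shift)
qed

lemma annulus_cases:
  obtains z where "q = annulus_of z"
  by (rule that[OF annulus_of_rep[symmetric]])

lemma descend_inverse:
  assumes "equivariant J" "equivariant J'" "\<And>z. J' (J z) = z"
  shows "descend J' (descend J q) = q"
  by (rule annulus_cases[of q]) (simp add: descend_annulus_of assms)

lemma continuous_on_descend:
  assumes "equivariant J" "continuous_on UNIV J" shows "continuous_on UNIV (descend J)"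
  by (rule continuous_on_annulus)
     (simp add: descend_annulus_of[OF assms(1)] continuous_on_UNIV_comp[OF continuous_on_annulus_of assms(2)])

lemma is_lift_descend:
  assumes "equivariant J" "continuous_on UNIV J" shows "is_lift annulus_of J (descend J)"
  using assms by (simp add: is_lift_def descend_annulus_of)

lemma homeo_descend:
  assumes "equivariant J" "equivariant J'" "continuous_on UNIV J" "continuous_on UNIV J'"
    "\<And>z. J' (J z) = z" "\<And>z. J (J' z) = z"
  shows "homeo (descend J)"
  unfolding homeo_def
proof (rule exI[of _ "descend J'"])
  show "homeomorphism UNIV UNIV (descend J) (descend J')"
  proof (rule homeomorphismI)
    show "continuous_on UNIV (descend J)" "continuous_on UNIV (descend J')"
      by (intro continuous_on_descend assms)+
  qed (use descend_inverse assms in auto)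
qed

lemma inv_descend:
  assumes "equivariant J" "equivariant J'" "\<And>z. J' (J z) = z" "\<And>z. J (J' z) = z"
  shows "inv (descend J) = descend J'" "bij (descend J)"
proof -
  have 1: "descend J' (descend J q) = q" "descend J (descend J' q) = q" for q
    using descend_inverse assms by blast+
  then show "inv (descend J) = descend J'" by (intro inv_equality)
  show "bij (descend J)" by (rule o_bij[of "descend J'"]) (use 1 in \<open>simp_all add: fun_eq_iff\<close>)
qed

lemma swap_derivative: "((\<lambda>z :: real \<times> real. (snd z, fst z)) has_derivative (\<lambda>v. (snd v, fst v))) (at z)"
  by (auto intro!: derivative_eq_intros)

section \<open>Exact symplectic maps from generating functions\<close>

text \<open>The generating function of a map of the annulus, written as a function \<open>W\<close> with the partial derivatives \<open>eta\<close>
  and \<open>H\<close>. Monotonicity of \<open>eta\<close> in \<open>c\<close> and of \<open>H\<close> in \<open>t\<close> takes the place of the usual sign condition on the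
  mixed second derivative of \<open>W\<close>, so that \<open>C\<^sup>1\<close> functions qualify.\<close>

locale generating_function =
  fixes W eta H :: "real \<times> real \<Rightarrow> real"
  assumes W_t: "((\<lambda>t. W (t, c)) has_real_derivative eta (t, c)) (at t)"
    and W_c: "((\<lambda>c. W (t, c)) has_real_derivative H (t, c)) (at c)"
    and eta_cont: "continuous_on UNIV eta" and H_cont: "continuous_on UNIV H"
    and eta_mono: "c < c' \<Longrightarrow> eta (t, c) < eta (t, c')" and eta_surj: "surj (\<lambda>c. eta (t, c))"
    and H_mono: "t < t' \<Longrightarrow> H (t, c) < H (t', c)"
    and W_shift: "W (t + 1, c) = W (t, c) + c"
begin

lemma eta_shift: "eta (t + 1, c) = eta (t, c)"
proof -
  have "((\<lambda>t. W (t + 1, c)) has_real_derivative eta (t + 1, c)) (at t)"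
    using W_t[of c "t + 1"] DERIV_shift[of "\<lambda>t. W (t, c)" "eta (t + 1, c)" t 1] by simp
  moreover have "((\<lambda>t. W (t, c) + c) has_real_derivative eta (t, c)) (at t)"
    by (auto intro!: derivative_eq_intros W_t)
  ultimately show ?thesis by (simp add: W_shift DERIV_unique)
qed

lemma H_shift: "H (t + 1, c) = H (t, c) + 1"
proof -
  have "((\<lambda>c. W (t + 1, c)) has_real_derivative H (t, c) + 1) (at c)"
    unfolding W_shift by (auto intro!: derivative_eq_intros W_c)
  then show ?thesis using W_c DERIV_unique by blast
qed

lemma H_slice_cont: "continuous_on UNIV (\<lambda>t. H (t, c))"
  by (rule continuous_on_UNIV_comp[OF H_cont]) (intro continuous_intros)

lemma H_surj: "surj (\<lambda>t. H (t, c))"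
proof -
  have "\<exists>t. H (t, c) = y" for y
  proof -
    have sh: "H (0 + of_int m, c) = H (0, c) + of_int m" for m
      using shift_of_int[of "\<lambda>t. H (t, c)" 1 0 m] H_shift by simp
    have "H (of_int \<lfloor>y - H (0, c)\<rfloor>, c) \<le> y" "y \<le> H (of_int \<lceil>y - H (0, c)\<rceil>, c)"
      using sh[of "\<lfloor>y - H (0, c)\<rfloor>"] sh[of "\<lceil>y - H (0, c)\<rceil>"] by simp_all linarith+
    moreover have "(of_int \<lfloor>y - H (0, c)\<rfloor> :: real) \<le> of_int \<lceil>y - H (0, c)\<rceil>"
      by (simp add: floor_le_ceiling)
    ultimately show ?thesis
      using IVT'[of "\<lambda>t. H (t, c)" "of_int \<lfloor>y - H (0, c)\<rfloor>" y "of_int \<lceil>y - H (0, c)\<rceil>"]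
        continuous_on_subset[OF H_slice_cont] by blast
  qed
  then show ?thesis unfolding surj_def by metis
qed

definition H_inv :: "real \<times> real \<Rightarrow> real" where "H_inv z = (THE t. H (t, snd z) = fst z)"
definition eta_inv :: "real \<times> real \<Rightarrow> real" where "eta_inv z = (THE c. eta (fst z, c) = snd z)"

lemma H_inj: "H (t, c) = H (t', c) \<longleftrightarrow> t = t'"
  using H_mono[of t t' c] H_mono[of t' t c] by (cases t t' rule: linorder_cases) auto

lemma eta_inj: "eta (t, c) = eta (t, c') \<longleftrightarrow> c = c'"
  using eta_mono[of c c' t] eta_mono[of c' c t] by (cases c c' rule: linorder_cases) auto

lemma H_inv_H: "H_inv (H (t, c), c) = t"
  unfolding H_inv_def by (rule the_equality) (auto simp: H_inj)

lemma H_H_inv: "H (H_inv (x, c), c) = x"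
  using surjD[OF H_surj[of c], of x] by (auto simp: H_inv_H)

lemma eta_inv_eta: "eta_inv (t, eta (t, c)) = c"
  unfolding eta_inv_def by (rule the_equality) (auto simp: eta_inj)

lemma eta_eta_inv: "eta (t, eta_inv (t, r)) = r"
  using surjD[OF eta_surj[of t], of r] by (auto simp: eta_inv_eta)

lemma H_inv_eqI: "H (t, c) = x \<Longrightarrow> H_inv (x, c) = t" using H_inv_H by auto

lemma eta_inv_eqI: "eta (t, c) = r \<Longrightarrow> eta_inv (t, r) = c" using eta_inv_eta by auto

lemma H_inv_cont: "continuous_on UNIV H_inv"
proof -
  have cs: "continuous_on UNIV (\<lambda>z. H (snd z, fst z))"
    by (rule continuous_on_UNIV_comp[OF H_cont]) (intro continuous_intros)
  have sw: "continuous_on UNIV (\<lambda>z :: real \<times> real. (snd z, fst z))" by (intro continuous_intros)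
  obtain Y where Y: "\<And>c x. H (Y (c, x), c) = x" and cY: "continuous_on UNIV Y"
    by (rule fibered_inverse_continuous[OF cs]) (simp_all add: H_mono H_surj, blast)
  have "H_inv z = Y (snd z, fst z)" for z
    using H_inv_eqI[OF Y[of "snd z" "fst z"]] by simp
  then have "H_inv = (\<lambda>z. Y (snd z, fst z))" by (simp add: fun_eq_iff)
  then show ?thesis using continuous_on_UNIV_comp[OF cY sw] by (simp only:)
qed

lemma eta_inv_cont: "continuous_on UNIV eta_inv"
proof -
  obtain Y where Y: "\<And>t r. eta (t, Y (t, r)) = r" and cY: "continuous_on UNIV Y"
    by (rule fibered_inverse_continuous[OF eta_cont]) (simp_all add: eta_mono eta_surj, blast)
  have "eta_inv z = Y z" for z
    using eta_inv_eqI[OF Y[of "fst z" "snd z"]] by simp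
  then have "eta_inv = Y" by (simp add: fun_eq_iff)
  then show ?thesis using cY by (simp only:)
qed

lemma H_inv_shift: "H_inv (x + 1, c) = H_inv (x, c) + 1"
  using H_inv_H[of "H_inv (x, c) + 1" c] by (simp add: H_shift H_H_inv)

lemma eta_inv_shift: "eta_inv (t + 1, r) = eta_inv (t, r)"
  using eta_inv_eta[of "t + 1" "eta_inv (t, r)"] by (simp add: eta_shift eta_eta_inv)

text \<open>The lift of the generated map: \<open>(H (t, c), c)\<close> is sent to \<open>(t, eta (t, c))\<close>.\<close>

definition plane_map :: "real \<times> real \<Rightarrow> real \<times> real" where
  "plane_map z = (H_inv z, eta (H_inv z, snd z))"

definition plane_map_inv :: "real \<times> real \<Rightarrow> real \<times> real" where
  "plane_map_inv z = (H (fst z, eta_inv z), eta_inv z)"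

lemma plane_map_inverse: "plane_map_inv (plane_map z) = z" "plane_map (plane_map_inv z) = z"
  using H_H_inv[of "fst z" "snd z"] eta_eta_inv[of "fst z" "snd z"]
  by (simp_all add: plane_map_def plane_map_inv_def eta_inv_eta H_inv_H)

lemma equivariant_plane_map: "equivariant plane_map" "equivariant plane_map_inv"
  by (simp_all add: equivariant_def plane_map_def plane_map_inv_def H_inv_shift eta_inv_shift eta_shift H_shift)

lemma plane_map_cont: "continuous_on UNIV plane_map" "continuous_on UNIV plane_map_inv"
  unfolding plane_map_def[abs_def] plane_map_inv_def[abs_def]
  by (intro continuous_intros H_inv_cont eta_inv_cont continuous_on_UNIV_comp[OF eta_cont] continuous_on_UNIV_comp[OF H_cont])+

definition annulus_map :: "annulus \<Rightarrow> annulus" where "annulus_map = descend plane_map"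

lemma annulus_map_of: "annulus_map (annulus_of z) = annulus_of (plane_map z)"
  unfolding annulus_map_def by (rule descend_annulus_of[OF equivariant_plane_map(1)])

lemma inv_annulus_map: "inv annulus_map = descend plane_map_inv" "bij annulus_map"
  unfolding annulus_map_def by (intro inv_descend[where J' = plane_map_inv] equivariant_plane_map plane_map_inverse)+

lemma homeo_annulus_map: "homeo annulus_map"
  unfolding annulus_map_def by (intro homeo_descend[where J' = plane_map_inv] equivariant_plane_map plane_map_cont plane_map_inverse)

lemma W_derivative: "(W has_derivative (\<lambda>v. eta z * fst v + H z * snd v)) (at z)"
  by (rule has_derivative_plane[OF W_t W_c H_cont])

end

text \<open>For a \<open>C\<^sup>2\<close> generating function the positive mixed derivative \<open>m\<close> gives differentiable inverses, and the
  generated map is a diffeomorphism.\<close>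

locale smooth_generating_function = generating_function +
  fixes eta_t m H_c :: "real \<times> real \<Rightarrow> real"
  assumes d_eta: "(eta has_derivative (\<lambda>v. eta_t z * fst v + m z * snd v)) (at z)"
    and d_H: "(H has_derivative (\<lambda>v. m z * fst v + H_c z * snd v)) (at z)"
    and m_pos: "m z > 0"
    and second_cont: "continuous_on UNIV eta_t" "continuous_on UNIV m" "continuous_on UNIV H_c"
begin

definition foot :: "real \<times> real \<Rightarrow> real \<times> real" where "foot z = (H_inv z, snd z)"
definition level :: "real \<times> real \<Rightarrow> real \<times> real" where "level z = (fst z, eta_inv z)"

lemma d_H_inv: "(H_inv has_derivative (\<lambda>v. 1 / m (foot z) * fst v + - H_c (foot z) / m (foot z) * snd v)) (at z)"
proof -
  have dX: "((\<lambda>z. H (snd z, fst z)) has_derivative (\<lambda>v. H_c (snd z, fst z) * fst v + m (snd z, fst z) * snd v)) (at z)" for z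
  proof -
    from has_derivative_compose[OF swap_derivative d_H] show ?thesis by (simp add: add.commute)
  qed
  obtain Y where Y: "\<And>c x. H (Y (c, x), c) = x"
    and dY: "\<And>c x. (Y has_derivative (\<lambda>v. - H_c (Y (c, x), c) / m (Y (c, x), c) * fst v + 1 / m (Y (c, x), c) * snd v)) (at (c, x))"
    by (rule fibered_inverse[OF dX m_pos, unfolded fst_conv snd_conv]) (rule H_surj, (rule that; assumption))
  have eq: "H_inv z = Y (snd z, fst z)" for z
    using H_inv_eqI[OF Y[of "snd z" "fst z"]] by simp
  from has_derivative_compose[OF swap_derivative dY]
  have "((\<lambda>z. Y (snd z, fst z)) has_derivative (\<lambda>v. 1 / m (foot z) * fst v + - H_c (foot z) / m (foot z) * snd v)) (at z)"
    by (simp add: eq add.commute foot_def)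
  moreover have "H_inv = (\<lambda>z. Y (snd z, fst z))" using eq by (simp add: fun_eq_iff)
  ultimately show ?thesis by simp
qed

lemma d_eta_inv: "(eta_inv has_derivative (\<lambda>v. - eta_t (level z) / m (level z) * fst v + 1 / m (level z) * snd v)) (at z)"
proof -
  obtain Y where Y: "\<And>t r. eta (t, Y (t, r)) = r"
    and dY: "\<And>t r. (Y has_derivative (\<lambda>v. - eta_t (t, Y (t, r)) / m (t, Y (t, r)) * fst v + 1 / m (t, Y (t, r)) * snd v)) (at (t, r))"
    by (rule fibered_inverse[OF d_eta m_pos eta_surj]) (rule that; assumption)
  have "eta_inv z = Y z" for z
    using eta_inv_eqI[OF Y[of "fst z" "snd z"]] by simp
  then have "eta_inv = Y" by (simp add: fun_eq_iff)
  then show ?thesis using dY[of "fst z" "snd z"] by (simp add: level_def)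
qed

lemma foot_cont: "continuous_on UNIV foot" and level_cont: "continuous_on UNIV level"
  unfolding foot_def[abs_def] level_def[abs_def] by (intro continuous_intros H_inv_cont eta_inv_cont)+

lemma m_nonzero: "m z \<noteq> 0" using m_pos[of z] by simp

lemma d_plane_map:
  "(plane_map has_derivative (\<lambda>v. (1 / m (foot z) * fst v + - H_c (foot z) / m (foot z) * snd v,
     eta_t (foot z) / m (foot z) * fst v + (m (foot z) - eta_t (foot z) * H_c (foot z) / m (foot z)) * snd v))) (at z)"
  and C1_plane_map: "C1_map plane_map"
proof -
  have d2: "((\<lambda>z. eta (foot z)) has_derivative (\<lambda>v. eta_t (foot z) / m (foot z) * fst v
      + (m (foot z) - eta_t (foot z) * H_c (foot z) / m (foot z)) * snd v)) (at z)" for z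
  proof -
    have "(foot has_derivative (\<lambda>v. (1 / m (foot z) * fst v + - H_c (foot z) / m (foot z) * snd v, snd v))) (at z)"
      unfolding foot_def[abs_def] by (intro has_derivative_Pair d_H_inv[unfolded foot_def] has_derivative_snd has_derivative_ident)
    from has_derivative_compose[OF this d_eta]
    show ?thesis by (rule has_derivative_eq_rhs) (auto simp: fun_eq_iff field_simps m_nonzero)
  qed
  show "(plane_map has_derivative (\<lambda>v. (1 / m (foot z) * fst v + - H_c (foot z) / m (foot z) * snd v,
     eta_t (foot z) / m (foot z) * fst v + (m (foot z) - eta_t (foot z) * H_c (foot z) / m (foot z)) * snd v))) (at z)"
    unfolding plane_map_def[abs_def] foot_def[symmetric] by (intro has_derivative_Pair d_H_inv d2)
  show "C1_map plane_map" unfolding plane_map_def[abs_def] foot_def[symmetric]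
    by (rule C1_map_plane[OF d_H_inv d2])
       (intro continuous_intros second_cont[THEN continuous_on_UNIV_comp, OF foot_cont] ballI m_nonzero)+
qed

lemma C1_plane_map_inv: "C1_map plane_map_inv"
proof -
  have d1: "((\<lambda>z. H (level z)) has_derivative (\<lambda>v. (m (level z) - H_c (level z) * eta_t (level z) / m (level z)) * fst v
      + H_c (level z) / m (level z) * snd v)) (at z)" for z
  proof -
    have "(level has_derivative (\<lambda>v. (fst v, - eta_t (level z) / m (level z) * fst v + 1 / m (level z) * snd v))) (at z)"
      unfolding level_def[abs_def] by (intro has_derivative_Pair d_eta_inv[unfolded level_def] has_derivative_fst has_derivative_ident)
    from has_derivative_compose[OF this d_H]
    show ?thesis by (rule has_derivative_eq_rhs) (auto simp: fun_eq_iff field_simps m_nonzero)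
  qed
  show "C1_map plane_map_inv" unfolding plane_map_inv_def[abs_def] level_def[symmetric]
    by (rule C1_map_plane[OF d1 d_eta_inv])
       (intro continuous_intros second_cont[THEN continuous_on_UNIV_comp, OF level_cont] ballI m_nonzero)+
qed

text \<open>With \<open>x = H (t, c)\<close> and \<open>r = eta (t, c)\<close> one has \<open>dW = r dt + x dc\<close>, so \<open>r dt - c dx = d(W - c x)\<close>; this primitive
  is periodic because \<open>W (t + 1, c) - W (t, c) = c\<close>.\<close>

theorem exact_symplectic_annulus_map: "exact_symplectic_diffeo annulus_map"
  unfolding exact_symplectic_diffeo_def C1_diffeo_via_def C1_via_def
proof (intro conjI)
  show "bij annulus_map" by (rule inv_annulus_map)
  show lift: "\<exists>F. is_lift annulus_of F annulus_map \<and> C1_map F"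
    unfolding annulus_map_def using C1_plane_map is_lift_descend[OF equivariant_plane_map(1) plane_map_cont(1)] by blast
  show "\<exists>F. is_lift annulus_of F (inv annulus_map) \<and> C1_map F"
    unfolding inv_annulus_map using C1_plane_map_inv is_lift_descend[OF equivariant_plane_map(2) plane_map_cont(2)] by blast
  define S where "S z = W (foot z) - snd z * fst z" for z :: "real \<times> real"
  define S' where "S' q = S (rep_circle (fst q), snd q)" for q :: annulus
  have S_shift: "S (t + 1, c) = S (t, c)" for t c unfolding S_def foot_def fst_conv snd_conv H_inv_shift W_shift by (simp add: algebra_simps)
  have S': "S' (annulus_of z) = S z" for z
  proof -
    have "circle_of (rep_circle (circle_of (fst z))) = circle_of (fst z)" by (rule circle_of_rep)
    then obtain k where "rep_circle (circle_of (fst z)) = fst z + of_int k"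
      unfolding circle_of_eq_iff by (metis Ints_cases add.commute diff_eq_eq)
    then show ?thesis using shift_of_int[of "\<lambda>t. S (t, snd z)" 0 "fst z" k] S_shift
      by (simp add: S'_def annulus_of_def)
  qed
  have dS: "(S has_derivative (\<lambda>v. liouville (plane_map z) (frechet_derivative plane_map (at z) v) - liouville z v)) (at z)" for z
  proof -
    let ?d = "\<lambda>v. 1 / m (foot z) * fst v + - H_c (foot z) / m (foot z) * snd v"
    have "(foot has_derivative (\<lambda>v. (?d v, snd v))) (at z)"
      unfolding foot_def[abs_def] by (intro has_derivative_Pair d_H_inv[unfolded foot_def] has_derivative_snd has_derivative_ident)
    from has_derivative_compose[OF this W_derivative]
    have dW: "((\<lambda>z. W (foot z)) has_derivative (\<lambda>v. eta (foot z) * ?d v + H (foot z) * snd v)) (at z)" by simp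
    have "(S has_derivative (\<lambda>v. (eta (foot z) * ?d v + H (foot z) * snd v) - (snd z * fst v + snd v * fst z))) (at z)"
      unfolding S_def[abs_def]
      by (intro has_derivative_diff dW has_derivative_mult has_derivative_fst has_derivative_snd has_derivative_ident)
    moreover have "frechet_derivative plane_map (at z) v = (?d v,
       eta_t (foot z) / m (foot z) * fst v + (m (foot z) - eta_t (foot z) * H_c (foot z) / m (foot z)) * snd v)" for v
      using frechet_derivative_at[OF d_plane_map[of z]] by (simp add: fun_eq_iff)
    then have "liouville (plane_map z) (frechet_derivative plane_map (at z) v) - liouville z v
       = (eta (foot z) * ?d v + H (foot z) * snd v) - (snd z * fst v + snd v * fst z)" for v
      using H_H_inv[of "fst z" "snd z"] by (simp add: liouville_def plane_map_def foot_def)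
    ultimately show ?thesis by simp
  qed
  have "is_lift annulus_of plane_map annulus_map"
    unfolding annulus_map_def by (rule is_lift_descend[OF equivariant_plane_map(1) plane_map_cont(1)])
  moreover have "((\<lambda>y. S' (annulus_of y)) has_derivative
     (\<lambda>v. liouville (plane_map z) (frechet_derivative plane_map (at z) v) - liouville z v)) (at z)" for z
    using dS by (simp add: S')
  ultimately show "\<exists>F S. is_lift annulus_of F annulus_map \<and>
        (\<forall>z. ((\<lambda>y. S (annulus_of y)) has_derivative
              (\<lambda>v. liouville (F z) (frechet_derivative F (at z) v) - liouville z v)) (at z))" by blast
qed

end

section \<open>Smoothing by box averages\<close>

definition avg :: "real \<times> real \<Rightarrow> (real \<times> real \<Rightarrow> real) \<Rightarrow> real \<times> real \<Rightarrow> real" where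
  "avg v f z = integral {0..1} (\<lambda>s. f (z + s *\<^sub>R v))"

lemma avg_slice_cont:
  fixes f :: "real \<times> real \<Rightarrow> real"
  assumes "continuous_on UNIV f" shows "continuous_on {0..1} (\<lambda>s. f (z + s *\<^sub>R v))"
  by (rule continuous_on_UNIV_comp[OF assms]) (intro continuous_intros)

lemma avg_joint_cont:
  fixes f :: "real \<times> real \<Rightarrow> real"
  assumes "continuous_on UNIV f" shows "continuous_on UNIV (\<lambda>x :: (real \<times> real) \<times> real. f (fst x + snd x *\<^sub>R v))"
  by (rule continuous_on_UNIV_comp[OF assms]) (intro continuous_intros)

lemma avg_cont:
  fixes f :: "real \<times> real \<Rightarrow> real"
  assumes "continuous_on UNIV f" shows "continuous_on UNIV (avg v f)"
proof -
  have "continuous_on (UNIV \<times> cbox 0 1) (\<lambda>(z, s). f (z + s *\<^sub>R v))"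
    unfolding case_prod_unfold by (rule continuous_on_subset[OF avg_joint_cont[OF assms]]) simp
  from integral_continuous_on_param[OF this] show ?thesis
    unfolding avg_def[abs_def] by (simp only: cbox_interval)
qed

lemma avg_derivative:
  fixes f f1 f2 :: "real \<times> real \<Rightarrow> real"
  assumes d: "\<And>z. (f has_derivative (\<lambda>w. f1 z * fst w + f2 z * snd w)) (at z)"
    and cont: "continuous_on UNIV f1" "continuous_on UNIV f2"
  shows "(avg v f has_derivative (\<lambda>w. avg v f1 z * fst w + avg v f2 z * snd w)) (at z)"
  unfolding avg_def[abs_def]
proof (rule parametric_integral_derivative)
  show "((\<lambda>z. f (z + s *\<^sub>R v)) has_derivative (\<lambda>w. f1 (z + s *\<^sub>R v) * fst w + f2 (z + s *\<^sub>R v) * snd w)) (at z)" for z s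
    by (rule has_derivative_compose[OF _ d, where f = "\<lambda>z. z + s *\<^sub>R v" and f' = "\<lambda>w. w", simplified])
       (auto intro!: derivative_eq_intros)
  have "continuous_on UNIV f"
    by (rule continuous_at_imp_continuous_on) (use d has_derivative_continuous in blast)
  then show "continuous_on UNIV (\<lambda>x. f (fst x + snd x *\<^sub>R v))" by (rule avg_joint_cont)
qed (intro avg_joint_cont cont)+

lemma avg_gradient:
  fixes f f1 f2 :: "real \<times> real \<Rightarrow> real"
  assumes d: "\<And>z. (f has_derivative (\<lambda>w. f1 z * fst w + f2 z * snd w)) (at z)"
  shows "integral {0..1} (\<lambda>s. f1 (z + s *\<^sub>R v) * fst v + f2 (z + s *\<^sub>R v) * snd v) = f (z + v) - f z"
proof -
  have "((\<lambda>s. f1 (z + s *\<^sub>R v) * fst v + f2 (z + s *\<^sub>R v) * snd v) has_integral (f (z + 1 *\<^sub>R v) - f (z + 0 *\<^sub>R v))) {0..1}"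
  proof (rule fundamental_theorem_of_calculus)
    fix s :: real
    have "((\<lambda>s. f (z + s *\<^sub>R v)) has_derivative (\<lambda>h. f1 (z + s *\<^sub>R v) * fst (h *\<^sub>R v) + f2 (z + s *\<^sub>R v) * snd (h *\<^sub>R v))) (at s)"
      by (rule has_derivative_compose[OF _ d]) (auto intro!: derivative_eq_intros)
    then have "((\<lambda>s. f (z + s *\<^sub>R v)) has_real_derivative (f1 (z + s *\<^sub>R v) * fst v + f2 (z + s *\<^sub>R v) * snd v)) (at s)"
      by (rule has_derivative_imp_has_field_derivative) (simp add: algebra_simps)
    then show "((\<lambda>s. f (z + s *\<^sub>R v)) has_vector_derivative (f1 (z + s *\<^sub>R v) * fst v + f2 (z + s *\<^sub>R v) * snd v)) (at s within {0..1})"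
      using has_real_derivative_iff_has_vector_derivative has_vector_derivative_at_within by blast
  qed simp
  then show ?thesis by (simp add: integral_unique)
qed

lemma avg_partial:
  fixes f f1 f2 :: "real \<times> real \<Rightarrow> real"
  assumes d: "\<And>z. (f has_derivative (\<lambda>w. f1 z * fst w + f2 z * snd w)) (at z)" and "\<delta> \<noteq> 0"
  shows "avg (\<delta>, 0) f1 z = (f (z + (\<delta>, 0)) - f z) / \<delta>" "avg (0, \<delta>) f2 z = (f (z + (0, \<delta>)) - f z) / \<delta>"
  using avg_gradient[OF d, of z "(\<delta>, 0)"] avg_gradient[OF d, of z "(0, \<delta>)"] assms(2)
  by (simp_all add: avg_def field_simps)

lemma avg_near:
  fixes f :: "real \<times> real \<Rightarrow> real"
  assumes "continuous_on UNIV f" "\<And>s. s \<in> {0..1} \<Longrightarrow> \<bar>f (z + s *\<^sub>R v) - l\<bar> \<le> e"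
  shows "\<bar>avg v f z - l\<bar> \<le> e"
proof -
  have "norm (integral {0..1} (\<lambda>s. f (z + s *\<^sub>R v) - l)) \<le> e * (1 - 0)"
    by (rule integral_bound) (use assms in \<open>auto intro!: continuous_intros avg_slice_cont\<close>)
  moreover have "integral {0..1} (\<lambda>s. f (z + s *\<^sub>R v) - l) = avg v f z - l"
    unfolding avg_def using avg_slice_cont[OF assms(1), of z v]
    by (subst Henstock_Kurzweil_Integration.integral_diff) (auto intro!: integrable_continuous_real)
  ultimately show ?thesis by simp
qed

lemma avg_ge:
  fixes f :: "real \<times> real \<Rightarrow> real"
  assumes "continuous_on UNIV f" "\<And>s. s \<in> {0..1} \<Longrightarrow> l \<le> f (z + s *\<^sub>R v)"
  shows "l \<le> avg v f z"
proof -
  have "integral {0..1} (\<lambda>s :: real. l) \<le> avg v f z" unfolding avg_def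
    by (rule integral_le) (use assms in \<open>auto intro!: integrable_continuous_real avg_slice_cont\<close>)
  then show ?thesis by simp
qed

lemma avg_le:
  fixes f :: "real \<times> real \<Rightarrow> real"
  assumes "continuous_on UNIV f" "\<And>s. s \<in> {0..1} \<Longrightarrow> f (z + s *\<^sub>R v) \<le> l"
  shows "avg v f z \<le> l"
proof -
  have "avg v f z \<le> integral {0..1} (\<lambda>s :: real. l)" unfolding avg_def
    by (rule integral_le) (use assms in \<open>auto intro!: integrable_continuous_real avg_slice_cont\<close>)
  then show ?thesis by simp
qed

lemma derivative_difference:
  fixes f :: "real \<times> real \<Rightarrow> real"
  assumes d: "\<And>z. (f has_derivative (\<lambda>w. f1 z * fst w + f2 z * snd w)) (at z)"
  shows "((\<lambda>z. (f (z + v) - f z) / \<delta>) has_derivative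
    (\<lambda>w. (f1 (z + v) - f1 z) / \<delta> * fst w + (f2 (z + v) - f2 z) / \<delta> * snd w)) (at z)"
proof -
  have "((\<lambda>z. f (z + v)) has_derivative (\<lambda>w. f1 (z + v) * fst w + f2 (z + v) * snd w)) (at z)"
    by (rule has_derivative_compose[OF _ d, where f = "\<lambda>z. z + v" and f' = "\<lambda>w. w", simplified])
       (auto intro!: derivative_eq_intros)
  from has_derivative_mult_left[OF has_derivative_diff[OF this d], of "1 / \<delta>"]
  have "((\<lambda>z. (f (z + v) - f z) * (1 / \<delta>)) has_derivative
    (\<lambda>w. (f1 (z + v) - f1 z) / \<delta> * fst w + (f2 (z + v) - f2 z) / \<delta> * snd w)) (at z)"
    by (rule has_derivative_eq_rhs) (auto simp: fun_eq_iff algebra_simps diff_divide_distrib)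
  then show ?thesis by simp
qed

context generating_function begin

text \<open>The average of \<open>W\<close> over boxes of size \<open>\<delta>\<close>: first over \<open>c\<close>, giving \<open>V\<close> with partial derivative \<open>U\<close> in \<open>c\<close>, then
  over \<open>t\<close>. An average of a derivative along a segment is a difference quotient, so two averages make the
  \<open>C\<^sup>1\<close> function \<open>W\<close> twice differentiable, and \<open>mixed\<close> is its mixed derivative. The average over \<open>c\<close> shifts the mean of
  the leaves by \<open>\<delta> / 2\<close>, which the term \<open>\<delta> / 2 * fst z\<close> corrects.\<close>

definition V :: "real \<Rightarrow> real \<times> real \<Rightarrow> real" where "V \<delta> = avg (0, \<delta>) W"
definition U :: "real \<Rightarrow> real \<times> real \<Rightarrow> real" where "U \<delta> z = (W (z + (0, \<delta>)) - W z) / \<delta>"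
definition W_smooth :: "real \<Rightarrow> real \<times> real \<Rightarrow> real" where "W_smooth \<delta> z = avg (\<delta>, 0) (V \<delta>) z - \<delta> / 2 * fst z"
definition eta_smooth :: "real \<Rightarrow> real \<times> real \<Rightarrow> real" where "eta_smooth \<delta> z = (V \<delta> (z + (\<delta>, 0)) - V \<delta> z) / \<delta> - \<delta> / 2"
definition H_smooth :: "real \<Rightarrow> real \<times> real \<Rightarrow> real" where "H_smooth \<delta> = avg (\<delta>, 0) (U \<delta>)"
definition mixed :: "real \<Rightarrow> real \<times> real \<Rightarrow> real" where "mixed \<delta> z = (U \<delta> (z + (\<delta>, 0)) - U \<delta> z) / \<delta>"

lemma cW: "continuous_on UNIV W"
  by (rule continuous_at_imp_continuous_on) (use W_derivative has_derivative_continuous in blast)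

lemma shift_cont: "continuous_on UNIV f \<Longrightarrow> continuous_on UNIV (\<lambda>z :: real \<times> real. f (z + v))"
  for f :: "real \<times> real \<Rightarrow> real"
  by (erule continuous_on_UNIV_comp) (intro continuous_intros)

context
  fixes \<delta> :: real
  assumes \<delta>: "\<delta> > 0"
begin

lemma avg_H: "avg (0, \<delta>) H = U \<delta>"
  using avg_partial(2)[OF W_derivative, of \<delta>] \<delta> by (simp add: fun_eq_iff U_def)

lemma dV: "(V \<delta> has_derivative (\<lambda>w. avg (0, \<delta>) eta z * fst w + U \<delta> z * snd w)) (at z)"
  using avg_derivative[OF W_derivative eta_cont H_cont, of "(0, \<delta>)" z] unfolding V_def avg_H .

lemma cU: "continuous_on UNIV (U \<delta>)"
  unfolding U_def[abs_def] using \<delta> by (intro continuous_intros shift_cont cW) auto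

lemma cV: "continuous_on UNIV (V \<delta>)"
  unfolding V_def by (rule avg_cont[OF cW])

lemma avg_V_t: "avg (\<delta>, 0) (avg (0, \<delta>) eta) z = (V \<delta> (z + (\<delta>, 0)) - V \<delta> z) / \<delta>"
  using avg_partial(1)[OF dV, of \<delta>] \<delta> by simp

lemma eta_smooth_eq: "eta_smooth \<delta> z = avg (\<delta>, 0) (avg (0, \<delta>) eta) z - \<delta> / 2"
  by (simp add: eta_smooth_def avg_V_t)

lemma H_smooth_eq: "H_smooth \<delta> z = avg (\<delta>, 0) (avg (0, \<delta>) H) z"
  by (simp add: H_smooth_def avg_H)

lemma dW_smooth: "(W_smooth \<delta> has_derivative (\<lambda>w. eta_smooth \<delta> z * fst w + H_smooth \<delta> z * snd w)) (at z)"
proof -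
  have "(avg (\<delta>, 0) (V \<delta>) has_derivative (\<lambda>w. avg (\<delta>, 0) (avg (0, \<delta>) eta) z * fst w + avg (\<delta>, 0) (U \<delta>) z * snd w)) (at z)"
    by (rule avg_derivative[OF dV avg_cont[OF eta_cont] cU])
  moreover have "((\<lambda>z :: real \<times> real. \<delta> / 2 * fst z) has_derivative (\<lambda>w. \<delta> / 2 * fst w)) (at z)"
    by (auto intro!: derivative_eq_intros)
  ultimately show ?thesis unfolding W_smooth_def[abs_def] eta_smooth_eq H_smooth_def
    by (rule has_derivative_eq_rhs[OF has_derivative_diff]) (simp add: fun_eq_iff algebra_simps)
qed

lemma d_eta_smooth: "(eta_smooth \<delta> has_derivative
    (\<lambda>w. (avg (0, \<delta>) eta (z + (\<delta>, 0)) - avg (0, \<delta>) eta z) / \<delta> * fst w + mixed \<delta> z * snd w)) (at z)"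
  unfolding eta_smooth_def[abs_def] mixed_def
  using has_derivative_diff[OF derivative_difference[OF dV] has_derivative_const] by simp

lemma dU: "(U \<delta> has_derivative (\<lambda>w. (eta (z + (0, \<delta>)) - eta z) / \<delta> * fst w + (H (z + (0, \<delta>)) - H z) / \<delta> * snd w)) (at z)"
  unfolding U_def[abs_def] by (rule derivative_difference[OF W_derivative])

lemma d_H_smooth: "(H_smooth \<delta> has_derivative
    (\<lambda>w. mixed \<delta> z * fst w + avg (\<delta>, 0) (\<lambda>z. (H (z + (0, \<delta>)) - H z) / \<delta>) z * snd w)) (at z)"
proof -
  have "avg (\<delta>, 0) (\<lambda>z. (eta (z + (0, \<delta>)) - eta z) / \<delta>) z = mixed \<delta> z" for z
    using avg_partial(1)[OF dU, of \<delta> z] \<delta> by (simp add: mixed_def)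
  moreover have "(H_smooth \<delta> has_derivative (\<lambda>w. avg (\<delta>, 0) (\<lambda>z. (eta (z + (0, \<delta>)) - eta z) / \<delta>) z * fst w
      + avg (\<delta>, 0) (\<lambda>z. (H (z + (0, \<delta>)) - H z) / \<delta>) z * snd w)) (at z)"
    unfolding H_smooth_def
    by (rule avg_derivative[OF dU]) (use \<delta> in \<open>intro continuous_intros shift_cont eta_cont H_cont; simp\<close>)+
  ultimately show ?thesis by simp
qed

text \<open>The mixed derivative is a second difference of \<open>W\<close>, positive because the leaves are ordered.\<close>

lemma mixed_pos: "mixed \<delta> z > 0"
proof -
  obtain t c where z: "z = (t, c)" by force
  have "U \<delta> (t, c) < U \<delta> (t + \<delta>, c)"
  proof (rule DERIV_pos_imp_increasing[where f = "\<lambda>t. U \<delta> (t, c)"])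
    fix x
    have "((\<lambda>t. U \<delta> (t, c)) has_real_derivative (eta ((x, c) + (0, \<delta>)) - eta (x, c)) / \<delta>) (at x)"
      by (rule has_derivative_plane_partials(1)[OF dU])
    moreover have "(eta ((x, c) + (0, \<delta>)) - eta (x, c)) / \<delta> > 0"
      using eta_mono[of c "c + \<delta>" x] \<delta> by simp
    ultimately show "\<exists>y. ((\<lambda>t. U \<delta> (t, c)) has_real_derivative y) (at x) \<and> y > 0" by blast
  qed (use \<delta> in simp)
  then show ?thesis using \<delta> by (simp add: mixed_def z)
qed

lemma box_bounds:
  obtains c0 c1 where "\<And>s c. s \<in> {0..1} \<Longrightarrow> c \<ge> c1 \<Longrightarrow> l \<le> eta (t + s * \<delta>, c)"
    "\<And>s c. s \<in> {0..1} \<Longrightarrow> c \<le> c0 \<Longrightarrow> eta (t + s * \<delta>, c) \<le> l"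
proof -
  have "continuous_on {0..1} (\<lambda>s. eta_inv (t + s * \<delta>, l))"
    by (rule continuous_on_UNIV_comp[OF eta_inv_cont]) (intro continuous_intros)
  then obtain M where M: "\<And>s. s \<in> {0..1} \<Longrightarrow> \<bar>eta_inv (t + s * \<delta>, l)\<bar> \<le> M"
    using compact_bound[of "{0..1}" "\<lambda>s. eta_inv (t + s * \<delta>, l)"] by auto
  have mono: "eta (x, c) \<le> eta (x, c')" if "c \<le> c'" for x c c'
    using eta_mono[of c c' x] that by (cases "c = c'") auto
  show thesis
  proof (rule that[of M "-M"])
    fix s c :: real assume s: "s \<in> {0..1}"
    have e: "eta (t + s * \<delta>, eta_inv (t + s * \<delta>, l)) = l" by (rule eta_eta_inv)
    have b: "\<bar>eta_inv (t + s * \<delta>, l)\<bar> \<le> M" by (rule M[OF s])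
    show "l \<le> eta (t + s * \<delta>, c)" if "M \<le> c"
    proof -
      have "eta_inv (t + s * \<delta>, l) \<le> c" using b that by linarith
      from mono[OF this, of "t + s * \<delta>"] show ?thesis unfolding e .
    qed
    show "eta (t + s * \<delta>, c) \<le> l" if "c \<le> - M"
    proof -
      have "c \<le> eta_inv (t + s * \<delta>, l)" using b that by linarith
      from mono[OF this, of "t + s * \<delta>"] show ?thesis unfolding e .
    qed
  qed
qed

text \<open>Averages over a box inherit the bounds of \<open>eta\<close> on the box, and by compactness \<open>eta\<close> exceeds any bound on the
  whole width of the box once \<open>c\<close> is large.\<close>

lemma eta_smooth_surj: "surj (\<lambda>c. eta_smooth \<delta> (t, c))"
proof -
  have "\<exists>c. eta_smooth \<delta> (t, c) = l" for l
  proof -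
    obtain c0 c1 where b: "\<And>s c. s \<in> {0..1} \<Longrightarrow> c \<ge> c1 \<Longrightarrow> l + \<delta> / 2 \<le> eta (t + s * \<delta>, c)"
      "\<And>s c. s \<in> {0..1} \<Longrightarrow> c \<le> c0 \<Longrightarrow> eta (t + s * \<delta>, c) \<le> l + \<delta> / 2"
      by (rule box_bounds[of "l + \<delta> / 2" t]) (rule that; assumption)
    define d1 where "d1 = max c1 c0"
    have "l + \<delta> / 2 \<le> avg (\<delta>, 0) (avg (0, \<delta>) eta) (t, d1)"
    proof (intro avg_ge avg_cont eta_cont)
      fix s s' :: real assume s: "s \<in> {0..1}" "s' \<in> {0..1}"
      have "d1 + s' * \<delta> \<ge> c1" using s \<delta> by (simp add: d1_def max_def add_increasing2)
      from b(1)[OF s(1) this] show "l + \<delta> / 2 \<le> eta ((t, d1) + s *\<^sub>R (\<delta>, 0) + s' *\<^sub>R (0, \<delta>))" by simp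
    qed
    then have 1: "l \<le> eta_smooth \<delta> (t, d1)" by (simp add: eta_smooth_eq)
    have "avg (\<delta>, 0) (avg (0, \<delta>) eta) (t, c0 - \<delta>) \<le> l + \<delta> / 2"
    proof (intro avg_le avg_cont eta_cont)
      fix s s' :: real assume s: "s \<in> {0..1}" "s' \<in> {0..1}"
      have "s' * \<delta> \<le> 1 * \<delta>" using s \<delta> by (intro mult_right_mono) auto
      then have "c0 - \<delta> + s' * \<delta> \<le> c0" by simp
      from b(2)[OF s(1) this] show "eta ((t, c0 - \<delta>) + s *\<^sub>R (\<delta>, 0) + s' *\<^sub>R (0, \<delta>)) \<le> l + \<delta> / 2" by simp
    qed
    then have 2: "eta_smooth \<delta> (t, c0 - \<delta>) \<le> l" by (simp add: eta_smooth_eq)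
    have "continuous_on {c0 - \<delta>..d1} (\<lambda>c. eta_smooth \<delta> (t, c))"
      by (intro continuous_at_imp_continuous_on ballI DERIV_isCont[OF has_derivative_plane_partials(2)[OF d_eta_smooth]])
    moreover have "c0 - \<delta> \<le> d1" using \<delta> by (simp add: d1_def)
    ultimately show ?thesis using IVT'[of "\<lambda>c. eta_smooth \<delta> (t, c)", OF 2 1] by blast
  qed
  then show ?thesis unfolding surj_def by metis
qed

theorem smooth_generating_function:
  "smooth_generating_function (W_smooth \<delta>) (eta_smooth \<delta>) (H_smooth \<delta>)
    (\<lambda>z. (avg (0, \<delta>) eta (z + (\<delta>, 0)) - avg (0, \<delta>) eta z) / \<delta>) (mixed \<delta>)
    (avg (\<delta>, 0) (\<lambda>z. (H (z + (0, \<delta>)) - H z) / \<delta>))"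
proof
  have dc: "continuous_on UNIV f" if "\<And>z. (f has_derivative f' z) (at z)" for f :: "real \<times> real \<Rightarrow> real" and f'
    by (rule continuous_at_imp_continuous_on) (use that has_derivative_continuous in blast)
  show "((\<lambda>t. W_smooth \<delta> (t, c)) has_real_derivative eta_smooth \<delta> (t, c)) (at t)" for c t
    by (rule has_derivative_plane_partials(1)[OF dW_smooth])
  show "((\<lambda>c. W_smooth \<delta> (t, c)) has_real_derivative H_smooth \<delta> (t, c)) (at c)" for c t
    by (rule has_derivative_plane_partials(2)[OF dW_smooth])
  show "continuous_on UNIV (eta_smooth \<delta>)" by (rule dc[OF d_eta_smooth])
  show "continuous_on UNIV (H_smooth \<delta>)" by (rule dc[OF d_H_smooth])
  show "eta_smooth \<delta> (t, c) < eta_smooth \<delta> (t, c')" if "c < c'" for t c c'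
    by (rule DERIV_pos_imp_increasing[OF that]) (use has_derivative_plane_partials(2)[OF d_eta_smooth] mixed_pos in blast)
  show "surj (\<lambda>c. eta_smooth \<delta> (t, c))" for t by (rule eta_smooth_surj)
  show "H_smooth \<delta> (t, c) < H_smooth \<delta> (t', c)" if "t < t'" for t t' c
    by (rule DERIV_pos_imp_increasing[OF that]) (use has_derivative_plane_partials(1)[OF d_H_smooth] mixed_pos in blast)
  show "W_smooth \<delta> (t + 1, c) = W_smooth \<delta> (t, c) + c" for t c
  proof -
    have "((\<lambda>s. c + s * \<delta>) has_integral ((1 * c + 1^2 * \<delta> / 2) - (0 * c + 0^2 * \<delta> / 2))) {0..1}" for c
      by (rule fundamental_theorem_of_calculus)
         (auto intro!: derivative_eq_intros simp flip: has_real_derivative_iff_has_vector_derivative)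
    then have int: "((\<lambda>s. c + s * \<delta>) has_integral (c + \<delta> / 2)) {0..1}" for c by simp
    have V: "V \<delta> (t + 1, c) = V \<delta> (t, c) + (c + \<delta> / 2)" for t c
    proof -
      have "W ((t + 1, c) + s *\<^sub>R (0, \<delta>)) = W ((t, c) + s *\<^sub>R (0, \<delta>)) + (c + s * \<delta>)" for s
        using W_shift[of t "c + s * \<delta>"] by simp
      then show ?thesis unfolding V_def avg_def
        using avg_slice_cont[OF cW, of "(t, c)" "(0, \<delta>)"] int[of c]
        by (simp only:) (subst Henstock_Kurzweil_Integration.integral_add, auto intro!: integrable_continuous_real continuous_intros simp: integral_unique)
    qed
    have "V \<delta> ((t + 1, c) + s *\<^sub>R (\<delta>, 0)) = V \<delta> ((t, c) + s *\<^sub>R (\<delta>, 0)) + (c + \<delta> / 2)" for s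
      using V[of "t + s * \<delta>" c] by (simp add: algebra_simps)
    then have "avg (\<delta>, 0) (V \<delta>) (t + 1, c) = avg (\<delta>, 0) (V \<delta>) (t, c) + (c + \<delta> / 2)" unfolding avg_def
      using avg_slice_cont[OF cV, of "(t, c)" "(\<delta>, 0)"]
      by (simp only:) (subst Henstock_Kurzweil_Integration.integral_add, auto intro!: integrable_continuous_real continuous_intros)
    then show ?thesis by (simp add: W_smooth_def algebra_simps)
  qed
  show "mixed \<delta> z > 0" for z by (rule mixed_pos)
  show "continuous_on UNIV (mixed \<delta>)" unfolding mixed_def[abs_def]
    using \<delta> by (intro continuous_intros shift_cont cU) auto
  show "continuous_on UNIV (\<lambda>z. (avg (0, \<delta>) eta (z + (\<delta>, 0)) - avg (0, \<delta>) eta z) / \<delta>)"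
    using \<delta> by (intro continuous_intros shift_cont avg_cont eta_cont) auto
  show "continuous_on UNIV (avg (\<delta>, 0) (\<lambda>z. (H (z + (0, \<delta>)) - H z) / \<delta>))"
    using \<delta> by (intro avg_cont continuous_intros shift_cont H_cont) auto
qed (rule d_eta_smooth d_H_smooth)+

end

end

section \<open>Approximation by exact symplectic diffeomorphisms\<close>

context generating_function begin

lemma box_average_tendsto:
  fixes f :: "real \<times> real \<Rightarrow> real"
  assumes f: "continuous_on UNIV f" and \<delta>: "\<And>n. \<delta> n > 0" "\<delta> \<longlonglongrightarrow> 0" and Z: "Z \<longlonglongrightarrow> z"
  shows "(\<lambda>n. avg (\<delta> n, 0) (avg (0, \<delta> n) f) (Z n)) \<longlonglongrightarrow> f z"
proof (rule tendstoI)
  fix e :: real assume e: "e > 0"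
  have "isCont f z" using f unfolding continuous_on_eq_continuous_at[OF open_UNIV] by blast
  then obtain r where r: "r > 0" "\<And>w. dist w z < r \<Longrightarrow> dist (f w) (f z) < e / 2"
    using e unfolding continuous_at_eps_delta by (metis half_gt_zero)
  have "\<forall>\<^sub>F n in sequentially. dist (Z n) z < r / 3" using r(1) by (intro tendstoD[OF Z]) simp
  moreover have "\<forall>\<^sub>F n in sequentially. dist (\<delta> n) 0 < r / 3" using r(1) by (intro tendstoD[OF \<delta>(2)]) simp
  ultimately show "\<forall>\<^sub>F n in sequentially. dist (avg (\<delta> n, 0) (avg (0, \<delta> n) f) (Z n)) (f z) < e"
  proof eventually_elim
    case (elim n)
    have "\<bar>avg (\<delta> n, 0) (avg (0, \<delta> n) f) (Z n) - f z\<bar> \<le> e / 2"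
    proof (intro avg_near avg_cont f)
      fix s s' :: real assume s: "s \<in> {0..1}" "s' \<in> {0..1}"
      let ?w = "Z n + s *\<^sub>R (\<delta> n, 0) + s' *\<^sub>R (0, \<delta> n)"
      have sd: "\<bar>s * \<delta> n\<bar> \<le> \<delta> n" "\<bar>s' * \<delta> n\<bar> \<le> \<delta> n"
        using s \<delta>(1)[of n] by (simp_all add: abs_mult mult_left_le_one_le)
      have "norm (s *\<^sub>R (\<delta> n, 0 :: real) + s' *\<^sub>R (0 :: real, \<delta> n)) \<le> \<bar>s * \<delta> n\<bar> + \<bar>s' * \<delta> n\<bar>"
        using norm_Pair_le[of "s * \<delta> n" "s' * \<delta> n"] by simp
      then have "dist ?w (Z n) \<le> 2 * \<delta> n" using sd by (simp add: dist_norm)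
      moreover have "\<delta> n < r / 3" using elim(2) \<delta>(1)[of n] by (simp add: dist_real_def)
      ultimately have "dist ?w z < r" using elim(1) dist_triangle[of ?w z "Z n"] by linarith
      from r(2)[OF this] show "\<bar>f ?w - f z\<bar> \<le> e / 2" by (simp add: dist_real_def)
    qed
    then show ?case using e by (simp add: dist_real_def)
  qed
qed

definition smooth_map :: "real \<Rightarrow> annulus \<Rightarrow> annulus" where
  "smooth_map \<delta> = generating_function.annulus_map (eta_smooth \<delta>) (H_smooth \<delta>)"

text \<open>The maps are given by inverse functions. These converge because the inverse value is enclosed, by
  monotonicity, as soon as the functions converge at \<open>H_inv z - e\<close> and \<open>H_inv z + e\<close>.\<close>

lemma smooth_map_limit:
  assumes \<delta>: "\<And>n. \<delta> n > 0" "\<delta> \<longlonglongrightarrow> 0" and Z: "Z \<longlonglongrightarrow> z"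
  shows "(\<lambda>n. smooth_map (\<delta> n) (annulus_of (Z n))) \<longlonglongrightarrow> annulus_map (annulus_of z)"
proof -
  have eta_lim: "(\<lambda>n. eta_smooth (\<delta> n) (Y n)) \<longlonglongrightarrow> eta y" if "Y \<longlonglongrightarrow> y" for Y y
  proof -
    have "(\<lambda>n. avg (\<delta> n, 0) (avg (0, \<delta> n) eta) (Y n) - \<delta> n / 2) \<longlonglongrightarrow> eta y - 0 / 2"
      by (intro tendsto_intros box_average_tendsto eta_cont \<delta> that) simp
    then show ?thesis by (simp add: eta_smooth_eq[OF \<delta>(1)])
  qed
  have H_lim: "(\<lambda>n. H_smooth (\<delta> n) (Y n)) \<longlonglongrightarrow> H y" if "Y \<longlonglongrightarrow> y" for Y y
    using box_average_tendsto[OF H_cont \<delta> that] by (simp add: H_smooth_eq[OF \<delta>(1)])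
  let ?T = "\<lambda>n. generating_function.H_inv (H_smooth (\<delta> n)) (Z n)"
  let ?t = "H_inv z"
  have gf: "generating_function (W_smooth (\<delta> n)) (eta_smooth (\<delta> n)) (H_smooth (\<delta> n))" for n
    by (rule smooth_generating_function.axioms(1)[OF smooth_generating_function[OF \<delta>(1)]])
  have H_T: "H_smooth (\<delta> n) (?T n, snd (Z n)) = fst (Z n)" for n
    using generating_function.H_H_inv[OF gf, of n "fst (Z n)" "snd (Z n)"] by simp
  have T_lim: "?T \<longlonglongrightarrow> ?t"
  proof (rule tendstoI)
    fix e :: real assume e: "e > 0"
    have c: "(\<lambda>n. snd (Z n)) \<longlonglongrightarrow> snd z" and x: "(\<lambda>n. fst (Z n)) \<longlonglongrightarrow> fst z"
      by (intro tendsto_intros Z)+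
    have Ht: "H (?t, snd z) = fst z" using H_H_inv[of "fst z" "snd z"] by simp
    have 1: "(\<lambda>n. fst (Z n) - H_smooth (\<delta> n) (?t - e, snd (Z n))) \<longlonglongrightarrow> fst z - H (?t - e, snd z)"
      by (intro tendsto_diff x H_lim tendsto_Pair tendsto_const c)
    have 2: "(\<lambda>n. H_smooth (\<delta> n) (?t + e, snd (Z n)) - fst (Z n)) \<longlonglongrightarrow> H (?t + e, snd z) - fst z"
      by (intro tendsto_diff x H_lim tendsto_Pair tendsto_const c)
    have "H (?t - e, snd z) < fst z" "fst z < H (?t + e, snd z)"
      using H_mono[of "?t - e" ?t "snd z"] H_mono[of ?t "?t + e" "snd z"] e by (simp_all add: Ht)
    then have "\<forall>\<^sub>F n in sequentially. 0 < fst (Z n) - H_smooth (\<delta> n) (?t - e, snd (Z n))"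
      "\<forall>\<^sub>F n in sequentially. 0 < H_smooth (\<delta> n) (?t + e, snd (Z n)) - fst (Z n)"
      using order_tendstoD(1)[OF 1, of 0] order_tendstoD(1)[OF 2, of 0] by simp_all
    then show "\<forall>\<^sub>F n in sequentially. dist (?T n) ?t < e"
    proof eventually_elim
      case (elim n)
      have less: "t < t'" if "H_smooth (\<delta> n) (t, c) < H_smooth (\<delta> n) (t', c)" for t t' c
        using generating_function.H_mono[OF gf, of t' t n c] that by (cases t t' rule: linorder_cases) auto
      have "?t - e < ?T n" by (rule less[where c = "snd (Z n)"]) (use elim(1) H_T[of n] in simp)
      moreover have "?T n < ?t + e" by (rule less[where c = "snd (Z n)"]) (use elim(2) H_T[of n] in simp)
      ultimately show ?case by (simp add: dist_real_def abs_less_iff)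
    qed
  qed
  have "(\<lambda>n. (?T n, eta_smooth (\<delta> n) (?T n, snd (Z n)))) \<longlonglongrightarrow> (?t, eta (?t, snd z))"
    by (intro tendsto_Pair T_lim eta_lim tendsto_snd[OF Z])
  then have "(\<lambda>n. generating_function.plane_map (eta_smooth (\<delta> n)) (H_smooth (\<delta> n)) (Z n)) \<longlonglongrightarrow> plane_map z"
    by (simp add: plane_map_def generating_function.plane_map_def[OF gf])
  from continuous_on_UNIV_tendsto[OF continuous_on_annulus_of this] show ?thesis
    unfolding smooth_map_def generating_function.annulus_map_of[OF gf] annulus_map_of .
qed

text \<open>Uniform convergence on a compact set follows from convergence along all convergent sequences of points, which
  \<open>smooth_map_limit\<close> provides.\<close>

theorem exact_symplectic_homeo_annulus_map: "exact_symplectic_homeo annulus_map"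
  unfolding exact_symplectic_homeo_def
proof (intro conjI exI[of _ "\<lambda>n. smooth_map (1 / of_nat (Suc n))"] allI impI)
  show "homeo annulus_map" by (rule homeo_annulus_map)
  show "exact_symplectic_diffeo (smooth_map (1 / of_nat (Suc n)))" for n
    unfolding smooth_map_def
    by (rule smooth_generating_function.exact_symplectic_annulus_map[OF smooth_generating_function]) simp
  fix C :: "annulus set" assume C: "compact C"
  show "uniform_limit C (\<lambda>n. smooth_map (1 / of_nat (Suc n))) annulus_map sequentially"
  proof (rule ccontr)
    assume "\<not> ?thesis"
    then obtain e where e: "e > 0"
      "\<not> (\<forall>\<^sub>F n in sequentially. \<forall>q\<in>C. dist (smooth_map (1 / of_nat (Suc n)) q) (annulus_map q) < e)"
      unfolding uniform_limit_iff by blast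
    have "\<forall>m. \<exists>n q. n \<ge> m \<and> q \<in> C \<and> e \<le> dist (smooth_map (1 / of_nat (Suc n)) q) (annulus_map q)"
      using e(2) unfolding eventually_sequentially by (meson not_less)
    then obtain n q where nq: "\<And>m :: nat. n m \<ge> m" "\<And>m. q m \<in> C"
      "\<And>m. e \<le> dist (smooth_map (1 / of_nat (Suc (n m))) (q m)) (annulus_map (q m))"
      by metis
    obtain l r where l: "l \<in> C" and r: "strict_mono (r :: nat \<Rightarrow> nat)" and lim: "(q \<circ> r) \<longlonglongrightarrow> l"
      using compact_imp_seq_compact[OF C] nq(2) by (metis seq_compactE)
    define \<delta> :: "nat \<Rightarrow> real" where "\<delta> k = 1 / of_nat (Suc (n (r k)))" for k
    have \<delta>0: "\<delta> k > 0" for k by (simp add: \<delta>_def)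
    have \<delta>lim: "\<delta> \<longlonglongrightarrow> 0"
    proof (rule tendsto_sandwich[OF _ _ tendsto_const LIMSEQ_inverse_real_of_nat])
      show "\<forall>\<^sub>F k in sequentially. 0 \<le> \<delta> k" by (simp add: \<delta>_def)
      have "\<delta> k \<le> inverse (of_nat (Suc k))" for k
      proof -
        have "k \<le> n (r k)" using nq(1)[of "r k"] seq_suble[OF r, of k] by linarith
        then show ?thesis by (simp add: \<delta>_def inverse_eq_divide frac_le)
      qed
      then show "\<forall>\<^sub>F k in sequentially. \<delta> k \<le> inverse (of_nat (Suc k))" by simp
    qed
    obtain z where z: "l = annulus_of z" by (rule annulus_cases)
    have "\<exists>y. annulus_of y = q (r k) \<and> dist y z = dist (q (r k)) l" for k
      unfolding z by (rule near_annulus_representative[of "q (r k)" z]) blast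
    then obtain Z where Z: "\<And>k. annulus_of (Z k) = q (r k)" "\<And>k. dist (Z k) z = dist (q (r k)) l" by metis
    have "Z \<longlonglongrightarrow> z" using lim unfolding tendsto_dist_iff[of Z] tendsto_dist_iff[of "q \<circ> r"] by (simp add: Z o_def)
    from smooth_map_limit[OF \<delta>0 \<delta>lim this]
    have 1: "(\<lambda>k. smooth_map (\<delta> k) (q (r k))) \<longlonglongrightarrow> annulus_map l" by (simp add: Z z)
    have "continuous_on UNIV annulus_map"
      unfolding annulus_map_def by (rule continuous_on_descend[OF equivariant_plane_map(1) plane_map_cont(1)])
    from continuous_on_UNIV_tendsto[OF this lim]
    have 2: "(\<lambda>k. annulus_map (q (r k))) \<longlonglongrightarrow> annulus_map l" by (simp add: o_def)
    have "(\<lambda>k. dist (smooth_map (\<delta> k) (q (r k))) (annulus_map (q (r k)))) \<longlonglongrightarrow> dist (annulus_map l) (annulus_map l)"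
      by (intro tendsto_dist 1 2)
    then have "e \<le> dist (annulus_map l) (annulus_map l)"
      by (rule tendsto_lowerbound) (use nq(3) in \<open>simp_all add: \<delta>_def\<close>)
    then show False using e(1) by simp
  qed
qed

end

section \<open>The degree of a lift\<close>

lemma integer_valued_constant:
  fixes f :: "'a::topological_space \<Rightarrow> real"
  assumes "connected S" "continuous_on S f" "\<And>x. x \<in> S \<Longrightarrow> f x \<in> \<int>" "x \<in> S" "y \<in> S"
  shows "f x = f y"
proof -
  have "f constant_on S"
  proof (rule continuous_discrete_range_constant[OF assms(1,2)])
    fix x assume x: "x \<in> S"
    have "1 \<le> norm (f y - f x)" if "y \<in> S" "f y \<noteq> f x" for y
    proof -
      have "f y - f x \<in> \<int>" using assms(3) x that by auto
      then obtain k where k: "f y - f x = of_int k" by (rule Ints_cases)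
      then have "k \<noteq> 0" using that by auto
      then have "1 \<le> \<bar>k\<bar>" by linarith
      then have "1 \<le> real_of_int \<bar>k\<bar>" by linarith
      then show ?thesis using k by simp
    qed
    then show "\<exists>e>0. \<forall>y. y \<in> S \<and> f y \<noteq> f x \<longrightarrow> e \<le> norm (f y - f x)" by (intro exI[of _ 1]) auto
  qed
  then show ?thesis using assms(4,5) by (auto simp: constant_on_def)
qed

text \<open>The embedding of the circle into the complex plane. It gives access to continuous logarithms, which lift the
  homotopy on a contractible square.\<close>

definition circle_exp :: "circle \<Rightarrow> complex" where
  "circle_exp \<theta> = cis (2 * pi * rep_circle \<theta>)"

lemma circle_exp_of: "circle_exp (circle_of t) = exp (\<i> * complex_of_real (2 * pi * t))"
proof -
  have "circle_of (rep_circle (circle_of t)) = circle_of t" by (rule circle_of_rep)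
  then obtain m where m: "rep_circle (circle_of t) - t = of_int m"
    unfolding circle_of_eq_iff by (metis Ints_cases)
  then have "rep_circle (circle_of t) = t + of_int m" by simp
  then have "2 * pi * rep_circle (circle_of t) = 2 * pi * t + of_int m * (2 * pi)" by (simp add: algebra_simps)
  then have "circle_exp (circle_of t) = cis (2 * pi * t) * cis (of_int m * (2 * pi))"
    unfolding circle_exp_def by (simp add: cis_mult)
  also have "cis (of_int m * (2 * pi)) = 1" by (metis cis_multiple_2pi Ints_of_int mult.commute)
  finally show ?thesis by (simp add: cis_conv_exp)
qed

lemma circle_exp_cont: "continuous_on UNIV (\<lambda>q :: annulus. circle_exp (fst q))"
proof (rule continuous_on_annulus)
  have "(\<lambda>z. circle_exp (fst (annulus_of z))) = (\<lambda>z. exp (\<i> * complex_of_real (2 * pi * fst z)))"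
    by (simp add: annulus_of_def circle_exp_of)
  then show "continuous_on UNIV (\<lambda>z. circle_exp (fst (annulus_of z)))"
    by (simp only:) (intro continuous_intros)
qed

lemma exp_eq_imp_Im:
  assumes "exp w = exp (\<i> * complex_of_real (2 * pi * x))"
  shows "Im w / (2 * pi) - x \<in> \<int>"
proof -
  obtain n :: int where "w = \<i> * complex_of_real (2 * pi * x) + of_int (2 * n) * pi * \<i>"
    using assms exp_eq by metis
  then have "Im w = 2 * pi * x + 2 * of_int n * pi" by simp
  then have "Im w / (2 * pi) - x = of_int n" by (simp add: field_simps)
  then show ?thesis by simp
qed

text \<open>Follow the loop \<open>t \<mapsto> (t, 0)\<close> through the homotopy from the identity to \<open>f\<close>. Its first coordinate is a map of the square
  \<open>[0, 1]\<^sup>2\<close> to the circle, which has a continuous logarithm \<open>g\<close>; the increment of \<open>g\<close> in \<open>t\<close> is an integer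
  depending continuously on the homotopy parameter, and it is \<open>1\<close> for the identity.\<close>

theorem degree_one_lift:
  assumes hom: "homotopic_with P euclidean euclidean id f" and lift: "is_lift annulus_of F f"
  shows "F (t + 1, r) = F (t, r) + (1, 0)"
proof -
  obtain h where h: "continuous_map (prod_topology (top_of_set {0..1::real}) (euclidean :: annulus topology)) euclidean h"
    "\<And>x. h (0, x) = id x" "\<And>x. h (1, x) = f x"
    using hom unfolding homotopic_with_def by auto
  have ch: "continuous_on ({0..1} \<times> UNIV) h"
    using h(1) by (simp add: euclidean_product_topology[symmetric] prod_topology_subtopology subtopology_Times[symmetric] del: euclidean_product_topology)
  define E where "E z = circle_exp (fst (h (fst z, annulus_of (snd z, 0))))" for z :: "real \<times> real"
  let ?Q = "{0..1::real} \<times> {0..1::real}"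
  have cE: "continuous_on ?Q E"
  proof -
    have "continuous_on ?Q (\<lambda>z :: real \<times> real. (fst z, annulus_of (snd z, 0)))"
      by (intro continuous_intros continuous_on_UNIV_comp[OF continuous_on_annulus_of])
    then have "continuous_on ?Q (\<lambda>z. h (fst z, annulus_of (snd z, 0)))"
      by (rule continuous_on_compose2[OF ch]) auto
    then show ?thesis unfolding E_def by (rule continuous_on_UNIV_comp[OF circle_exp_cont])
  qed
  have "contractible ?Q" by (intro convex_imp_contractible convex_Times convex_real_interval)
  then obtain g where g: "continuous_on ?Q g" "\<And>z. z \<in> ?Q \<Longrightarrow> E z = exp (g z)"
    using continuous_logarithm_on_contractible[OF cE] by (auto simp: E_def circle_exp_def)
  have cs: "continuous_on {0..1} (\<lambda>t. g (s, t))" "continuous_on {0..1} (\<lambda>t. g (t, s))" if "s \<in> {0..1}" for s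
    by (rule continuous_on_compose2[OF g(1)]; use that in \<open>auto intro!: continuous_intros\<close>)+
  have cF: "continuous_on UNIV F" and pF: "\<And>z. annulus_of (F z) = f (annulus_of z)"
    using lift by (auto simp: is_lift_def)
  have E0: "exp (g (0, t)) = exp (\<i> * complex_of_real (2 * pi * t))" if "t \<in> {0..1}" for t
    using g(2)[of "(0, t)"] that by (simp add: E_def h(2) annulus_of_def circle_exp_of)
  have E1: "exp (g (1, t)) = exp (\<i> * complex_of_real (2 * pi * fst (F (t, 0))))" if "t \<in> {0..1}" for t
    using g(2)[of "(1, t)"] that pF[of "(t, 0)", symmetric] by (simp add: E_def h(3)) (simp add: annulus_of_def circle_exp_of)
  have Es: "exp (g (s, 1)) = exp (g (s, 0))" if "s \<in> {0..1}" for s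
  proof -
    have "annulus_of (1, 0) = annulus_of (0, 0)" by (simp add: annulus_of_eq_iff)
    then show ?thesis using g(2)[of "(s, 0)"] g(2)[of "(s, 1)"] that by (simp add: E_def)
  qed
  \<comment> \<open>On the sides \<open>s = 0\<close> and \<open>s = 1\<close> the logarithm agrees, up to an integer constant, with the lifts of \<open>id\<close> and \<open>f\<close>.\<close>
  have k0: "Im (g (0, 1)) / (2 * pi) - 1 = Im (g (0, 0)) / (2 * pi) - 0"
    by (rule integer_valued_constant[where f = "\<lambda>t. Im (g (0, t)) / (2 * pi) - t" and S = "{0..1}"])
       (use cs[of 0] in \<open>auto intro!: continuous_intros exp_eq_imp_Im E0\<close>)
  have cF0: "continuous_on {0..1} (\<lambda>t. fst (F (t, 0)))"
    by (intro continuous_intros continuous_on_UNIV_comp[OF cF])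
  have k1: "Im (g (1, 1)) / (2 * pi) - fst (F (1, 0)) = Im (g (1, 0)) / (2 * pi) - fst (F (0, 0))"
    by (rule integer_valued_constant[where f = "\<lambda>t. Im (g (1, t)) / (2 * pi) - fst (F (t, 0))" and S = "{0..1}"])
       (use cs[of 1] cF0 in \<open>auto intro!: continuous_intros exp_eq_imp_Im E1\<close>)
  have ks: "(Im (g (0, 1)) - Im (g (0, 0))) / (2 * pi) = (Im (g (1, 1)) - Im (g (1, 0))) / (2 * pi)"
  proof (rule integer_valued_constant[where f = "\<lambda>s. (Im (g (s, 1)) - Im (g (s, 0))) / (2 * pi)" and S = "{0..1}"])
    fix s :: real assume s: "s \<in> {0..1}"
    have "exp (g (s, 1) - g (s, 0)) = exp (\<i> * complex_of_real (2 * pi * 0))" using Es[OF s] by (simp add: exp_diff)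
    from exp_eq_imp_Im[OF this] show "(Im (g (s, 1)) - Im (g (s, 0))) / (2 * pi) \<in> \<int>" by simp
  qed (use cs(2)[of 0] cs(2)[of 1] in \<open>auto intro!: continuous_intros\<close>)
  have one: "fst (F (0 + 1, 0)) - fst (F (0, 0)) = 1"
    using k0 k1 ks by (simp add: diff_divide_distrib)
  define D where "D z = fst (F (z + (1, 0))) - fst (F z)" for z :: "real \<times> real"
  have pz: "annulus_of (F (z + (1, 0))) = annulus_of (F z)" for z :: "real \<times> real"
  proof -
    have "annulus_of (z + (1, 0)) = annulus_of z" by (simp add: annulus_of_eq_iff)
    then show ?thesis by (simp add: pF)
  qed
  have "D (t, r) = D (0, 0)"
  proof (rule integer_valued_constant[where S = UNIV and f = D])
    show "continuous_on UNIV D" unfolding D_def[abs_def]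
      by (intro continuous_intros cF continuous_on_UNIV_comp[OF cF])
    show "D z \<in> \<int>" for z using pz[of z] by (simp add: D_def annulus_of_eq_iff)
  qed auto
  then have "fst (F (t + 1, r)) = fst (F (t, r)) + 1" using one by (simp add: D_def)
  moreover have "snd (F (t + 1, r)) = snd (F (t, r))" using pz[of "(t, r)"] by (simp add: annulus_of_eq_iff)
  ultimately show ?thesis by (simp add: prod_eq_iff)
qed

section \<open>Bi-Lipschitz bounds on compact parts of the annulus\<close>

text \<open>Walk from \<open>a\<close> to \<open>b\<close> in steps of length \<open>\<delta> / 2\<close>.\<close>

lemma local_monotone_imp_le:
  fixes \<phi> :: "real \<Rightarrow> real"
  assumes \<delta>: "\<delta> > 0" and le: "a \<le> b"
    and loc: "\<And>x y. a \<le> x \<Longrightarrow> x \<le> y \<Longrightarrow> y \<le> b \<Longrightarrow> y < x + \<delta> \<Longrightarrow> \<phi> x \<le> \<phi> y"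
  shows "\<phi> a \<le> \<phi> b"
proof -
  have step: "\<phi> a \<le> \<phi> y" if "a \<le> y" "y \<le> b" "y \<le> a + of_nat n * (\<delta> / 2)" for n y
    using that
  proof (induction n arbitrary: y)
    case (Suc n)
    define x where "x = max a (y - \<delta> / 2)"
    have "0 \<le> of_nat n * (\<delta> / 2)" using \<delta> by simp
    moreover have "of_nat (Suc n) * (\<delta> / 2) = of_nat n * (\<delta> / 2) + \<delta> / 2" by (simp add: field_simps)
    ultimately have "a \<le> x \<and> x \<le> b \<and> x \<le> a + of_nat n * (\<delta> / 2)"
      using Suc.prems \<delta> unfolding x_def by (simp only: max_def split: if_split) linarith
    then have "\<phi> a \<le> \<phi> x" by (intro Suc.IH) auto
    also have "\<phi> x \<le> \<phi> y" by (rule loc) (use Suc.prems \<delta> in \<open>auto simp: x_def\<close>)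
    finally show ?case .
  qed auto
  obtain n :: nat where "(b - a) / (\<delta> / 2) < of_nat n" using reals_Archimedean2 by blast
  then have "b - a < of_nat n * (\<delta> / 2)" using \<delta> by (simp add: pos_divide_less_eq)
  then show ?thesis using step[of b n] le by simp
qed

text \<open>A Lebesgue number argument: the balls of the cover have twice the radius of those of a finite subcover, so that
  they contain the \<open>\<delta>\<close>-neighbours of each point of \<open>C\<close>.\<close>

lemma locally_bilipschitz_compact:
  fixes h :: "'a::metric_space \<Rightarrow> 'b::metric_space"
  assumes h: "locally_bilipschitz h" and C: "compact C"
  obtains K \<delta> where "K \<ge> 1" "\<delta> > 0" "\<And>x y. x \<in> C \<Longrightarrow> dist y x < \<delta> \<Longrightarrow>
    dist (h y) (h x) \<le> K * dist y x \<and> dist y x \<le> K * dist (h y) (h x)"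
proof -
  have "\<exists>K \<rho>. \<rho> > 0 \<and> (\<forall>x\<in>ball z (2 * \<rho>). \<forall>y\<in>ball z (2 * \<rho>). dist (h y) (h x) \<le> K * dist y x \<and> dist y x \<le> K * dist (h y) (h x))" for z
  proof -
    obtain U K where U: "open U" "z \<in> U" "K-lipschitz_on U h" "\<forall>x\<in>U. \<forall>y\<in>U. dist x y \<le> K * dist (h x) (h y)"
      using h unfolding locally_bilipschitz_def by blast
    obtain e where e: "e > 0" "ball z e \<subseteq> U" using U(1,2) open_contains_ball by blast
    show ?thesis
    proof (intro exI conjI ballI)
      show "e / 2 > 0" using e by simp
      fix x y assume "x \<in> ball z (2 * (e / 2))" "y \<in> ball z (2 * (e / 2))"
      then have xy: "x \<in> U" "y \<in> U" using e(2) by auto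
      show "dist (h y) (h x) \<le> K * dist y x" by (rule lipschitz_onD[OF U(3) xy(2,1)])
      show "dist y x \<le> K * dist (h y) (h x)" using U(4) xy by blast
    qed
  qed
  then obtain K \<rho> where \<rho>: "\<And>z. \<rho> z > (0 :: real)"
    "\<And>z x y. x \<in> ball z (2 * \<rho> z) \<Longrightarrow> y \<in> ball z (2 * \<rho> z) \<Longrightarrow> dist (h y) (h x) \<le> K z * dist y x \<and> dist y x \<le> K z * dist (h y) (h x)"
    by metis
  have "C \<subseteq> (\<Union>z\<in>C. ball z (\<rho> z))" using \<rho>(1) by auto
  then obtain T where T: "T \<subseteq> C" "finite T" "C \<subseteq> (\<Union>z\<in>T. ball z (\<rho> z))"
    using compactE_image[OF C, of C "\<lambda>z. ball z (\<rho> z)"] by auto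
  define L where "L = Max (insert 1 (K ` T))"
  define \<delta> where "\<delta> = Min (insert 1 (\<rho> ` T))"
  have L: "1 \<le> L" "\<And>z. z \<in> T \<Longrightarrow> K z \<le> L" using T(2) by (auto simp: L_def)
  have \<delta>: "\<delta> > 0" "\<And>z. z \<in> T \<Longrightarrow> \<delta> \<le> \<rho> z" using T(2) \<rho>(1) by (auto simp: \<delta>_def)
  show thesis
  proof (rule that[OF L(1) \<delta>(1)])
    fix x y assume x: "x \<in> C" and y: "dist y x < \<delta>"
    obtain z where z: "z \<in> T" "x \<in> ball z (\<rho> z)" using T(3) x by blast
    have "x \<in> ball z (2 * \<rho> z)" using z(2) \<rho>(1)[of z] by simp
    moreover have "y \<in> ball z (2 * \<rho> z)"
      using z(2) y \<delta>(2)[OF z(1)] dist_triangle[of z y x] by (simp add: dist_commute)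
    ultimately have *: "dist (h y) (h x) \<le> K z * dist y x" "dist y x \<le> K z * dist (h y) (h x)"
      using \<rho>(2) by blast+
    have "K z * dist y x \<le> L * dist y x" "K z * dist (h y) (h x) \<le> L * dist (h y) (h x)"
      using L(2)[OF z(1)] by (simp_all add: mult_right_mono)
    with * show "dist (h y) (h x) \<le> L * dist y x \<and> dist y x \<le> L * dist (h y) (h x)" by linarith
  qed
qed

section \<open>The twist foliation on the universal cover\<close>

context twist_foliation begin

lemma W_gf: "generating_function W eta H"
proof
  show "((\<lambda>t. W (t, c)) has_real_derivative eta (t, c)) (at t)" for t c by (rule W_der)
  show "((\<lambda>c. W (t, c)) has_real_derivative H (t, c)) (at c)" for t c by (rule H_der)
  show "continuous_on UNIV eta" by (rule cont_eta)
  show "continuous_on UNIV H" by (rule H_continuous)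
  show "c < c' \<Longrightarrow> eta (t, c) < eta (t, c')" for t c c' by (rule eta_strict_mono)
  show "surj (\<lambda>c. eta (t, c))" for t by (rule eta_surj)
  show "t < t' \<Longrightarrow> H (t, c) < H (t', c)" for t t' c by (rule strict_monoD[OF H_strict_mono])
  show "W (t + 1, c) = W (t, c) + c" for t c by (rule W_shift)
qed

sublocale gf: generating_function W eta H by (rule W_gf)

lemma rho_cont: "continuous_on UNIV rho"
proof -
  have "continuous_on UNIV (\<lambda>c. G (0, c))"
    by (rule continuous_on_UNIV_comp[OF cont_G]) (intro continuous_intros)
  then show ?thesis unfolding rho_def[abs_def]
    by (intro continuous_on_UNIV_comp[OF H_continuous] continuous_intros)
qed

text \<open>On the cover, \<open>rho c\<close> differs from \<open>G (0, c)\<close> by at most \<open>1\<close>, and \<open>G (0, _)\<close> is onto by the twist property.\<close>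

lemma rho_surj: "surj rho"
proof -
  have G: "\<exists>c. G (0, c) = y" for y
  proof -
    obtain r where r: "y = fst (F (0, r))" using surjD[OF twist_surj[of 0], of y] by auto
    obtain c where "r = eta (0, c)" using surjD[OF eta_surj[of 0], of r] by auto
    then show ?thesis using r by (auto simp: G_def)
  qed
  have "\<exists>c. rho c = y" for y
  proof -
    obtain c0 where c0: "G (0, c0) = y - 1" using G by blast
    obtain c1 where c1: "G (0, c1) = y + 1" using G by blast
    have b: "rho c0 \<le> y" "y \<le> rho c1"
      using H_near_id[of "G (0, c0)" c0] H_near_id[of "G (0, c1)" c1] by (simp_all add: rho_def c0 c1)
    have "c0 \<le> c1"
      using strict_mono_less[OF rho_strict_mono, of c1 c0] b by (meson dual_order.trans linorder_not_le)
    then show ?thesis using IVT'[of rho c0 y c1, OF b] continuous_on_subset[OF rho_cont] by blast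
  qed
  then show ?thesis unfolding surj_def by metis
qed

lemma rho_homeo: "homeo rho"
proof -
  have "inj rho" by (rule strict_mono_imp_inj_on[OF rho_strict_mono])
  then obtain g where "homeomorphism UNIV (rho ` UNIV) rho g"
    using invariance_of_domain_homeomorphism[OF open_UNIV rho_cont] by auto
  then show ?thesis using rho_surj by (auto simp: homeo_def)
qed

lemma rho_locally_bilipschitz: "locally_bilipschitz rho"
  unfolding locally_bilipschitz_def
proof
  fix c
  obtain K L \<kappa> where "local_twist_foliation F F' eta W (\<bar>c\<bar> + 1) K L \<kappa>" by (rule local_foliation)
  then interpret lf: local_twist_foliation F F' eta W "\<bar>c\<bar> + 1" K L \<kappa> .
  define \<alpha> where "\<alpha> = \<kappa> / K^2"
  define \<beta> where "\<beta> = L * K^2"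
  have \<alpha>: "\<alpha> > 0" and \<beta>: "\<beta> > 0" using lf.\<kappa> lf.K lf.L by (simp_all add: \<alpha>_def \<beta>_def)
  let ?U = "{- (\<bar>c\<bar> + 1)<..<\<bar>c\<bar> + 1}"
  define C where "C = max \<beta> (1 / \<alpha>)"
  have le: "\<alpha> * \<bar>y - x\<bar> \<le> \<bar>rho y - rho x\<bar> \<and> \<bar>rho y - rho x\<bar> \<le> \<beta> * \<bar>y - x\<bar>" if "x \<in> ?U" "y \<in> ?U" "x \<le> y" for x y
  proof -
    have xy: "\<bar>x\<bar> < \<bar>c\<bar> + 1" "\<bar>y\<bar> < \<bar>c\<bar> + 1" using that by auto
    have "0 \<le> \<alpha> * (y - x)" using \<alpha> that by simp
    then show ?thesis using lf.rho_bilip[OF xy that(3)] that by (simp add: \<alpha>_def \<beta>_def)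
  qed
  have two: "\<alpha> * dist x y \<le> dist (rho x) (rho y) \<and> dist (rho x) (rho y) \<le> \<beta> * dist x y" if "x \<in> ?U" "y \<in> ?U" for x y
    using le[of x y] le[of y x] that unfolding dist_real_def by (cases "x \<le> y") (auto simp: abs_minus_commute)
  show "\<exists>U K. open U \<and> c \<in> U \<and> K-lipschitz_on U rho \<and> (\<forall>x\<in>U. \<forall>y\<in>U. dist x y \<le> K * dist (rho x) (rho y))"
  proof (intro exI conjI ballI)
    show "open ?U" "c \<in> ?U" by auto
    show "C-lipschitz_on ?U rho"
    proof (rule lipschitz_onI)
      fix x y assume xy: "x \<in> ?U" "y \<in> ?U"
      have "\<beta> * dist x y \<le> C * dist x y" by (intro mult_right_mono) (auto simp: C_def)
      then show "dist (rho x) (rho y) \<le> C * dist x y" using two[OF xy] by linarith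
    qed (use \<beta> in \<open>simp add: C_def\<close>)
    fix x y assume xy: "x \<in> ?U" "y \<in> ?U"
    have "dist x y \<le> 1 / \<alpha> * dist (rho x) (rho y)" using two[OF xy] \<alpha> by (simp add: pos_le_divide_eq mult.commute)
    also have "\<dots> \<le> C * dist (rho x) (rho y)" by (intro mult_right_mono) (auto simp: C_def)
    finally show "dist x y \<le> C * dist (rho x) (rho y)" .
  qed
qed

lemma H_inv_C1:
  obtains k where "\<And>x. ((\<lambda>x. gf.H_inv (x, c)) has_real_derivative k x) (at x)" "continuous_on UNIV k"
proof -
  obtain h' where h': "\<And>t. ((\<lambda>t. H (t, c)) has_real_derivative h' t) (at t)" "continuous_on UNIV h'" "\<And>t. h' t > 0"
    by (rule H_C1[of c]) (rule that; assumption)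
  have ci: "continuous_on UNIV (\<lambda>x. gf.H_inv (x, c))"
    by (rule continuous_on_UNIV_comp[OF gf.H_inv_cont]) (intro continuous_intros)
  show thesis
  proof
    show "((\<lambda>x. gf.H_inv (x, c)) has_real_derivative inverse (h' (gf.H_inv (x, c)))) (at x)" for x
    proof (rule DERIV_inverse_function[OF h'(1)])
      show "h' (gf.H_inv (x, c)) \<noteq> 0" using h'(3)[of "gf.H_inv (x, c)"] by simp
      show "isCont (\<lambda>x. gf.H_inv (x, c)) x" using ci unfolding continuous_on_eq_continuous_at[OF open_UNIV] by blast
      show "x - 1 < x" "x < x + 1" by auto
    qed (rule gf.H_H_inv)
    show "continuous_on UNIV (\<lambda>x. inverse (h' (gf.H_inv (x, c))))"
      by (intro continuous_intros continuous_on_UNIV_comp[OF h'(2) ci]) (use h'(3) in \<open>simp add: order_less_imp_not_eq2\<close>)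
  qed
qed

end

section \<open>From the annulus to its universal cover\<close>

definition cover_eta :: "(real \<Rightarrow> circle \<Rightarrow> real) \<Rightarrow> real \<times> real \<Rightarrow> real" where
  "cover_eta \<eta> z = \<eta> (snd z) (circle_of (fst z))"

definition cover_W :: "(annulus \<Rightarrow> real) \<Rightarrow> real \<times> real \<Rightarrow> real" where
  "cover_W u z = u (annulus_of z) + snd z * fst z"

lemma circle_deriv_of: "circle_deriv g (circle_of t) = deriv (\<lambda>s. g (circle_of s)) t"
  by (simp add: circle_deriv.abs_eq)

text \<open>The leaf described by \<open>c + du/d\<theta>\<close> has mean \<open>c\<close>, because \<open>u (_, c)\<close> is periodic, and the mean identifies the leaf.\<close>

lemma foliation_generating_function_leaf:
  assumes fol: "graph_foliation \<eta>" and u: "foliation_generating_function u \<eta>"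
  shows "c + d_theta u \<theta> c = \<eta> c \<theta>"
    and "((\<lambda>t. u (circle_of t, c)) has_real_derivative (\<eta> c (circle_of t) - c)) (at t)"
proof -
  have "C1_map (\<lambda>t. u (circle_of t, c))" using u by (simp add: foliation_generating_function_def)
  then obtain p where p: "\<And>t. ((\<lambda>t. u (circle_of t, c)) has_real_derivative p t) (at t)" "continuous_on UNIV p"
    by (rule C1_map_lineD) (rule that; assumption)
  have dt: "d_theta u (circle_of t) c = p t" for t
    unfolding d_theta_def circle_deriv_of by (rule DERIV_imp_deriv[OF p(1)])
  have "graph_of (\<lambda>\<theta>. c + d_theta u \<theta> c) \<in> leaves \<eta>" using u by (simp add: foliation_generating_function_def)
  then obtain c' where "graph_of (\<lambda>\<theta>. c + d_theta u \<theta> c) = graph_of (\<eta> c')" by (auto simp: leaves_def)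
  then have eq: "c + d_theta u \<theta> c = \<eta> c' \<theta>" for \<theta>
    unfolding graph_of_def by (simp add: set_eq_iff) (metis prod.inject)
  have "((\<lambda>t. c + p t) has_integral ((c * 1 + u (circle_of 1, c)) - (c * 0 + u (circle_of 0, c)))) {0..1}"
  proof (rule fundamental_theorem_of_calculus)
    fix t :: real
    have "((\<lambda>t. c * t + u (circle_of t, c)) has_real_derivative (c + p t)) (at t)"
      by (auto intro!: derivative_eq_intros p)
    then show "((\<lambda>t. c * t + u (circle_of t, c)) has_vector_derivative (c + p t)) (at t within {0..1})"
      using has_real_derivative_iff_has_vector_derivative has_vector_derivative_at_within by blast
  qed simp
  moreover have "circle_of 1 = circle_of 0" by (simp add: circle_of_eq_iff)
  ultimately have "integral {0..1} (\<lambda>t. \<eta> c' (circle_of t)) = c"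
    by (simp add: integral_unique eq[symmetric] dt)
  moreover have "integral {0..1} (\<lambda>t. \<eta> c' (circle_of t)) = c'" using fol by (simp add: graph_foliation_def)
  ultimately have "c' = c" by simp
  then show 1: "c + d_theta u \<theta> c = \<eta> c \<theta>" for \<theta> using eq by simp
  have "p t = \<eta> c (circle_of t) - c" using 1[of "circle_of t"] by (simp add: dt)
  then show "((\<lambda>t. u (circle_of t, c)) has_real_derivative (\<eta> c (circle_of t) - c)) (at t)" using p(1)[of t] by simp
qed

context
  fixes \<eta> :: "real \<Rightarrow> circle \<Rightarrow> real"
  assumes fol: "graph_foliation \<eta>"
begin

lemma leaf_map_bij: "bij (leaf_map \<eta>)" and leaf_map_cont: "continuous_on UNIV (leaf_map \<eta>)"
proof -
  have "homeo (leaf_map \<eta>)" using fol by (simp add: graph_foliation_def)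
  then obtain g where "homeomorphism UNIV UNIV (leaf_map \<eta>) g" by (auto simp: homeo_def)
  then show "bij (leaf_map \<eta>)" "continuous_on UNIV (leaf_map \<eta>)"
    by (auto simp: homeomorphism_def intro!: o_bij[of g])
qed

lemma cover_eta_cont: "continuous_on UNIV (cover_eta \<eta>)"
proof -
  have "continuous_on UNIV (\<lambda>z. snd (leaf_map \<eta> (annulus_of z)))"
    by (intro continuous_intros continuous_on_UNIV_comp[OF leaf_map_cont continuous_on_annulus_of])
  then show ?thesis by (simp add: cover_eta_def[abs_def] leaf_map_def annulus_of_def)
qed

lemma leaf_surj: "surj (\<lambda>c. \<eta> c \<theta>)"
proof -
  have "\<exists>c. \<eta> c \<theta> = r" for r
  proof -
    obtain p where "(\<theta>, r) = leaf_map \<eta> p" using surjD[OF bij_is_surj[OF leaf_map_bij]] by blast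
    then show ?thesis by (cases p) (auto simp: leaf_map_def)
  qed
  then show ?thesis unfolding surj_def by metis
qed

lemma leaf_inj: "\<eta> c \<theta> = \<eta> c' \<theta> \<Longrightarrow> c = c'"
  using injD[OF bij_is_inj[OF leaf_map_bij], of "(\<theta>, c)" "(\<theta>, c')"] by (simp add: leaf_map_def)

text \<open>Leaves are disjoint, so two of them are ordered in the same way at all points, and the order is that of their
  means.\<close>

lemma leaf_mono:
  assumes c: "c < c'" shows "\<eta> c \<theta> < \<eta> c' \<theta>"
proof (rule ccontr)
  assume neg: "\<not> ?thesis"
  obtain t where t: "\<theta> = circle_of t" by (rule circle_cases)
  define \<Delta> where "\<Delta> s = \<eta> c' (circle_of s) - \<eta> c (circle_of s)" for s
  have cs: "continuous_on S (\<lambda>s. \<eta> c (circle_of s))" for c S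
  proof -
    have "continuous_on S (\<lambda>s. cover_eta \<eta> (s, c))"
      by (rule continuous_on_UNIV_comp[OF cover_eta_cont]) (intro continuous_intros)
    then show ?thesis by (simp add: cover_eta_def)
  qed
  have c\<Delta>: "continuous_on S \<Delta>" for S unfolding \<Delta>_def[abs_def] by (intro continuous_intros cs)
  have nz: "\<Delta> s \<noteq> 0" for s using leaf_inj[of c "circle_of s" c'] c by (auto simp: \<Delta>_def)
  have "\<Delta> t < 0" using neg nz[of t] by (simp add: \<Delta>_def t)
  have "\<Delta> s < 0" for s
  proof (rule ccontr)
    assume "\<not> \<Delta> s < 0"
    then have "\<Delta> s > 0" using nz[of s] by simp
    have "connected (\<Delta> ` UNIV)" by (intro connected_continuous_image c\<Delta> connected_UNIV)
    then have "0 \<in> \<Delta> ` UNIV"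
      using \<open>\<Delta> t < 0\<close> \<open>\<Delta> s > 0\<close> connectedD_interval[of "\<Delta> ` UNIV" "\<Delta> t" "\<Delta> s" 0] by auto
    then show False using nz by auto
  qed
  then have "integral {0..1} (\<lambda>s. \<eta> c' (circle_of s)) \<le> integral {0..1} (\<lambda>s. \<eta> c (circle_of s))"
    by (intro integral_le integrable_continuous_real cs) (auto simp: \<Delta>_def less_imp_le)
  then have "c' \<le> c" using fol by (simp add: graph_foliation_def)
  then show False using c by simp
qed

text \<open>On a compact part of the annulus the foliation is bi-Lipschitz at a uniform small scale. Each of the estimates says
  that a combination such as \<open>K * x - eta (x, c)\<close> is increasing, which passes from small to large scales.\<close>

lemma cover_eta_bilip:
  assumes lip: "locally_bilipschitz (leaf_map \<eta>)"
  shows "\<exists>K\<ge>1. \<forall>t t' c c'. \<bar>c\<bar> \<le> N \<longrightarrow> \<bar>c'\<bar> \<le> N \<longrightarrow>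
    \<bar>cover_eta \<eta> (t', c) - cover_eta \<eta> (t, c)\<bar> \<le> K * \<bar>t' - t\<bar> \<and>
    (c \<le> c' \<longrightarrow> (c' - c) / K \<le> cover_eta \<eta> (t, c') - cover_eta \<eta> (t, c) \<and>
       cover_eta \<eta> (t, c') - cover_eta \<eta> (t, c) \<le> K * (c' - c))"
proof -
  have "compact ((UNIV :: circle set) \<times> {- N..N})" by (intro compact_Times compact_circle compact_Icc)
  then obtain K \<delta> where K: "K \<ge> 1" and \<delta>: "\<delta> > 0"
    and b: "\<And>x y. x \<in> UNIV \<times> {- N..N} \<Longrightarrow> dist y x < \<delta> \<Longrightarrow>
      dist (leaf_map \<eta> y) (leaf_map \<eta> x) \<le> K * dist y x \<and> dist y x \<le> K * dist (leaf_map \<eta> y) (leaf_map \<eta> x)"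
    by (rule locally_bilipschitz_compact[OF lip]) (rule that; assumption)
  let ?e = "cover_eta \<eta>"
  have hor: "\<bar>?e (t', c) - ?e (t, c)\<bar> \<le> K * \<bar>t' - t\<bar>" if c: "\<bar>c\<bar> \<le> N" and t: "\<bar>t' - t\<bar> < \<delta>" for t t' c
  proof -
    have d: "dist (annulus_of (t', c)) (annulus_of (t, c)) \<le> \<bar>t' - t\<bar>"
      using dist_annulus_of_le[of "(t', c)" "(t, c)"] by (simp add: dist_Pair_Pair dist_real_def)
    then have "dist (annulus_of (t', c)) (annulus_of (t, c)) < \<delta>" using t by linarith
    moreover have "annulus_of (t, c) \<in> UNIV \<times> {- N..N}" using c by (auto simp: annulus_of_def)
    ultimately have "dist (leaf_map \<eta> (annulus_of (t', c))) (leaf_map \<eta> (annulus_of (t, c))) \<le> K * dist (annulus_of (t', c)) (annulus_of (t, c))"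
      using b[of "annulus_of (t, c)" "annulus_of (t', c)"] by simp
    also have "\<dots> \<le> K * \<bar>t' - t\<bar>" using d K by (intro mult_left_mono) auto
    finally show ?thesis
      using dist_snd_le[of "leaf_map \<eta> (annulus_of (t', c))" "leaf_map \<eta> (annulus_of (t, c))"]
      by (simp add: leaf_map_def annulus_of_def cover_eta_def dist_real_def)
  qed
  have ver: "?e (t, c') - ?e (t, c) \<le> K * (c' - c) \<and> c' - c \<le> K * (?e (t, c') - ?e (t, c))"
    if c: "\<bar>c\<bar> \<le> N" and le: "c \<le> c'" "c' < c + \<delta>" for t c c'
  proof -
    have "annulus_of (t, c) \<in> UNIV \<times> {- N..N}" using c by (auto simp: annulus_of_def)
    moreover have d: "dist (annulus_of (t, c')) (annulus_of (t, c)) = c' - c"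
      using le by (simp add: annulus_of_def dist_Pair_Pair dist_real_def)
    moreover have "?e (t, c) \<le> ?e (t, c')"
      using leaf_mono[of c c' "circle_of t"] le by (cases "c = c'") (auto simp: cover_eta_def)
    then have "dist (leaf_map \<eta> (annulus_of (t, c'))) (leaf_map \<eta> (annulus_of (t, c))) = ?e (t, c') - ?e (t, c)"
      by (simp add: leaf_map_def annulus_of_def cover_eta_def dist_Pair_Pair dist_real_def)
    ultimately show ?thesis using b[of "annulus_of (t, c)" "annulus_of (t, c')"] le by simp
  qed
  show ?thesis
  proof (intro exI[of _ K] conjI K allI impI)
    fix t t' c c' assume c: "\<bar>c\<bar> \<le> N" "\<bar>c'\<bar> \<le> N"
    have half: "\<bar>?e (t', c) - ?e (t, c)\<bar> \<le> K * \<bar>t' - t\<bar>" if "t \<le> t'" for t t'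
    proof -
      have 1: "K * t - ?e (t, c) \<le> K * t' - ?e (t', c)"
      proof (rule local_monotone_imp_le[OF \<delta> that])
        fix x y assume "x \<le> y" "y < x + \<delta>"
        then show "K * x - ?e (x, c) \<le> K * y - ?e (y, c)"
          using hor[OF c(1), of y x] by (simp add: abs_le_iff algebra_simps)
      qed
      have 2: "K * t + ?e (t, c) \<le> K * t' + ?e (t', c)"
      proof (rule local_monotone_imp_le[OF \<delta> that])
        fix x y assume "x \<le> y" "y < x + \<delta>"
        then show "K * x + ?e (x, c) \<le> K * y + ?e (y, c)"
          using hor[OF c(1), of y x] by (simp add: abs_le_iff algebra_simps)
      qed
      show ?thesis using 1 2 that by (simp add: abs_le_iff algebra_simps)
    qed
    show "\<bar>?e (t', c) - ?e (t, c)\<bar> \<le> K * \<bar>t' - t\<bar>"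
      using half[of t t'] half[of t' t] by (metis abs_minus_commute linear)
    assume le: "c \<le> c'"
    have "K * c - ?e (t, c) \<le> K * c' - ?e (t, c')"
    proof (rule local_monotone_imp_le[OF \<delta> le])
      fix x y assume "c \<le> x" "x \<le> y" "y \<le> c'" "y < x + \<delta>"
      then show "K * x - ?e (t, x) \<le> K * y - ?e (t, y)"
        using ver[of x y t] c by (simp add: abs_le_iff algebra_simps)
    qed
    then show "?e (t, c') - ?e (t, c) \<le> K * (c' - c)" by (simp add: algebra_simps)
    have "K * ?e (t, c) - c \<le> K * ?e (t, c') - c'"
    proof (rule local_monotone_imp_le[OF \<delta> le])
      fix x y assume "c \<le> x" "x \<le> y" "y \<le> c'" "y < x + \<delta>"
      then show "K * ?e (t, x) - x \<le> K * ?e (t, y) - y"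
        using ver[of x y t] c by (simp add: abs_le_iff algebra_simps)
    qed
    then have "c' - c \<le> (?e (t, c') - ?e (t, c)) * K" by (simp add: algebra_simps)
    then show "(c' - c) / K \<le> ?e (t, c') - ?e (t, c)"
      using K by (simp only: pos_divide_le_eq)
  qed
qed

end

text \<open>A \<open>C\<^sup>1\<close> inverse excludes critical points.\<close>

lemma positive_twist:
  assumes "strict_mono \<phi>" "C1_diffeo_via (id :: real \<Rightarrow> real) \<phi>" and der: "(\<phi> has_real_derivative l) (at r)"
  shows "l > 0" "surj \<phi>"
proof -
  have bij: "bij \<phi>" and "C1_via (id :: real \<Rightarrow> real) (inv \<phi>)" using assms(2) by (auto simp: C1_diffeo_via_def)
  then obtain g where g: "\<And>z. id (g z) = inv \<phi> (id z)" "C1_map g" by (auto simp: C1_via_def is_lift_def)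
  have "g = inv \<phi>" using g(1) by (simp add: fun_eq_iff)
  then obtain k where k: "\<And>t. (inv \<phi> has_real_derivative k t) (at t)"
    using C1_map_lineD[OF g(2)] by metis
  show "surj \<phi>" by (rule bij_is_surj[OF bij])
  have "((\<lambda>r. inv \<phi> (\<phi> r)) has_real_derivative k (\<phi> r) * l) (at r)" by (rule DERIV_chain2[OF k der])
  moreover have "(\<lambda>r. inv \<phi> (\<phi> r)) = (\<lambda>r. r)" using bij by (simp add: bij_is_inj)
  ultimately have "k (\<phi> r) * l = 1" using DERIV_unique[OF _ DERIV_ident] by metis
  then have "l \<noteq> 0" by auto
  moreover have "l \<ge> 0"
  proof (rule tendsto_lowerbound)
    show "((\<lambda>y. (\<phi> y - \<phi> r) / (y - r)) \<longlongrightarrow> l) (at r)" using der by (simp add: has_field_derivative_iff)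
    have "0 \<le> (\<phi> y - \<phi> r) / (y - r)" for y
      using strict_mono_less_eq[OF assms(1), of y r] strict_mono_less_eq[OF assms(1), of r y]
      by (cases "y \<le> r") (auto simp: divide_nonpos_nonpos divide_nonneg_nonneg zero_le_divide_iff)
    then show "\<forall>\<^sub>F y in at r. 0 \<le> (\<phi> y - \<phi> r) / (y - r)" by simp
  qed simp
  ultimately show "l > 0" by simp
qed

section \<open>Straightening the foliation\<close>

lemma twist_foliation_lift:
  assumes f: "symplectic_twist_diffeo f" and lip: "lipschitz_foliation \<eta>"
    and inv: "foliation_invariant f \<eta>" and u: "foliation_generating_function u \<eta>"
  obtains F F' where "\<And>z. annulus_of (F z) = f (annulus_of z)" "twist_foliation F F' (cover_eta \<eta>) (cover_W u)"
proof -
  have fol: "graph_foliation \<eta>" and bilip: "locally_bilipschitz (leaf_map \<eta>)" using lip by (auto simp: lipschitz_foliation_def)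
  have "C1_via annulus_of f" and hom: "homotopic_with homeo euclidean euclidean id f" and om: "preserves_omega f"
    and tw: "\<And>F t. is_lift annulus_of F f \<Longrightarrow> strict_mono (\<lambda>r. fst (F (t, r))) \<and> C1_diffeo_via (id :: real \<Rightarrow> real) (\<lambda>r. fst (F (t, r)))"
    using f by (auto simp: symplectic_twist_diffeo_def C1_diffeo_via_def)
  then obtain F where lift: "is_lift annulus_of F f" and "C1_map F" by (auto simp: C1_via_def)
  then obtain F' where dF: "\<And>z. (F has_derivative blinfun_apply (F' z)) (at z)" and cF': "continuous_on UNIV F'"
    by (auto simp: C1_map_def)
  have pF: "annulus_of (F z) = f (annulus_of z)" for z using lift unfolding is_lift_def by blast
  have dr: "((\<lambda>r. fst (F (t, r))) has_real_derivative fst (F' (t, r) (0, 1))) (at r)" for t r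
  proof -
    have "((\<lambda>r. (t, r)) has_derivative (\<lambda>h. (0, h))) (at r)" by (auto intro!: derivative_eq_intros)
    from has_derivative_fst[OF has_derivative_compose[OF this dF]]
    have "((\<lambda>r. fst (F (t, r))) has_derivative (\<lambda>h. fst (F' (t, r) (0, h)))) (at r)" .
    moreover have "(\<lambda>h. fst (F' (t, r) (0, h))) = (*) (fst (F' (t, r) (0, 1)))"
    proof
      fix h
      have "F' (t, r) (0, h) = h *\<^sub>R F' (t, r) (0, 1)" by (simp add: blinfun.scaleR_right[symmetric])
      then show "fst (F' (t, r) (0, h)) = fst (F' (t, r) (0, 1)) * h" by simp
    qed
    ultimately show ?thesis unfolding has_field_derivative_def by (rule back_subst)
  qed
  have "twist_foliation F F' (cover_eta \<eta>) (cover_W u)"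
  proof
    show "(F has_derivative blinfun_apply (F' z)) (at z)" for z by (rule dF)
    show "continuous_on UNIV F'" by (rule cF')
    show "omega (F' z v) (F' z w) = omega v w" for z v w
      using om lift unfolding preserves_omega_def frechet_derivative_at[OF dF, of z] by blast
    show "fst (F' z (0, 1)) > 0" for z
      using positive_twist(1)[OF _ _ dr] tw[OF lift, of "fst z"] by (metis prod.collapse)
    show "surj (\<lambda>r. fst (F (t, r)))" for t
      using positive_twist(2)[OF _ _ dr] tw[OF lift, of t] by blast
    show "F (t + 1, r) = F (t, r) + (1, 0)" for t r by (rule degree_one_lift[OF hom lift])
    show "snd (F (t, cover_eta \<eta> (t, c))) = cover_eta \<eta> (fst (F (t, cover_eta \<eta> (t, c))), c)" for t c
    proof -
      have "f ` graph_of (\<eta> c) = graph_of (\<eta> c)" using inv by (auto simp: foliation_invariant_def leaves_def)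
      moreover have "annulus_of (t, cover_eta \<eta> (t, c)) \<in> graph_of (\<eta> c)"
        by (auto simp: graph_of_def annulus_of_def cover_eta_def)
      ultimately have "annulus_of (F (t, cover_eta \<eta> (t, c))) \<in> graph_of (\<eta> c)" unfolding pF by blast
      then show ?thesis by (auto simp: graph_of_def annulus_of_def cover_eta_def)
    qed
    show "\<exists>K\<ge>1. \<forall>t t' c c'. \<bar>c\<bar> \<le> N \<longrightarrow> \<bar>c'\<bar> \<le> N \<longrightarrow>
        \<bar>cover_eta \<eta> (t', c) - cover_eta \<eta> (t, c)\<bar> \<le> K * \<bar>t' - t\<bar> \<and>
        (c \<le> c' \<longrightarrow> (c' - c) / K \<le> cover_eta \<eta> (t, c') - cover_eta \<eta> (t, c) \<and>
          cover_eta \<eta> (t, c') - cover_eta \<eta> (t, c) \<le> K * (c' - c))" for N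
      by (rule cover_eta_bilip[OF fol bilip])
    show "surj (\<lambda>c. cover_eta \<eta> (t, c))" for t using leaf_surj[OF fol] by (simp add: cover_eta_def)
    show "((\<lambda>t. cover_W u (t, c)) has_real_derivative cover_eta \<eta> (t, c)) (at t)" for t c
      unfolding cover_W_def cover_eta_def annulus_of_def
      by (auto intro!: derivative_eq_intros foliation_generating_function_leaf(2)[OF fol u])
    have "circle_of 0 = 0" by (simp add: zero_circle.abs_eq)
    then show "cover_W u (0, c) = 0" for c
      using u by (simp add: cover_W_def annulus_of_def foliation_generating_function_def)
    show "cover_W u (t + 1, c) = cover_W u (t, c) + c" for t c
      using circle_of_shift[of t 1] by (simp add: cover_W_def annulus_of_def algebra_simps)
  qed
  then show thesis by (rule that[OF pF])
qed

locale lifted_foliation = twist_foliation F F' "cover_eta \<eta>" "cover_W u"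
  for F F' and \<eta> :: "real \<Rightarrow> circle \<Rightarrow> real" and u :: "annulus \<Rightarrow> real" +
  fixes f :: "annulus \<Rightarrow> annulus"
  assumes lift: "annulus_of (F z) = f (annulus_of z)"
    and fol: "graph_foliation \<eta>" and gen: "foliation_generating_function u \<eta>"
begin

lemma annulus_of_leaf: "annulus_of (t, cover_eta \<eta> (t, c)) = (circle_of t, \<eta> c (circle_of t))"
  by (simp add: annulus_of_def cover_eta_def)

lemma leaf_height: "c + d_theta u \<theta> c = \<eta> c \<theta>"
  by (rule foliation_generating_function_leaf(1)[OF fol gen])

lemma d_c_lift: "d_c u (circle_of t) c = H (t, c) - t"
  unfolding d_c_def
proof (rule DERIV_imp_deriv)
  have "((\<lambda>a. cover_W u (t, a) - a * t) has_real_derivative H (t, c) - t) (at c)"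
    by (auto intro!: derivative_eq_intros H_der)
  then show "((\<lambda>a. u (circle_of t, a)) has_real_derivative H (t, c) - t) (at c)"
    by (simp add: cover_W_def annulus_of_def)
qed

lemma conjugacy_lift: "conjugacy u c (circle_of t) = circle_of (H (t, c))"
  by (simp add: conjugacy_def d_c_lift circle_of_add)

lemma projected_dynamics_lift: "projected_dynamics f u c (circle_of t) = circle_of (G (t, c))"
  unfolding projected_dynamics_def leaf_height annulus_of_leaf[symmetric] lift[symmetric]
  by (simp add: F_leaf) (simp add: annulus_of_def)

lemma annulus_map_leaf: "gf.annulus_map (circle_of (H (t, c)), c) = (circle_of t, \<eta> c (circle_of t))"
  using gf.annulus_map_of[of "(H (t, c), c)"]
  by (simp add: gf.plane_map_def gf.H_inv_H annulus_of_leaf) (simp add: annulus_of_def)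

lemma circle_cases_H:
  obtains t where "\<theta> = circle_of (H (t, c))"
proof -
  obtain s where "\<theta> = circle_of s" by (rule circle_cases)
  then show thesis using that[of "gf.H_inv (s, c)"] by (simp add: gf.H_H_inv)
qed

lemma generating_function_of_annulus_map: "generating_function_of u gf.annulus_map"
  unfolding generating_function_of_def
proof (intro conjI allI)
  have "((\<lambda>z. cover_W u z - snd z * fst z) has_derivative
      (\<lambda>v. (cover_eta \<eta> z - snd z) * fst v + (H z - fst z) * snd v)) (at z)" for z
    by (auto intro!: derivative_eq_intros gf.W_derivative simp: algebra_simps)
  then have "C1_map (\<lambda>z. cover_W u z - snd z * fst z)"
    by (rule C1_map_scalar) (intro continuous_intros cont_eta H_continuous)+
  then show "C1_map (\<lambda>z. u (annulus_of z))" by (simp add: cover_W_def)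
  fix x c \<theta> r
  show "gf.annulus_map (x, c) = (\<theta>, r) \<longleftrightarrow> x = \<theta> + circle_of (d_c u \<theta> c) \<and> r = c + d_theta u \<theta> c"
  proof
    assume eq: "gf.annulus_map (x, c) = (\<theta>, r)"
    obtain t where t: "x = circle_of (H (t, c))" by (rule circle_cases_H)
    then have "\<theta> = circle_of t" "r = \<eta> c (circle_of t)" using eq by (auto simp: annulus_map_leaf)
    then show "x = \<theta> + circle_of (d_c u \<theta> c) \<and> r = c + d_theta u \<theta> c"
      by (simp add: t d_c_lift circle_of_add leaf_height)
  next
    assume eq: "x = \<theta> + circle_of (d_c u \<theta> c) \<and> r = c + d_theta u \<theta> c"
    obtain t where t: "\<theta> = circle_of t" by (rule circle_cases)
    have "x = circle_of (H (t, c))" "r = \<eta> c (circle_of t)"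
      using eq by (simp_all add: t d_c_lift circle_of_add leaf_height)
    then show "gf.annulus_map (x, c) = (\<theta>, r)" by (simp add: annulus_map_leaf t)
  qed
qed

lemma annulus_map_leaves: "(`) gf.annulus_map ` leaves standard_foliation = leaves \<eta>"
proof -
  have "gf.annulus_map ` graph_of (standard_foliation c) = graph_of (\<eta> c)" for c
  proof (intro set_eqI iffI)
    fix q assume "q \<in> gf.annulus_map ` graph_of (standard_foliation c)"
    then obtain x where "q = gf.annulus_map (x, c)" by (auto simp: graph_of_def standard_foliation_def)
    moreover obtain t where "x = circle_of (H (t, c))" by (rule circle_cases_H)
    ultimately show "q \<in> graph_of (\<eta> c)" by (auto simp: annulus_map_leaf graph_of_def)
  next
    fix q assume "q \<in> graph_of (\<eta> c)"
    then obtain \<theta> where q: "q = (\<theta>, \<eta> c \<theta>)" by (auto simp: graph_of_def)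
    obtain t where "\<theta> = circle_of t" by (rule circle_cases)
    then have "q = gf.annulus_map (circle_of (H (t, c)), c)" by (simp add: annulus_map_leaf q)
    then show "q \<in> gf.annulus_map ` graph_of (standard_foliation c)"
      by (auto simp: graph_of_def standard_foliation_def)
  qed
  then show ?thesis by (simp add: leaves_def image_image)
qed

lemma annulus_map_conjugates: "(inv gf.annulus_map \<circ> f \<circ> gf.annulus_map) (x, c) = (x + circle_of (rho c), c)"
proof -
  obtain t where x: "x = circle_of (H (t, c))" by (rule circle_cases_H)
  have "f (gf.annulus_map (x, c)) = annulus_of (F (t, cover_eta \<eta> (t, c)))"
    by (simp add: x annulus_map_leaf lift annulus_of_leaf)
  also have "\<dots> = (circle_of (G (t, c)), \<eta> c (circle_of (G (t, c))))" by (simp only: F_leaf annulus_of_leaf)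
  also have "\<dots> = gf.annulus_map (circle_of (H (G (t, c), c)), c)" by (simp only: annulus_map_leaf)
  also have "circle_of (H (G (t, c), c)) = x + circle_of (rho c)" by (simp add: H_conjugacy x circle_of_add)
  finally show ?thesis using gf.inv_annulus_map(2) by (simp add: bij_is_inj)
qed

lemma annulus_map_partial_theta: "has_partial_theta gf.annulus_map"
  unfolding has_partial_theta_def
proof (intro exI conjI allI)
  show "is_lift annulus_of gf.plane_map gf.annulus_map"
    unfolding gf.annulus_map_def by (rule is_lift_descend[OF gf.equivariant_plane_map(1) gf.plane_map_cont(1)])
  fix t c
  obtain k where k: "\<And>x. ((\<lambda>x. gf.H_inv (x, c)) has_real_derivative k x) (at x)"
    by (rule H_inv_C1[of c]) (rule that; assumption)
  have "((\<lambda>s. cover_eta \<eta> (gf.H_inv (s, c), c)) has_real_derivative slope (gf.H_inv (t, c), c) * k t) (at t)"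
    by (rule DERIV_chain2[OF eta_C1 k])
  then have "(\<lambda>s. (gf.H_inv (s, c), cover_eta \<eta> (gf.H_inv (s, c), c))) differentiable at t"
    unfolding has_field_derivative_def
    by (intro differentiableI[OF has_derivative_Pair[OF k[of t, unfolded has_field_derivative_def]]])
  then show "(\<lambda>s. gf.plane_map (s, c)) differentiable at t" by (simp add: gf.plane_map_def)
qed

lemma circle_deriv_leaf: "circle_deriv (\<eta> c) (circle_of t) = slope (t, c)"
  using DERIV_imp_deriv[OF eta_C1[of c t]] by (simp add: circle_deriv_of cover_eta_def)

lemma C1_lamination_leaves: "C1_lamination \<eta>"
  unfolding C1_lamination_def
proof (intro conjI allI)
  show "homeo (leaf_map \<eta>)" using fol by (simp add: graph_foliation_def)
  have sec: "continuous_on UNIV (\<lambda>t. f (t, a))" if "continuous_on UNIV f" for f :: "real \<times> real \<Rightarrow> real" and a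
    by (rule continuous_on_UNIV_comp[OF that]) (intro continuous_intros)
  show "C1_map (\<lambda>t. \<eta> a (circle_of t))" for a
    using C1_map_line[OF eta_C1[of a] sec[OF slope_continuous]] by (simp add: cover_eta_def)
  have unif: "uniform_limit UNIV \<phi> (\<phi> a) (at a)"
    if g: "continuous_on UNIV g" "\<And>t b. \<phi> b (circle_of t) = g (t, b)" for g and \<phi> :: "real \<Rightarrow> circle \<Rightarrow> real" and a
    unfolding uniform_limit_iff
  proof (intro allI impI)
    fix e :: real assume e: "e > 0"
    have "(g \<longlongrightarrow> g (x, a)) (at (x, a) within {z. snd z \<noteq> a})" for x
      using g(1) by (metis UNIV_I continuous_on_def tendsto_within_subset subset_UNIV)
    from uniform_from_continuous_convergence[OF compact_Icc[of 0 1] sec[OF g(1)] e this]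
    show "\<forall>\<^sub>F b in at a. \<forall>\<theta>\<in>UNIV. dist (\<phi> b \<theta>) (\<phi> a \<theta>) < e"
    proof (rule eventually_mono)
      fix b assume b: "\<forall>x\<in>{0..1}. \<bar>g (x, b) - g (x, a)\<bar> < e"
      show "\<forall>\<theta>\<in>UNIV. dist (\<phi> b \<theta>) (\<phi> a \<theta>) < e"
      proof
        fix \<theta>
        obtain t where t: "\<theta> = circle_of t" by (rule circle_cases)
        have "\<theta> = circle_of (frac t)" using circle_of_shift[of "frac t" "\<lfloor>t\<rfloor>"] by (simp add: t frac_def)
        moreover have "frac t \<in> {0..1}" by (simp add: less_imp_le[OF frac_lt_1])
        ultimately show "dist (\<phi> b \<theta>) (\<phi> a \<theta>) < e" using b by (simp add: g(2) dist_real_def)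
      qed
    qed
  qed
  show "uniform_limit UNIV \<eta> (\<eta> a) (at a)" for a
    by (rule unif[OF cont_eta]) (simp add: cover_eta_def)
  show "uniform_limit UNIV (\<lambda>b. circle_deriv (\<eta> b)) (circle_deriv (\<eta> a)) (at a)" for a
    by (rule unif[OF slope_continuous, where \<phi> = "\<lambda>b. circle_deriv (\<eta> b)"]) (rule circle_deriv_leaf)
qed

lemma C1_diffeo_conjugacy: "C1_diffeo_via circle_of (conjugacy u c)"
proof -
  obtain h' where h': "\<And>t. ((\<lambda>t. H (t, c)) has_real_derivative h' t) (at t)" "continuous_on UNIV h'"
    by (rule H_C1[of c]) (rule that; assumption)
  obtain k where k: "\<And>x. ((\<lambda>x. gf.H_inv (x, c)) has_real_derivative k x) (at x)" "continuous_on UNIV k"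
    by (rule H_inv_C1[of c]) (rule that; assumption)
  have int: "H (t, c) - H (s, c) \<in> \<int> \<longleftrightarrow> t - s \<in> \<int>" for s t
  proof
    assume "t - s \<in> \<int>"
    then obtain m where "t - s = of_int m" by (rule Ints_cases)
    then have "t = s + of_int m" by simp
    then show "H (t, c) - H (s, c) \<in> \<int>" by (simp add: H_shift_int)
  next
    assume "H (t, c) - H (s, c) \<in> \<int>"
    then obtain m where "H (t, c) - H (s, c) = of_int m" by (rule Ints_cases)
    then have "H (t, c) = H (s + of_int m, c)" by (simp add: H_shift_int)
    then have "t = s + of_int m" by (simp add: gf.H_inj)
    then show "t - s \<in> \<int>" by simp
  qed
  have bij: "bij (conjugacy u c)"
  proof (rule bijI)
    show "inj (conjugacy u c)"
    proof (rule injI)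
      fix \<theta> \<theta>' assume eq: "conjugacy u c \<theta> = conjugacy u c \<theta>'"
      obtain t where t: "\<theta> = circle_of t" by (rule circle_cases)
      obtain s where s: "\<theta>' = circle_of s" by (rule circle_cases)
      show "\<theta> = \<theta>'" using eq by (simp add: t s conjugacy_lift circle_of_eq_iff int)
    qed
    show "surj (conjugacy u c)"
    proof -
      have "\<exists>\<theta>'. \<theta> = conjugacy u c \<theta>'" for \<theta>
      proof -
        obtain t where "\<theta> = circle_of (H (t, c))" by (rule circle_cases_H)
        then have "\<theta> = conjugacy u c (circle_of t)" by (simp add: conjugacy_lift)
        then show ?thesis by blast
      qed
      then show ?thesis unfolding surj_def by blast
    qed
 qed
  have via: "C1_via circle_of \<phi>"
    if "\<And>t. (\<psi> has_real_derivative \<psi>' t) (at t)" "continuous_on UNIV \<psi>'" "\<And>t. circle_of (\<psi> t) = \<phi> (circle_of t)"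
    for \<phi> \<psi> \<psi>'
    using that(3) DERIV_isCont[OF that(1)] C1_map_line[OF that(1,2)]
    by (auto simp: C1_via_def is_lift_def intro!: exI[of _ \<psi>] continuous_at_imp_continuous_on)
  have "C1_via circle_of (conjugacy u c)" by (rule via[OF h']) (simp add: conjugacy_lift)
  moreover have "C1_via circle_of (inv (conjugacy u c))"
  proof (rule via[OF k])
    fix x
    have "conjugacy u c (circle_of (gf.H_inv (x, c))) = circle_of x" by (simp add: conjugacy_lift gf.H_H_inv)
    then show "circle_of (gf.H_inv (x, c)) = inv (conjugacy u c) (circle_of x)"
      using inv_f_f[OF bij_is_inj[OF bij]] by metis
  qed
  ultimately show ?thesis using bij by (simp add: C1_diffeo_via_def)
qed

lemma conjugacy_projected_dynamics:
  "conjugacy u c \<circ> projected_dynamics f u c = (\<lambda>\<theta>. \<theta> + circle_of (rho c)) \<circ> conjugacy u c"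
proof
  fix \<theta>
  obtain t where "\<theta> = circle_of t" by (rule circle_cases)
  then show "(conjugacy u c \<circ> projected_dynamics f u c) \<theta> = ((\<lambda>\<theta>. \<theta> + circle_of (rho c)) \<circ> conjugacy u c) \<theta>"
    by (simp add: projected_dynamics_lift conjugacy_lift H_conjugacy circle_of_add)
qed

end

theorem corollary1p5:
  fixes f :: "annulus \<Rightarrow> annulus"
    and \<eta> :: "real \<Rightarrow> circle \<Rightarrow> real"
    and u :: "annulus \<Rightarrow> real"
  assumes "symplectic_twist_diffeo f"
    and "lipschitz_foliation \<eta>"
    and "foliation_invariant f \<eta>"
    and "foliation_generating_function u \<eta>"
  shows "(\<exists>\<Phi>. exact_symplectic_homeo \<Phi> \<and>
            generating_function_of u \<Phi> \<and>
            (`) \<Phi> ` leaves standard_foliation = leaves \<eta> \<and>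
            (\<exists>\<rho> :: real \<Rightarrow> real. strict_mono \<rho> \<and> homeo \<rho> \<and> locally_bilipschitz \<rho> \<and>
               (\<forall>x c. (inv \<Phi> \<circ> f \<circ> \<Phi>) (x, c) = (x + circle_of (\<rho> c), c))) \<and>
            has_partial_theta \<Phi>) \<and>
         C1_lamination \<eta> \<and>
         (\<forall>c. C1_diffeo_via circle_of (conjugacy u c) \<and>
              (\<exists>\<alpha>. conjugacy u c \<circ> projected_dynamics f u c = (\<lambda>\<theta>. \<theta> + \<alpha>) \<circ> conjugacy u c))"
proof -
  obtain F F' where lift: "\<And>z. annulus_of (F z) = f (annulus_of z)"
    and tf: "twist_foliation F F' (cover_eta \<eta>) (cover_W u)"
    by (rule twist_foliation_lift[OF assms]) (rule that; assumption)
  interpret twist_foliation F F' "cover_eta \<eta>" "cover_W u" by (rule tf)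
  interpret lifted_foliation F F' \<eta> u f
    by unfold_locales (use lift assms in \<open>auto simp: lipschitz_foliation_def\<close>)
  show ?thesis
    using gf.exact_symplectic_homeo_annulus_map generating_function_of_annulus_map annulus_map_leaves
      rho_strict_mono rho_homeo rho_locally_bilipschitz annulus_map_conjugates annulus_map_partial_theta
      C1_lamination_leaves C1_diffeo_conjugacy conjugacy_projected_dynamics
    by blast
qed

end
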